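(* Let $p>2$ be a prime and let $k$ be a field of characteristic $p$. Let $A$ be the augmented $k$-algebra generated by $a,b$ with relations $$a^p=0,\qquad b^p=0,\qquad ba=ab+\tfrac12 a^2,$$ and augmentation $\varepsilon:A\to k$ given by $\varepsilon(a)=\varepsilon(b)=0$. Let $G$ be a cyclic group of order $p$ with generator $g$, acting on $A$ on the right by the algebra automorphism with $g(a)=a$ and $g(b)=a+b$, and let $A\# kG$ be the resulting skew group algebra (so that in $A\# kG$ one has $g^{-1}ag=a$ and $g^{-1}bg=a+b$), which is a Hopf algebra with comultiplication $$\Delta(g)=g\otimes g,\qquad \Delta(a)=a\otimes 1+g\otimes a,\qquad \Delta(b)=b\otimes 1+g\otimes b.$$ Then the cohomology ring $\mathrm{H}^*(A\# kG,k)$ is Noetherian.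
   Context: Let $\otimes=\otimes_k$. The skew group algebra (smash product) $A\# kG$ is $A\otimes kG$ as a vector space, with multiplication $(x\otimes h)(y\otimes h')=x({}^{h}y)\otimes hh'$ for $x,y\in A$, $h,h'\in G$, where ${}^h y$ denotes the left action. The right action in the claim corresponds to the left action with ${}^g a=a$, ${}^g b=b-a$, i.e. $gag^{-1}=a$ and $gbg^{-1}=b-a$ in $A\# kG$. The algebra $A\# kG$ is augmented by $x\otimes h\mapsto\varepsilon(x)$, and this is the counit of the Hopf algebra. The symbol $k$ also denotes the one-dimensional $A\# kG$-module on which $A\# kG$ acts via its augmentation. The cohomology ring is $\mathrm{H}^*(A\# kG,k):=\mathrm{Ext}^*_{A\# kG}(k,k)$, a graded $k$-algebra under Yoneda composition. Modules are left modules, and Noetherian is understood on the left. *)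

theory Defs
  imports "HOL-Computational_Algebra.Primes" "HOL-Algebra.Module" "HOL-Algebra.QuotRing" "HOL-Algebra.Product_Groups"
begin

section \<open>Associative algebras over a field\<close>

text \<open>
  The ground field is a type \<open>'k\<close> of class \<open>field\<close>. Algebras over it are not assumed commutative,
  so they only share the record type of HOL-Algebra's \<open>module\<close> and \<open>algebra\<close>.
\<close>

definition ground_algebra :: "('k::field, 'k) module" where
  "ground_algebra =
    \<lparr>carrier = UNIV, mult = (*), one = 1, zero = 0, add = (+), smult = (*)\<rparr>"

locale assoc_algebra = ring A for A :: "('k::field, 'a) module" (structure) +
  assumes smult_closed: "x \<in> carrier A \<Longrightarrow> c \<odot> x \<in> carrier A"
    and smult_l_distr: "x \<in> carrier A \<Longrightarrow> (c + d) \<odot> x = c \<odot> x \<oplus> d \<odot> x"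
    and smult_r_distr:
      "\<lbrakk>x \<in> carrier A; y \<in> carrier A\<rbrakk> \<Longrightarrow> c \<odot> (x \<oplus> y) = c \<odot> x \<oplus> c \<odot> y"
    and smult_assoc1: "x \<in> carrier A \<Longrightarrow> (c * d) \<odot> x = c \<odot> (d \<odot> x)"
    and smult_one: "x \<in> carrier A \<Longrightarrow> 1 \<odot> x = x"
    and smult_mult_l:
      "\<lbrakk>x \<in> carrier A; y \<in> carrier A\<rbrakk> \<Longrightarrow> (c \<odot> x) \<otimes> y = c \<odot> (x \<otimes> y)"
    and smult_mult_r:
      "\<lbrakk>x \<in> carrier A; y \<in> carrier A\<rbrakk> \<Longrightarrow> x \<otimes> (c \<odot> y) = c \<odot> (x \<otimes> y)"

definition linear_maps :: "('k::field, 'a) module \<Rightarrow> ('k, 'b) module \<Rightarrow> ('a \<Rightarrow> 'b) set" where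
  "linear_maps A B = {f \<in> carrier A \<rightarrow> carrier B.
     (\<forall>x\<in>carrier A. \<forall>y\<in>carrier A. f (x \<oplus>\<^bsub>A\<^esub> y) = f x \<oplus>\<^bsub>B\<^esub> f y) \<and>
     (\<forall>c. \<forall>x\<in>carrier A. f (c \<odot>\<^bsub>A\<^esub> x) = c \<odot>\<^bsub>B\<^esub> f x)}"

definition algebra_hom :: "('k::field, 'a) module \<Rightarrow> ('k, 'b) module \<Rightarrow> ('a \<Rightarrow> 'b) set" where
  "algebra_hom A B = ring_hom A B \<inter> linear_maps A B"

definition quot_algebra :: "('k::field, 'a) module \<Rightarrow> 'a set \<Rightarrow> ('k, 'a set) module" where
  "quot_algebra R I =
     ring.extend (R Quot I) (module.fields (\<lambda>c X. \<Union>x\<in>X. I +>\<^bsub>R\<^esub> (c \<odot>\<^bsub>R\<^esub> x)))"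

definition basis_elt :: "'m \<Rightarrow> 'm \<Rightarrow> 'k::field" where
  "basis_elt x = (\<lambda>y. if y = x then 1 else 0)"

definition monoid_algebra :: "('m, 'c) monoid_scheme \<Rightarrow> ('k::field, 'm \<Rightarrow> 'k) module" where
  "monoid_algebra M =
    \<lparr>carrier = {f. finite {x. f x \<noteq> 0} \<and> {x. f x \<noteq> 0} \<subseteq> carrier M},
     mult = (\<lambda>f g z. \<Sum>x\<in>{x. f x \<noteq> 0}. \<Sum>y\<in>{y. g y \<noteq> 0}.
               if x \<otimes>\<^bsub>M\<^esub> y = z then f x * g y else 0),
     one = basis_elt \<one>\<^bsub>M\<^esub>,
     zero = (\<lambda>_. 0),
     add = (\<lambda>f g z. f z + g z),
     smult = (\<lambda>c f z. c * f z)\<rparr>"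

section \<open>Tensor products and Hopf algebras\<close>

text \<open>
  The span of the bilinearity relations in the monoid algebra of the multiplicative monoid
  \<open>B \<times>\<times> C\<close> is stable under multiplication by basis elements, so it is already a two-sided ideal.
  The quotient below is therefore the usual tensor product of vector spaces, equipped with
  the multiplication \<open>(x \<otimes> y)(x' \<otimes> y') = xx' \<otimes> yy'\<close>.
\<close>

definition tensor_relations :: "('k::field, 'b) module \<Rightarrow> ('k, 'c) module \<Rightarrow> ('b \<times> 'c \<Rightarrow> 'k) set" where
  "tensor_relations B C =
     {(\<lambda>z. basis_elt (x \<oplus>\<^bsub>B\<^esub> x', y) z - basis_elt (x, y) z - basis_elt (x', y) z) |x x' y.
        x \<in> carrier B \<and> x' \<in> carrier B \<and> y \<in> carrier C} \<union>
     {(\<lambda>z. basis_elt (x, y \<oplus>\<^bsub>C\<^esub> y') z - basis_elt (x, y) z - basis_elt (x, y') z) |x y y'.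
        x \<in> carrier B \<and> y \<in> carrier C \<and> y' \<in> carrier C} \<union>
     {(\<lambda>z. basis_elt (c \<odot>\<^bsub>B\<^esub> x, y) z - c * basis_elt (x, y) z) |c x y.
        x \<in> carrier B \<and> y \<in> carrier C} \<union>
     {(\<lambda>z. basis_elt (x, c \<odot>\<^bsub>C\<^esub> y) z - c * basis_elt (x, y) z) |c x y.
        x \<in> carrier B \<and> y \<in> carrier C}"

definition tensor_ideal :: "('k::field, 'b) module \<Rightarrow> ('k, 'c) module \<Rightarrow> ('b \<times> 'c \<Rightarrow> 'k) set" where
  "tensor_ideal B C = Idl\<^bsub>(monoid_algebra (B \<times>\<times> C))\<^esub> (tensor_relations B C)"

definition tensor_algebra ::
    "('k::field, 'b) module \<Rightarrow> ('k, 'c) module \<Rightarrow> ('k, ('b \<times> 'c \<Rightarrow> 'k) set) module" where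
  "tensor_algebra B C = quot_algebra (monoid_algebra (B \<times>\<times> C)) (tensor_ideal B C)"

definition pure_tensor ::
    "('k::field, 'b) module \<Rightarrow> ('k, 'c) module \<Rightarrow> 'b \<Rightarrow> 'c \<Rightarrow> ('b \<times> 'c \<Rightarrow> 'k) set" where
  "pure_tensor B C x y =
     tensor_ideal B C +>\<^bsub>(monoid_algebra (B \<times>\<times> C) :: ('k, 'b \<times> 'c \<Rightarrow> 'k) module)\<^esub> basis_elt (x, y)"

text \<open>
  For bilinear \<open>\<beta>\<close>, the linear map out of the tensor product with \<open>x \<otimes> y \<mapsto> \<beta> x y\<close>: evaluating any
  representative of the coset gives the same value.
\<close>

definition tensor_lift ::
    "('k::field, 'd) module \<Rightarrow> ('b \<Rightarrow> 'c \<Rightarrow> 'd) \<Rightarrow> ('b \<times> 'c \<Rightarrow> 'k) set \<Rightarrow> 'd" where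
  "tensor_lift D \<beta> T = the_elem
     ((\<lambda>t. \<Oplus>\<^bsub>D\<^esub>z\<in>{z. t z \<noteq> 0}. t z \<odot>\<^bsub>D\<^esub> \<beta> (fst z) (snd z)) ` T)"

definition tensor_assoc ::
    "('k::field, 'b) module \<Rightarrow> ('k, 'c) module \<Rightarrow> ('k, 'd) module \<Rightarrow>
     (('b \<times> 'c \<Rightarrow> 'k) set \<times> 'd \<Rightarrow> 'k) set \<Rightarrow> ('b \<times> ('c \<times> 'd \<Rightarrow> 'k) set \<Rightarrow> 'k) set" where
  "tensor_assoc B C D =
     tensor_lift (tensor_algebra B (tensor_algebra C D))
       (\<lambda>t z. tensor_lift (tensor_algebra B (tensor_algebra C D))
          (\<lambda>x y. pure_tensor B (tensor_algebra C D) x (pure_tensor C D y z)) t)"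

locale hopf_algebra = assoc_algebra H for H :: "('k::field, 'h) module" (structure) +
  fixes comult :: "'h \<Rightarrow> ('h \<times> 'h \<Rightarrow> 'k) set"
    and counit :: "'h \<Rightarrow> 'k"
    and antipode :: "'h \<Rightarrow> 'h"
  assumes comult_hom: "comult \<in> algebra_hom H (tensor_algebra H H)"
    and counit_hom: "counit \<in> algebra_hom H ground_algebra"
    and antipode_linear: "antipode \<in> linear_maps H H"
    and coassoc: "x \<in> carrier H \<Longrightarrow>
      tensor_assoc H H H
        (tensor_lift (tensor_algebra (tensor_algebra H H) H)
          (\<lambda>y z. pure_tensor (tensor_algebra H H) H (comult y) z) (comult x)) =
      tensor_lift (tensor_algebra H (tensor_algebra H H))
        (\<lambda>y z. pure_tensor H (tensor_algebra H H) y (comult z)) (comult x)"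
    and counit_left: "x \<in> carrier H \<Longrightarrow>
      tensor_lift H (\<lambda>y z. counit y \<odot> z) (comult x) = x"
    and counit_right: "x \<in> carrier H \<Longrightarrow>
      tensor_lift H (\<lambda>y z. counit z \<odot> y) (comult x) = x"
    and antipode_left: "x \<in> carrier H \<Longrightarrow>
      tensor_lift H (\<lambda>y z. antipode y \<otimes> z) (comult x) = counit x \<odot> \<one>"
    and antipode_right: "x \<in> carrier H \<Longrightarrow>
      tensor_lift H (\<lambda>y z. y \<otimes> antipode z) (comult x) = counit x \<odot> \<one>"

section \<open>The algebra on two generators\<close>

datatype letter = La | Lb

definition free_algebra :: "('k::field, letter list \<Rightarrow> 'k) module" where
  "free_algebra = monoid_algebra \<lparr>carrier = UNIV, mult = (@), one = []\<rparr>"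

definition rel_ideal :: "nat \<Rightarrow> (letter list \<Rightarrow> 'k::field) set" where
  "rel_ideal p = Idl\<^bsub>free_algebra\<^esub>
     {basis_elt (replicate p La),
      basis_elt (replicate p Lb),
      (\<lambda>w. basis_elt [Lb, La] w - basis_elt [La, Lb] w - (1 / 2) * basis_elt [La, La] w)}"

type_synonym 'k presented = "(letter list \<Rightarrow> 'k) set"

definition alg_A :: "nat \<Rightarrow> ('k::field, 'k presented) module" where
  "alg_A p = quot_algebra free_algebra (rel_ideal p)"

definition gen_a :: "nat \<Rightarrow> 'k::field presented" where
  "gen_a p = rel_ideal p +>\<^bsub>(free_algebra :: ('k, letter list \<Rightarrow> 'k) module)\<^esub> basis_elt [La]"

definition gen_b :: "nat \<Rightarrow> 'k::field presented" where
  "gen_b p = rel_ideal p +>\<^bsub>(free_algebra :: ('k, letter list \<Rightarrow> 'k) module)\<^esub> basis_elt [Lb]"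

section \<open>Skew group algebras\<close>

definition right_action ::
    "('g, 'c) monoid_scheme \<Rightarrow> ('k::field, 'a) module \<Rightarrow> ('a \<Rightarrow> 'g \<Rightarrow> 'a) \<Rightarrow> bool" where
  "right_action G A act \<longleftrightarrow>
     (\<forall>h\<in>carrier G. (\<lambda>x. act x h) \<in> algebra_hom A A) \<and>
     (\<forall>x\<in>carrier A. act x \<one>\<^bsub>G\<^esub> = x) \<and>
     (\<forall>x\<in>carrier A. \<forall>h\<in>carrier G. \<forall>h'\<in>carrier G. act x (h \<otimes>\<^bsub>G\<^esub> h') = act (act x h) h')"

definition left_of_right :: "('g, 'c) monoid_scheme \<Rightarrow> ('a \<Rightarrow> 'g \<Rightarrow> 'a) \<Rightarrow> 'g \<Rightarrow> 'a \<Rightarrow> 'a" where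
  "left_of_right G act h x = act x (inv\<^bsub>G\<^esub> h)"

definition skew_elt :: "('k::field, 'a) module \<Rightarrow> 'a \<Rightarrow> 'g \<Rightarrow> 'g \<Rightarrow> 'a" where
  "skew_elt A x h = (\<lambda>u. if u = h then x else \<zero>\<^bsub>A\<^esub>)"

text \<open>
  An element \<open>\<Sum>h. x h \<otimes> h\<close> of the vector space \<open>A \<otimes> kG\<close> is encoded as the finitely supported
  function \<open>x\<close>; \<open>skew_elt A x h\<close> is \<open>x \<otimes> h\<close>. The argument \<open>lact\<close> is a left action, and the product is
  the bilinear extension of \<open>(x \<otimes> h)(y \<otimes> h') = x (lact h y) \<otimes> hh'\<close>.
\<close>

definition skew_group_algebra ::
    "('g, 'c) monoid_scheme \<Rightarrow> ('k::field, 'a) module \<Rightarrow> ('g \<Rightarrow> 'a \<Rightarrow> 'a) \<Rightarrow> ('k, 'g \<Rightarrow> 'a) module" where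
  "skew_group_algebra G A lact =
    \<lparr>carrier = {f. (\<forall>h\<in>carrier G. f h \<in> carrier A) \<and> (\<forall>h. h \<notin> carrier G \<longrightarrow> f h = \<zero>\<^bsub>A\<^esub>) \<and>
                   finite {h. f h \<noteq> \<zero>\<^bsub>A\<^esub>}},
     mult = (\<lambda>f f' u. if u \<in> carrier G
               then \<Oplus>\<^bsub>A\<^esub>h\<in>{h. f h \<noteq> \<zero>\<^bsub>A\<^esub>}. f h \<otimes>\<^bsub>A\<^esub> lact h (f' (inv\<^bsub>G\<^esub> h \<otimes>\<^bsub>G\<^esub> u))
               else \<zero>\<^bsub>A\<^esub>),
     one = skew_elt A \<one>\<^bsub>A\<^esub> \<one>\<^bsub>G\<^esub>,
     zero = (\<lambda>_. \<zero>\<^bsub>A\<^esub>),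
     add = (\<lambda>f f' u. f u \<oplus>\<^bsub>A\<^esub> f' u),
     smult = (\<lambda>c f u. c \<odot>\<^bsub>A\<^esub> f u)\<rparr>"

definition skew_augmentation ::
    "('k::field, 'a) module \<Rightarrow> ('a \<Rightarrow> 'k) \<Rightarrow> ('g \<Rightarrow> 'a) \<Rightarrow> 'k" where
  "skew_augmentation A \<epsilon> f = (\<Sum>h\<in>{h. f h \<noteq> \<zero>\<^bsub>A\<^esub>}. \<epsilon> (f h))"

section \<open>Left modules and projective resolutions\<close>

text \<open>
  HOL-Algebra's locale \<open>module\<close> requires a commutative ring. Of the record type \<open>module\<close>, the fields
  \<open>mult\<close> and \<open>one\<close> play no role for left modules.
\<close>

locale left_module = R?: ring R + M?: abelian_group M
  for R :: "('r, 'c) ring_scheme" (structure) and M :: "('r, 'm) module" (structure) +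
  assumes smult_closed: "\<lbrakk>r \<in> carrier R; x \<in> carrier M\<rbrakk> \<Longrightarrow> r \<odot>\<^bsub>M\<^esub> x \<in> carrier M"
    and smult_l_distr: "\<lbrakk>r \<in> carrier R; s \<in> carrier R; x \<in> carrier M\<rbrakk> \<Longrightarrow>
      (r \<oplus>\<^bsub>R\<^esub> s) \<odot>\<^bsub>M\<^esub> x = r \<odot>\<^bsub>M\<^esub> x \<oplus>\<^bsub>M\<^esub> s \<odot>\<^bsub>M\<^esub> x"
    and smult_r_distr: "\<lbrakk>r \<in> carrier R; x \<in> carrier M; y \<in> carrier M\<rbrakk> \<Longrightarrow>
      r \<odot>\<^bsub>M\<^esub> (x \<oplus>\<^bsub>M\<^esub> y) = r \<odot>\<^bsub>M\<^esub> x \<oplus>\<^bsub>M\<^esub> r \<odot>\<^bsub>M\<^esub> y"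
    and smult_assoc: "\<lbrakk>r \<in> carrier R; s \<in> carrier R; x \<in> carrier M\<rbrakk> \<Longrightarrow>
      (r \<otimes>\<^bsub>R\<^esub> s) \<odot>\<^bsub>M\<^esub> x = r \<odot>\<^bsub>M\<^esub> (s \<odot>\<^bsub>M\<^esub> x)"
    and smult_one: "x \<in> carrier M \<Longrightarrow> \<one>\<^bsub>R\<^esub> \<odot>\<^bsub>M\<^esub> x = x"

definition mod_hom ::
    "('r, 'c) ring_scheme \<Rightarrow> ('r, 'm) module \<Rightarrow> ('r, 'n) module \<Rightarrow> ('m \<Rightarrow> 'n) set" where
  "mod_hom R M N = {f \<in> carrier M \<rightarrow>\<^sub>E carrier N.
     (\<forall>x\<in>carrier M. \<forall>y\<in>carrier M. f (x \<oplus>\<^bsub>M\<^esub> y) = f x \<oplus>\<^bsub>N\<^esub> f y) \<and>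
     (\<forall>r\<in>carrier R. \<forall>x\<in>carrier M. f (r \<odot>\<^bsub>M\<^esub> x) = r \<odot>\<^bsub>N\<^esub> f x)}"

definition free_left_module :: "('r, 'c) ring_scheme \<Rightarrow> 'x set \<Rightarrow> ('r, 'x \<Rightarrow> 'r) module" where
  "free_left_module R X =
    \<lparr>carrier = {f. (\<forall>x\<in>X. f x \<in> carrier R) \<and> (\<forall>x. x \<notin> X \<longrightarrow> f x = \<zero>\<^bsub>R\<^esub>) \<and>
                   finite {x. f x \<noteq> \<zero>\<^bsub>R\<^esub>}},
     mult = undefined, one = undefined,
     zero = (\<lambda>_. \<zero>\<^bsub>R\<^esub>),
     add = (\<lambda>f g x. f x \<oplus>\<^bsub>R\<^esub> g x),
     smult = (\<lambda>r f x. r \<otimes>\<^bsub>R\<^esub> f x)\<rparr>"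

text \<open>
  Projective modules are the direct summands of free modules. Letting the basis be a set \<open>X\<close> of
  elements of the type of \<open>M\<close> loses nothing: if \<open>M\<close> is a summand of any free module, then the
  canonical surjection onto \<open>M\<close> from the free module on \<open>carrier M\<close> splits.
\<close>

definition projective_module :: "('r, 'c) ring_scheme \<Rightarrow> ('r, 'm) module \<Rightarrow> bool" where
  "projective_module R M \<longleftrightarrow> left_module R M \<and>
     (\<exists>X :: 'm set. \<exists>i \<in> mod_hom R M (free_left_module R X).
        \<exists>q \<in> mod_hom R (free_left_module R X) M. \<forall>x\<in>carrier M. q (i x) = x)"

text \<open>\<open>bd C n\<close> is the boundary map from \<open>obj C (Suc n)\<close> to \<open>obj C n\<close>.\<close>

record ('r, 'm, 'n) aug_complex =
  obj :: "nat \<Rightarrow> ('r, 'm) module"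
  bd :: "nat \<Rightarrow> 'm \<Rightarrow> 'm"
  aug :: "'m \<Rightarrow> 'n"

definition projective_resolution ::
    "('r, 'c) ring_scheme \<Rightarrow> ('r, 'n) module \<Rightarrow> ('r, 'm, 'n) aug_complex \<Rightarrow> bool" where
  "projective_resolution R M P \<longleftrightarrow>
     (\<forall>n. projective_module R (obj P n)) \<and>
     (\<forall>n. bd P n \<in> mod_hom R (obj P (Suc n)) (obj P n)) \<and>
     aug P \<in> mod_hom R (obj P 0) M \<and>
     aug P ` carrier (obj P 0) = carrier M \<and>
     {x \<in> carrier (obj P 0). aug P x = \<zero>\<^bsub>M\<^esub>} = bd P 0 ` carrier (obj P (Suc 0)) \<and>
     (\<forall>n. {x \<in> carrier (obj P (Suc n)). bd P n x = \<zero>\<^bsub>obj P n\<^esub>} =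
          bd P (Suc n) ` carrier (obj P (Suc (Suc n))))"

section \<open>Ext and the Yoneda product\<close>

text \<open>
  Ext is computed from a given projective resolution. The type \<open>'m\<close> housing the resolution is
  arbitrary; a theorem for all resolutions in all types \<open>'m\<close> covers every projective resolution
  (they exist once \<open>'m\<close> is large enough). Chain maps commute strictly with the boundaries;
  other sign conventions change the product of classes of degrees \<open>m\<close>, \<open>n\<close> by \<open>(-1)\<^sup>m\<^sup>n\<close>.

  Throughout, \<open>P\<close> is a projective resolution of \<open>M\<close>, and \<open>Ext_grp R M P n\<close> is the \<open>n\<close>-th cohomology
  group of the complex \<open>Hom(P, M)\<close>, i.e. \<open>Ext\<^sup>n(M, M)\<close>.
\<close>

definition cocycles ::
    "('r, 'c) ring_scheme \<Rightarrow> ('r, 'n) module \<Rightarrow> ('r, 'm, 'n) aug_complex \<Rightarrow> nat \<Rightarrow> ('m \<Rightarrow> 'n) set" where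
  "cocycles R M P n =
     {f \<in> mod_hom R (obj P n) M. \<forall>x\<in>carrier (obj P (Suc n)). f (bd P n x) = \<zero>\<^bsub>M\<^esub>}"

definition coboundaries ::
    "('r, 'c) ring_scheme \<Rightarrow> ('r, 'n) module \<Rightarrow> ('r, 'm, 'n) aug_complex \<Rightarrow> nat \<Rightarrow> ('m \<Rightarrow> 'n) set" where
  "coboundaries R M P n = (case n of
       0 \<Rightarrow> {\<lambda>x\<in>carrier (obj P 0). \<zero>\<^bsub>M\<^esub>}
     | Suc m \<Rightarrow> (\<lambda>f. compose (carrier (obj P (Suc m))) f (bd P m)) ` mod_hom R (obj P m) M)"

definition cocycle_grp ::
    "('r, 'c) ring_scheme \<Rightarrow> ('r, 'n) module \<Rightarrow> ('r, 'm, 'n) aug_complex \<Rightarrow> nat \<Rightarrow> ('m \<Rightarrow> 'n) monoid" where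
  "cocycle_grp R M P n =
    \<lparr>carrier = cocycles R M P n,
     mult = (\<lambda>f g. \<lambda>x\<in>carrier (obj P n). f x \<oplus>\<^bsub>M\<^esub> g x),
     one = (\<lambda>x\<in>carrier (obj P n). \<zero>\<^bsub>M\<^esub>)\<rparr>"

definition Ext_grp ::
    "('r, 'c) ring_scheme \<Rightarrow> ('r, 'n) module \<Rightarrow> ('r, 'm, 'n) aug_complex \<Rightarrow> nat \<Rightarrow> ('m \<Rightarrow> 'n) set monoid" where
  "Ext_grp R M P n = cocycle_grp R M P n Mod coboundaries R M P n"

text \<open>The chain maps \<open>\<phi> i : P(i + n) \<rightarrow> P i\<close> lifting an \<open>n\<close>-cocycle \<open>g : P n \<rightarrow> M\<close>.\<close>

definition chain_lifts ::
    "('r, 'c) ring_scheme \<Rightarrow> ('r, 'm, 'n) aug_complex \<Rightarrow> nat \<Rightarrow> ('m \<Rightarrow> 'n) \<Rightarrow> (nat \<Rightarrow> 'm \<Rightarrow> 'm) set" where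
  "chain_lifts R P n g = {\<phi>.
     (\<forall>i. \<phi> i \<in> mod_hom R (obj P (i + n)) (obj P i)) \<and>
     (\<forall>x\<in>carrier (obj P n). aug P (\<phi> 0 x) = g x) \<and>
     (\<forall>i. \<forall>x\<in>carrier (obj P (Suc i + n)). bd P i (\<phi> (Suc i) x) = \<phi> i (bd P (i + n) x))}"

text \<open>
  The Yoneda composite of \<open>[f]\<close> in degree \<open>m\<close> and \<open>[g]\<close> in degree \<open>n\<close> is \<open>[f \<circ> \<phi> m]\<close> for any
  lift \<open>\<phi>\<close> of \<open>g\<close>; as in \<^const>\<open>rcoset_mult\<close>, the union is over all choices and consists of a
  single coset.
\<close>

definition yoneda ::
    "('r, 'c) ring_scheme \<Rightarrow> ('r, 'n) module \<Rightarrow> ('r, 'm, 'n) aug_complex \<Rightarrow> nat \<Rightarrow> nat \<Rightarrow>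
     ('m \<Rightarrow> 'n) set \<Rightarrow> ('m \<Rightarrow> 'n) set \<Rightarrow> ('m \<Rightarrow> 'n) set" where
  "yoneda R M P m n \<xi> \<eta> = (\<Union>f\<in>\<xi>. \<Union>g\<in>\<eta>. \<Union>\<phi>\<in>chain_lifts R P n g.
     coboundaries R M P (m + n) #>\<^bsub>cocycle_grp R M P (m + n)\<^esub>
       compose (carrier (obj P (m + n))) f (\<phi> m))"

definition Ext_ring ::
    "('r, 'c) ring_scheme \<Rightarrow> ('r, 'n) module \<Rightarrow> ('r, 'm, 'n) aug_complex \<Rightarrow>
     (nat \<Rightarrow> ('m \<Rightarrow> 'n) set) ring" where
  "Ext_ring R M P =
    \<lparr>carrier = carrier (sum_group UNIV (Ext_grp R M P)),
     mult = (\<lambda>\<xi> \<eta> n. \<Otimes>\<^bsub>Ext_grp R M P n\<^esub>i\<in>{..n}. yoneda R M P i (n - i) (\<xi> i) (\<eta> (n - i))),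
     one = (\<lambda>n. if n = 0 then coboundaries R M P 0 #>\<^bsub>cocycle_grp R M P 0\<^esub> aug P
                else \<one>\<^bsub>Ext_grp R M P n\<^esub>),
     zero = \<one>\<^bsub>sum_group UNIV (Ext_grp R M P)\<^esub>,
     add = (\<lambda>\<xi> \<eta>. \<xi> \<otimes>\<^bsub>sum_group UNIV (Ext_grp R M P)\<^esub> \<eta>)\<rparr>"

definition trivial_module :: "('h \<Rightarrow> 'k::field) \<Rightarrow> ('h, 'k) module" where
  "trivial_module \<epsilon> =
    \<lparr>carrier = UNIV, mult = undefined, one = undefined, zero = 0, add = (+),
     smult = (\<lambda>r c. \<epsilon> r * c)\<rparr>"

section \<open>Left Noetherian rings\<close>

text \<open>
  HOL-Algebra's \<open>noetherian_ring\<close> is about two-sided ideals (\<^const>\<open>ideal\<close>), so it is not the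
  required notion for a ring that is not known to be commutative.
\<close>

definition left_ideal :: "'a set \<Rightarrow> ('a, 'c) ring_scheme \<Rightarrow> bool" where
  "left_ideal I R \<longleftrightarrow> additive_subgroup I R \<and>
     (\<forall>r\<in>carrier R. \<forall>x\<in>I. r \<otimes>\<^bsub>R\<^esub> x \<in> I)"

locale left_noetherian_ring = ring +
  assumes left_finitely_gen: "left_ideal I R \<Longrightarrow>
    \<exists>S \<subseteq> carrier R. finite S \<and> I = \<Inter>{J. left_ideal J R \<and> S \<subseteq> J}"

end

theory Submission
 imports "HOL-Library.Function_Algebras" "HOL-Computational_Algebra.Polynomial"
  "HOL-Algebra.Multiplicative_Group" "HOL-Algebra.Elementary_Groups" Defs
begin

text \<open>
  Monomials \<open>a\<^sup>i g\<^sup>k b\<^sup>j\<close> with \<open>i, k, j < p\<close> form a basis of \<open>H = A # kG\<close>: the space they span formally, with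
  the expected product, is an algebra, even after the relations \<open>a\<^sup>p = 0\<close>, \<open>g\<^sup>p = 1\<close>, \<open>b\<^sup>p = 0\<close> are deformed
  one at a time. To first order each deformation is a Hochschild 2-cocycle \<open>c\<close> of \<open>H\<close>. The basis also shows that \<open>H\<close> is
  presented by its relations, so that comultiplication and antipode are determined on generators; the relation
  \<open>\<Delta>(b)\<^sup>p = 0\<close> holds because the Lah numbers \<open>L(p, r)\<close> with \<open>0 < r < p\<close> are divisible by \<open>p\<close>.

  A cocycle \<open>c\<close> twists the action on every projective module, and the failure of the boundaries of a resolution \<open>P\<close>
  to respect the twists gives a chain map \<open>\<chi> : P(n + 2) \<rightarrow> P n\<close>, central up to homotopy. The three maps \<open>\<chi>\<close> play the role
  of polynomial generators over which the cohomology is finite. To see this, filter the augmentation ideal by the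
  right ideals generated by \<open>{}\<close>, \<open>{a}\<close>, \<open>{g - 1, a}\<close>, \<open>{b, g - 1, a}\<close>, and let \<open>L S n\<close> be the functionals on \<open>P n\<close>
  killed by \<open>S\<close>. Passing from \<open>S\<close> to \<open>S\<close> with one element \<open>t\<close> adjoined is like passing to the cohomology of a
  truncated polynomial algebra, and the ascending chain condition for families of cocycles stable under the maps
  \<open>\<chi>\<close> found so far is inherited once the new \<open>\<chi>\<close> is added. For \<open>S = {}\<close> it holds because \<open>P\<close> is exact, and for the last \<open>S\<close>
  it applies to the top components of elements of left ideals of the Ext ring.
\<close>

\<comment> \<open>Each generator \<open>t\<close> comes with a cofactor \<open>t'\<close>:
  \<open>a\<close> with \<open>a^(p-1)\<close>, \<open>g - 1\<close> with the norm
  \<open>1 + g + ... + g^(p-1)\<close>, \<open>b\<close> with \<open>b^(p-1)\<close>. In the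
  deformation belonging to \<open>t\<close> the products \<open>t t'\<close> and \<open>t' t\<close>
  equal the parameter, so \<open>c t t' = c t' t = 1\<close> while \<open>t t' = t' t = 0\<close> in
  \<open>H\<close>. This makes kernels and images of \<open>t\<close> and \<open>t'\<close> on
  functionals alternate exactly, and \<chi> becomes a periodicity operator, like the Eisenbud
  operator of a hypersurface. A step also needs \<open>c\<close> to vanish when its left argument is
  an earlier generator, which dictates the order of letters in a monomial: with \<open>b\<close>
  last, left multiplication by \<open>a\<close> or \<open>g\<close> never creates
  \<open>b^p\<close>. The order of the steps is dictated by \<open>g a = a g\<close>,
  \<open>b a = a (b + a/2)\<close> and \<open>b (g - 1) = (g - 1) b + a g\<close>, which keep each
  right ideal stable under left multiplication. The Ext ring is not known to be commutative and
  \<chi> commutes with chain maps only up to boundaries. A chain condition on families of cocycles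
  tolerates this and needs no named generators.\<close>
syntax (input) "_index" :: "id \<Rightarrow> index"  (\<open>\<^sub>_\<close>)

section \<open>Linear extension and monoid algebras\<close>

text \<open>The linear map on formal sums that extends \<open>F\<close> from basis elements. The
  body repeats the one inside \<open>tensor_lift\<close>, so facts about it transfer by
  unfolding.\<close>

definition mext :: "('k::field, 'd) module \<Rightarrow> ('z \<Rightarrow> 'd) \<Rightarrow> ('z \<Rightarrow> 'k) \<Rightarrow> 'd" where
 "mext D F t = (\<Oplus>\<^sub>D z\<in>{z. t z \<noteq> 0}. t z \<odot>\<^sub>D F z)"

context assoc_algebra
begin

lemma smult_zero_left [simp]: "x \<in> carrier A ==> 0 \<odot> x = \<zero>"
 by (metis smult_closed smult_l_distr add.r_cancel_one' add_0)

lemma smult_zero_right [simp]: "c \<odot> \<zero> = \<zero>"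
 by (metis smult_closed smult_r_distr add.r_cancel_one' l_zero zero_closed)

lemma smult_minus_left: "x \<in> carrier A ==> (- c) \<odot> x = \<ominus> (c \<odot> x)"
proof -
 assume x: "x \<in> carrier A"
 have "(- c) \<odot> x \<oplus> c \<odot> x = (- c + c) \<odot> x" by (rule smult_l_distr[OF x, symmetric])
 also have "\<dots> = \<zero>" using x by simp
 finally show ?thesis using x by (intro minus_equality[symmetric]) (auto intro: smult_closed)
qed

lemma smult_minus_right: "x \<in> carrier A ==> c \<odot> (\<ominus> x) = \<ominus> (c \<odot> x)"
proof -
 assume x: "x \<in> carrier A"
 have "c \<odot> (\<ominus> x) \<oplus> c \<odot> x = c \<odot> (\<ominus> x \<oplus> x)" using x by (intro smult_r_distr[symmetric]) auto
 also have "\<dots> = \<zero>" using x by (simp add: l_neg)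
 finally show ?thesis using x by (intro minus_equality[symmetric]) (auto intro: smult_closed)
qed

lemma smult_as_mult: "x \<in> carrier A ==> c \<odot> x = (c \<odot> \<one>) \<otimes> x"
 by (simp add: smult_mult_l)

lemma finsum_smult:
 assumes "finite Z" "F \<in> Z \<rightarrow> carrier A"
 shows "c \<odot> (\<Oplus>z\<in>Z. F z) = (\<Oplus>z\<in>Z. c \<odot> F z)"
 using assms by (induct Z rule: finite_induct) (auto simp: smult_r_distr smult_closed Pi_def)

text \<open>Additivity compares sums over three different supports; all of them are first moved to a
  common finite superset.\<close>

lemma mext_superset:
 assumes "finite Z" "{z. t z \<noteq> 0} \<subseteq> Z" "F \<in> Z \<rightarrow> carrier A"
 shows "mext A F t = (\<Oplus>z\<in>Z. t z \<odot> F z)"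
 unfolding mext_def
 using assms by (intro add.finprod_mono_neutral_cong_left) (auto simp: Pi_def smult_closed)

lemma mext_closed:
 assumes "F \<in> {z. t z \<noteq> 0} \<rightarrow> carrier A"
 shows "mext A F t \<in> carrier A"
 unfolding mext_def using assms by (intro finsum_closed) (auto simp: smult_closed Pi_def)

lemma mext_basis: "F x \<in> carrier A ==> mext A F (basis_elt x) = F x"
 by (subst mext_superset[of "{x}"]) (auto simp: basis_elt_def smult_one smult_closed split: if_splits)

lemma mext_add:
 assumes "finite {z. s z \<noteq> 0}" "finite {z. t z \<noteq> 0}"
  "F \<in> {z. s z \<noteq> 0} \<rightarrow> carrier A" "F \<in> {z. t z \<noteq> 0} \<rightarrow> carrier A"
 shows "mext A F (\<lambda>z. s z + t z) = mext A F s \<oplus> mext A F t"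
proof -
 let ?Z = "{z. s z \<noteq> 0} \<union> {z. t z \<noteq> 0}"
 have F: "F \<in> ?Z \<rightarrow> carrier A" using assms by auto
 have "mext A F (\<lambda>z. s z + t z) = (\<Oplus>z\<in>?Z. (s z + t z) \<odot> F z)"
  using assms by (intro mext_superset) auto
 also have "\<dots> = (\<Oplus>z\<in>?Z. s z \<odot> F z \<oplus> t z \<odot> F z)"
  using F by (intro finsum_cong') (auto simp: smult_l_distr smult_closed Pi_def)
 also have "\<dots> = (\<Oplus>z\<in>?Z. s z \<odot> F z) \<oplus> (\<Oplus>z\<in>?Z. t z \<odot> F z)"
  using F by (intro finsum_addf) (auto simp: smult_closed Pi_def)
 also have "(\<Oplus>z\<in>?Z. s z \<odot> F z) = mext A F s"
  using assms by (intro mext_superset[symmetric]) auto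
 also have "(\<Oplus>z\<in>?Z. t z \<odot> F z) = mext A F t"
  using assms by (intro mext_superset[symmetric]) auto
 finally show ?thesis .
qed

lemma mext_smult:
 assumes "finite {z. t z \<noteq> 0}" "F \<in> {z. t z \<noteq> 0} \<rightarrow> carrier A"
 shows "mext A F (\<lambda>z. c * t z) = c \<odot> mext A F t"
proof -
 let ?Z = "{z. t z \<noteq> 0}"
 have "mext A F (\<lambda>z. c * t z) = (\<Oplus>z\<in>?Z. (c * t z) \<odot> F z)"
  using assms by (intro mext_superset) auto
 also have "\<dots> = (\<Oplus>z\<in>?Z. c \<odot> (t z \<odot> F z))"
  using assms by (intro finsum_cong') (auto simp: smult_assoc1 smult_closed Pi_def)
 also have "\<dots> = c \<odot> mext A F t"
  unfolding mext_def using assms by (intro finsum_smult[symmetric]) (auto simp: smult_closed Pi_def)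
 finally show ?thesis .
qed

lemma assoc_algebra_self: "assoc_algebra A" ..

end

lemma linear_mapsI:
 assumes "\<And>x. x \<in> carrier A ==> f x \<in> carrier B"
  "\<And>x y. x \<in> carrier A ==> y \<in> carrier A ==> f (x \<oplus>\<^sub>A y) = f x \<oplus>\<^sub>B f y"
  "\<And>c x. x \<in> carrier A ==> f (c \<odot>\<^sub>A x) = c \<odot>\<^sub>B f x"
 shows "f \<in> linear_maps A B"
 using assms by (auto simp: linear_maps_def)

lemma linear_mapsD:
 assumes "f \<in> linear_maps A B"
 shows "x \<in> carrier A ==> f x \<in> carrier B"
  "x \<in> carrier A ==> y \<in> carrier A ==> f (x \<oplus>\<^sub>A y) = f x \<oplus>\<^sub>B f y"
  "x \<in> carrier A ==> f (c \<odot>\<^sub>A x) = c \<odot>\<^sub>B f x"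
 using assms by (auto simp: linear_maps_def)

lemma algebra_homI:
 assumes "f \<in> linear_maps A B"
  "\<And>x y. x \<in> carrier A ==> y \<in> carrier A ==> f (x \<otimes>\<^sub>A y) = f x \<otimes>\<^sub>B f y"
  "f \<one>\<^sub>A = \<one>\<^sub>B"
 shows "f \<in> algebra_hom A B"
 using assms by (auto simp: algebra_hom_def ring_hom_def linear_maps_def)

lemma algebra_homD:
 assumes "f \<in> algebra_hom A B"
 shows "f \<in> linear_maps A B"
  "x \<in> carrier A ==> f x \<in> carrier B"
  "x \<in> carrier A ==> y \<in> carrier A ==> f (x \<oplus>\<^sub>A y) = f x \<oplus>\<^sub>B f y"
  "x \<in> carrier A ==> f (c \<odot>\<^sub>A x) = c \<odot>\<^sub>B f x"
  "x \<in> carrier A ==> y \<in> carrier A ==> f (x \<otimes>\<^sub>A y) = f x \<otimes>\<^sub>B f y"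
  "f \<one>\<^sub>A = \<one>\<^sub>B"
 using assms by (auto simp: algebra_hom_def ring_hom_def linear_maps_def)

lemma linear_maps_zero:
 assumes "assoc_algebra A" "assoc_algebra B" "f \<in> linear_maps A B"
 shows "f \<zero>\<^sub>A = \<zero>\<^sub>B"
proof -
 interpret A: assoc_algebra A by fact
 interpret B: assoc_algebra B by fact
 have "f \<zero>\<^sub>A = f (0 \<odot>\<^sub>A \<zero>\<^sub>A)" by simp
 also have "\<dots> = 0 \<odot>\<^sub>B f \<zero>\<^sub>A" using linear_mapsD(3)[OF assms(3)] A.zero_closed by blast
 also have "\<dots> = \<zero>\<^sub>B" using linear_mapsD(1)[OF assms(3)] by simp
 finally show ?thesis .
qed

lemma linear_maps_minus:
 assumes "assoc_algebra A" "assoc_algebra B" "f \<in> linear_maps A B" "x \<in> carrier A" "y \<in> carrier A"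
 shows "f (x \<ominus>\<^sub>A y) = f x \<ominus>\<^sub>B f y"
proof -
 interpret A: assoc_algebra A by fact
 interpret B: assoc_algebra B by fact
 have "\<ominus>\<^sub>A y = (-1) \<odot>\<^sub>A y" using A.smult_minus_left[of y 1] assms by (simp add: A.smult_one)
 moreover have "\<ominus>\<^sub>B f y = (-1) \<odot>\<^sub>B f y"
  using B.smult_minus_left[of "f y" 1] assms linear_mapsD(1)[OF assms(3)] by (simp add: B.smult_one)
 ultimately show ?thesis using assms(4,5) by (simp add: A.minus_eq B.minus_eq linear_mapsD[OF assms(3)] A.smult_closed)
qed

lemma linear_maps_finsum:
 assumes "assoc_algebra A" "assoc_algebra B" "f \<in> linear_maps A B" "finite Z" "F \<in> Z \<rightarrow> carrier A"
 shows "f (\<Oplus>\<^sub>A z\<in>Z. F z) = (\<Oplus>\<^sub>B z\<in>Z. f (F z))"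
proof -
 interpret A: assoc_algebra A by fact
 interpret B: assoc_algebra B by fact
 show ?thesis using assms(4,5)
  by (induct Z rule: finite_induct)
   (auto simp: linear_maps_zero[OF assms(1-3)] linear_mapsD[OF assms(3)] Pi_def)
qed

lemma monoid_algebra_sel [simp]:
 "carrier (monoid_algebra M) = {f. finite {x. f x \<noteq> 0} \<and> {x. f x \<noteq> 0} \<subseteq> carrier M}"
 "\<one>\<^bsub>monoid_algebra M\<^esub> = basis_elt \<one>\<^sub>M"
 "\<zero>\<^bsub>monoid_algebra M\<^esub> = (\<lambda>_. 0)"
 "f \<oplus>\<^bsub>monoid_algebra M\<^esub> g = (\<lambda>z. f z + g z)"
 "c \<odot>\<^bsub>monoid_algebra M\<^esub> f = (\<lambda>z. c * f z)"
 by (auto simp: monoid_algebra_def)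

lemma monoid_algebra_mult:
 assumes "finite X" "finite Y" "{x. f x \<noteq> 0} \<subseteq> X" "{y. g y \<noteq> 0} \<subseteq> Y"
 shows "(f \<otimes>\<^bsub>monoid_algebra M\<^esub> g) z = (\<Sum>x\<in>X. \<Sum>y\<in>Y. if x \<otimes>\<^sub>M y = z then f x * g y else 0)"
proof -
 have "(f \<otimes>\<^bsub>monoid_algebra M\<^esub> g) z = (\<Sum>x\<in>{x. f x \<noteq> 0}. \<Sum>y\<in>{y. g y \<noteq> 0}. if x \<otimes>\<^sub>M y = z then f x * g y else 0)"
  by (simp add: monoid_algebra_def)
 also have "\<dots> = (\<Sum>x\<in>{x. f x \<noteq> 0}. \<Sum>y\<in>Y. if x \<otimes>\<^sub>M y = z then f x * g y else 0)"
  using assms by (intro sum.cong refl sum.mono_neutral_left) auto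
 also have "\<dots> = (\<Sum>x\<in>X. \<Sum>y\<in>Y. if x \<otimes>\<^sub>M y = z then f x * g y else 0)"
  using assms by (intro sum.mono_neutral_left ballI sum.neutral) auto
 finally show ?thesis .
qed

lemma basis_elt_mult:
 "basis_elt x \<otimes>\<^bsub>monoid_algebra M\<^esub> basis_elt y = (basis_elt (x \<otimes>\<^sub>M y) :: _ \<Rightarrow> 'k::field)"
 by (rule ext, subst monoid_algebra_mult[of "{x}" "{y}"]) (auto simp: basis_elt_def)

lemma basis_elt_closed: "x \<in> carrier M ==> basis_elt x \<in> carrier (monoid_algebra M)"
 by (simp add: basis_elt_def)

lemma supp_monoid_algebra_mult:
 assumes "finite X" "finite Y" "{x. f x \<noteq> 0} \<subseteq> X" "{y. g y \<noteq> 0} \<subseteq> Y"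
 shows "{z. (f \<otimes>\<^bsub>monoid_algebra M\<^esub> g) z \<noteq> 0} \<subseteq> (\<lambda>(x,y). x \<otimes>\<^sub>M y) ` (X \<times> Y)"
proof
 fix z assume "z \<in> {z. (f \<otimes>\<^bsub>monoid_algebra M\<^esub> g) z \<noteq> 0}"
 then have nz: "(\<Sum>x\<in>X. \<Sum>y\<in>Y. if x \<otimes>\<^sub>M y = z then f x * g y else 0) \<noteq> 0"
  by (simp add: monoid_algebra_mult[OF assms])
 show "z \<in> (\<lambda>(x,y). x \<otimes>\<^sub>M y) ` (X \<times> Y)"
 proof (rule ccontr)
  assume "z \<notin> (\<lambda>(x,y). x \<otimes>\<^sub>M y) ` (X \<times> Y)"
  then have "(\<Sum>x\<in>X. \<Sum>y\<in>Y. if x \<otimes>\<^sub>M y = z then f x * g y else 0) = 0"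
   by (intro sum.neutral ballI) auto
  with nz show False by simp
 qed
qed

text \<open>Associativity is the substantial axiom: both bracketings become the same triple sum over
  the three supports, once the sum over products of support elements has collapsed to the one
  matching index.\<close>

lemma assoc_algebra_monoid_algebra:
 assumes "monoid M"
 shows "assoc_algebra (monoid_algebra M :: ('k::field, 'm \<Rightarrow> 'k) module)"
proof -
 interpret M: monoid M by fact
 let ?R = "monoid_algebra M :: ('k, 'm \<Rightarrow> 'k) module"
 have fin_add: "finite {x. f x + g x \<noteq> 0}" if "finite {x. f x \<noteq> 0}" "finite {x. g x \<noteq> 0}" for f g :: "'m \<Rightarrow> 'k"
  by (rule finite_subset[OF _ finite_UnI[OF that]]) auto
 have add_cl: "f \<oplus>\<^bsub>?R\<^esub> g \<in> carrier ?R" if "f \<in> carrier ?R" "g \<in> carrier ?R" for f g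
 proof -
  have "{x. f x + g x \<noteq> 0} \<subseteq> {x. f x \<noteq> 0} \<union> {x. g x \<noteq> 0}" by auto
  then show ?thesis using that fin_add[of f g] unfolding monoid_algebra_sel mem_Collect_eq by blast
 qed
 have sm_cl: "c \<odot>\<^bsub>?R\<^esub> f \<in> carrier ?R" if "f \<in> carrier ?R" for f c
 proof -
  have "{x. c * f x \<noteq> 0} \<subseteq> {x. f x \<noteq> 0}" by auto
  then show ?thesis using that finite_subset unfolding monoid_algebra_sel mem_Collect_eq by blast
 qed
 have mult_cl: "f \<otimes>\<^bsub>?R\<^esub> g \<in> carrier ?R" if "f \<in> carrier ?R" "g \<in> carrier ?R" for f g
 proof -
  have s: "{z. (f \<otimes>\<^bsub>?R\<^esub> g) z \<noteq> 0} \<subseteq> (\<lambda>(x,y). x \<otimes>\<^sub>M y) ` ({x. f x \<noteq> 0} \<times> {x. g x \<noteq> 0})"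
   using that by (intro supp_monoid_algebra_mult) auto
  moreover have "finite ((\<lambda>(x,y). x \<otimes>\<^sub>M y) ` ({x. f x \<noteq> 0} \<times> {x. g x \<noteq> 0}))" using that by auto
  moreover have "(\<lambda>(x,y). x \<otimes>\<^sub>M y) ` ({x. f x \<noteq> 0} \<times> {x. g x \<noteq> 0}) \<subseteq> carrier M" using that by auto
  ultimately show ?thesis
   unfolding monoid_algebra_sel mem_Collect_eq by (meson finite_subset subset_trans)
 qed
 have ab: "abelian_group ?R"
 proof (rule abelian_groupI)
  fix x assume x: "x \<in> carrier ?R"
  show "\<exists>y\<in>carrier ?R. y \<oplus>\<^bsub>?R\<^esub> x = \<zero>\<^bsub>?R\<^esub>"
   by (rule bexI[OF _ sm_cl[OF x, of "-1"]]) simp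
 next
  show "\<zero>\<^bsub>?R\<^esub> \<in> carrier ?R" by simp
 qed (rule add_cl | simp_all only: monoid_algebra_sel add_ac add_0_left add_0_right)+
 have mon: "Group.monoid ?R"
 proof (rule monoidI)
  fix f g h assume f: "f \<in> carrier ?R" and g: "g \<in> carrier ?R" and h: "h \<in> carrier ?R"
  let ?X = "{x. f x \<noteq> 0}" and ?Y = "{x. g x \<noteq> 0}" and ?Z = "{x. h x \<noteq> 0}"
  let ?XY = "(\<lambda>(x,y). x \<otimes>\<^sub>M y) ` (?X \<times> ?Y)" and ?YZ = "(\<lambda>(x,y). x \<otimes>\<^sub>M y) ` (?Y \<times> ?Z)"
  have fin: "finite ?X" "finite ?Y" "finite ?Z" "finite ?XY" "finite ?YZ" using f g h by auto
  have sub: "?X \<subseteq> carrier M" "?Y \<subseteq> carrier M" "?Z \<subseteq> carrier M" using f g h by auto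
  have mi: "(if P then u else 0) * v = (if P then u * v else 0)" "v * (if P then u else 0) = (if P then v * u else 0)"
   for P and u v :: 'k by auto
  have fg: "(f \<otimes>\<^bsub>?R\<^esub> g) w = (\<Sum>x\<in>?X. \<Sum>y\<in>?Y. if x \<otimes>\<^sub>M y = w then f x * g y else 0)" for w
   by (rule monoid_algebra_mult[OF fin(1,2) subset_refl subset_refl])
  have gh: "(g \<otimes>\<^bsub>?R\<^esub> h) w = (\<Sum>x\<in>?Y. \<Sum>y\<in>?Z. if x \<otimes>\<^sub>M y = w then g x * h y else 0)" for w
   by (rule monoid_algebra_mult[OF fin(2,3) subset_refl subset_refl])
  show "f \<otimes>\<^bsub>?R\<^esub> g \<otimes>\<^bsub>?R\<^esub> h = f \<otimes>\<^bsub>?R\<^esub> (g \<otimes>\<^bsub>?R\<^esub> h)"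
  proof
   fix z
   let ?t = "\<lambda>x y u. if x \<otimes>\<^sub>M (y \<otimes>\<^sub>M u) = z then f x * (g y * h u) else 0"
   have "(f \<otimes>\<^bsub>?R\<^esub> g \<otimes>\<^bsub>?R\<^esub> h) z =
    (\<Sum>w\<in>?XY. \<Sum>u\<in>?Z. if w \<otimes>\<^sub>M u = z then (f \<otimes>\<^bsub>?R\<^esub> g) w * h u else 0)"
    by (rule monoid_algebra_mult[OF fin(4) fin(3) supp_monoid_algebra_mult[OF fin(1,2) subset_refl subset_refl] subset_refl])
   also have "\<dots> = (\<Sum>u\<in>?Z. \<Sum>w\<in>?XY. if w \<otimes>\<^sub>M u = z then (f \<otimes>\<^bsub>?R\<^esub> g) w * h u else 0)"
    by (rule sum.swap)
   also have "\<dots> = (\<Sum>u\<in>?Z. \<Sum>x\<in>?X. \<Sum>y\<in>?Y. ?t x y u)"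
   proof (rule sum.cong[OF refl])
    fix u assume u: "u \<in> ?Z"
    have "(\<Sum>w\<in>?XY. if w \<otimes>\<^sub>M u = z then (f \<otimes>\<^bsub>?R\<^esub> g) w * h u else 0) =
      (\<Sum>w\<in>?XY. \<Sum>x\<in>?X. \<Sum>y\<in>?Y. if x \<otimes>\<^sub>M y = w then (if w \<otimes>\<^sub>M u = z then f x * g y * h u else 0) else 0)"
    proof (rule sum.cong[OF refl])
     fix w
     show "(if w \<otimes>\<^sub>M u = z then (f \<otimes>\<^bsub>?R\<^esub> g) w * h u else 0) =
      (\<Sum>x\<in>?X. \<Sum>y\<in>?Y. if x \<otimes>\<^sub>M y = w then (if w \<otimes>\<^sub>M u = z then f x * g y * h u else 0) else 0)"
      by (cases "w \<otimes>\<^sub>M u = z") (simp_all add: fg sum_distrib_right mi cong: if_cong)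
    qed
    also have "\<dots> = (\<Sum>x\<in>?X. \<Sum>w\<in>?XY. \<Sum>y\<in>?Y. if x \<otimes>\<^sub>M y = w then (if w \<otimes>\<^sub>M u = z then f x * g y * h u else 0) else 0)"
     by (rule sum.swap)
    also have "\<dots> = (\<Sum>x\<in>?X. \<Sum>y\<in>?Y. ?t x y u)"
    proof (rule sum.cong[OF refl])
     fix x assume x: "x \<in> ?X"
     have "(\<Sum>w\<in>?XY. \<Sum>y\<in>?Y. if x \<otimes>\<^sub>M y = w then (if w \<otimes>\<^sub>M u = z then f x * g y * h u else 0) else 0)
      = (\<Sum>y\<in>?Y. \<Sum>w\<in>?XY. if x \<otimes>\<^sub>M y = w then (if w \<otimes>\<^sub>M u = z then f x * g y * h u else 0) else 0)"
      by (rule sum.swap)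
     also have "\<dots> = (\<Sum>y\<in>?Y. ?t x y u)"
     proof (rule sum.cong[OF refl])
      fix y assume y: "y \<in> ?Y"
      have "x \<otimes>\<^sub>M y \<in> ?XY" using x y by auto
      then show "(\<Sum>w\<in>?XY. if x \<otimes>\<^sub>M y = w then (if w \<otimes>\<^sub>M u = z then f x * g y * h u else 0) else 0) = ?t x y u"
       using fin(4) u x y sub by (simp add: M.m_assoc subset_iff mult.assoc)
     qed
     finally show "(\<Sum>w\<in>?XY. \<Sum>y\<in>?Y. if x \<otimes>\<^sub>M y = w then (if w \<otimes>\<^sub>M u = z then f x * g y * h u else 0) else 0)
      = (\<Sum>y\<in>?Y. ?t x y u)" .
    qed
    finally show "(\<Sum>w\<in>?XY. if w \<otimes>\<^sub>M u = z then (f \<otimes>\<^bsub>?R\<^esub> g) w * h u else 0) = (\<Sum>x\<in>?X. \<Sum>y\<in>?Y. ?t x y u)" .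
   qed
   also have "\<dots> = (\<Sum>x\<in>?X. \<Sum>u\<in>?Z. \<Sum>y\<in>?Y. ?t x y u)" by (rule sum.swap)
   also have "\<dots> = (\<Sum>x\<in>?X. \<Sum>w\<in>?YZ. if x \<otimes>\<^sub>M w = z then f x * (g \<otimes>\<^bsub>?R\<^esub> h) w else 0)"
   proof (rule sum.cong[OF refl])
    fix x
    have "(\<Sum>w\<in>?YZ. if x \<otimes>\<^sub>M w = z then f x * (g \<otimes>\<^bsub>?R\<^esub> h) w else 0) =
      (\<Sum>w\<in>?YZ. \<Sum>y\<in>?Y. \<Sum>u\<in>?Z. if y \<otimes>\<^sub>M u = w then (if x \<otimes>\<^sub>M w = z then f x * (g y * h u) else 0) else 0)"
    proof (rule sum.cong[OF refl])
     fix w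
     show "(if x \<otimes>\<^sub>M w = z then f x * (g \<otimes>\<^bsub>?R\<^esub> h) w else 0) =
      (\<Sum>y\<in>?Y. \<Sum>u\<in>?Z. if y \<otimes>\<^sub>M u = w then (if x \<otimes>\<^sub>M w = z then f x * (g y * h u) else 0) else 0)"
      by (cases "x \<otimes>\<^sub>M w = z") (simp_all add: gh sum_distrib_left mi cong: if_cong)
    qed
    also have "\<dots> = (\<Sum>y\<in>?Y. \<Sum>w\<in>?YZ. \<Sum>u\<in>?Z. if y \<otimes>\<^sub>M u = w then (if x \<otimes>\<^sub>M w = z then f x * (g y * h u) else 0) else 0)"
     by (rule sum.swap)
    also have "\<dots> = (\<Sum>y\<in>?Y. \<Sum>u\<in>?Z. ?t x y u)"
    proof (rule sum.cong[OF refl])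
     fix y assume y: "y \<in> ?Y"
     have "(\<Sum>w\<in>?YZ. \<Sum>u\<in>?Z. if y \<otimes>\<^sub>M u = w then (if x \<otimes>\<^sub>M w = z then f x * (g y * h u) else 0) else 0)
      = (\<Sum>u\<in>?Z. \<Sum>w\<in>?YZ. if y \<otimes>\<^sub>M u = w then (if x \<otimes>\<^sub>M w = z then f x * (g y * h u) else 0) else 0)"
      by (rule sum.swap)
     also have "\<dots> = (\<Sum>u\<in>?Z. ?t x y u)"
     proof (rule sum.cong[OF refl])
      fix u assume u: "u \<in> ?Z"
      have "y \<otimes>\<^sub>M u \<in> ?YZ" using u y by auto
      then show "(\<Sum>w\<in>?YZ. if y \<otimes>\<^sub>M u = w then (if x \<otimes>\<^sub>M w = z then f x * (g y * h u) else 0) else 0) = ?t x y u"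
       using fin(5) by simp
     qed
     finally show "(\<Sum>w\<in>?YZ. \<Sum>u\<in>?Z. if y \<otimes>\<^sub>M u = w then (if x \<otimes>\<^sub>M w = z then f x * (g y * h u) else 0) else 0)
      = (\<Sum>u\<in>?Z. ?t x y u)" .
    qed
    also have "\<dots> = (\<Sum>u\<in>?Z. \<Sum>y\<in>?Y. ?t x y u)" by (rule sum.swap)
    finally show "(\<Sum>u\<in>?Z. \<Sum>y\<in>?Y. ?t x y u) = (\<Sum>w\<in>?YZ. if x \<otimes>\<^sub>M w = z then f x * (g \<otimes>\<^bsub>?R\<^esub> h) w else 0)" by simp
   qed
   also have "\<dots> = (f \<otimes>\<^bsub>?R\<^esub> (g \<otimes>\<^bsub>?R\<^esub> h)) z"
    by (rule monoid_algebra_mult[OF fin(1) fin(5) subset_refl supp_monoid_algebra_mult[OF fin(2,3) subset_refl subset_refl], symmetric])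
   finally show "(f \<otimes>\<^bsub>?R\<^esub> g \<otimes>\<^bsub>?R\<^esub> h) z = (f \<otimes>\<^bsub>?R\<^esub> (g \<otimes>\<^bsub>?R\<^esub> h)) z" .
  qed
 next
  fix f assume f: "f \<in> carrier ?R"
  then have fin: "finite {x. f x \<noteq> 0}" and sub: "\<And>x. f x \<noteq> 0 ==> x \<in> carrier M" by auto
  show "\<one>\<^bsub>?R\<^esub> \<otimes>\<^bsub>?R\<^esub> f = f"
  proof
   fix z
   have "(\<one>\<^bsub>?R\<^esub> \<otimes>\<^bsub>?R\<^esub> f) z = (\<Sum>y\<in>{x. f x \<noteq> 0}. if \<one>\<^sub>M \<otimes>\<^sub>M y = z then f y else 0)"
    by (subst monoid_algebra_mult[of "{\<one>\<^sub>M}", OF _ fin]) (auto simp: basis_elt_def cong: if_cong)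
   also have "\<dots> = (\<Sum>y\<in>{x. f x \<noteq> 0}. if y = z then f y else 0)"
    using sub by (intro sum.cong) auto
   also have "\<dots> = f z" using fin by simp
   finally show "(\<one>\<^bsub>?R\<^esub> \<otimes>\<^bsub>?R\<^esub> f) z = f z" .
  qed
  show "f \<otimes>\<^bsub>?R\<^esub> \<one>\<^bsub>?R\<^esub> = f"
  proof
   fix z
   have "(f \<otimes>\<^bsub>?R\<^esub> \<one>\<^bsub>?R\<^esub>) z = (\<Sum>y\<in>{x. f x \<noteq> 0}. if y \<otimes>\<^sub>M \<one>\<^sub>M = z then f y else 0)"
    by (subst monoid_algebra_mult[of _ "{\<one>\<^sub>M}", OF fin]) (auto simp: basis_elt_def cong: if_cong)
   also have "\<dots> = (\<Sum>y\<in>{x. f x \<noteq> 0}. if y = z then f y else 0)"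
    using sub by (intro sum.cong) auto
   also have "\<dots> = f z" using fin by simp
   finally show "(f \<otimes>\<^bsub>?R\<^esub> \<one>\<^bsub>?R\<^esub>) z = f z" .
  qed
 next
  show "\<one>\<^bsub>?R\<^esub> \<in> carrier ?R" by (auto simp: basis_elt_def)
 qed (rule mult_cl)
 have dl: "(f \<oplus>\<^bsub>?R\<^esub> g) \<otimes>\<^bsub>?R\<^esub> h = f \<otimes>\<^bsub>?R\<^esub> h \<oplus>\<^bsub>?R\<^esub> g \<otimes>\<^bsub>?R\<^esub> h"
  and dr: "h \<otimes>\<^bsub>?R\<^esub> (f \<oplus>\<^bsub>?R\<^esub> g) = h \<otimes>\<^bsub>?R\<^esub> f \<oplus>\<^bsub>?R\<^esub> h \<otimes>\<^bsub>?R\<^esub> g"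
  if "f \<in> carrier ?R" "g \<in> carrier ?R" "h \<in> carrier ?R" for f g h
 proof -
  let ?X = "{x. f x \<noteq> 0} \<union> {x. g x \<noteq> 0}" and ?Y = "{x. h x \<noteq> 0}"
  have fin: "finite ?X" "finite ?Y" using that by auto
  have sub: "{x. f x \<noteq> 0} \<subseteq> ?X" "{x. g x \<noteq> 0} \<subseteq> ?X" "{x. f x + g x \<noteq> 0} \<subseteq> ?X" "{x. h x \<noteq> 0} \<subseteq> ?Y" by auto
  note l = monoid_algebra_mult[OF fin sub(1,4), of M] monoid_algebra_mult[OF fin sub(2,4), of M] monoid_algebra_mult[OF fin sub(3,4), of M]
  note r = monoid_algebra_mult[OF fin(2,1) sub(4,1), of M] monoid_algebra_mult[OF fin(2,1) sub(4,2), of M] monoid_algebra_mult[OF fin(2,1) sub(4,3), of M]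
  show "(f \<oplus>\<^bsub>?R\<^esub> g) \<otimes>\<^bsub>?R\<^esub> h = f \<otimes>\<^bsub>?R\<^esub> h \<oplus>\<^bsub>?R\<^esub> g \<otimes>\<^bsub>?R\<^esub> h"
   unfolding monoid_algebra_sel l by (rule ext) (auto simp: sum.distrib[symmetric] distrib_right intro!: sum.cong)
  show "h \<otimes>\<^bsub>?R\<^esub> (f \<oplus>\<^bsub>?R\<^esub> g) = h \<otimes>\<^bsub>?R\<^esub> f \<oplus>\<^bsub>?R\<^esub> h \<otimes>\<^bsub>?R\<^esub> g"
   unfolding monoid_algebra_sel r by (rule ext) (auto simp: sum.distrib[symmetric] distrib_left intro!: sum.cong)
 qed
 have ml: "(c \<odot>\<^bsub>?R\<^esub> f) \<otimes>\<^bsub>?R\<^esub> g = c \<odot>\<^bsub>?R\<^esub> (f \<otimes>\<^bsub>?R\<^esub> g)"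
  and mr: "f \<otimes>\<^bsub>?R\<^esub> (c \<odot>\<^bsub>?R\<^esub> g) = c \<odot>\<^bsub>?R\<^esub> (f \<otimes>\<^bsub>?R\<^esub> g)"
  if "f \<in> carrier ?R" "g \<in> carrier ?R" for f g c
 proof -
  let ?X = "{x. f x \<noteq> 0}" and ?Y = "{x. g x \<noteq> 0}"
  have fin: "finite ?X" "finite ?Y" using that by auto
  have sub: "?X \<subseteq> ?X" "?Y \<subseteq> ?Y" "{x. c * f x \<noteq> 0} \<subseteq> ?X" "{x. c * g x \<noteq> 0} \<subseteq> ?Y" by auto
  note l = monoid_algebra_mult[OF fin sub(1,2), of M] monoid_algebra_mult[OF fin sub(3,2), of M] monoid_algebra_mult[OF fin sub(1,4), of M]
  show "(c \<odot>\<^bsub>?R\<^esub> f) \<otimes>\<^bsub>?R\<^esub> g = c \<odot>\<^bsub>?R\<^esub> (f \<otimes>\<^bsub>?R\<^esub> g)"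
   unfolding monoid_algebra_sel l by (rule ext) (auto simp: sum_distrib_left mult_ac intro!: sum.cong)
  show "f \<otimes>\<^bsub>?R\<^esub> (c \<odot>\<^bsub>?R\<^esub> g) = c \<odot>\<^bsub>?R\<^esub> (f \<otimes>\<^bsub>?R\<^esub> g)"
   unfolding monoid_algebra_sel l by (rule ext) (auto simp: sum_distrib_left mult_ac intro!: sum.cong)
 qed
 have "Ring.ring ?R"
  by (rule ringI[OF ab mon dl dr])
 then show ?thesis
  unfolding assoc_algebra_def assoc_algebra_axioms_def
  by (intro conjI allI impI sm_cl ml mr) (simp_all only: monoid_algebra_sel distrib_left distrib_right mult.assoc mult_1)
qed

text \<open>A formal sum is built by peeling points off a finite set that contains its
  support.\<close>

lemma monoid_algebra_induct [consumes 1, case_names zero add smult basis]: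
 assumes "f \<in> carrier (monoid_algebra M :: ('k::field, 'm \<Rightarrow> 'k) module)"
  and zero: "P (\<lambda>_. 0)"
  and add: "\<And>f g. f \<in> carrier (monoid_algebra M :: ('k, 'm \<Rightarrow> 'k) module) ==>
   g \<in> carrier (monoid_algebra M :: ('k, 'm \<Rightarrow> 'k) module) ==> P f ==> P g ==> P (\<lambda>z. f z + g z)"
  and smult: "\<And>c f. f \<in> carrier (monoid_algebra M :: ('k, 'm \<Rightarrow> 'k) module) ==> P f ==> P (\<lambda>z. c * f z)"
  and basis: "\<And>x. x \<in> carrier M ==> P (basis_elt x)"
 shows "P f"
proof -
 let ?R = "monoid_algebra M :: ('k, 'm \<Rightarrow> 'k) module"
 have "f \<in> carrier ?R \<longrightarrow> {x. f x \<noteq> 0} \<subseteq> S \<longrightarrow> P f" if "finite S" for S f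
  using that
 proof (induct S arbitrary: f rule: finite_induct)
  case empty
  show ?case
  proof (intro impI)
   assume "{x. f x \<noteq> 0} \<subseteq> {}"
   then have "f = (\<lambda>_. 0)" by auto
   then show "P f" using zero by simp
  qed
 next
  case (insert x S)
  show ?case
  proof (intro impI)
   assume f: "f \<in> carrier ?R" and s: "{x. f x \<noteq> 0} \<subseteq> insert x S"
   let ?g = "f(x := 0)"
   have sub: "{y. ?g y \<noteq> 0} \<subseteq> {y. f y \<noteq> 0}" "{y. ?g y \<noteq> 0} \<subseteq> S" using s by auto
   have "?g \<in> carrier ?R" using f sub(1) unfolding monoid_algebra_sel mem_Collect_eq
    by (meson finite_subset subset_trans)
   then have g: "?g \<in> carrier ?R" "P ?g" using insert(3)[of ?g] sub by blast+
   show "P f"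
   proof (cases "f x = 0")
    case True
    then have "?g = f" by auto
    then show ?thesis using g by metis
   next
    case False
    then have x: "x \<in> carrier M" using f by auto
    have e: "basis_elt x \<in> carrier ?R" by (rule basis_elt_closed[OF x])
    have "(\<lambda>z. f x * basis_elt x z) \<in> carrier ?R" using x by (auto simp: basis_elt_def)
    then have "P (\<lambda>z. f x * basis_elt x z + ?g z)"
     using smult[OF e basis[OF x]] g by (intro add)
    also have "(\<lambda>z. f x * basis_elt x z + ?g z) = f" by (auto simp: basis_elt_def)
    finally show ?thesis .
   qed
  qed
 qed
 then show ?thesis using assms(1) by (auto simp: subset_iff)
qed

lemma (in assoc_algebra) mext_linear:
 assumes "F \<in> carrier M \<rightarrow> carrier A"
 shows "mext A F \<in> linear_maps (monoid_algebra M) A"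
proof (rule linear_mapsI)
 have F: "F \<in> {z. t z \<noteq> 0} \<rightarrow> carrier A" if "t \<in> carrier (monoid_algebra M)" for t :: "_ \<Rightarrow> 'k"
  using that assms by auto
 fix s t :: "_ \<Rightarrow> 'k" and c assume s: "s \<in> carrier (monoid_algebra M)"
 show "mext A F s \<in> carrier A" by (rule mext_closed[OF F[OF s]])
 show "mext A F (c \<odot>\<^bsub>monoid_algebra M\<^esub> s) = c \<odot> mext A F s"
  using s F[OF s] by (simp add: mext_smult)
 assume t: "t \<in> carrier (monoid_algebra M)"
 show "mext A F (s \<oplus>\<^bsub>monoid_algebra M\<^esub> t) = mext A F s \<oplus> mext A F t"
  using s t F[OF s] F[OF t] by (simp add: mext_add)
qed

lemma linear_maps_monoid_algebra_eq:
 assumes "assoc_algebra D" "monoid M" "f \<in> linear_maps (monoid_algebra M) D" "f' \<in> linear_maps (monoid_algebra M) D"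
  and "\<And>x. x \<in> carrier M ==> f (basis_elt x) = f' (basis_elt x)"
  and "t \<in> carrier (monoid_algebra M)"
 shows "f t = f' t"
 using assms(6)
proof (induct t rule: monoid_algebra_induct)
 case zero
 show ?case
  using linear_maps_zero[OF assoc_algebra_monoid_algebra[OF assms(2)] assms(1) assms(3)]
   linear_maps_zero[OF assoc_algebra_monoid_algebra[OF assms(2)] assms(1) assms(4)] by simp
qed (use assms(5) linear_mapsD(2,3)[OF assms(3)] linear_mapsD(2,3)[OF assms(4)] in \<open>simp_all\<close>)

text \<open>Both sides are linear in each argument, so multiplicativity of \<open>F\<close> on basis
  elements suffices; the right argument is treated first.\<close>

lemma (in assoc_algebra) mext_mult:
 assumes M: "monoid M" and F: "F \<in> carrier M \<rightarrow> carrier A"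
  and m: "\<And>x y. x \<in> carrier M ==> y \<in> carrier M ==> F (x \<otimes>\<^sub>M y) = F x \<otimes> F y"
  and s: "s \<in> carrier (monoid_algebra M)" and t: "t \<in> carrier (monoid_algebra M)"
 shows "mext A F (s \<otimes>\<^bsub>monoid_algebra M\<^esub> t) = mext A F s \<otimes> mext A F t"
proof -
 let ?R = "monoid_algebra M :: ('k, _ \<Rightarrow> 'k) module"
 interpret R: assoc_algebra ?R by (rule assoc_algebra_monoid_algebra[OF M])
 have Fx: "F x \<in> carrier A" if "x \<in> carrier M" for x using F that by auto
 note L = mext_linear[OF F]
 note LD = linear_mapsD[OF L]
 have 1: "mext A F (basis_elt x \<otimes>\<^bsub>?R\<^esub> t) = F x \<otimes> mext A F t" if x: "x \<in> carrier M" and t: "t \<in> carrier ?R" for x t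
 proof (rule linear_maps_monoid_algebra_eq[OF assoc_algebra_self M _ _ _ t])
  have e: "basis_elt x \<in> carrier ?R" by (rule basis_elt_closed[OF x])
  show "(\<lambda>t. mext A F (basis_elt x \<otimes>\<^bsub>?R\<^esub> t)) \<in> linear_maps ?R A"
   by (rule linear_mapsI) (simp_all only: R.m_closed e LD R.r_distr R.smult_mult_r)
  show "(\<lambda>t. F x \<otimes> mext A F t) \<in> linear_maps ?R A"
   by (rule linear_mapsI) (simp_all only: m_closed LD r_distr smult_mult_r Fx x)
  fix y assume "y \<in> carrier M"
  then show "mext A F (basis_elt x \<otimes>\<^bsub>?R\<^esub> basis_elt y) = F x \<otimes> mext A F (basis_elt y)"
   using x M by (simp add: basis_elt_mult mext_basis Fx m monoid.m_closed)
 qed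
 show ?thesis
 proof (rule linear_maps_monoid_algebra_eq[OF assoc_algebra_self M _ _ _ s])
  show "(\<lambda>s. mext A F (s \<otimes>\<^bsub>?R\<^esub> t)) \<in> linear_maps ?R A"
   by (rule linear_mapsI) (simp_all only: R.m_closed t LD R.l_distr R.smult_mult_l)
  show "(\<lambda>s. mext A F s \<otimes> mext A F t) \<in> linear_maps ?R A"
   by (rule linear_mapsI) (simp_all only: m_closed t LD l_distr smult_mult_l)
  fix x assume "x \<in> carrier M"
  then show "mext A F (basis_elt x \<otimes>\<^bsub>?R\<^esub> t) = mext A F (basis_elt x) \<otimes> mext A F t"
   using 1 t by (simp add: mext_basis Fx)
 qed
qed

section \<open>Quotient algebras\<close>

locale algebra_ideal = R: assoc_algebra R + I: ideal I R for R :: "('k::field, 'a) module" and I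
begin

abbreviation Q where "Q \<equiv> quot_algebra R I"

lemma quot_sel:
 "carrier Q = {I +>\<^bsub>R\<^esub> x | x. x \<in> carrier R}"
 "\<one>\<^sub>Q = I +>\<^bsub>R\<^esub> \<one>\<^sub>R"
 "\<zero>\<^sub>Q = I"
 by (auto simp: quot_algebra_def FactRing_def ring.defs module.defs A_RCOSETS_def' RCOSETS_def a_r_coset_def)

lemma coset_closed: "x \<in> carrier R ==> I +>\<^bsub>R\<^esub> x \<in> carrier Q"
 by (auto simp: quot_sel)

lemma coset_add: "x \<in> carrier R ==> y \<in> carrier R ==> (I +>\<^bsub>R\<^esub> x) \<oplus>\<^sub>Q (I +>\<^bsub>R\<^esub> y) = I +>\<^bsub>R\<^esub> (x \<oplus>\<^sub>R y)"
 using I.a_rcos_sum by (simp add: quot_algebra_def FactRing_def ring.defs module.defs)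

lemma coset_mult: "x \<in> carrier R ==> y \<in> carrier R ==> (I +>\<^bsub>R\<^esub> x) \<otimes>\<^sub>Q (I +>\<^bsub>R\<^esub> y) = I +>\<^bsub>R\<^esub> (x \<otimes>\<^sub>R y)"
 using I.rcoset_mult_add by (simp add: quot_algebra_def FactRing_def ring.defs module.defs)

lemma smult_mem: "x \<in> I ==> c \<odot>\<^sub>R x \<in> I"
 using R.smult_as_mult[of x c] I.I_l_closed[of x "c \<odot>\<^sub>R \<one>\<^sub>R"] R.smult_closed[of "\<one>\<^sub>R" c] I.Icarr by auto

lemma coset_eqI: "x \<in> carrier R ==> y \<in> carrier R ==> x \<ominus>\<^sub>R y \<in> I ==> I +>\<^bsub>R\<^esub> x = I +>\<^bsub>R\<^esub> y"
 using R.quotient_eq_iff_same_a_r_cos[OF I.is_ideal] by blast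

lemma coset_elem: "x \<in> carrier R ==> z \<in> I +>\<^bsub>R\<^esub> x \<longleftrightarrow> (\<exists>i\<in>I. z = i \<oplus>\<^sub>R x)"
 by (auto simp: a_r_coset_def r_coset_def)

text \<open>Scalar multiplication on the quotient is a union over representatives. It is a single
  coset because an ideal of an algebra is stable under scalars.\<close>

lemma coset_smult:
 assumes x: "x \<in> carrier R"
 shows "c \<odot>\<^sub>Q (I +>\<^bsub>R\<^esub> x) = I +>\<^bsub>R\<^esub> (c \<odot>\<^sub>R x)"
proof -
 have eq: "I +>\<^bsub>R\<^esub> (c \<odot>\<^sub>R z) = I +>\<^bsub>R\<^esub> (c \<odot>\<^sub>R x)" if z: "z \<in> I +>\<^bsub>R\<^esub> x" for z
 proof -
  obtain i where i: "i \<in> I" "z = i \<oplus>\<^sub>R x" using z coset_elem[OF x] by blast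
  have ic: "i \<in> carrier R" using i I.Icarr by auto
  have "c \<odot>\<^sub>R z \<ominus>\<^sub>R c \<odot>\<^sub>R x = c \<odot>\<^sub>R i"
   using i ic x by (simp add: R.smult_r_distr R.smult_closed R.minus_eq R.a_assoc R.r_neg)
  then show ?thesis using i ic x smult_mem[OF i(1)] by (intro coset_eqI) (auto simp: R.smult_closed)
 qed
 have "x \<in> I +>\<^bsub>R\<^esub> x" using x I.a_rcos_self by auto
 then have "(\<Union>z\<in>I +>\<^bsub>R\<^esub> x. I +>\<^bsub>R\<^esub> (c \<odot>\<^sub>R z)) = I +>\<^bsub>R\<^esub> (c \<odot>\<^sub>R x)" using eq by blast
 then show ?thesis by (simp add: quot_algebra_def FactRing_def ring.defs module.defs)
qed

lemma quot_elem: "X \<in> carrier Q ==> \<exists>x\<in>carrier R. X = I +>\<^bsub>R\<^esub> x"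
 by (auto simp: quot_sel)

lemma assoc_algebra_quot: "assoc_algebra Q"
proof -
 have fr: "Ring.ring (R Quot I)" by (rule I.quotient_is_ring)
 have 1: "carrier Q = carrier (R Quot I)" "mult Q = mult (R Quot I)" "one Q = one (R Quot I)"
  "add Q = add (R Quot I)" "zero Q = zero (R Quot I)"
  by (auto simp: quot_algebra_def FactRing_def ring.defs module.defs)
 have "Ring.ring Q"
 proof (rule ringI)
  interpret F: Ring.ring "R Quot I" by (rule fr)
  show "abelian_group Q"
  proof (rule abelian_groupI)
   fix x assume "x \<in> carrier Q"
   then show "\<exists>y\<in>carrier Q. y \<oplus>\<^sub>Q x = \<zero>\<^sub>Q"
    unfolding 1 using F.a_inv_closed F.l_neg by blast
  qed (unfold 1, simp_all only: F.a_closed F.zero_closed F.a_assoc F.l_zero, simp only: F.a_comm)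
  show "Group.monoid Q"
   using ring.axioms(2)[OF fr] unfolding Group.monoid_def by (simp add: 1)
 qed (use fr[unfolded ring_def ring_axioms_def] in \<open>simp_all only: 1\<close>)
 then show ?thesis
  unfolding assoc_algebra_def assoc_algebra_axioms_def
  by (auto dest!: quot_elem simp: coset_add coset_mult coset_smult coset_closed R.smult_closed R.smult_l_distr
   R.smult_r_distr R.smult_assoc1 R.smult_one R.smult_mult_l R.smult_mult_r)
qed

text \<open>A linear map that kills \<open>I\<close> is constant on cosets. The form with
  \<open>the_elem\<close> of an image matches \<open>tensor_lift\<close> and the maps out of the
  presented algebra.\<close>

lemma the_elem_coset:
 assumes "assoc_algebra D" "f \<in> linear_maps R D" "\<And>i. i \<in> I ==> f i = \<zero>\<^sub>D" "x \<in> carrier R"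
 shows "the_elem (f ` (I +>\<^bsub>R\<^esub> x)) = f x"
proof -
 interpret D: assoc_algebra D by fact
 have "f z = f x" if z: "z \<in> I +>\<^bsub>R\<^esub> x" for z
 proof -
  obtain i where i: "i \<in> I" "z = i \<oplus>\<^sub>R x" using z coset_elem[OF assms(4)] by blast
  then show ?thesis using linear_mapsD[OF assms(2)] assms(3,4) I.Icarr by simp
 qed
 moreover have "x \<in> I +>\<^bsub>R\<^esub> x" using assms(4) I.a_rcos_self by auto
 ultimately have "f ` (I +>\<^bsub>R\<^esub> x) = {f x}" by blast
 then show ?thesis by simp
qed

lemma quot_lift_linear:
 assumes "assoc_algebra D" "f \<in> linear_maps R D" "\<And>i. i \<in> I ==> f i = \<zero>\<^sub>D"
 shows "(\<lambda>X. the_elem (f ` X)) \<in> linear_maps Q D"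
 by (rule linear_mapsI) (auto dest!: quot_elem simp: coset_add coset_smult R.smult_closed
  the_elem_coset[OF assms] linear_mapsD[OF assms(2)])

lemma quot_lift_hom:
 assumes "assoc_algebra D" "f \<in> algebra_hom R D" "\<And>i. i \<in> I ==> f i = \<zero>\<^sub>D"
 shows "(\<lambda>X. the_elem (f ` X)) \<in> algebra_hom Q D"
 by (rule algebra_homI[OF quot_lift_linear[OF assms(1) algebra_homD(1)[OF assms(2)] assms(3)]])
  (auto dest!: quot_elem simp: coset_mult quot_sel(2) the_elem_coset[OF assms(1) algebra_homD(1)[OF assms(2)] assms(3)]
   algebra_homD[OF assms(2)])

end

section \<open>Tensor products\<close>

definition bilinear_maps where
 "bilinear_maps B C D = {\<beta>. (\<forall>x\<in>carrier B. \<beta> x \<in> linear_maps C D) \<and> (\<forall>y\<in>carrier C. (\<lambda>x. \<beta> x y) \<in> linear_maps B D)}"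

lemma bilinear_mapsD:
 assumes "\<beta> \<in> bilinear_maps B C D"
 shows "x \<in> carrier B ==> y \<in> carrier C ==> \<beta> x y \<in> carrier D"
  "x \<in> carrier B ==> x' \<in> carrier B ==> y \<in> carrier C ==> \<beta> (x \<oplus>\<^sub>B x') y = \<beta> x y \<oplus>\<^sub>D \<beta> x' y"
  "x \<in> carrier B ==> y \<in> carrier C ==> y' \<in> carrier C ==> \<beta> x (y \<oplus>\<^sub>C y') = \<beta> x y \<oplus>\<^sub>D \<beta> x y'"
  "x \<in> carrier B ==> y \<in> carrier C ==> \<beta> (c \<odot>\<^sub>B x) y = c \<odot>\<^sub>D \<beta> x y"
  "x \<in> carrier B ==> y \<in> carrier C ==> \<beta> x (c \<odot>\<^sub>C y) = c \<odot>\<^sub>D \<beta> x y"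
 using assms by (auto simp: bilinear_maps_def linear_maps_def)

lemma bilinear_mapsI:
 assumes "\<And>x y. x \<in> carrier B ==> y \<in> carrier C ==> \<beta> x y \<in> carrier D"
  "\<And>x x' y. x \<in> carrier B ==> x' \<in> carrier B ==> y \<in> carrier C ==> \<beta> (x \<oplus>\<^sub>B x') y = \<beta> x y \<oplus>\<^sub>D \<beta> x' y"
  "\<And>x y y'. x \<in> carrier B ==> y \<in> carrier C ==> y' \<in> carrier C ==> \<beta> x (y \<oplus>\<^sub>C y') = \<beta> x y \<oplus>\<^sub>D \<beta> x y'"
  "\<And>c x y. x \<in> carrier B ==> y \<in> carrier C ==> \<beta> (c \<odot>\<^sub>B x) y = c \<odot>\<^sub>D \<beta> x y"
  "\<And>c x y. x \<in> carrier B ==> y \<in> carrier C ==> \<beta> x (c \<odot>\<^sub>C y) = c \<odot>\<^sub>D \<beta> x y"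
 shows "\<beta> \<in> bilinear_maps B C D"
 using assms by (auto simp: bilinear_maps_def linear_maps_def)

locale two_algebras = B: assoc_algebra B + C: assoc_algebra C
 for B :: "('k::field, 'b) module" and C :: "('k, 'c) module"
begin

abbreviation R where "R \<equiv> monoid_algebra (B \<times>\<times> C) :: ('k, 'b \<times> 'c \<Rightarrow> 'k) module"
abbreviation T where "T \<equiv> tensor_algebra B C"
abbreviation pt where "pt \<equiv> pure_tensor B C"

lemma monoid_BC: "Group.monoid (B \<times>\<times> C)"
 by (intro DirProd_monoid) unfold_locales

sublocale R: assoc_algebra R
 by (rule assoc_algebra_monoid_algebra[OF monoid_BC])

lemma basis_pair_closed: "x \<in> carrier B ==> y \<in> carrier C ==> basis_elt (x, y) \<in> carrier R"
 by (rule basis_elt_closed) simp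

lemma tensor_relations_closed: "tensor_relations B C \<subseteq> carrier R"
proof -
 have d: "(\<lambda>z. f z - g z - h z) \<in> carrier R" if "f \<in> carrier R" "g \<in> carrier R" "h \<in> carrier R" for f g h
 proof -
  have "{z. f z - g z - h z \<noteq> 0} \<subseteq> {z. f z \<noteq> 0} \<union> {z. g z \<noteq> 0} \<union> {z. h z \<noteq> 0}" by auto
  moreover have "finite ({z. f z \<noteq> 0} \<union> {z. g z \<noteq> 0} \<union> {z. h z \<noteq> 0})" using that by auto
  moreover have "{z. f z \<noteq> 0} \<union> {z. g z \<noteq> 0} \<union> {z. h z \<noteq> 0} \<subseteq> carrier (B \<times>\<times> C)" using that by auto
  ultimately show ?thesis unfolding monoid_algebra_sel mem_Collect_eq by (meson finite_subset subset_trans)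
 qed
 have d2: "(\<lambda>z. f z - c * g z) \<in> carrier R" if "f \<in> carrier R" "g \<in> carrier R" for f g c
  using d[of f "\<lambda>z. c * g z" "\<lambda>_. 0"] R.smult_closed[of g c] that by auto
 show ?thesis
  unfolding tensor_relations_def
  by (intro Un_least subsetI; clarify; intro d d2 basis_pair_closed B.a_closed C.a_closed B.smult_closed C.smult_closed)
qed

sublocale algebra_ideal R "tensor_ideal B C"
 by (intro algebra_ideal.intro R.assoc_algebra_self) (simp add: tensor_ideal_def R.genideal_ideal[OF tensor_relations_closed])

lemma T_eq: "T = Q"
 by (simp add: tensor_algebra_def)

sublocale T: assoc_algebra T
 unfolding T_eq by (rule assoc_algebra_quot)

lemma pt_closed [simp]: "x \<in> carrier B ==> y \<in> carrier C ==> pt x y \<in> carrier T"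
 unfolding T_eq pure_tensor_def by (intro coset_closed basis_pair_closed)

lemma pt_mult: "\<lbrakk>x \<in> carrier B; y \<in> carrier C; x' \<in> carrier B; y' \<in> carrier C\<rbrakk> \<Longrightarrow>
  pt x y \<otimes>\<^sub>T pt x' y' = pt (x \<otimes>\<^sub>B x') (y \<otimes>\<^sub>C y')"
 unfolding T_eq pure_tensor_def by (simp only: coset_mult basis_pair_closed basis_elt_mult mult_DirProd)

lemma pt_one: "\<one>\<^sub>T = pt \<one>\<^sub>B \<one>\<^sub>C"
 unfolding T_eq pure_tensor_def by (simp add: quot_sel)

lemma relation_mem: "r \<in> tensor_relations B C ==> r \<in> tensor_ideal B C"
 unfolding tensor_ideal_def using R.genideal_self[OF tensor_relations_closed] by blast

lemma R_minus: "f \<in> carrier R ==> g \<in> carrier R ==> f \<ominus>\<^sub>R g = (\<lambda>z. f z - g z)"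
proof -
 assume f: "f \<in> carrier R" and g: "g \<in> carrier R"
 have "\<ominus>\<^sub>R g = (-1) \<odot>\<^sub>R g" using R.smult_minus_left[OF g, of 1] g by (simp add: R.smult_one del: monoid_algebra_sel)
 then show ?thesis using f g by (simp add: R.minus_eq)
qed

lemma R_diff2:
 "f \<in> carrier R ==> g \<in> carrier R ==> h \<in> carrier R ==> (\<lambda>z. f z - g z - h z) = f \<ominus>\<^sub>R (g \<oplus>\<^sub>R h)"
 by (subst R_minus[OF _ R.a_closed]) (simp_all only: monoid_algebra_sel(4) diff_diff_add)

lemma R_diff_smult:
 "f \<in> carrier R ==> g \<in> carrier R ==> (\<lambda>z. f z - c * g z) = f \<ominus>\<^sub>R (c \<odot>\<^sub>R g)"
 by (subst R_minus[OF _ R.smult_closed]) (simp_all only: monoid_algebra_sel(5))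

lemma pt_bilinear: "pt \<in> bilinear_maps B C T"
proof (rule bilinear_mapsI)
 fix x x' y y' c
 note bp = basis_pair_closed
 { assume *: "x \<in> carrier B" "x' \<in> carrier B" "y \<in> carrier C"
  have "(\<lambda>z. basis_elt (x \<oplus>\<^sub>B x', y) z - basis_elt (x, y) z - basis_elt (x', y) z) \<in> tensor_ideal B C"
   by (rule relation_mem, unfold tensor_relations_def) (use * in blast)
  also have "(\<lambda>z. basis_elt (x \<oplus>\<^sub>B x', y) z - basis_elt (x, y) z - basis_elt (x', y) z) =
   basis_elt (x \<oplus>\<^sub>B x', y) \<ominus>\<^sub>R (basis_elt (x, y) \<oplus>\<^sub>R basis_elt (x', y))"
   using * by (intro R_diff2 bp B.a_closed C.a_closed)
  finally show "pt (x \<oplus>\<^sub>B x') y = pt x y \<oplus>\<^sub>T pt x' y"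
   unfolding T_eq pure_tensor_def using * by (simp only: coset_add bp) (intro coset_eqI R.a_closed bp B.a_closed) }
 { assume *: "x \<in> carrier B" "y \<in> carrier C" "y' \<in> carrier C"
  have "(\<lambda>z. basis_elt (x, y \<oplus>\<^sub>C y') z - basis_elt (x, y) z - basis_elt (x, y') z) \<in> tensor_ideal B C"
   by (rule relation_mem, unfold tensor_relations_def) (use * in blast)
  also have "(\<lambda>z. basis_elt (x, y \<oplus>\<^sub>C y') z - basis_elt (x, y) z - basis_elt (x, y') z) =
   basis_elt (x, y \<oplus>\<^sub>C y') \<ominus>\<^sub>R (basis_elt (x, y) \<oplus>\<^sub>R basis_elt (x, y'))"
   using * by (intro R_diff2 bp B.a_closed C.a_closed)
  finally show "pt x (y \<oplus>\<^sub>C y') = pt x y \<oplus>\<^sub>T pt x y'"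
   unfolding T_eq pure_tensor_def using * by (simp only: coset_add bp) (intro coset_eqI R.a_closed bp C.a_closed) }
 { assume *: "x \<in> carrier B" "y \<in> carrier C"
  have "(\<lambda>z. basis_elt (c \<odot>\<^sub>B x, y) z - c * basis_elt (x, y) z) \<in> tensor_ideal B C"
   by (rule relation_mem, unfold tensor_relations_def) (use * in blast)
  also have "(\<lambda>z. basis_elt (c \<odot>\<^sub>B x, y) z - c * basis_elt (x, y) z) = basis_elt (c \<odot>\<^sub>B x, y) \<ominus>\<^sub>R (c \<odot>\<^sub>R basis_elt (x, y))"
   using * by (intro R_diff_smult bp B.smult_closed)
  finally show "pt (c \<odot>\<^sub>B x) y = c \<odot>\<^sub>T pt x y"
   unfolding T_eq pure_tensor_def using * by (simp only: coset_smult bp) (intro coset_eqI R.smult_closed bp B.smult_closed)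
  have "(\<lambda>z. basis_elt (x, c \<odot>\<^sub>C y) z - c * basis_elt (x, y) z) \<in> tensor_ideal B C"
   by (rule relation_mem, unfold tensor_relations_def) (use * in blast)
  also have "(\<lambda>z. basis_elt (x, c \<odot>\<^sub>C y) z - c * basis_elt (x, y) z) = basis_elt (x, c \<odot>\<^sub>C y) \<ominus>\<^sub>R (c \<odot>\<^sub>R basis_elt (x, y))"
   using * by (intro R_diff_smult bp C.smult_closed)
  finally show "pt x (c \<odot>\<^sub>C y) = c \<odot>\<^sub>T pt x y"
   unfolding T_eq pure_tensor_def using * by (simp only: coset_smult bp) (intro coset_eqI R.smult_closed bp C.smult_closed) }
qed simp

text \<open>Scalars get no case of their own: a multiple of a pure tensor is again pure, the scalar
  being absorbed by the left factor.\<close>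

lemma tensor_induct [consumes 1, case_names pure add]:
 assumes "t \<in> carrier T"
  and pure: "\<And>x y. x \<in> carrier B ==> y \<in> carrier C ==> P (pt x y)"
  and add: "\<And>s t. s \<in> carrier T ==> t \<in> carrier T ==> P s ==> P t ==> P (s \<oplus>\<^sub>T t)"
 shows "P t"
proof -
 obtain r where r: "r \<in> carrier R" "t = tensor_ideal B C +>\<^bsub>R\<^esub> r"
  using assms(1) quot_elem unfolding T_eq by blast
 \<comment> \<open>\<open>P\<close> is not assumed stable under scalars, so the induction on the
   representative has to cover all its multiples at once.\<close>
 have "\<forall>c. P (tensor_ideal B C +>\<^bsub>R\<^esub> (c \<odot>\<^sub>R r))"
  using r(1)
 proof (induct r rule: monoid_algebra_induct)
  case zero
  have "pt \<zero>\<^sub>B \<zero>\<^sub>C = 0 \<odot>\<^sub>T pt \<zero>\<^sub>B \<zero>\<^sub>C"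
   using bilinear_mapsD(4)[OF pt_bilinear, of "\<zero>\<^sub>B" "\<zero>\<^sub>C" 0] by simp
  then have "pt \<zero>\<^sub>B \<zero>\<^sub>C = \<zero>\<^sub>T" by simp
  also have "\<dots> = tensor_ideal B C +>\<^bsub>R\<^esub> \<zero>\<^sub>R" unfolding T_eq quot_sel using R.a_coset_add_zero[OF I.a_subset] by simp
  finally show ?case using pure[of "\<zero>\<^sub>B" "\<zero>\<^sub>C"] by simp
 next
  case (add f g)
  show ?case
  proof
   fix c
   have "tensor_ideal B C +>\<^bsub>R\<^esub> (c \<odot>\<^sub>R (f \<oplus>\<^sub>R g)) = (tensor_ideal B C +>\<^bsub>R\<^esub> (c \<odot>\<^sub>R f)) \<oplus>\<^sub>T (tensor_ideal B C +>\<^bsub>R\<^esub> (c \<odot>\<^sub>R g))"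
    unfolding T_eq using add(1,2) by (simp only: coset_add R.smult_closed R.smult_r_distr)
   then show "P (tensor_ideal B C +>\<^bsub>R\<^esub> (c \<odot>\<^sub>R (\<lambda>z. f z + g z)))"
    using add assms(3)[OF coset_closed[OF R.smult_closed[OF add(1)], folded T_eq] coset_closed[OF R.smult_closed[OF add(2)], folded T_eq]]
    by (simp del: monoid_algebra_sel(5))
  qed
 next
  case (smult c f)
  have "c' \<odot>\<^sub>R (\<lambda>z. c * f z) = (c' * c) \<odot>\<^sub>R f" for c' by (simp add: mult.assoc)
  then show ?case using smult by metis
 next
  case (basis xy)
  obtain x y where xy: "xy = (x, y)" "x \<in> carrier B" "y \<in> carrier C" using basis by auto
  show ?case
  proof
   fix c
   have "pt (c \<odot>\<^sub>B x) y = tensor_ideal B C +>\<^bsub>R\<^esub> (c \<odot>\<^sub>R basis_elt (x, y))"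
    using bilinear_mapsD(4)[OF pt_bilinear xy(2,3)] unfolding T_eq pure_tensor_def
    using xy by (simp only: coset_smult basis_pair_closed)
   then show "P (tensor_ideal B C +>\<^bsub>R\<^esub> (c \<odot>\<^sub>R basis_elt xy))" using pure[of "c \<odot>\<^sub>B x" y] xy B.smult_closed by auto
  qed
 qed
 moreover have "1 \<odot>\<^sub>R r = r" using r(1) R.smult_one by blast
 ultimately show ?thesis using r(2) by metis
qed

context
 fixes D :: "('k, 'd) module" and \<beta>
 assumes D: "assoc_algebra D" and \<beta>: "\<beta> \<in> bilinear_maps B C D"
begin

lemma mext_bilinear: "mext D (\<lambda>z. \<beta> (fst z) (snd z)) \<in> linear_maps R D"
 by (rule assoc_algebra.mext_linear[OF D]) (auto intro: bilinear_mapsD[OF \<beta>])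

end

text \<open>The relations generate a two-sided ideal, and the kernel of the extension of a single
  \<beta> need not be an ideal. The common kernel over all bilinear maps into \<open>D\<close> is
  one: multiplying by a basis element replaces \<beta> by its composite with multiplications by
  \<open>x\<close> and \<open>y\<close>, which is again bilinear.\<close>

lemma mext_tensor_ideal:
 fixes D :: "('k, 'd) module"
 assumes D: "assoc_algebra D" and \<beta>: "\<beta> \<in> bilinear_maps B C D" and i: "i \<in> tensor_ideal B C"
 shows "mext D (\<lambda>z. \<beta> (fst z) (snd z)) i = \<zero>\<^sub>D"
proof -
 interpret D: assoc_algebra D by fact
 let ?E = "\<lambda>\<beta>. mext D (\<lambda>z. \<beta> (fst z) (snd z))"
 let ?K = "{t \<in> carrier R. \<forall>\<beta>\<in>bilinear_maps B C D. ?E \<beta> t = \<zero>\<^sub>D}"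
 have Eb: "?E \<beta> (basis_elt (x, y)) = \<beta> x y" if "\<beta> \<in> bilinear_maps B C D" "x \<in> carrier B" "y \<in> carrier C" for \<beta> x y
  using D.mext_basis[of "\<lambda>z. \<beta> (fst z) (snd z)" "(x, y)"] bilinear_mapsD(1)[OF that] by simp
 have mb: "\<beta> \<in> bilinear_maps B C D ==> ?E \<beta> \<in> linear_maps R D" for \<beta> by (rule mext_bilinear[OF D])
 have sub0: "?E \<beta> \<zero>\<^sub>R = \<zero>\<^sub>D" if "\<beta> \<in> bilinear_maps B C D" for \<beta>
  by (rule linear_maps_zero[OF R.assoc_algebra_self D mb[OF that]])
 have l: "?E \<beta> (s \<otimes>\<^sub>R t) = \<zero>\<^sub>D" if t: "t \<in> ?K" and s: "s \<in> carrier R" and b: "\<beta> \<in> bilinear_maps B C D" for s t \<beta>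
 proof -
  have tc: "t \<in> carrier R" using t by blast
  have "(\<lambda>s. ?E \<beta> (s \<otimes>\<^sub>R t)) \<in> linear_maps R D"
   by (rule linear_mapsI) (simp_all only: R.m_closed tc linear_mapsD[OF mb[OF b]] R.l_distr R.smult_mult_l)
  moreover have "(\<lambda>s. \<zero>\<^sub>D) \<in> linear_maps R D" by (rule linear_mapsI) auto
  ultimately show ?thesis
  proof (rule linear_maps_monoid_algebra_eq[OF D monoid_BC _ _ _ s])
   fix xy assume "xy \<in> carrier (B \<times>\<times> C)"
   then obtain x y where xy: "xy = (x, y)" "x \<in> carrier B" "y \<in> carrier C" by auto
   let ?b = "\<lambda>x' y'. \<beta> (x \<otimes>\<^sub>B x') (y \<otimes>\<^sub>C y')"
   have b': "?b \<in> bilinear_maps B C D"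
    by (rule bilinear_mapsI) (simp_all only: xy bilinear_mapsD[OF b] B.m_closed C.m_closed B.r_distr C.r_distr B.smult_mult_r C.smult_mult_r)
   have e: "basis_elt (x, y) \<in> carrier R" by (rule basis_pair_closed[OF xy(2,3)])
   have "?E \<beta> (basis_elt xy \<otimes>\<^sub>R t) = ?E ?b t"
   proof (rule linear_maps_monoid_algebra_eq[OF D monoid_BC _ mb[OF b'] _ tc])
    show "(\<lambda>t. ?E \<beta> (basis_elt xy \<otimes>\<^sub>R t)) \<in> linear_maps R D" unfolding xy
     by (rule linear_mapsI) (simp_all only: R.m_closed e linear_mapsD[OF mb[OF b]] R.r_distr R.smult_mult_r)
    fix z assume "z \<in> carrier (B \<times>\<times> C)"
    then obtain x' y' where z: "z = (x', y')" "x' \<in> carrier B" "y' \<in> carrier C" by auto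
    show "?E \<beta> (basis_elt xy \<otimes>\<^sub>R basis_elt z) = ?E ?b (basis_elt z)"
     unfolding xy z basis_elt_mult mult_DirProd Eb[OF b' z(2,3)] using xy z by (simp only: Eb b B.m_closed C.m_closed)
   qed
   also have "\<dots> = \<zero>\<^sub>D" using bspec[OF conjunct2[OF t[unfolded mem_Collect_eq]] b'] .
   finally show "?E \<beta> (basis_elt xy \<otimes>\<^sub>R t) = \<zero>\<^sub>D" .
  qed
 qed
 have r: "?E \<beta> (t \<otimes>\<^sub>R s) = \<zero>\<^sub>D" if t: "t \<in> ?K" and s: "s \<in> carrier R" and b: "\<beta> \<in> bilinear_maps B C D" for s t \<beta>
 proof -
  have tc: "t \<in> carrier R" using t by blast
  have "(\<lambda>s. ?E \<beta> (t \<otimes>\<^sub>R s)) \<in> linear_maps R D"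
   by (rule linear_mapsI) (simp_all only: R.m_closed tc linear_mapsD[OF mb[OF b]] R.r_distr R.smult_mult_r)
  moreover have "(\<lambda>s. \<zero>\<^sub>D) \<in> linear_maps R D" by (rule linear_mapsI) auto
  ultimately show ?thesis
  proof (rule linear_maps_monoid_algebra_eq[OF D monoid_BC _ _ _ s])
   fix xy assume "xy \<in> carrier (B \<times>\<times> C)"
   then obtain x y where xy: "xy = (x, y)" "x \<in> carrier B" "y \<in> carrier C" by auto
   let ?b = "\<lambda>x' y'. \<beta> (x' \<otimes>\<^sub>B x) (y' \<otimes>\<^sub>C y)"
   have b': "?b \<in> bilinear_maps B C D"
    by (rule bilinear_mapsI) (simp_all only: xy bilinear_mapsD[OF b] B.m_closed C.m_closed B.l_distr C.l_distr B.smult_mult_l C.smult_mult_l)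
   have e: "basis_elt (x, y) \<in> carrier R" by (rule basis_pair_closed[OF xy(2,3)])
   have "?E \<beta> (t \<otimes>\<^sub>R basis_elt xy) = ?E ?b t"
   proof (rule linear_maps_monoid_algebra_eq[OF D monoid_BC _ mb[OF b'] _ tc])
    show "(\<lambda>t. ?E \<beta> (t \<otimes>\<^sub>R basis_elt xy)) \<in> linear_maps R D" unfolding xy
     by (rule linear_mapsI) (simp_all only: R.m_closed e linear_mapsD[OF mb[OF b]] R.l_distr R.smult_mult_l)
    fix z assume "z \<in> carrier (B \<times>\<times> C)"
    then obtain x' y' where z: "z = (x', y')" "x' \<in> carrier B" "y' \<in> carrier C" by auto
    show "?E \<beta> (basis_elt z \<otimes>\<^sub>R basis_elt xy) = ?E ?b (basis_elt z)"
     unfolding xy z basis_elt_mult mult_DirProd Eb[OF b' z(2,3)] using xy z by (simp only: Eb b B.m_closed C.m_closed)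
   qed
   also have "\<dots> = \<zero>\<^sub>D" using bspec[OF conjunct2[OF t[unfolded mem_Collect_eq]] b'] .
   finally show "?E \<beta> (t \<otimes>\<^sub>R basis_elt xy) = \<zero>\<^sub>D" .
  qed
 qed
 have "ideal ?K R"
 proof (rule idealI[OF R.ring_axioms])
  show "subgroup ?K (add_monoid R)"
  proof (rule R.add.subgroupI)
   show "?K \<noteq> {}" using R.zero_closed sub0 by blast
   fix s t assume s: "s \<in> ?K" and t: "t \<in> ?K"
   show "s \<oplus>\<^sub>R t \<in> ?K"
    using s t by (simp add: linear_mapsD(2)[OF mb] R.a_closed del: monoid_algebra_sel)
  next
   fix s assume s: "s \<in> ?K"
   have "\<ominus>\<^sub>R s = (-1) \<odot>\<^sub>R s" using R.smult_minus_left[of s 1] s by (simp add: R.smult_one del: monoid_algebra_sel)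
   then show "\<ominus>\<^sub>R s \<in> ?K"
    using s by (simp add: linear_mapsD(3)[OF mb] R.smult_closed del: monoid_algebra_sel)
  qed blast
 qed (use l r in \<open>simp_all del: monoid_algebra_sel\<close>)
 moreover have "tensor_relations B C \<subseteq> ?K"
 proof (intro subsetI CollectI conjI ballI)
  fix r assume r: "r \<in> tensor_relations B C"
  then show rc: "r \<in> carrier R" using tensor_relations_closed by blast
  fix \<beta> assume b: "\<beta> \<in> bilinear_maps B C D"
  note bp = basis_pair_closed
  note E = linear_maps_minus[OF R.assoc_algebra_self D mb[OF b]] linear_mapsD(2,3)[OF mb[OF b]] Eb[OF b] bilinear_mapsD[OF b]
  have dd: "x \<in> carrier D ==> x \<ominus>\<^sub>D x = \<zero>\<^sub>D" for x by (simp add: D.minus_eq D.r_neg)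
  show "?E \<beta> r = \<zero>\<^sub>D"
   using r unfolding tensor_relations_def
  proof (elim UnE CollectE exE conjE, goal_cases)
   case (1 x x' y)
   have "r = basis_elt (x \<oplus>\<^sub>B x', y) \<ominus>\<^sub>R (basis_elt (x, y) \<oplus>\<^sub>R basis_elt (x', y))"
    unfolding 1(1) using 1 by (intro R_diff2 bp B.a_closed)
   then show ?case using 1(2-) by (simp only: E bp R.a_closed B.a_closed D.a_closed dd)
  next
   case (2 x y y')
   have "r = basis_elt (x, y \<oplus>\<^sub>C y') \<ominus>\<^sub>R (basis_elt (x, y) \<oplus>\<^sub>R basis_elt (x, y'))"
    unfolding 2(1) using 2 by (intro R_diff2 bp C.a_closed)
   then show ?case using 2(2-) by (simp only: E bp R.a_closed C.a_closed D.a_closed dd)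
  next
   case (3 c x y)
   have "r = basis_elt (c \<odot>\<^sub>B x, y) \<ominus>\<^sub>R (c \<odot>\<^sub>R basis_elt (x, y))"
    unfolding 3(1) using 3 by (intro R_diff_smult bp B.smult_closed)
   then show ?case using 3(2-) by (simp only: E bp R.smult_closed B.smult_closed D.smult_closed dd)
  next
   case (4 c x y)
   have "r = basis_elt (x, c \<odot>\<^sub>C y) \<ominus>\<^sub>R (c \<odot>\<^sub>R basis_elt (x, y))"
    unfolding 4(1) using 4 by (intro R_diff_smult bp C.smult_closed)
   then show ?case using 4(2-) by (simp only: E bp R.smult_closed C.smult_closed D.smult_closed dd)
  qed
 qed
 ultimately have "tensor_ideal B C \<subseteq> ?K"
  unfolding tensor_ideal_def by (rule R.genideal_minimal)
 then show ?thesis using i \<beta> by blast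
qed

lemma tensor_lift_pt:
 fixes D :: "('k, 'd) module"
 assumes D: "assoc_algebra D" and b: "\<beta> \<in> bilinear_maps B C D" and x: "x \<in> carrier B" "y \<in> carrier C"
 shows "tensor_lift D \<beta> (pt x y) = \<beta> x y"
proof -
 interpret D: assoc_algebra D by fact
 have "tensor_lift D \<beta> (pt x y) = mext D (\<lambda>z. \<beta> (fst z) (snd z)) (basis_elt (x, y))"
  unfolding tensor_lift_def pure_tensor_def
  using the_elem_coset[OF D mext_bilinear[OF D b] mext_tensor_ideal[OF D b] basis_pair_closed[OF x]]
  by (simp add: mext_def)
 also have "\<dots> = \<beta> x y"
  using D.mext_basis[of "\<lambda>z. \<beta> (fst z) (snd z)" "(x, y)"] bilinear_mapsD(1)[OF b x] by simp
 finally show ?thesis .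
qed

lemma tensor_lift_linear:
 fixes D :: "('k, 'd) module"
 assumes D: "assoc_algebra D" and b: "\<beta> \<in> bilinear_maps B C D"
 shows "tensor_lift D \<beta> \<in> linear_maps T D"
 using quot_lift_linear[OF D mext_bilinear[OF D b] mext_tensor_ideal[OF D b]]
 unfolding T_eq by (simp add: tensor_lift_def[abs_def] mext_def)

lemma tensor_lift_hom:
 fixes D :: "('k, 'd) module"
 assumes D: "assoc_algebra D" and b: "\<beta> \<in> bilinear_maps B C D"
  and m: "\<And>x y x' y'. \<lbrakk>x \<in> carrier B; y \<in> carrier C; x' \<in> carrier B; y' \<in> carrier C\<rbrakk> \<Longrightarrow>
   \<beta> (x \<otimes>\<^sub>B x') (y \<otimes>\<^sub>C y') = \<beta> x y \<otimes>\<^sub>D \<beta> x' y'"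
  and o: "\<beta> \<one>\<^sub>B \<one>\<^sub>C = \<one>\<^sub>D"
 shows "tensor_lift D \<beta> \<in> algebra_hom T D"
proof -
 interpret D: assoc_algebra D by fact
 note L = tensor_lift_linear[OF D b] and P = tensor_lift_pt[OF D b]
 note LD = linear_mapsD[OF L]
 have 1: "tensor_lift D \<beta> (pt x y \<otimes>\<^sub>T t) = \<beta> x y \<otimes>\<^sub>D tensor_lift D \<beta> t"
  if x: "x \<in> carrier B" "y \<in> carrier C" and t: "t \<in> carrier T" for x y t
  using t
 proof (induct t rule: tensor_induct)
  case (pure x' y')
  then show ?case using x by (simp add: pt_mult P m)
 next
  case (add s t)
  then show ?case using x by (simp add: T.r_distr LD D.r_distr bilinear_mapsD[OF b])
 qed
 show ?thesis
 proof (rule algebra_homI[OF L])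
  show "tensor_lift D \<beta> \<one>\<^sub>T = \<one>\<^sub>D" by (simp add: pt_one P o)
  fix s t assume s: "s \<in> carrier T" and t: "t \<in> carrier T"
  show "tensor_lift D \<beta> (s \<otimes>\<^sub>T t) = tensor_lift D \<beta> s \<otimes>\<^sub>D tensor_lift D \<beta> t"
   using s
  proof (induct s rule: tensor_induct)
   case (pure x y)
   then show ?case using t by (simp add: 1 P)
  next
   case (add u v)
   then show ?case using t by (simp add: T.l_distr LD D.l_distr)
  qed
 qed
qed

end

section \<open>A model of the algebra on a monomial basis\<close>

text \<open>The coefficients form a commutative ring rather than a field, since polynomials in a
  deformation parameter occur as well.\<close>

definition sc :: "'r::comm_ring_1 \<Rightarrow> ('q \<Rightarrow> 'r) \<Rightarrow> 'q \<Rightarrow> 'r" where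
 "sc c x = (\<lambda>q. c * x q)"

interpretation vec: Modules.module "sc :: 'r::comm_ring_1 \<Rightarrow> ('q \<Rightarrow> 'r) \<Rightarrow> 'q \<Rightarrow> 'r"
 by unfold_locales (auto simp: sc_def fun_eq_iff algebra_simps)

abbreviation lin :: "(('q \<Rightarrow> 'r::comm_ring_1) \<Rightarrow> 's \<Rightarrow> 'r) \<Rightarrow> bool" where
 "lin \<equiv> module_hom sc sc"

lemma linI:
 assumes "\<And>x y. L (x + y) = L x + L y" "\<And>c x. L (sc c x) = sc c (L x)"
 shows "lin L"
 by (intro module_hom.intro module_hom_axioms.intro vec.module_axioms assms)

lemmas lin_add = module_hom.add and lin_scale = module_hom.scale and lin_sum = module_hom.sum

lemma lin_plus: "lin L ==> lin L' ==> lin (\<lambda>x. L x + L' x)"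
 by (rule linI) (simp_all only: lin_add lin_scale vec.scale_right_distrib add_ac)

lemma lin_sc: "lin L ==> lin (\<lambda>x. sc c (L x))"
 by (rule linI) (simp_all only: lin_add lin_scale vec.scale_right_distrib vec.scale_scale mult.commute)

lemma lin_comp: "lin L ==> lin L' ==> lin (\<lambda>x. L (L' x))"
 by (rule linI) (simp_all only: lin_add lin_scale)

lemma lin_id: "lin (\<lambda>x. x)"
 by (rule linI) simp_all

lemma lin_sc_self: "lin (sc c)"
 using lin_sc[OF lin_id] by simp

lemma lin_funpow: "lin L ==> lin (L ^^ n)" for L :: "('q \<Rightarrow> 'r::comm_ring_1) \<Rightarrow> 'q \<Rightarrow> 'r"
proof (rule linI)
 assume L: "lin L"
 show "(L ^^ n) (x + y) = (L ^^ n) x + (L ^^ n) y" for x y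
  by (induct n) (simp_all only: funpow.simps o_apply id_apply lin_add[OF L])
 show "(L ^^ n) (sc c x) = sc c ((L ^^ n) x)" for c x
  by (induct n) (simp_all only: funpow.simps o_apply id_apply lin_scale[OF L])
qed

lemma sum_fun_apply: "(\<Sum>q\<in>S. F q) x = (\<Sum>q\<in>S. F q (x :: 'x) :: 'r::comm_monoid_add)"
 by (induct S rule: infinite_finite_induct) auto

text \<open>\<alpha>, \<kappa>, \<beta> are the values prescribed for \<open>a^p\<close>,
  \<open>g^p\<close>, \<open>b^p\<close>. The locale is used over the field and over its polynomial
  ring, hence the general coefficient ring and the separate constant \<open>half\<close>.\<close>

locale pbw =
 fixes p :: nat and half \<alpha> \<kappa> \<beta> :: "'r::comm_ring_1"
 assumes prime_p: "prime p" and p2: "p > 2" and char_p: "of_nat p = (0::'r)" and half: "2 * half = 1"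
begin

definition B :: "(nat \<times> nat \<times> nat) set" where
 "B = {..<p} \<times> {..<p} \<times> {..<p}"

text \<open>Exponents are unrestricted; multiples of \<open>p\<close> are traded for powers of
  \<alpha>, \<kappa>, \<beta>. This removes the case distinctions at the edge of the box from the
  formulas for \<open>La\<close>, \<open>Lg\<close>, \<open>Lb\<close>.\<close>

definition mon :: "nat \<Rightarrow> nat \<Rightarrow> nat \<Rightarrow> nat \<times> nat \<times> nat \<Rightarrow> 'r" where
 "mon i k j = (\<lambda>q. if q = (i mod p, k mod p, j mod p) then \<alpha> ^ (i div p) * \<kappa> ^ (k div p) * \<beta> ^ (j div p) else 0)"

definition ext :: "(nat \<Rightarrow> nat \<Rightarrow> nat \<Rightarrow> 's \<Rightarrow> 'r) \<Rightarrow> (nat \<times> nat \<times> nat \<Rightarrow> 'r) \<Rightarrow> 's \<Rightarrow> 'r" where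
 "ext F x = (\<Sum>(i, k, j)\<in>B. sc (x (i, k, j)) (F i k j))"

text \<open>Moving \<open>b\<close> to the right gives
  \<open>b a^i g^k = a^i g^k b + (k + i/2) a^(i+1) g^k\<close>.\<close>

definition cf :: "nat \<Rightarrow> nat \<Rightarrow> 'r" where
 "cf i k = of_nat k + of_nat i * half"

text \<open>Left multiplications by the generators, read off from the desired normal form. The
  algebra is recovered from these operators, so associativity never has to be checked on structure
  constants.\<close>

definition La where "La = ext (\<lambda>i k j. mon (Suc i) k j)"
definition Lg where "Lg = ext (\<lambda>i k j. mon i (Suc k) j)"
definition Lb where "Lb = ext (\<lambda>i k j. mon i k (Suc j) + sc (cf i k) (mon (Suc i) k j))"

definition U :: "(nat \<times> nat \<times> nat \<Rightarrow> 'r) set" where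
 "U = {x. \<forall>q. q \<notin> B \<longrightarrow> x q = 0}"

lemma p0: "p > 0" using p2 by simp

lemma finite_B: "finite B" by (simp add: B_def)

lemma ext_apply: "ext F x s = (\<Sum>(i, k, j)\<in>B. x (i, k, j) * F i k j s)"
 unfolding ext_def sum_fun_apply by (intro sum.cong refl) (auto simp: sc_def)

lemma lin_ext: "lin (ext F)"
 by (rule linI)
  (auto simp: ext_apply split_def distrib_right sum.distrib sum_distrib_left mult.assoc sc_def fun_eq_iff)

lemma mon_box: "i < p ==> k < p ==> j < p ==> mon i k j = (\<lambda>q. if q = (i, k, j) then 1 else 0)"
 by (auto simp: mon_def)

lemma ext_mon_box:
 assumes "i < p" "k < p" "j < p"
 shows "ext F (mon i k j) = F i k j"
proof
 fix s
 have "ext F (mon i k j) s = (\<Sum>q\<in>B. if q = (i, k, j) then F i k j s else 0)"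
  unfolding ext_apply mon_box[OF assms] by (intro sum.cong) (auto split: if_splits)
 also have "\<dots> = F i k j s" using assms finite_B by (simp add: B_def)
 finally show "ext F (mon i k j) s = F i k j s" .
qed

lemma mon_shift: "mon (i + p * u) (k + p * v) (j + p * w) = sc (\<alpha> ^ u * \<kappa> ^ v * \<beta> ^ w) (mon i k j)"
 using p0 by (auto simp: mon_def sc_def fun_eq_iff power_add algebra_simps)

lemma mon_red: "mon i k j = sc (\<alpha> ^ (i div p) * \<kappa> ^ (k div p) * \<beta> ^ (j div p)) (mon (i mod p) (k mod p) (j mod p))"
 using mon_shift[of "i mod p" "i div p" "k mod p" "k div p" "j mod p" "j div p"] by simp

lemma of_nat_mod_p: "of_nat (n mod p) = (of_nat n :: 'r)"
proof -
 have "(of_nat n :: 'r) = of_nat (n mod p + p * (n div p))" by simp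
 also have "\<dots> = of_nat (n mod p)" unfolding of_nat_add of_nat_mult char_p by simp
 finally show ?thesis by simp
qed

text \<open>\<open>ext\<close> only sees exponents below \<open>p\<close>; a rule with the same
  periodicity as \<open>mon\<close> is reproduced by it on all exponents.\<close>

lemma ext_mon:
 assumes "\<And>i k j u v w. F (i + p * u) (k + p * v) (j + p * w) = sc (\<alpha> ^ u * \<kappa> ^ v * \<beta> ^ w) (F i k j)"
 shows "ext F (mon i k j) = F i k j"
proof -
 have "ext F (mon i k j) = sc (\<alpha> ^ (i div p) * \<kappa> ^ (k div p) * \<beta> ^ (j div p)) (F (i mod p) (k mod p) (j mod p))"
  using p0 by (subst mon_red, subst lin_scale[OF lin_ext], subst ext_mon_box) auto
 also have "\<dots> = F i k j"
  using assms[of "i mod p" "i div p" "k mod p" "k div p" "j mod p" "j div p"] by simp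
 finally show ?thesis .
qed

lemma cf_shift: "cf (i + p * u) (k + p * v) = cf i k"
 by (simp add: cf_def char_p)

lemma La_mon [simp]: "La (mon i k j) = mon (Suc i) k j"
 unfolding La_def by (rule ext_mon) (rule mon_shift[of "Suc _", simplified])
lemma Lg_mon [simp]: "Lg (mon i k j) = mon i (Suc k) j"
 unfolding Lg_def by (rule ext_mon) (rule mon_shift[of _ _ "Suc _", simplified])
lemma Lb_mon [simp]: "Lb (mon i k j) = mon i k (Suc j) + sc (cf i k) (mon (Suc i) k j)"
 unfolding Lb_def
 by (rule ext_mon)
  (simp add: mon_shift[of "Suc _", simplified] mon_shift[of _ _ _ _ "Suc _", simplified] cf_shift vec.scale_right_distrib mult.commute[of _ "cf _ _"])

lemma lin_La: "lin La" and lin_Lg: "lin Lg" and lin_Lb: "lin Lb"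
 by (simp_all add: La_def Lg_def Lb_def lin_ext)

lemma mon_U [simp]: "mon i k j \<in> U"
 using p0 by (auto simp: U_def mon_def B_def)

lemma U_add: "x \<in> U ==> y \<in> U ==> x + y \<in> U" and U_sc: "x \<in> U ==> sc c x \<in> U" and U_zero: "0 \<in> U"
 by (auto simp: U_def sc_def)

lemma U_sum: "(\<And>q. q \<in> S ==> F q \<in> U) ==> sum F S \<in> U"
 by (induct S rule: infinite_finite_induct) (auto simp: U_zero U_add)

lemma ext_U: "(\<And>i k j. F i k j \<in> U) ==> ext F x \<in> U"
 unfolding ext_def by (intro U_sum) (auto intro: U_sc)

lemma L_U [simp]: "La x \<in> U" "Lg x \<in> U" "Lb x \<in> U"
 by (auto simp: La_def Lg_def Lb_def intro!: ext_U U_add U_sc)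

lemma funpow_U: "(\<And>x. L x \<in> U) ==> x \<in> U ==> (L ^^ n) x \<in> U"
 by (induct n) auto

lemma U_expand:
 assumes "x \<in> U"
 shows "x = (\<Sum>(i, k, j)\<in>B. sc (x (i, k, j)) (mon i k j))"
proof
 fix q
 have "(\<Sum>(i, k, j)\<in>B. sc (x (i, k, j)) (mon i k j)) q = (\<Sum>r\<in>B. if r = q then x q else 0)"
  unfolding sum_fun_apply by (intro sum.cong) (auto simp: B_def mon_box sc_def)
 also have "\<dots> = x q" using assms finite_B by (cases q) (auto simp: U_def)
 finally show "x q = (\<Sum>(i, k, j)\<in>B. sc (x (i, k, j)) (mon i k j)) q" by simp
qed

lemma lin_eq_U:
 assumes "lin L" "lin L'" "\<And>i k j. L (mon i k j) = L' (mon i k j)" "x \<in> U"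
 shows "L x = L' x"
 by (subst (1 2) U_expand[OF assms(4)])
  (simp add: lin_sum[OF assms(1)] lin_sum[OF assms(2)] split_def lin_scale[OF assms(1)] lin_scale[OF assms(2)] assms(3))

lemma cf_Suc: "cf (Suc i) k = cf i k + half" "cf i (Suc k) = cf i k + 1"
 by (simp_all add: cf_def distrib_right add_ac)

lemma Lg_La: "x \<in> U ==> Lg (La x) = La (Lg x)"
 by (rule lin_eq_U[of "\<lambda>x. Lg (La x)" "\<lambda>x. La (Lg x)"]) (auto intro: lin_comp[OF lin_La lin_Lg] lin_comp[OF lin_Lg lin_La])

text \<open>\<open>cf\<close> grows by \<open>half\<close> when the exponent of \<open>a\<close>
  grows by one. Likewise \<open>Lb_Lg\<close> rests on its growth by 1 in the exponent of
  \<open>g\<close>.\<close>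

lemma Lb_La: "x \<in> U ==> Lb (La x) = La (Lb x) + sc half (La (La x))"
proof (rule lin_eq_U[of "\<lambda>x. Lb (La x)" "\<lambda>x. La (Lb x) + sc half (La (La x))"])
 show "Lb (La (mon i k j)) = La (Lb (mon i k j)) + sc half (La (La (mon i k j)))" for i k j
  by (simp only: La_mon Lb_mon lin_add[OF lin_La] lin_scale[OF lin_La] cf_Suc vec.scale_left_distrib add.assoc)
qed (intro lin_plus lin_sc lin_comp[OF lin_La lin_La] lin_comp[OF lin_La lin_Lb] lin_comp[OF lin_Lb lin_La])+

lemma Lb_Lg: "x \<in> U ==> Lb (Lg x) = Lg (Lb x) + La (Lg x)"
proof (rule lin_eq_U[of "\<lambda>x. Lb (Lg x)" "\<lambda>x. Lg (Lb x) + La (Lg x)"])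
 show "Lb (Lg (mon i k j)) = Lg (Lb (mon i k j)) + La (Lg (mon i k j))" for i k j
  by (simp only: La_mon Lb_mon Lg_mon lin_add[OF lin_Lg] lin_scale[OF lin_Lg] cf_Suc vec.scale_left_distrib vec.scale_one add.assoc)
qed (intro lin_plus lin_comp[OF lin_La lin_Lg] lin_comp[OF lin_Lg lin_Lb] lin_comp[OF lin_Lb lin_Lg])+

lemma La_pow_mon: "(La ^^ n) (mon i k j) = mon (i + n) k j"
 by (induct n) auto
lemma Lg_pow_mon: "(Lg ^^ n) (mon i k j) = mon i (k + n) j"
 by (induct n) auto

definition pcf :: "nat \<Rightarrow> nat \<Rightarrow> nat \<Rightarrow> 'r" where
 "pcf i k m = (\<Prod>l<m. cf (i + l) k)"

text \<open>Each application of \<open>Lb\<close> raises either the exponent of \<open>b\<close>, or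
  that of \<open>a\<close> with weight \<open>cf\<close>. The weight ignores the exponent of
  \<open>b\<close>, so the order of the choices is irrelevant and only their number is
  counted.\<close>

lemma Lb_pow_mon:
 "(Lb ^^ n) (mon i k j) = (\<Sum>m\<le>n. sc (of_nat (n choose m) * pcf i k m) (mon (i + m) k (j + n - m)))"
proof (induct n)
 case 0
 show ?case by (simp add: pcf_def)
next
 case (Suc n)
 let ?c = "\<lambda>n m. of_nat (n choose m) * pcf i k m"
 have "(Lb ^^ Suc n) (mon i k j) = (\<Sum>m\<le>n. sc (?c n m) (Lb (mon (i + m) k (j + n - m))))"
  by (simp add: Suc lin_sum[OF lin_Lb] lin_scale[OF lin_Lb] del: Lb_mon)
 also have "\<dots> = (\<Sum>m\<le>n. sc (?c n m) (mon (i + m) k (j + Suc n - m)) + sc (of_nat (n choose m) * pcf i k (Suc m)) (mon (i + Suc m) k (j + Suc n - Suc m)))"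
  by (intro sum.cong refl) (simp add: vec.scale_right_distrib pcf_def mult.assoc Suc_diff_le)
 also have "\<dots> = (\<Sum>m\<le>Suc n. sc (?c n m) (mon (i + m) k (j + Suc n - m)))
   + (\<Sum>m\<le>n. sc (of_nat (n choose m) * pcf i k (Suc m)) (mon (i + Suc m) k (j + Suc n - Suc m)))"
  by (simp add: sum.distrib binomial_eq_0)
 also have "(\<Sum>m\<le>n. sc (of_nat (n choose m) * pcf i k (Suc m)) (mon (i + Suc m) k (j + Suc n - Suc m)))
   = (\<Sum>m\<le>Suc n. sc (if m = 0 then 0 else of_nat (n choose (m - 1)) * pcf i k m) (mon (i + m) k (j + Suc n - m)))"
  by (subst sum.atMost_Suc_shift) simp
 also have "(\<Sum>m\<le>Suc n. sc (?c n m) (mon (i + m) k (j + Suc n - m))) + \<dots> = (\<Sum>m\<le>Suc n. sc (?c (Suc n) m) (mon (i + m) k (j + Suc n - m)))"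
 proof (subst sum.distrib[symmetric], intro sum.cong refl)
  fix m assume "m \<in> {..Suc n}"
  show "sc (?c n m) (mon (i + m) k (j + Suc n - m)) + sc (if m = 0 then 0 else of_nat (n choose (m - 1)) * pcf i k m) (mon (i + m) k (j + Suc n - m))
   = sc (?c (Suc n) m) (mon (i + m) k (j + Suc n - m))"
   by (cases m) (simp_all add: distrib_right vec.scale_left_distrib add_ac del: plus_fun_apply)
 qed
 finally show ?case .
qed

text \<open>Twice the factors are \<open>2k + i + l\<close> for \<open>p\<close> consecutive values
  of \<open>l\<close>, so one of them is divisible by \<open>p\<close>. The witness for
  \<open>l\<close> is the residue of \<open>-(2k + i)\<close>.\<close>

lemma pcf_p: "pcf i k p = 0"
proof -
 obtain l where l: "l < p" "(2 * k + i + l) mod p = 0"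
 proof
  show "(p - (2 * k + i) mod p) mod p < p" using p0 by simp
  have "(2 * k + i + (p - (2 * k + i) mod p) mod p) mod p = ((2 * k + i) mod p + (p - (2 * k + i) mod p)) mod p"
   by (metis mod_add_left_eq mod_add_right_eq)
  also have "(2 * k + i) mod p + (p - (2 * k + i) mod p) = p" using p0 by (simp add: less_imp_le)
  finally show "(2 * k + i + (p - (2 * k + i) mod p) mod p) mod p = 0" by simp
 qed
 have "(of_nat (2 * k + i + l) :: 'r) = 0" using of_nat_mod_p[of "2 * k + i + l"] l(2) by simp
 then have "half * (2 * of_nat k + of_nat (i + l)) = 0" by (simp add: add.assoc)
 moreover have "half * (2 * of_nat k + of_nat (i + l)) = (2 * half) * of_nat k + of_nat (i + l) * half" by (simp add: algebra_simps)
 ultimately have "cf (i + l) k = 0" unfolding cf_def half by simp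
 then show ?thesis unfolding pcf_def using l(1) by (intro prod_zero) auto
qed

text \<open>Terms with \<open>0 < m < p\<close> die by the binomial coefficient, the term
  \<open>m = p\<close> by \<open>pcf_p\<close>; what remains raises the exponent of \<open>b\<close>
  by \<open>p\<close>. This is the consistency of \<open>b^p = \<beta>\<close> with the commutation
  rules.\<close>

lemma Lb_p: "x \<in> U ==> (Lb ^^ p) x = sc \<beta> x"
proof (rule lin_eq_U[of "Lb ^^ p" "sc \<beta>"])
 fix i k j
 have "(Lb ^^ p) (mon i k j) = (\<Sum>m\<in>{0}. sc (of_nat (p choose m) * pcf i k m) (mon (i + m) k (j + p - m)))"
  unfolding Lb_pow_mon
 proof (rule sum.mono_neutral_right)
  show "\<forall>m\<in>{..p} - {0}. sc (of_nat (p choose m) * pcf i k m) (mon (i + m) k (j + p - m)) = 0"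
  proof
   fix m assume m: "m \<in> {..p} - {0}"
   have "of_nat (p choose m) * pcf i k m = 0"
   proof (cases "m = p")
    case True then show ?thesis by (simp add: pcf_p)
   next
    case False
    then have "p dvd (p choose m)" using m prime_p by (intro dvd_choose_prime) auto
    then obtain c where "p choose m = p * c" by (auto elim: dvdE)
    then show ?thesis by (simp add: char_p)
   qed
   then show "sc (of_nat (p choose m) * pcf i k m) (mon (i + m) k (j + p - m)) = 0" by simp
  qed
 qed auto
 also have "\<dots> = sc \<beta> (mon i k j)" using mon_shift[of i 0 k 0 j 1] by (simp add: pcf_def)
 finally show "(Lb ^^ p) (mon i k j) = sc \<beta> (mon i k j)" .
qed (auto intro: lin_funpow lin_Lb lin_sc_self)

lemma La_p: "x \<in> U ==> (La ^^ p) x = sc \<alpha> x"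
 by (rule lin_eq_U[of "La ^^ p" "sc \<alpha>"])
  (use mon_shift[of _ 1 _ 0 _ 0] in \<open>auto intro: lin_funpow lin_La lin_sc_self simp: La_pow_mon\<close>)
lemma Lg_p: "x \<in> U ==> (Lg ^^ p) x = sc \<kappa> x"
 by (rule lin_eq_U[of "Lg ^^ p" "sc \<kappa>"])
  (use mon_shift[of _ 0 _ 1 _ 0] in \<open>auto intro: lin_funpow lin_Lg lin_sc_self simp: Lg_pow_mon\<close>)

definition T :: "nat \<Rightarrow> nat \<Rightarrow> nat \<Rightarrow> (nat \<times> nat \<times> nat \<Rightarrow> 'r) \<Rightarrow> (nat \<times> nat \<times> nat \<Rightarrow> 'r)" where
 "T i k j x = (La ^^ i) ((Lg ^^ k) ((Lb ^^ j) x))"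

lemma lin_T: "lin (T i k j)"
 unfolding T_def[abs_def] by (rule lin_comp[OF lin_funpow[OF lin_La] lin_comp[OF lin_funpow[OF lin_Lg] lin_funpow[OF lin_Lb]]])

lemma pow_U [simp]: "x \<in> U ==> (La ^^ n) x \<in> U" "x \<in> U ==> (Lg ^^ n) x \<in> U" "x \<in> U ==> (Lb ^^ n) x \<in> U"
 by (auto intro: funpow_U)

lemma T_U [simp]: "x \<in> U ==> T i k j x \<in> U"
 by (simp add: T_def)

lemma pow_shift:
 assumes "lin L" "\<And>x. x \<in> U ==> (L ^^ p) x = sc c x" "x \<in> U" "\<And>x. L x \<in> U"
 shows "(L ^^ (n + p * u)) x = sc (c ^ u) ((L ^^ n) x)"
proof (induct u)
 case (Suc u)
 have "(L ^^ (n + p * Suc u)) x = (L ^^ p) ((L ^^ (n + p * u)) x)"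
  by (simp add: funpow_add[symmetric, THEN fun_cong, unfolded o_apply] add_ac)
 also have "\<dots> = sc (c ^ u) (sc c ((L ^^ n) x))"
  unfolding Suc lin_scale[OF lin_funpow[OF assms(1)]] by (subst assms(2)) (auto intro: funpow_U assms)
 finally show ?case by (simp add: mult.commute)
qed simp

lemma T_shift:
 assumes "x \<in> U"
 shows "T (i + p * u) (k + p * v) (j + p * w) x = sc (\<alpha> ^ u * \<kappa> ^ v * \<beta> ^ w) (T i k j x)"
 unfolding T_def using assms
 by (simp add: pow_shift[OF lin_La La_p] pow_shift[OF lin_Lg Lg_p] pow_shift[OF lin_Lb Lb_p]
  lin_scale[OF lin_funpow[OF lin_La]] lin_scale[OF lin_funpow[OF lin_Lg]] U_sc mult_ac)

lemma La_T: "La (T i k j x) = T (Suc i) k j x"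
 by (simp add: T_def)

lemma Lg_La_pow: "x \<in> U ==> Lg ((La ^^ i) x) = (La ^^ i) (Lg x)"
 by (induct i) (auto simp: Lg_La)

lemma Lg_T: "x \<in> U ==> Lg (T i k j x) = T i (Suc k) j x"
 by (simp add: T_def Lg_La_pow)

lemma Lb_La_pow: "x \<in> U ==> Lb ((La ^^ i) x) = (La ^^ i) (Lb x) + sc (of_nat i * half) ((La ^^ Suc i) x)"
 by (induct i) (auto simp: Lb_La lin_add[OF lin_La] lin_scale[OF lin_La] vec.scale_left_distrib distrib_right)

lemma Lb_Lg_pow: "x \<in> U ==> Lb ((Lg ^^ k) x) = (Lg ^^ k) (Lb x) + sc (of_nat k) (La ((Lg ^^ k) x))"
 by (induct k) (auto simp: Lb_Lg Lg_La lin_add[OF lin_Lg] lin_scale[OF lin_Lg] vec.scale_left_distrib)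

lemma Lb_T: "x \<in> U ==> Lb (T i k j x) = T i k (Suc j) x + sc (cf i k) (T (Suc i) k j x)"
 by (simp add: T_def Lb_La_pow Lb_Lg_pow lin_add[OF lin_funpow[OF lin_La]] lin_scale[OF lin_funpow[OF lin_La]]
  funpow_swap1 cf_def vec.scale_left_distrib add_ac)

text \<open>The product of the model: \<open>x\<close> is expanded in monomials and each monomial
  acts on \<open>y\<close> as a composite of \<open>La\<close>, \<open>Lg\<close>,
  \<open>Lb\<close>.\<close>

definition Op :: "(nat \<times> nat \<times> nat \<Rightarrow> 'r) \<Rightarrow> (nat \<times> nat \<times> nat \<Rightarrow> 'r) \<Rightarrow> (nat \<times> nat \<times> nat \<Rightarrow> 'r)" where
 "Op x y = ext (\<lambda>i k j. T i k j y) x"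

lemma lin_Op1: "lin (\<lambda>x. Op x y)"
 using lin_ext[of "\<lambda>i k j. T i k j y"] by (simp add: Op_def)

lemma Op_apply: "Op x y s = (\<Sum>(i, k, j)\<in>B. x (i, k, j) * T i k j y s)"
 by (simp add: Op_def ext_apply)

lemma lin_Op2: "lin (Op x)"
proof (rule linI)
 show "Op x (y + z) = Op x y + Op x z" for y z
  by (simp add: fun_eq_iff Op_apply lin_add[OF lin_T] distrib_left sum.distrib split_def)
 show "Op x (sc c y) = sc c (Op x y)" for c y
 proof
  fix s
  show "Op x (sc c y) s = sc c (Op x y) s"
   unfolding Op_apply lin_scale[OF lin_T] by (simp add: Op_apply sum_distrib_left split_def sc_def mult.left_commute)
 qed
qed

lemma Op_U [simp]: "y \<in> U ==> Op x y \<in> U"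
 unfolding Op_def by (rule ext_U) simp

lemma Op_mon: "y \<in> U ==> Op (mon i k j) y = T i k j y"
 unfolding Op_def by (rule ext_mon) (rule T_shift)

lemma Op_La: "x \<in> U ==> y \<in> U ==> Op (La x) y = La (Op x y)"
 by (rule lin_eq_U[of "\<lambda>x. Op (La x) y" "\<lambda>x. La (Op x y)"])
  (auto intro: lin_comp[OF lin_Op1 lin_La] lin_comp[OF lin_La lin_Op1] simp: Op_mon La_T)
lemma Op_Lg: "x \<in> U ==> y \<in> U ==> Op (Lg x) y = Lg (Op x y)"
 by (rule lin_eq_U[of "\<lambda>x. Op (Lg x) y" "\<lambda>x. Lg (Op x y)"])
  (auto intro: lin_comp[OF lin_Op1 lin_Lg] lin_comp[OF lin_Lg lin_Op1] simp: Op_mon Lg_T)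
lemma Op_Lb: "x \<in> U ==> y \<in> U ==> Op (Lb x) y = Lb (Op x y)"
 by (rule lin_eq_U[of "\<lambda>x. Op (Lb x) y" "\<lambda>x. Lb (Op x y)"])
  (auto intro: lin_comp[OF lin_Op1 lin_Lb] lin_comp[OF lin_Lb lin_Op1] simp: Op_mon Lb_T lin_add[OF lin_Op1] lin_scale[OF lin_Op1])

lemma Op_pow: "x \<in> U ==> y \<in> U ==> Op ((La ^^ n) x) y = (La ^^ n) (Op x y)"
 "x \<in> U ==> y \<in> U ==> Op ((Lg ^^ n) x) y = (Lg ^^ n) (Op x y)"
 "x \<in> U ==> y \<in> U ==> Op ((Lb ^^ n) x) y = (Lb ^^ n) (Op x y)"
 by (induct n) (auto simp: Op_La Op_Lg Op_Lb)

text \<open>By linearity \<open>x\<close> may be a monomial. Then \<open>Op x\<close> is a composite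
  of \<open>La\<close>, \<open>Lg\<close>, \<open>Lb\<close>, and each of these slides out of the
  left argument of \<open>Op\<close>.\<close>

lemma Op_assoc: "x \<in> U ==> y \<in> U ==> z \<in> U ==> Op (Op x y) z = Op x (Op y z)"
 by (rule lin_eq_U[of "\<lambda>x. Op (Op x y) z" "\<lambda>x. Op x (Op y z)"])
  (auto intro: lin_comp[OF lin_Op1 lin_Op1] lin_Op1 simp: Op_mon, simp add: T_def Op_pow)

lemma Op_one_left: "y \<in> U ==> Op (mon 0 0 0) y = y"
 by (simp add: Op_mon T_def)

lemma Lb_pow_mon0: "(Lb ^^ n) (mon 0 0 j) = mon 0 0 (j + n)"
 by (induct n) (auto simp: cf_def)

lemma Op_one_right: "x \<in> U ==> Op x (mon 0 0 0) = x"
 by (rule lin_eq_U[of "\<lambda>x. Op x (mon 0 0 0)" "\<lambda>x. x"])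
  (auto intro: lin_Op1 lin_id simp: Op_mon T_def Lb_pow_mon0 Lg_pow_mon La_pow_mon)

text \<open>Displays the dependence on both arguments through fixed structure constants, which is
  the form in which the product can be differentiated.\<close>

lemma Op_expand:
 assumes "y \<in> U"
 shows "Op x y s = (\<Sum>(i, k, j)\<in>B. \<Sum>(i', k', j')\<in>B. x (i, k, j) * y (i', k', j') * Op (mon i k j) (mon i' k' j') s)"
proof -
 have "Op x y s = (\<Sum>(i, k, j)\<in>B. x (i, k, j) * T i k j y s)"
  by (rule Op_apply)
 also have "\<dots> = (\<Sum>(i, k, j)\<in>B. \<Sum>(i', k', j')\<in>B. x (i, k, j) * y (i', k', j') * Op (mon i k j) (mon i' k' j') s)"
 proof (intro sum.cong refl, clarify)
  fix i k j
  have "T i k j y = (\<Sum>(i', k', j')\<in>B. sc (y (i', k', j')) (T i k j (mon i' k' j')))"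
   by (subst U_expand[OF assms]) (simp add: lin_sum[OF lin_T] split_def lin_scale[OF lin_T])
  then have "T i k j y s = (\<Sum>(i', k', j')\<in>B. y (i', k', j') * T i k j (mon i' k' j') s)"
   by (simp add: sum_fun_apply split_def sc_def)
  then show "x (i, k, j) * T i k j y s = (\<Sum>(i', k', j')\<in>B. x (i, k, j) * y (i', k', j') * Op (mon i k j) (mon i' k' j') s)"
   by (simp add: sum_distrib_left split_def Op_mon mult.assoc)
 qed
 finally show ?thesis .
qed

end

section \<open>First order deformations of the model\<close>

text \<open>Polynomials in the deformation parameter are truncated to first order: \<open>E0\<close> and \<open>D1\<close> are the coefficients of degree 0 and 1.\<close>

definition cn :: "('q \<Rightarrow> 'k) \<Rightarrow> 'q \<Rightarrow> 'k::comm_ring_1 poly" where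
 "cn x = (\<lambda>q. [:x q:])"
definition E0 :: "('q \<Rightarrow> 'k::idom poly) \<Rightarrow> 'q \<Rightarrow> 'k" where
 "E0 x = (\<lambda>q. poly (x q) 0)"
definition D1 :: "('q \<Rightarrow> 'k::idom poly) \<Rightarrow> 'q \<Rightarrow> 'k" where
 "D1 x = (\<lambda>q. poly (pderiv (x q)) 0)"

lemma E0_cn [simp]: "E0 (cn x) = x" and D1_cn [simp]: "D1 (cn x) = 0"
 by (auto simp: E0_def cn_def D1_def pderiv_pCons)
lemma E0_add: "E0 (x + y) = E0 x + E0 y" and D1_add: "D1 (x + y) = D1 x + D1 y"
 and E0_diff: "E0 (x - y) = E0 x - E0 y" and D1_diff: "D1 (x - y) = D1 x - D1 y"
 and cn_add: "cn (u + v) = cn u + cn v" and cn_diff: "cn (u - v) = cn u - cn v"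
 and cn_sc: "cn (sc c u) = sc [:c:] (cn u)"
 and E0_zero [simp]: "E0 0 = 0" and D1_zero [simp]: "D1 0 = 0" and cn_zero [simp]: "cn 0 = 0"
 by (auto simp: E0_def D1_def cn_def sc_def pderiv_add pderiv_diff fun_eq_iff)
lemma E0_sc: "E0 (sc f x) = sc (poly f 0) (E0 x)"
 and D1_sc: "D1 (sc f x) = sc (poly f 0) (D1 x) + sc (poly (pderiv f) 0) (E0 x)"
 by (auto simp: E0_def D1_def sc_def pderiv_mult fun_eq_iff)
lemma cn_sum: "cn (sum F S) = (\<Sum>s\<in>S. cn (F s))" and D1_sum: "D1 (sum G S) = (\<Sum>s\<in>S. D1 (G s))"
 by (induct S rule: infinite_finite_induct) (auto simp: cn_add D1_add)

lemma pderiv_sum': "pderiv (sum F S) = (\<Sum>s\<in>S. pderiv (F s :: 'k::idom poly))"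
 by (induct S rule: infinite_finite_induct) (auto simp: pderiv_add)

lemma poly_pderiv_const_mult: "poly (pderiv ([:a:] * [:b:] * K)) (0 :: 'k::idom) = a * b * poly (pderiv K) 0"
 by (simp add: pderiv_mult pderiv_pCons pderiv_smult mult_ac)

lemma poly_pderiv_mult3: "poly (pderiv (f * g * K)) (0 :: 'k::idom) =
 poly f 0 * poly g 0 * poly (pderiv K) 0 + poly (pderiv f) 0 * poly g 0 * poly K 0 + poly f 0 * poly (pderiv g) 0 * poly K 0"
 by (simp add: pderiv_mult algebra_simps)

context pbw
begin

definition mq :: "nat \<times> nat \<times> nat \<Rightarrow> nat \<times> nat \<times> nat \<Rightarrow> 'r" where
 "mq q = mon (fst q) (fst (snd q)) (snd (snd q))"

lemma Op_expand_mq: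
 assumes "y \<in> U"
 shows "Op x y s = (\<Sum>q\<in>B. \<Sum>r\<in>B. x q * y r * Op (mq q) (mq r) s)"
 unfolding Op_expand[OF assms] by (intro sum.cong refl) (auto simp: mq_def intro!: sum.cong)

end

text \<open>The argument \<open>ty\<close> pins down the coefficient field, which no other parameter
  mentions.\<close>

locale pbw_field =
 fixes p :: nat and ty :: "'k::field itself"
 assumes prime_p': "prime p" and p2': "p > 2" and char': "CHAR('k::field) = p"
begin

lemma char_k: "of_nat p = (0 :: 'k)"
 using of_nat_CHAR[where 'a='k] char' by simp

lemma two_nonzero: "(2 :: 'k) \<noteq> 0"
proof
 assume "(2 :: 'k) = 0"
 then have "of_nat 2 = (0 :: 'k)" by simp
 then have "p dvd 2" unfolding of_nat_eq_0_iff_char_dvd char' .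
 then show False using p2' by (auto dest: dvd_imp_le)
qed

sublocale V: pbw p "1/2 :: 'k" 0 1 0
 using prime_p' p2' char_k two_nonzero by unfold_locales auto

end

text \<open>The conditions \<open>spec\<close> say that the parameter value 0 gives back the
  relations \<open>a^p = 0\<close>, \<open>g^p = 1\<close>, \<open>b^p = 0\<close>.\<close>

locale pbw_deform = pbw_field p ty for p and ty :: "'k::field itself" +
 fixes \<alpha> \<kappa> \<beta> :: "'k::field poly"
 assumes spec: "poly \<alpha> 0 = 0" "poly \<kappa> 0 = 1" "poly \<beta> 0 = 0"
begin

sublocale W: pbw p "[:1/2:] :: 'k poly" \<alpha> \<kappa> \<beta>
 using prime_p' p2' char_k two_nonzero
 by unfold_locales (auto simp: of_nat_poly numeral_poly one_pCons)

lemma E0_mon: "E0 (W.mon i k j) = V.mon i k j"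
 by (auto simp: E0_def W.mon_def V.mon_def spec fun_eq_iff)

lemma cn_mon: "i < p ==> k < p ==> j < p ==> cn (V.mon i k j) = W.mon i k j"
 by (auto simp: cn_def W.mon_box V.mon_box fun_eq_iff one_pCons)

text \<open>Setting the parameter to 0 commutes with every construction of the model; the lemmas up
  to \<open>E0_Op\<close> follow this through.\<close>

lemma E0_ext: "E0 (W.ext F x) = V.ext (\<lambda>i k j. E0 (F i k j)) (E0 x)"
 by (rule ext) (simp add: E0_def W.ext_apply V.ext_apply poly_sum split_def)

lemma E0_cf: "poly (W.cf i k) 0 = V.cf i k"
 by (simp add: W.cf_def V.cf_def)

lemma E0_La: "E0 (W.La x) = V.La (E0 x)" and E0_Lg: "E0 (W.Lg x) = V.Lg (E0 x)" and E0_Lb: "E0 (W.Lb x) = V.Lb (E0 x)"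
 by (simp_all only: W.La_def V.La_def W.Lg_def V.Lg_def W.Lb_def V.Lb_def E0_ext E0_mon E0_add E0_sc E0_cf)

lemma E0_pow: "E0 ((W.La ^^ n) x) = (V.La ^^ n) (E0 x)" "E0 ((W.Lg ^^ n) x) = (V.Lg ^^ n) (E0 x)" "E0 ((W.Lb ^^ n) x) = (V.Lb ^^ n) (E0 x)"
 by (induct n) (simp_all add: E0_La E0_Lg E0_Lb)

lemma E0_T: "E0 (W.T i k j x) = V.T i k j (E0 x)"
 by (simp add: W.T_def V.T_def E0_pow)

lemma E0_Op: "E0 (W.Op x y) = V.Op (E0 x) (E0 y)"
 by (simp add: W.Op_def V.Op_def E0_ext E0_T)

text \<open>The infinitesimal of the deformation in the sense of Gerstenhaber.\<close>

definition c :: "(nat \<times> nat \<times> nat \<Rightarrow> 'k) \<Rightarrow> (nat \<times> nat \<times> nat \<Rightarrow> 'k) \<Rightarrow> (nat \<times> nat \<times> nat \<Rightarrow> 'k)" where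
 "c x y = D1 (W.Op (cn x) (cn y))"

lemma E0_U: "x \<in> W.U ==> E0 x \<in> V.U" and D1_U: "x \<in> W.U ==> D1 x \<in> V.U" and cn_U: "y \<in> V.U ==> cn y \<in> W.U"
 by (auto simp: E0_def D1_def cn_def W.U_def V.U_def)

lemma c_add: "c (x + y) z = c x z + c y z" "c x (y + z) = c x y + c x z"
 unfolding c_def cn_add by (simp_all only: lin_add[OF W.lin_Op1] lin_add[OF W.lin_Op2] D1_add)
lemma c_sc: "c (sc l x) z = sc l (c x z)" "c x (sc l z) = sc l (c x z)"
 unfolding c_def cn_sc by (simp_all only: lin_scale[OF W.lin_Op1] lin_scale[OF W.lin_Op2] D1_sc, simp_all add: pderiv_pCons)

text \<open>A Leibniz rule for a product with varying structure constants: the derivative falls on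
  the constants, on \<open>x\<close> or on \<open>y\<close>.\<close>

lemma D1_Op:
 assumes y: "y \<in> W.U"
 shows "D1 (W.Op x y) = c (E0 x) (E0 y) + V.Op (D1 x) (E0 y) + V.Op (E0 x) (D1 y)"
proof
 fix s
 let ?K = "\<lambda>q r. W.Op (W.mq q) (W.mq r) s" and ?k = "\<lambda>q r. V.Op (V.mq q) (V.mq r) s"
 have e: "poly (X s) 0 = E0 X s" for X :: "nat \<times> nat \<times> nat \<Rightarrow> 'k poly" by (simp add: E0_def)
 have k: "poly (?K q r) 0 = ?k q r" for q r
  unfolding e by (simp only: E0_Op W.mq_def V.mq_def E0_mon)
 have "c (E0 x) (E0 y) s = (\<Sum>q\<in>V.B. \<Sum>r\<in>V.B. poly (pderiv (cn (E0 x) q * cn (E0 y) r * ?K q r)) 0)"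
  unfolding c_def D1_def W.Op_expand_mq[OF cn_U[OF E0_U[OF y]]] pderiv_sum' poly_sum by (rule refl)
 also have "\<dots> = (\<Sum>q\<in>V.B. \<Sum>r\<in>V.B. E0 x q * E0 y r * poly (pderiv (?K q r)) 0)"
  unfolding cn_def poly_pderiv_const_mult by (rule refl)
 finally have c: "c (E0 x) (E0 y) s = (\<Sum>q\<in>V.B. \<Sum>r\<in>V.B. E0 x q * E0 y r * poly (pderiv (?K q r)) 0)" .
 have "D1 (W.Op x y) s = (\<Sum>q\<in>V.B. \<Sum>r\<in>V.B. poly (pderiv (x q * y r * ?K q r)) 0)"
  unfolding D1_def W.Op_expand_mq[OF y] pderiv_sum' poly_sum by (rule refl)
 also have "\<dots> = (\<Sum>q\<in>V.B. \<Sum>r\<in>V.B. E0 x q * E0 y r * poly (pderiv (?K q r)) 0 + D1 x q * E0 y r * ?k q r + E0 x q * D1 y r * ?k q r)"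
  unfolding poly_pderiv_mult3 k by (simp only: E0_def D1_def)
 also have "\<dots> = c (E0 x) (E0 y) s + (V.Op (D1 x) (E0 y) s + V.Op (E0 x) (D1 y) s)"
  unfolding c V.Op_expand_mq[OF E0_U[OF y], of "D1 x" s] V.Op_expand_mq[OF D1_U[OF y], of "E0 x" s]
  by (simp only: sum.distrib add.assoc)
 finally show "D1 (W.Op x y) s = (c (E0 x) (E0 y) + V.Op (D1 x) (E0 y) + V.Op (E0 x) (D1 y)) s" by simp
qed

text \<open>These are the terms of degree 1 in the associativity of the deformed product.\<close>

lemma cocycle:
 assumes "x \<in> V.U" "y \<in> V.U" "z \<in> V.U"
 shows "c (V.Op x y) z + V.Op (c x y) z = c x (V.Op y z) + V.Op x (c y z)"
proof -
 note u = cn_U[OF assms(1)] cn_U[OF assms(2)] cn_U[OF assms(3)]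
 have z: "V.Op x 0 = 0" "V.Op 0 x = 0" for x
  using module_hom.zero[OF V.lin_Op2] module_hom.zero[OF V.lin_Op1] by auto
 have "D1 (W.Op (W.Op (cn x) (cn y)) (cn z)) = D1 (W.Op (cn x) (W.Op (cn y) (cn z)))"
  using W.Op_assoc[OF u] by simp
 then show ?thesis
  by (simp only: D1_Op u W.Op_U E0_Op E0_cn D1_cn z add_0_right c_def[symmetric])
qed

text \<open>The unit is not deformed, so the cocycle is normalised.\<close>

lemma c_scalar: "y \<in> V.U ==> c (sc l (V.mon 0 0 0)) y = 0" "y \<in> V.U ==> c y (sc l (V.mon 0 0 0)) = 0"
 using V.p0 by (simp_all add: c_sc) (simp_all add: c_def cn_mon cn_U W.Op_one_left W.Op_one_right)

lemma c_mon_left: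
 assumes "y \<in> V.U" "i < p" "k < p" "j < p"
 shows "c (V.mon i k j) y = D1 (W.T i k j (cn y))"
 using assms by (simp add: c_def cn_mon W.Op_mon cn_U)

lemma D1_ext: "D1 (W.ext F (cn y)) = V.ext (\<lambda>i k j. D1 (F i k j)) y"
 by (rule ext) (simp add: D1_def W.ext_apply V.ext_apply poly_sum pderiv_sum' pderiv_smult split_def cn_def W.B_def V.B_def)

lemma ext_zero: "(\<And>i k j. i < p ==> k < p ==> j < p ==> F i k j = 0) ==> V.ext F y = 0"
 by (rule ext) (auto simp: V.ext_apply V.B_def intro!: sum.neutral)

lemma lt: "0 < p" "1 < p" "Suc 0 < p" "2 < p" "Suc (Suc 0) < p" "p - 1 < p" "p - Suc 0 < p" "Suc (p - Suc 0) = p" "p - Suc 0 + Suc 0 = p"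
 using p2' by auto

lemma mon_p: "W.mon p k j = sc \<alpha> (W.mon 0 k j)" "W.mon i p j = sc \<kappa> (W.mon i 0 j)" "W.mon i k p = sc \<beta> (W.mon i k 0)"
 using W.mon_shift[of 0 1 k 0 j 0] W.mon_shift[of i 0 0 1 j 0] W.mon_shift[of i 0 k 0 0 1] by simp_all

end

locale deform_a = pbw_deform p ty "[:0, 1:]" 1 0 for p and ty :: "'k::field itself"
begin

text \<open>In this deformation \<open>a^p\<close> is the parameter itself, whose coefficient of
  degree 1 is 1.\<close>

lemma c_a: "c (V.mon 1 0 0) (V.mon (p - 1) 0 0) = V.mon 0 0 0" "c (V.mon (p - 1) 0 0) (V.mon 1 0 0) = V.mon 0 0 0"
 by (simp_all add: c_mon_left lt cn_mon W.T_def W.La_pow_mon mon_p D1_sc E0_mon pderiv_pCons)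

end

locale deform_g = pbw_deform p ty 0 "[:1, 1:]" 0 for p and ty :: "'k::field itself"
begin

lemma D1_mon: "k < p ==> D1 (W.mon i k j) = 0"
 by (auto simp: D1_def W.mon_def fun_eq_iff power_0_left pderiv_pCons)

text \<open>Left multiplication by \<open>a\<close> leaves the exponent of \<open>g\<close> below
  \<open>p\<close>, and here the parameter enters only through \<open>g^p\<close>.\<close>

lemma c_a: "y \<in> V.U ==> c (V.mon 1 0 0) y = 0"
 by (simp add: c_mon_left lt W.T_def W.La_def D1_ext ext_zero D1_mon)

abbreviation "N \<equiv> \<Sum>k<p. V.mon 0 k 0"
abbreviation "t \<equiv> V.mon 0 1 0 - V.mon 0 0 0"

lemma cn_N: "cn N = (\<Sum>k<p. W.mon 0 k 0)"
 by (simp add: cn_sum cn_mon lt)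

lemma cn_t: "cn t = W.mon 0 1 0 - W.mon 0 0 0"
 by (simp add: cn_diff cn_mon lt)

lemma c_t_a: "c t (V.mon 1 0 0) = 0"
 unfolding c_def cn_t module_hom.diff[OF W.lin_Op1]
 by (simp add: cn_mon lt W.Op_mon W.T_def D1_diff D1_mon)

lemma c_N_a: "c N (V.mon 1 0 0) = 0"
 unfolding c_def cn_N lin_sum[OF W.lin_Op1]
 by (simp add: cn_mon lt W.Op_mon W.T_def W.Lg_pow_mon D1_sum D1_mon)

text \<open>The left-hand side is \<open>(g - 1) N = g^p - 1\<close>. That it equals the parameter
  is the reason for deforming \<kappa> to \<open>[:1, 1:]\<close>.\<close>

lemma tel: "(\<Sum>k<p. W.mon 0 (Suc k) 0 - W.mon 0 k 0) = sc [:0, 1:] (W.mon 0 0 0)"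
proof -
 have "(\<Sum>k<p. W.mon 0 (Suc k) 0 - W.mon 0 k 0) = W.mon 0 p 0 - W.mon 0 0 0"
  by (rule sum_lessThan_telescope[of "\<lambda>k. W.mon 0 k 0"])
 then show ?thesis by (simp add: mon_p sc_def fun_eq_iff algebra_simps)
qed

lemma W_Op_t_N: "W.Op (cn t) (cn N) = sc [:0, 1:] (W.mon 0 0 0)" "W.Op (cn N) (cn t) = sc [:0, 1:] (W.mon 0 0 0)"
proof -
 show "W.Op (cn t) (cn N) = sc [:0, 1:] (W.mon 0 0 0)"
  unfolding cn_t module_hom.diff[OF W.lin_Op1] cn_N lin_sum[OF W.lin_Op2]
  using tel by (simp add: W.Op_mon W.T_def)
 show "W.Op (cn N) (cn t) = sc [:0, 1:] (W.mon 0 0 0)"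
  unfolding cn_t module_hom.diff[OF W.lin_Op2] cn_N lin_sum[OF W.lin_Op1]
  using tel[unfolded sum_subtractf] by (simp add: W.Op_mon W.T_def W.Lg_pow_mon)
qed

lemma c_t_N: "c t N = V.mon 0 0 0" "c N t = V.mon 0 0 0"
 by (simp_all only: c_def W_Op_t_N, simp_all add: D1_sc D1_mon lt E0_mon pderiv_pCons)

text \<open>The deformed product \<open>W_Op_t_N\<close> is specialised to parameter value
  0.\<close>

lemma Op_t_N: "V.Op t N = 0" "V.Op N t = 0"
 using arg_cong[OF W_Op_t_N(1), of E0] arg_cong[OF W_Op_t_N(2), of E0] by (simp_all only: E0_Op E0_cn E0_sc) simp_all

end

locale deform_b = pbw_deform p ty 0 1 "[:0, 1:]" for p and ty :: "'k::field itself"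
begin

lemma D1_mon: "j < p ==> D1 (W.mon i k j) = 0"
 by (auto simp: D1_def W.mon_def fun_eq_iff power_0_left)

lemma c_a: "y \<in> V.U ==> c (V.mon 1 0 0) y = 0"
 by (simp add: c_mon_left lt W.T_def W.La_def D1_ext ext_zero D1_mon)

lemma c_g: "y \<in> V.U ==> c (V.mon 0 1 0) y = 0"
 by (simp add: c_mon_left lt W.T_def W.Lg_def D1_ext ext_zero D1_mon)

lemma cf_const: "\<exists>d. W.cf i k = [:d:]"
 by (rule exI[of _ "of_nat k + of_nat i * (1/2)"]) (simp add: W.cf_def of_nat_poly)

lemma pcf_const: "\<exists>d. W.pcf i k m = [:d:]"
proof (induct m)
 case 0
 show ?case by (rule exI[of _ 1]) (simp add: W.pcf_def one_pCons)
next
 case (Suc m)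
 then obtain d where "W.pcf i k m = [:d:]" by blast
 moreover obtain e where "W.cf (i + m) k = [:e:]" using cf_const by blast
 ultimately have "W.pcf i k (Suc m) = [:d * e:]" by (simp add: W.pcf_def)
 then show ?case by blast
qed

text \<open>The exponent of \<open>b\<close> stays below \<open>p\<close>, so no reduction takes
  place, and the remaining coefficients are constant by \<open>pcf_const\<close>.\<close>

lemma D1_Lb_pow: "n + j < p ==> D1 ((W.Lb ^^ n) (W.mon i k j)) = 0"
 unfolding W.Lb_pow_mon D1_sum
proof (intro sum.neutral ballI)
 fix m assume "m \<in> {..n}" "n + j < p"
 moreover obtain d where "W.pcf i k m = [:d:]" using pcf_const by blast
 ultimately show "D1 (sc (of_nat (n choose m) * W.pcf i k m) (W.mon (i + m) k (j + n - m))) = 0"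
  by (simp add: D1_sc D1_mon of_nat_poly pderiv_pCons)
qed

text \<open>Taken with \<open>n = 1\<close> and \<open>n = p - 1\<close>, this gives the vanishing
  of \<open>c\<close> between \<open>b\<close> or its cofactor and the generators treated before
  \<open>b\<close>.\<close>

lemma c_b_box: "n < p ==> i < p ==> k < p ==> c (V.mon 0 0 n) (V.mon i k 0) = 0"
 by (simp add: c_mon_left lt cn_mon W.T_def D1_Lb_pow)

lemma c_b: "c (V.mon 0 0 1) (V.mon 0 0 (p - 1)) = V.mon 0 0 0" "c (V.mon 0 0 (p - 1)) (V.mon 0 0 1) = V.mon 0 0 0"
proof -
 have "W.mon 0 0 p = sc [:0, 1:] (W.mon 0 0 0)" by (rule mon_p)
 then have 1: "D1 ((W.Lb ^^ n) (W.mon 0 0 j)) = V.mon 0 0 0" if "j + n = p" for n j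
  unfolding W.Lb_pow_mon0 that by (simp add: D1_sc D1_mon lt E0_mon pderiv_pCons)
 show "c (V.mon 0 0 1) (V.mon 0 0 (p - 1)) = V.mon 0 0 0"
  using 1[of "p - 1" 1] lt by (simp add: c_mon_left lt cn_mon W.T_def del: W.Lb_mon)
 show "c (V.mon 0 0 (p - 1)) (V.mon 0 0 1) = V.mon 0 0 0"
  using 1[of 1 "p - 1"] lt by (simp add: c_mon_left lt cn_mon W.T_def del: W.Lb_mon)
qed

end

section \<open>Skew group algebras of finite groups\<close>

lemma (in abelian_monoid) finsum_swap:
 assumes "finite X" "finite Y" "\<And>x y. x \<in> X ==> y \<in> Y ==> f x y \<in> carrier G"
 shows "(\<Oplus>x\<in>X. \<Oplus>y\<in>Y. f x y) = (\<Oplus>y\<in>Y. \<Oplus>x\<in>X. f x y)"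
 using assms(1,3)
proof (induct X rule: finite_induct)
 case empty
 then show ?case by simp
next
 case (insert x X)
 have 1: "f x \<in> Y \<rightarrow> carrier G" "\<And>y. y \<in> Y ==> (\<lambda>x. f x y) \<in> X \<rightarrow> carrier G" using insert(4) by auto
 have "(\<Oplus>y\<in>Y. \<Oplus>x\<in>insert x X. f x y) = (\<Oplus>y\<in>Y. f x y \<oplus> (\<Oplus>x\<in>X. f x y))"
  using insert 1 by (intro finsum_cong') (auto intro!: finsum_closed)
 also have "\<dots> = (\<Oplus>y\<in>Y. f x y) \<oplus> (\<Oplus>y\<in>Y. \<Oplus>x\<in>X. f x y)"
  using insert 1 by (intro finsum_addf) (auto intro!: finsum_closed)
 finally show ?case using insert 1 by (auto intro!: finsum_closed)
qed

lemma (in abelian_monoid) finsum_reindex_bij: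
 assumes "bij_betw h X Y" "\<And>y. y \<in> Y ==> f y \<in> carrier G"
 shows "(\<Oplus>x\<in>X. f (h x)) = (\<Oplus>y\<in>Y. f y)"
 using add.finprod_reindex[of f h X] assms by (auto simp: bij_betw_def)

locale skew_data = A: assoc_algebra A + G: group G
 for A :: "('k::field, 'a) module" and G :: "('g, 'c) monoid_scheme" and lact :: "'g \<Rightarrow> 'a \<Rightarrow> 'a" +
 assumes fin: "finite (carrier G)"
  and lact_hom: "h \<in> carrier G ==> lact h \<in> algebra_hom A A"
  and lact_one: "x \<in> carrier A ==> lact \<one>\<^sub>G x = x"
  and lact_mult: "x \<in> carrier A ==> h \<in> carrier G ==> h' \<in> carrier G ==> lact (h \<otimes>\<^sub>G h') x = lact h (lact h' x)"
begin

abbreviation H where "H \<equiv> skew_group_algebra G A lact"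

lemmas lact_simps = algebra_homD(2-)[OF lact_hom]

lemma lact_zero: "h \<in> carrier G ==> lact h \<zero>\<^sub>A = \<zero>\<^sub>A"
 by (rule linear_maps_zero[OF A.assoc_algebra_self A.assoc_algebra_self algebra_homD(1)[OF lact_hom]])

lemma carrier_H: "carrier H = {f. (\<forall>h\<in>carrier G. f h \<in> carrier A) \<and> (\<forall>h. h \<notin> carrier G \<longrightarrow> f h = \<zero>\<^sub>A)}"
proof -
 have "finite {h. f h \<noteq> \<zero>\<^sub>A}" if "\<forall>h. h \<notin> carrier G \<longrightarrow> f h = \<zero>\<^sub>A" for f
  by (rule finite_subset[OF _ fin]) (use that in auto)
 then show ?thesis by (auto simp: skew_group_algebra_def)
qed

lemma H_closed: "f \<in> carrier H ==> f h \<in> carrier A"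
 by (cases "h \<in> carrier G") (auto simp: carrier_H)

lemma H_memI: "(\<And>h. h \<in> carrier G ==> f h \<in> carrier A) ==> (\<And>h. h \<notin> carrier G ==> f h = \<zero>\<^sub>A) ==> f \<in> carrier H"
 by (simp add: carrier_H)

lemma H_out: "f \<in> carrier H ==> h \<notin> carrier G ==> f h = \<zero>\<^sub>A"
 by (simp add: carrier_H)

lemma H_mult:
 assumes f: "f \<in> carrier H" and f': "f' \<in> carrier H" and u: "u \<in> carrier G"
 shows "(f \<otimes>\<^sub>H f') u = (\<Oplus>\<^sub>A h\<in>carrier G. f h \<otimes>\<^sub>A lact h (f' (inv\<^bsub>G\<^esub> h \<otimes>\<^sub>G u)))"
proof -
 have "{h. f h \<noteq> \<zero>\<^sub>A} \<subseteq> carrier G" using f by (auto simp: carrier_H)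
 then have "(\<Oplus>\<^sub>A h\<in>{h. f h \<noteq> \<zero>\<^sub>A}. f h \<otimes>\<^sub>A lact h (f' (inv\<^bsub>G\<^esub> h \<otimes>\<^sub>G u)))
  = (\<Oplus>\<^sub>A h\<in>carrier G. f h \<otimes>\<^sub>A lact h (f' (inv\<^bsub>G\<^esub> h \<otimes>\<^sub>G u)))"
  using fin H_closed[OF f] H_closed[OF f'] by (intro A.add.finprod_mono_neutral_cong_left) (auto simp: lact_simps)
 then show ?thesis using u by (simp add: skew_group_algebra_def)
qed

lemma H_mult_out: "u \<notin> carrier G ==> (f \<otimes>\<^sub>H f') u = \<zero>\<^sub>A"
 by (simp add: skew_group_algebra_def)

lemma H_sel: "f \<oplus>\<^sub>H f' = (\<lambda>u. f u \<oplus>\<^sub>A f' u)" "c \<odot>\<^sub>H f = (\<lambda>u. c \<odot>\<^sub>A f u)" "\<zero>\<^sub>H = (\<lambda>_. \<zero>\<^sub>A)" "\<one>\<^sub>H = skew_elt A \<one>\<^sub>A \<one>\<^sub>G"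
 by (auto simp: skew_group_algebra_def)

lemma skew_elt_closed: "x \<in> carrier A ==> h \<in> carrier G ==> skew_elt A x h \<in> carrier H"
 by (auto simp: carrier_H skew_elt_def)

lemma term_closed: "f \<in> carrier H ==> f' \<in> carrier H ==> h \<in> carrier G ==> f h \<otimes>\<^sub>A lact h (f' u) \<in> carrier A"
 by (simp add: H_closed lact_simps)

lemma H_mult_closed: "f \<in> carrier H ==> f' \<in> carrier H ==> f \<otimes>\<^sub>H f' \<in> carrier H"
 by (rule H_memI) (auto simp: H_mult_out H_mult intro!: A.finsum_closed term_closed)

lemma finsum_single:
 assumes "i \<in> carrier G" "f i \<in> carrier A"
 shows "(\<Oplus>\<^sub>A h\<in>carrier G. if h = i then f h else \<zero>\<^sub>A) = f i"
proof -
 have "(\<Oplus>\<^sub>A h\<in>carrier G. if h = i then f h else \<zero>\<^sub>A) = (\<Oplus>\<^sub>A h\<in>{i}. f h)"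
  using assms fin by (intro A.add.finprod_mono_neutral_cong_right) auto
 then show ?thesis using assms by simp
qed

lemma skew_elt_mult_left:
 assumes f: "f \<in> carrier H" and x: "x \<in> carrier A" and h: "h \<in> carrier G" and u: "u \<in> carrier G"
 shows "(skew_elt A x h \<otimes>\<^sub>H f) u = x \<otimes>\<^sub>A lact h (f (inv\<^bsub>G\<^esub> h \<otimes>\<^sub>G u))"
proof -
 have "(skew_elt A x h \<otimes>\<^sub>H f) u = (\<Oplus>\<^sub>A l\<in>carrier G. if l = h then x \<otimes>\<^sub>A lact l (f (inv\<^bsub>G\<^esub> l \<otimes>\<^sub>G u)) else \<zero>\<^sub>A)"
  unfolding H_mult[OF skew_elt_closed[OF x h] f u]
  using x H_closed[OF f] by (intro A.finsum_cong') (auto simp: skew_elt_def lact_simps)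
 also have "\<dots> = x \<otimes>\<^sub>A lact h (f (inv\<^bsub>G\<^esub> h \<otimes>\<^sub>G u))"
  using x h H_closed[OF f] by (intro finsum_single) (auto simp: lact_simps)
 finally show ?thesis .
qed

lemma H_eqI: "f \<in> carrier H ==> f' \<in> carrier H ==> (\<And>u. u \<in> carrier G ==> f u = f' u) ==> f = f'"
proof (rule ext)
 fix u assume "f \<in> carrier H" "f' \<in> carrier H" "\<And>u. u \<in> carrier G ==> f u = f' u"
 then show "f u = f' u" by (cases "u \<in> carrier G") (simp_all add: H_out)
qed

lemma skew_elt_mult:
 assumes "x \<in> carrier A" "y \<in> carrier A" "h \<in> carrier G" "l \<in> carrier G"
 shows "skew_elt A x h \<otimes>\<^sub>H skew_elt A y l = skew_elt A (x \<otimes>\<^sub>A lact h y) (h \<otimes>\<^sub>G l)"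
proof (rule H_eqI)
 show "skew_elt A x h \<otimes>\<^sub>H skew_elt A y l \<in> carrier H" "skew_elt A (x \<otimes>\<^sub>A lact h y) (h \<otimes>\<^sub>G l) \<in> carrier H"
  using assms by (auto intro!: H_mult_closed skew_elt_closed simp: lact_simps)
 fix u assume u: "u \<in> carrier G"
 have "inv\<^bsub>G\<^esub> h \<otimes>\<^sub>G u = l \<longleftrightarrow> u = h \<otimes>\<^sub>G l"
  using assms u G.inv_solve_left G.inv_solve_left' by metis
 then show "(skew_elt A x h \<otimes>\<^sub>H skew_elt A y l) u = skew_elt A (x \<otimes>\<^sub>A lact h y) (h \<otimes>\<^sub>G l) u"
  unfolding skew_elt_mult_left[OF skew_elt_closed[OF assms(2,4)] assms(1,3) u]
  using assms u by (auto simp: skew_elt_def lact_zero)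
qed

text \<open>For associativity the inner product at \<open>l^(-1) u\<close> is a sum over
  \<open>m\<close>, and the substitution \<open>h = l m\<close> matches the two orders of
  summation.\<close>

lemma assoc_algebra_H: "assoc_algebra H"
proof -
 have ab: "abelian_group H"
 proof (rule abelian_groupI)
  fix x assume "x \<in> carrier H"
  then show "\<exists>y\<in>carrier H. y \<oplus>\<^sub>H x = \<zero>\<^sub>H"
   using H_closed[of x] by (intro bexI[of _ "\<lambda>u. \<ominus>\<^sub>A x u"] H_memI) (simp_all add: H_sel A.l_neg H_out)
 next
  fix x y assume "x \<in> carrier H" "y \<in> carrier H"
  then show "x \<oplus>\<^sub>H y = y \<oplus>\<^sub>H x" unfolding H_sel using H_closed by (intro ext A.a_comm)
  show "x \<oplus>\<^sub>H y \<in> carrier H"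
   using \<open>x \<in> carrier H\<close> \<open>y \<in> carrier H\<close> unfolding H_sel by (intro H_memI) (simp_all add: H_closed H_out)
 qed (auto simp: H_sel H_closed A.a_assoc intro!: H_memI)
 have mon: "Group.monoid H"
 proof (rule monoidI)
  fix f f' f'' assume f: "f \<in> carrier H" and f': "f' \<in> carrier H" and f'': "f'' \<in> carrier H"
  note cl = H_closed[OF f] H_closed[OF f'] H_closed[OF f'']
  show "f \<otimes>\<^sub>H f' \<otimes>\<^sub>H f'' = f \<otimes>\<^sub>H (f' \<otimes>\<^sub>H f'')"
  proof (rule H_eqI)
   fix u assume u: "u \<in> carrier G"
   let ?t = "\<lambda>l h. f l \<otimes>\<^sub>A lact l (f' (inv\<^bsub>G\<^esub> l \<otimes>\<^sub>G h)) \<otimes>\<^sub>A lact h (f'' (inv\<^bsub>G\<^esub> h \<otimes>\<^sub>G u))"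
   have tc: "?t l h \<in> carrier A" if "l \<in> carrier G" "h \<in> carrier G" for l h
    using that cl by (simp add: lact_simps)
   have "(f \<otimes>\<^sub>H f' \<otimes>\<^sub>H f'') u = (\<Oplus>\<^sub>A h\<in>carrier G. \<Oplus>\<^sub>A l\<in>carrier G. ?t l h)"
    unfolding H_mult[OF H_mult_closed[OF f f'] f'' u] using cl fin tc
    by (intro A.finsum_cong') (auto simp: H_mult[OF f f'] lact_simps intro!: A.finsum_ldistr A.finsum_closed)
   also have "\<dots> = (\<Oplus>\<^sub>A l\<in>carrier G. \<Oplus>\<^sub>A h\<in>carrier G. ?t l h)"
    by (rule A.finsum_swap[OF fin fin tc])
   also have "\<dots> = (\<Oplus>\<^sub>A l\<in>carrier G. f l \<otimes>\<^sub>A lact l ((f' \<otimes>\<^sub>H f'') (inv\<^bsub>G\<^esub> l \<otimes>\<^sub>G u)))"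
   proof (intro A.finsum_cong')
    fix l assume l: "l \<in> carrier G"
    have lu: "inv\<^bsub>G\<^esub> l \<otimes>\<^sub>G u \<in> carrier G" using l u by simp
    let ?m = "\<lambda>m. f' m \<otimes>\<^sub>A lact m (f'' (inv\<^bsub>G\<^esub> m \<otimes>\<^sub>G (inv\<^bsub>G\<^esub> l \<otimes>\<^sub>G u)))"
    have mc: "?m m \<in> carrier A" if "m \<in> carrier G" for m using that cl by (simp add: lact_simps)
    have eq: "f l \<otimes>\<^sub>A lact l (?m m) = ?t l (l \<otimes>\<^sub>G m)" if m: "m \<in> carrier G" for m
    proof -
     have "inv\<^bsub>G\<^esub> l \<otimes>\<^sub>G (l \<otimes>\<^sub>G m) = m" using l m by (simp add: G.m_assoc[symmetric])
     moreover have "inv\<^bsub>G\<^esub> (l \<otimes>\<^sub>G m) \<otimes>\<^sub>G u = inv\<^bsub>G\<^esub> m \<otimes>\<^sub>G (inv\<^bsub>G\<^esub> l \<otimes>\<^sub>G u)"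
      using l m u by (simp add: G.inv_mult_group G.m_assoc)
     ultimately show ?thesis using l m cl by (simp add: lact_simps lact_mult A.m_assoc)
    qed
    have bij: "bij_betw (\<lambda>m. l \<otimes>\<^sub>G m) (carrier G) (carrier G)"
     using G.inj_on_cmult[OF l] G.surj_const_mult[OF l] by (simp add: bij_betw_def)
    have "f l \<otimes>\<^sub>A lact l ((f' \<otimes>\<^sub>H f'') (inv\<^bsub>G\<^esub> l \<otimes>\<^sub>G u)) = f l \<otimes>\<^sub>A (\<Oplus>\<^sub>A m\<in>carrier G. lact l (?m m))"
     unfolding H_mult[OF f' f'' lu]
     using linear_maps_finsum[OF A.assoc_algebra_self A.assoc_algebra_self algebra_homD(1)[OF lact_hom[OF l]] fin, of ?m] mc by simp
    also have "\<dots> = (\<Oplus>\<^sub>A m\<in>carrier G. f l \<otimes>\<^sub>A lact l (?m m))"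
     using fin cl mc l by (intro A.finsum_rdistr) (auto simp: lact_simps)
    also have "\<dots> = (\<Oplus>\<^sub>A m\<in>carrier G. ?t l (l \<otimes>\<^sub>G m))"
     using eq tc l by (intro A.finsum_cong') auto
    also have "\<dots> = (\<Oplus>\<^sub>A h\<in>carrier G. ?t l h)"
     by (rule A.finsum_reindex_bij[OF bij tc[OF l]])
    finally show "(\<Oplus>\<^sub>A h\<in>carrier G. ?t l h) = f l \<otimes>\<^sub>A lact l ((f' \<otimes>\<^sub>H f'') (inv\<^bsub>G\<^esub> l \<otimes>\<^sub>G u))" by simp
   qed (auto simp: lact_simps cl H_closed[OF H_mult_closed[OF f' f'']])
   also have "\<dots> = (f \<otimes>\<^sub>H (f' \<otimes>\<^sub>H f'')) u"
    by (rule H_mult[OF f H_mult_closed[OF f' f''] u, symmetric])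
   finally show "(f \<otimes>\<^sub>H f' \<otimes>\<^sub>H f'') u = (f \<otimes>\<^sub>H (f' \<otimes>\<^sub>H f'')) u" .
  qed (intro H_mult_closed f f' f'')+
 next
  fix f assume f: "f \<in> carrier H"
  note cl = H_closed[OF f]
  have one: "skew_elt A \<one>\<^sub>A \<one>\<^sub>G \<in> carrier H" by (rule skew_elt_closed) auto
  show "\<one>\<^sub>H \<otimes>\<^sub>H f = f"
   unfolding H_sel by (rule H_eqI[OF H_mult_closed[OF one f] f]) (simp add: skew_elt_mult_left[OF f] cl lact_one)
  show "f \<otimes>\<^sub>H \<one>\<^sub>H = f"
   unfolding H_sel
  proof (rule H_eqI[OF H_mult_closed[OF f one] f])
   fix u assume u: "u \<in> carrier G"
   have "(f \<otimes>\<^sub>H skew_elt A \<one>\<^sub>A \<one>\<^sub>G) u = (\<Oplus>\<^sub>A h\<in>carrier G. if h = u then f h else \<zero>\<^sub>A)"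
    unfolding H_mult[OF f one u]
   proof (intro A.finsum_cong')
    fix h assume h: "h \<in> carrier G"
    have "inv\<^bsub>G\<^esub> h \<otimes>\<^sub>G u = \<one>\<^sub>G \<longleftrightarrow> h = u" using h u by (metis G.inv_solve_left' G.one_closed G.r_one)
    then show "f h \<otimes>\<^sub>A lact h (skew_elt A \<one>\<^sub>A \<one>\<^sub>G (inv\<^bsub>G\<^esub> h \<otimes>\<^sub>G u)) = (if h = u then f h else \<zero>\<^sub>A)"
     using h cl by (auto simp: skew_elt_def lact_zero lact_simps)
   qed (use cl in auto)
   also have "\<dots> = f u" by (rule finsum_single[OF u cl])
   finally show "(f \<otimes>\<^sub>H skew_elt A \<one>\<^sub>A \<one>\<^sub>G) u = f u" .
  qed
 qed (auto simp: H_sel intro: skew_elt_closed H_mult_closed)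
 have add_closed: "f \<oplus>\<^sub>H f' \<in> carrier H" if "f \<in> carrier H" "f' \<in> carrier H" for f f'
  using that unfolding H_sel by (auto intro!: H_memI simp: H_closed H_out A.smult_closed)
 have sm_closed: "c \<odot>\<^sub>H f \<in> carrier H" if "f \<in> carrier H" for f c
  using that unfolding H_sel by (auto intro!: H_memI simp: H_closed H_out A.smult_closed)
 have rng: "Ring.ring H"
 proof (rule ringI[OF ab mon])
  fix f f' f'' assume f: "f \<in> carrier H" and f': "f' \<in> carrier H" and f'': "f'' \<in> carrier H"
  note cl = H_closed[OF f] H_closed[OF f'] H_closed[OF f'']
  have tc: "(\<lambda>h. f1 h \<otimes>\<^sub>A lact h (f2 (inv\<^bsub>G\<^esub> h \<otimes>\<^sub>G u))) \<in> carrier G \<rightarrow> carrier A"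
   if "f1 \<in> carrier H" "f2 \<in> carrier H" for f1 f2 u using term_closed[OF that] by auto
  show "(f \<oplus>\<^sub>H f') \<otimes>\<^sub>H f'' = f \<otimes>\<^sub>H f'' \<oplus>\<^sub>H f' \<otimes>\<^sub>H f''"
  proof (rule H_eqI)
   fix u assume u: "u \<in> carrier G"
   have "((f \<oplus>\<^sub>H f') \<otimes>\<^sub>H f'') u = (\<Oplus>\<^sub>A h\<in>carrier G. f h \<otimes>\<^sub>A lact h (f'' (inv\<^bsub>G\<^esub> h \<otimes>\<^sub>G u)) \<oplus>\<^sub>A f' h \<otimes>\<^sub>A lact h (f'' (inv\<^bsub>G\<^esub> h \<otimes>\<^sub>G u)))"
    unfolding H_mult[OF add_closed[OF f f'] f'' u] using cl
    by (intro A.finsum_cong') (auto simp: H_sel A.l_distr lact_simps)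
   also have "\<dots> = (f \<otimes>\<^sub>H f'' \<oplus>\<^sub>H f' \<otimes>\<^sub>H f'') u"
    unfolding H_sel H_mult[OF f f'' u] H_mult[OF f' f'' u] by (intro A.finsum_addf tc f f' f'')
   finally show "((f \<oplus>\<^sub>H f') \<otimes>\<^sub>H f'') u = (f \<otimes>\<^sub>H f'' \<oplus>\<^sub>H f' \<otimes>\<^sub>H f'') u" .
  qed (intro add_closed H_mult_closed f f' f'')+
  show "f'' \<otimes>\<^sub>H (f \<oplus>\<^sub>H f') = f'' \<otimes>\<^sub>H f \<oplus>\<^sub>H f'' \<otimes>\<^sub>H f'"
  proof (rule H_eqI)
   fix u assume u: "u \<in> carrier G"
   have "(f'' \<otimes>\<^sub>H (f \<oplus>\<^sub>H f')) u = (\<Oplus>\<^sub>A h\<in>carrier G. f'' h \<otimes>\<^sub>A lact h (f (inv\<^bsub>G\<^esub> h \<otimes>\<^sub>G u)) \<oplus>\<^sub>A f'' h \<otimes>\<^sub>A lact h (f' (inv\<^bsub>G\<^esub> h \<otimes>\<^sub>G u)))"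
    unfolding H_mult[OF f'' add_closed[OF f f'] u] using cl
    by (intro A.finsum_cong') (auto simp: H_sel A.r_distr lact_simps)
   also have "\<dots> = (f'' \<otimes>\<^sub>H f \<oplus>\<^sub>H f'' \<otimes>\<^sub>H f') u"
    unfolding H_sel H_mult[OF f'' f u] H_mult[OF f'' f' u] by (intro A.finsum_addf tc f f' f'')
   finally show "(f'' \<otimes>\<^sub>H (f \<oplus>\<^sub>H f')) u = (f'' \<otimes>\<^sub>H f \<oplus>\<^sub>H f'' \<otimes>\<^sub>H f') u" .
  qed (intro add_closed H_mult_closed f f' f'')+
 qed
 have sm: "(c \<odot>\<^sub>H f) \<otimes>\<^sub>H f' = c \<odot>\<^sub>H (f \<otimes>\<^sub>H f')" "f \<otimes>\<^sub>H (c \<odot>\<^sub>H f') = c \<odot>\<^sub>H (f \<otimes>\<^sub>H f')"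
  if f: "f \<in> carrier H" and f': "f' \<in> carrier H" for c f f'
 proof -
  note cl = H_closed[OF f] H_closed[OF f']
  have e: "(c \<odot>\<^sub>H (f \<otimes>\<^sub>H f')) u = (\<Oplus>\<^sub>A h\<in>carrier G. c \<odot>\<^sub>A (f h \<otimes>\<^sub>A lact h (f' (inv\<^bsub>G\<^esub> h \<otimes>\<^sub>G u))))" if u: "u \<in> carrier G" for u
   unfolding H_sel H_mult[OF f f' u] using cl fin by (intro A.finsum_smult) (auto simp: lact_simps)
  show "(c \<odot>\<^sub>H f) \<otimes>\<^sub>H f' = c \<odot>\<^sub>H (f \<otimes>\<^sub>H f')"
  proof (rule H_eqI)
   fix u assume u: "u \<in> carrier G"
   show "((c \<odot>\<^sub>H f) \<otimes>\<^sub>H f') u = (c \<odot>\<^sub>H (f \<otimes>\<^sub>H f')) u"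
    unfolding e[OF u] H_mult[OF sm_closed[OF f] f' u] using cl
    by (intro A.finsum_cong') (auto simp: H_sel A.smult_mult_l lact_simps A.smult_closed)
  qed (intro sm_closed H_mult_closed f f')+
  show "f \<otimes>\<^sub>H (c \<odot>\<^sub>H f') = c \<odot>\<^sub>H (f \<otimes>\<^sub>H f')"
  proof (rule H_eqI)
   fix u assume u: "u \<in> carrier G"
   show "(f \<otimes>\<^sub>H (c \<odot>\<^sub>H f')) u = (c \<odot>\<^sub>H (f \<otimes>\<^sub>H f')) u"
    unfolding e[OF u] H_mult[OF f sm_closed[OF f'] u] using cl
    by (intro A.finsum_cong') (auto simp: H_sel A.smult_mult_r lact_simps A.smult_closed)
  qed (intro sm_closed H_mult_closed f f')+
 qed
 show ?thesis
  unfolding assoc_algebra_def assoc_algebra_axioms_def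
  by (intro conjI allI impI rng sm_closed sm; assumption?)
   (simp_all add: H_sel H_closed A.smult_l_distr A.smult_r_distr A.smult_assoc1 A.smult_one fun_eq_iff)
qed

end

section \<open>The presented algebra and its monomial basis\<close>

lemma monoid_algebra_minus:
 assumes M: "monoid M" and f: "f \<in> carrier (monoid_algebra M)" and g: "g \<in> carrier (monoid_algebra M)"
 shows "f \<ominus>\<^bsub>monoid_algebra M\<^esub> g = (\<lambda>z. f z - (g z :: 'k::field))"
proof -
 interpret R: assoc_algebra "monoid_algebra M :: ('k, _) module" by (rule assoc_algebra_monoid_algebra[OF M])
 have "\<ominus>\<^bsub>monoid_algebra M\<^esub> g = (-1) \<odot>\<^bsub>monoid_algebra M\<^esub> g"
  using R.smult_minus_left[OF g, of 1] g by (simp add: R.smult_one del: monoid_algebra_sel)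
 then show ?thesis using f g by (simp add: R.minus_eq)
qed

text \<open>The scalar \<open>s\<close> stays free: it is \<open>1/2\<close> for the given relations
  and \<open>- (1/2)\<close> for the elements that determine the antipode.\<close>

locale jordan_rels = D: assoc_algebra D for D :: "('k::field, 'd) module" (structure) +
 fixes a g b :: 'd and s :: 'k
 assumes cl [simp]: "a \<in> carrier D" "g \<in> carrier D" "b \<in> carrier D"
  and ga: "g \<otimes> a = a \<otimes> g" and ba: "b \<otimes> a = a \<otimes> b \<oplus> s \<odot> (a \<otimes> a)" and bg: "b \<otimes> g = g \<otimes> b \<oplus> a \<otimes> g"
begin

lemma g_pow_a: "g \<otimes> a [^] i = a [^] i \<otimes> g" for i :: nat
proof (induct i)
 case (Suc i)
 have "g \<otimes> a [^] Suc i = (g \<otimes> a [^] i) \<otimes> a" by (simp add: D.m_assoc)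
 also have "\<dots> = a [^] i \<otimes> (g \<otimes> a)" unfolding Suc by (simp add: D.m_assoc)
 finally show ?case unfolding ga by (simp add: D.m_assoc)
qed simp

lemma a_pow_Suc: "a \<otimes> a [^] i = a [^] Suc i" for i :: nat
 using D.nat_pow_Suc2[of a i] by simp

lemma b_pow_a: "b \<otimes> a [^] i = a [^] i \<otimes> b \<oplus> (of_nat i * s) \<odot> a [^] Suc i" for i :: nat
proof (induct i)
 case (Suc i)
 have "b \<otimes> a [^] Suc i = (b \<otimes> a) \<otimes> a [^] i" using D.nat_pow_Suc2[of a i] by (simp add: D.m_assoc)
 also have "\<dots> = a \<otimes> (b \<otimes> a [^] i) \<oplus> s \<odot> a [^] Suc (Suc i)"
  unfolding ba using D.nat_pow_Suc2[of a] by (simp add: D.l_distr D.smult_closed D.m_assoc D.smult_mult_l del: D.nat_pow_Suc)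
 also have "a \<otimes> (b \<otimes> a [^] i) = a [^] Suc i \<otimes> b \<oplus> (of_nat i * s) \<odot> a [^] Suc (Suc i)"
  unfolding Suc using D.nat_pow_Suc2[of a] by (simp add: D.r_distr D.smult_closed D.m_assoc D.smult_mult_r del: D.nat_pow_Suc)
 also have "\<dots> \<oplus> s \<odot> a [^] Suc (Suc i) = a [^] Suc i \<otimes> b \<oplus> (of_nat (Suc i) * s) \<odot> a [^] Suc (Suc i)"
 proof -
  have e: "of_nat (Suc i) * s = of_nat i * s + s" by (simp add: distrib_right add.commute)
  show ?thesis unfolding e by (simp add: D.a_assoc D.smult_closed D.smult_l_distr del: D.nat_pow_Suc)
 qed
 finally show ?case .
qed simp

lemma b_pow_g: "b \<otimes> g [^] k = g [^] k \<otimes> b \<oplus> of_nat k \<odot> (a \<otimes> g [^] k)" for k :: nat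
proof (induct k)
 case (Suc k)
 have "b \<otimes> g [^] Suc k = (b \<otimes> g) \<otimes> g [^] k" using D.nat_pow_Suc2[of g k] by (simp add: D.m_assoc)
 also have "\<dots> = g \<otimes> (b \<otimes> g [^] k) \<oplus> a \<otimes> g [^] Suc k"
  unfolding bg using D.nat_pow_Suc2[of g] by (simp add: D.l_distr D.m_assoc del: D.nat_pow_Suc)
 also have "g \<otimes> (b \<otimes> g [^] k) = g [^] Suc k \<otimes> b \<oplus> of_nat k \<odot> ((g \<otimes> a) \<otimes> g [^] k)"
  unfolding Suc using D.nat_pow_Suc2[of g] by (simp add: D.r_distr D.smult_closed D.m_assoc D.smult_mult_r del: D.nat_pow_Suc)
 also have "(g \<otimes> a) \<otimes> g [^] k = a \<otimes> g [^] Suc k"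
  unfolding ga using D.nat_pow_Suc2[of g] by (simp add: D.m_assoc del: D.nat_pow_Suc)
 also have "g [^] Suc k \<otimes> b \<oplus> of_nat k \<odot> (a \<otimes> g [^] Suc k) \<oplus> a \<otimes> g [^] Suc k = g [^] Suc k \<otimes> b \<oplus> of_nat (Suc k) \<odot> (a \<otimes> g [^] Suc k)"
  using D.smult_one[of "a \<otimes> g [^] Suc k"] D.smult_l_distr[of "a \<otimes> g [^] Suc k" "of_nat k" 1]
  by (simp add: D.a_assoc D.smult_closed add.commute del: D.nat_pow_Suc)
 finally show ?case .
qed simp

end

section \<open>Homomorphisms from the model into algebras satisfying the relations\<close>

locale pbw_rels = pbw_field p ty + jordan_rels D a g b "1/2"
 for p and ty :: "'k::field itself" and D :: "('k, 'd) module" (structure) and a g b +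
 assumes ap: "a [^] p = \<zero>" and bp: "b [^] p = \<zero>" and gp: "g [^] p = \<one>"
begin

definition mono :: "nat \<Rightarrow> nat \<Rightarrow> nat \<Rightarrow> 'd" where
 "mono i k j = a [^] i \<otimes> (g [^] k \<otimes> b [^] j)"

definition psi :: "(nat \<times> nat \<times> nat \<Rightarrow> 'k) \<Rightarrow> 'd" where
 "psi x = (\<Oplus>q\<in>V.B. x q \<odot> (case q of (i, k, j) \<Rightarrow> mono i k j))"

lemma mono_closed [simp]: "mono i k j \<in> carrier D"
 by (simp add: mono_def)

lemma psi_closed [simp]: "psi x \<in> carrier D"
 unfolding psi_def by (intro D.finsum_closed) (auto intro: D.smult_closed split: prod.splits)

lemma psi_add: "psi (x + y) = psi x \<oplus> psi y"
proof -
 have "psi (x + y) = (\<Oplus>q\<in>V.B. x q \<odot> (case q of (i, k, j) \<Rightarrow> mono i k j) \<oplus> y q \<odot> (case q of (i, k, j) \<Rightarrow> mono i k j))"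
  unfolding psi_def by (intro D.finsum_cong') (auto simp: D.smult_l_distr D.smult_closed split: prod.splits)
 then show ?thesis unfolding psi_def by (subst (asm) D.finsum_addf) (auto simp: D.smult_closed split: prod.splits)
qed

lemma psi_sc: "psi (sc c x) = c \<odot> psi x"
 unfolding psi_def
 by (subst D.finsum_smult[OF V.finite_B])
  (auto simp: D.smult_closed D.smult_assoc1 sc_def split: prod.splits intro!: D.finsum_cong')

lemma psi_zero: "psi 0 = \<zero>"
proof -
 have e: "sc 0 (0 :: nat \<times> nat \<times> nat \<Rightarrow> 'k) = 0" by (rule vec.scale_zero_left)
 show ?thesis using trans[OF psi_sc[of 0 0, unfolded e] D.smult_zero_left[OF psi_closed]] .
qed

lemma psi_sum: "finite S ==> psi (\<Sum>s\<in>S. F s) = (\<Oplus>s\<in>S. psi (F s))"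
 by (induct S rule: finite_induct) (auto simp: psi_zero[unfolded zero_fun_def] psi_zero psi_add simp del: plus_fun_apply)

lemma psi_box: "i < p ==> k < p ==> j < p ==> psi (V.mon i k j) = mono i k j"
proof -
 assume *: "i < p" "k < p" "j < p"
 have "psi (V.mon i k j) = (\<Oplus>q\<in>{(i, k, j)}. V.mon i k j q \<odot> (case q of (i, k, j) \<Rightarrow> mono i k j))"
  unfolding psi_def using * V.finite_B
  by (intro D.add.finprod_mono_neutral_cong_right) (auto simp: V.B_def V.mon_box D.smult_closed)
 then show ?thesis using * by (simp add: V.mon_box D.smult_one D.smult_closed)
qed

lemma pow_zero: "x \<in> carrier D ==> x [^] p = \<zero> ==> p \<le> n ==> x [^] n = \<zero>"
 using D.nat_pow_mult[of x p "n - p"] by auto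

lemma g_mod: "g [^] (k mod p) = g [^] k"
proof -
 have "g [^] k = g [^] (k mod p + p * (k div p))" by simp
 also have "\<dots> = g [^] (k mod p) \<otimes> (g [^] p) [^] (k div p)" by (simp add: D.nat_pow_mult D.nat_pow_pow)
 finally show ?thesis by (simp add: gp)
qed

text \<open>Extends \<open>psi_box\<close> to all exponents: both sides reduce in the same way
  because \<open>g^p = 1\<close> and \<open>a^p = b^p = 0\<close> hold in \<open>D\<close>
  too.\<close>

lemma psi_mon: "psi (V.mon i k j) = mono i k j"
proof (cases "i < p \<and> j < p")
 case True
 then have "V.mon i k j = V.mon i (k mod p) j" by (auto simp: V.mon_def fun_eq_iff)
 then show ?thesis using True V.p0 psi_box[of i "k mod p" j] by (simp add: mono_def g_mod)
next
 case False
 then have "V.mon i k j = 0" using V.p0 by (auto simp: V.mon_def fun_eq_iff power_0_left div_eq_0_iff)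
 moreover have "mono i k j = \<zero>" using False pow_zero[OF _ ap, of i] pow_zero[OF _ bp, of j] by (auto simp: mono_def)
 ultimately show ?thesis by (simp add: psi_zero)
qed

lemma psi_ext: "psi (V.ext F x) = (\<Oplus>q\<in>V.B. x q \<odot> psi (case q of (i, k, j) \<Rightarrow> F i k j))"
 unfolding V.ext_def psi_sum[OF V.finite_B]
 by (intro D.finsum_cong') (auto simp: psi_sc D.smult_closed)

lemma mult_psi: "y \<in> carrier D ==> y \<otimes> psi x = (\<Oplus>q\<in>V.B. x q \<odot> (y \<otimes> (case q of (i, k, j) \<Rightarrow> mono i k j)))"
 unfolding psi_def
 by (subst D.finsum_rdistr[OF V.finite_B])
  (auto simp: D.smult_closed D.smult_mult_r split: prod.splits intro!: D.finsum_cong')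

lemma psi_mult: "y \<in> carrier D ==> psi x \<otimes> y = (\<Oplus>q\<in>V.B. x q \<odot> ((case q of (i, k, j) \<Rightarrow> mono i k j) \<otimes> y))"
 unfolding psi_def
 by (subst D.finsum_ldistr[OF V.finite_B])
  (auto simp: D.smult_closed D.smult_mult_l split: prod.splits intro!: D.finsum_cong')

lemma a_mono: "a \<otimes> mono i k j = mono (Suc i) k j"
 unfolding mono_def using a_pow_Suc[of i] by (simp add: D.m_assoc[symmetric] del: D.nat_pow_Suc)

lemma g_mono: "g \<otimes> mono i k j = mono i (Suc k) j"
proof -
 have "g \<otimes> mono i k j = (g \<otimes> a [^] i) \<otimes> (g [^] k \<otimes> b [^] j)" by (simp add: mono_def D.m_assoc)
 also have "\<dots> = a [^] i \<otimes> ((g \<otimes> g [^] k) \<otimes> b [^] j)" unfolding g_pow_a by (simp add: D.m_assoc)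
 finally show ?thesis using D.nat_pow_Suc2[of g k] by (simp add: mono_def del: D.nat_pow_Suc)
qed

lemma b_mono: "b \<otimes> mono i k j = mono i k (Suc j) \<oplus> V.cf i k \<odot> mono (Suc i) k j"
proof -
 let ?i = "a [^] i" and ?k = "g [^] k" and ?j = "b [^] j"
 have "b \<otimes> mono i k j = (b \<otimes> ?i) \<otimes> (?k \<otimes> ?j)" by (simp add: mono_def D.m_assoc)
 also have "\<dots> = ?i \<otimes> ((b \<otimes> ?k) \<otimes> ?j) \<oplus> (of_nat i * (1/2)) \<odot> mono (Suc i) k j"
  unfolding b_pow_a by (simp add: D.l_distr D.smult_closed D.smult_mult_l D.m_assoc mono_def del: D.nat_pow_Suc)
 also have "?i \<otimes> ((b \<otimes> ?k) \<otimes> ?j) = ?i \<otimes> (?k \<otimes> (b \<otimes> ?j)) \<oplus> of_nat k \<odot> ((?i \<otimes> a) \<otimes> (?k \<otimes> ?j))"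
  unfolding b_pow_g by (simp add: D.l_distr D.r_distr D.smult_closed D.smult_mult_l D.smult_mult_r D.m_assoc)
 also have "b \<otimes> ?j = b [^] Suc j" using D.nat_pow_Suc2[of b j] by simp
 also have "?i \<otimes> a = a [^] Suc i" by simp
 finally show ?thesis
  by (simp add: mono_def V.cf_def D.smult_l_distr D.smult_closed D.a_assoc del: D.nat_pow_Suc)
qed

lemma psi_La: "psi (V.La x) = a \<otimes> psi x"
 unfolding V.La_def psi_ext mult_psi[OF cl(1)] by (intro D.finsum_cong') (auto simp: psi_mon a_mono D.smult_closed)
lemma psi_Lg: "psi (V.Lg x) = g \<otimes> psi x"
 unfolding V.Lg_def psi_ext mult_psi[OF cl(2)] by (intro D.finsum_cong') (auto simp: psi_mon g_mono D.smult_closed)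
lemma psi_Lb: "psi (V.Lb x) = b \<otimes> psi x"
 unfolding V.Lb_def psi_ext mult_psi[OF cl(3)]
 by (intro D.finsum_cong') (auto simp: psi_mon psi_add psi_sc b_mono D.smult_closed simp del: plus_fun_apply)

lemma psi_T: "psi (V.T i k j y) = mono i k j \<otimes> psi y"
proof -
 have "psi ((V.La ^^ n) x) = a [^] n \<otimes> psi x" "psi ((V.Lg ^^ n) x) = g [^] n \<otimes> psi x" "psi ((V.Lb ^^ n) x) = b [^] n \<otimes> psi x" for n x
  by (induct n) (simp_all add: psi_La psi_Lg psi_Lb D.m_assoc[symmetric] D.nat_pow_Suc2[symmetric] del: D.nat_pow_Suc)
 then show ?thesis by (simp add: V.T_def mono_def D.m_assoc)
qed

text \<open>\<open>psi\<close> intertwines \<open>La\<close>, \<open>Lg\<close>, \<open>Lb\<close>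
  with left multiplications by the generators, and \<open>Op\<close> is built from these
  operators.\<close>

lemma psi_Op: "psi (V.Op x y) = psi x \<otimes> psi y"
 unfolding V.Op_def psi_ext psi_mult[OF psi_closed] by (intro D.finsum_cong') (auto simp: psi_T D.smult_closed)

lemma psi_gens: "psi (V.mon 0 0 0) = \<one>" "psi (V.mon 1 0 0) = a" "psi (V.mon 0 1 0) = g" "psi (V.mon 0 0 1) = b"
 by (simp_all add: psi_mon mono_def)

end

context pbw_field
begin

definition VA :: "('k, nat \<times> nat \<times> nat \<Rightarrow> 'k) module" where
 "VA = \<lparr>carrier = V.U, mult = V.Op, one = V.mon 0 0 0, zero = 0, add = (+), smult = sc\<rparr>"

lemma VA_sel [simp]: "carrier VA = V.U" "x \<otimes>\<^sub>VA y = V.Op x y" "\<one>\<^sub>VA = V.mon 0 0 0" "\<zero>\<^sub>VA = 0"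
 "x \<oplus>\<^sub>VA y = x + y" "c \<odot>\<^sub>VA x = sc c x"
 by (simp_all add: VA_def)

lemma assoc_algebra_VA: "assoc_algebra VA"
proof -
 have "abelian_group VA"
 proof (rule abelian_groupI)
  fix x assume "x \<in> carrier VA"
  then show "\<exists>y\<in>carrier VA. y \<oplus>\<^sub>VA x = \<zero>\<^sub>VA"
   by (intro bexI[of _ "sc (-1) x"]) (auto simp: V.U_def sc_def fun_eq_iff)
 qed (simp_all add: V.U_add V.U_zero add_ac del: plus_fun_apply)
 moreover have "Group.monoid VA"
  by (rule monoidI) (simp_all add: V.Op_assoc V.Op_one_left V.Op_one_right)
 ultimately have "Ring.ring VA"
  by (rule ringI) (simp_all add: lin_add[OF V.lin_Op1] lin_add[OF V.lin_Op2] del: plus_fun_apply)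
 then show ?thesis
  unfolding assoc_algebra_def assoc_algebra_axioms_def
  by (intro conjI) (simp_all add: V.U_sc vec.scale_left_distrib vec.scale_right_distrib lin_scale[OF V.lin_Op1] lin_scale[OF V.lin_Op2] del: plus_fun_apply)
qed

sublocale VA: assoc_algebra VA by (rule assoc_algebra_VA)

lemma VA_pow: "V.mon 1 0 0 [^]\<^sub>VA n = V.mon n 0 0" "V.mon 0 0 1 [^]\<^sub>VA n = V.mon 0 0 n" for n :: nat
 by (induct n) (simp_all add: V.Op_mon V.T_def V.La_pow_mon V.Lb_pow_mon0 del: V.Lb_mon)

lemma VA_rels: "V.mon 1 0 0 [^]\<^sub>VA p = \<zero>\<^sub>VA" "V.mon 0 0 1 [^]\<^sub>VA p = \<zero>\<^sub>VA"
 "V.mon 0 0 1 \<otimes>\<^sub>VA V.mon 1 0 0 = V.mon 1 0 0 \<otimes>\<^sub>VA V.mon 0 0 1 \<oplus>\<^sub>VA (1/2) \<odot>\<^sub>VA (V.mon 1 0 0 \<otimes>\<^sub>VA V.mon 1 0 0)"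
 unfolding VA_pow using V.mon_shift[of 0 1 0 0 0 0] V.mon_shift[of 0 0 0 0 0 1]
 by (simp_all add: V.Op_mon V.T_def V.cf_def)

end

section \<open>The presented algebra \<open>A\<close> and its universal property\<close>

definition words :: "letter list monoid" where
 "words = \<lparr>carrier = UNIV, mult = (@), one = []\<rparr>"

lemma words_sel [simp]: "carrier words = UNIV" "x \<otimes>\<^sub>words y = x @ y" "\<one>\<^sub>words = []"
 by (simp_all add: words_def)

lemma monoid_words: "monoid words"
 by (rule monoidI) auto

locale presented = pbw_field p ty for p and ty :: "'k::field itself"
begin

abbreviation FR where "FR \<equiv> free_algebra :: ('k, letter list \<Rightarrow> 'k) module"
abbreviation AA where "AA \<equiv> alg_A p :: ('k, 'k presented) module"
abbreviation ea where "ea \<equiv> gen_a p :: 'k presented"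
abbreviation eb where "eb \<equiv> gen_b p :: 'k presented"

lemma FR_eq: "FR = monoid_algebra words"
 by (simp add: free_algebra_def words_def)

sublocale FR: assoc_algebra FR
 unfolding FR_eq by (rule assoc_algebra_monoid_algebra[OF monoid_words])

definition rel_gens :: "(letter list \<Rightarrow> 'k) set" where
 "rel_gens = {basis_elt (replicate p La), basis_elt (replicate p Lb),
   (\<lambda>w. basis_elt [Lb, La] w - basis_elt [La, Lb] w - (1 / 2) * basis_elt [La, La] w)}"

lemma wd_closed [simp]: "basis_elt w \<in> carrier FR"
 unfolding FR_eq by (rule basis_elt_closed) simp

lemma wd_mult: "basis_elt u \<otimes>\<^sub>FR basis_elt v = basis_elt (u @ v)"
 unfolding FR_eq basis_elt_mult by simp

lemma rel3: "(\<lambda>w. basis_elt [Lb, La] w - basis_elt [La, Lb] w - (1 / 2) * basis_elt [La, La] w)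
  = basis_elt [Lb, La] \<ominus>\<^sub>FR (basis_elt [La, Lb] \<oplus>\<^sub>FR (1/2) \<odot>\<^sub>FR basis_elt [La, La])"
proof -
 have 1: "basis_elt [La, Lb] \<oplus>\<^sub>FR (1/2) \<odot>\<^sub>FR basis_elt [La, La] \<in> carrier FR"
  by (intro FR.a_closed FR.smult_closed wd_closed)
 show ?thesis
  using monoid_algebra_minus[OF monoid_words wd_closed[unfolded FR_eq] 1[unfolded FR_eq]]
  by (simp add: FR_eq fun_eq_iff)
qed

lemma rel_gens_closed: "rel_gens \<subseteq> carrier FR"
 unfolding rel_gens_def rel3 by (auto intro!: FR.minus_closed FR.a_closed FR.smult_closed)

lemma rel_ideal_eq: "rel_ideal p = Idl\<^bsub>FR\<^esub> rel_gens"
 by (simp add: rel_ideal_def rel_gens_def)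

sublocale AI: algebra_ideal FR "rel_ideal p"
 by (intro algebra_ideal.intro FR.assoc_algebra_self) (simp add: rel_ideal_eq FR.genideal_ideal[OF rel_gens_closed])

lemma AA_eq: "AA = quot_algebra FR (rel_ideal p)"
 by (simp add: alg_A_def)

sublocale A: assoc_algebra AA
 unfolding AA_eq by (rule AI.assoc_algebra_quot)

definition wc :: "letter list \<Rightarrow> 'k presented" where
 "wc w = rel_ideal p +>\<^bsub>FR\<^esub> basis_elt w"

lemma wc_closed [simp]: "wc w \<in> carrier AA"
 unfolding wc_def AA_eq by (intro AI.coset_closed wd_closed)

lemma wc_mult: "wc u \<otimes>\<^sub>AA wc v = wc (u @ v)"
 unfolding wc_def AA_eq by (simp add: AI.coset_mult wd_mult)

lemma wc_gen: "ea = wc [La]" "eb = wc [Lb]" "\<one>\<^sub>AA = wc []"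
 by (simp_all add: gen_a_def gen_b_def wc_def AA_eq AI.quot_sel, simp add: FR_eq)

lemma gen_closed [simp]: "ea \<in> carrier AA" "eb \<in> carrier AA"
 by (simp_all add: wc_gen)

lemma wc_pow: "wc [l] [^]\<^sub>AA n = wc (replicate n l)"
 by (induct n) (simp_all add: wc_gen wc_mult replicate_append_same)

lemma mem_zero: "x \<in> rel_gens ==> rel_ideal p +>\<^bsub>FR\<^esub> x = \<zero>\<^sub>AA"
proof -
 assume x: "x \<in> rel_gens"
 then have xi: "x \<in> rel_ideal p" and xc: "x \<in> carrier FR"
  using FR.genideal_self[OF rel_gens_closed] rel_gens_closed by (auto simp: rel_ideal_eq)
 have "rel_ideal p +>\<^bsub>FR\<^esub> x = rel_ideal p +>\<^bsub>FR\<^esub> \<zero>\<^sub>FR"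
  using xi xc by (intro AI.coset_eqI) (auto simp: FR.minus_eq)
 then show ?thesis
  unfolding AA_eq AI.quot_sel using FR.a_coset_add_zero[OF AI.I.a_subset] by simp
qed

lemma A_rels: "ea [^]\<^sub>AA p = \<zero>\<^sub>AA" "eb [^]\<^sub>AA p = \<zero>\<^sub>AA"
 "eb \<otimes>\<^sub>AA ea = ea \<otimes>\<^sub>AA eb \<oplus>\<^sub>AA (1/2) \<odot>\<^sub>AA (ea \<otimes>\<^sub>AA ea)"
proof -
 show "ea [^]\<^sub>AA p = \<zero>\<^sub>AA" "eb [^]\<^sub>AA p = \<zero>\<^sub>AA"
  unfolding wc_gen wc_pow unfolding wc_def by (rule mem_zero, simp add: rel_gens_def)+
 let ?r = "basis_elt [Lb, La] \<ominus>\<^sub>FR (basis_elt [La, Lb] \<oplus>\<^sub>FR (1/2) \<odot>\<^sub>FR basis_elt [La, La]) :: letter list \<Rightarrow> 'k"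
 have "?r \<in> rel_gens" unfolding rel_gens_def rel3 by simp
 then have "?r \<in> rel_ideal p" using FR.genideal_self[OF rel_gens_closed] by (auto simp: rel_ideal_eq)
 then have "wc [Lb, La] = rel_ideal p +>\<^bsub>FR\<^esub> (basis_elt [La, Lb] \<oplus>\<^sub>FR (1/2) \<odot>\<^sub>FR basis_elt [La, La])"
  unfolding wc_def by (intro AI.coset_eqI FR.a_closed FR.smult_closed wd_closed)
 also have "\<dots> = wc [La, Lb] \<oplus>\<^sub>AA (1/2) \<odot>\<^sub>AA wc [La, La]"
  unfolding wc_def AA_eq by (simp add: AI.coset_add AI.coset_smult FR.smult_closed)
 finally show "eb \<otimes>\<^sub>AA ea = ea \<otimes>\<^sub>AA eb \<oplus>\<^sub>AA (1/2) \<odot>\<^sub>AA (ea \<otimes>\<^sub>AA ea)"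
  by (simp add: wc_gen wc_mult)
qed

text \<open>Words span \<open>A\<close>, and every word arises from the empty one by prefixing
  letters. Left multiplications are chosen because the model is described by left multiplication
  operators.\<close>

lemma A_induct [consumes 1, case_names one add smult a b]:
 assumes "x \<in> carrier AA" and one: "P \<one>\<^sub>AA"
  and add: "\<And>x y. x \<in> carrier AA ==> y \<in> carrier AA ==> P x ==> P y ==> P (x \<oplus>\<^sub>AA y)"
  and smult: "\<And>c x. x \<in> carrier AA ==> P x ==> P (c \<odot>\<^sub>AA x)"
  and a: "\<And>x. x \<in> carrier AA ==> P x ==> P (ea \<otimes>\<^sub>AA x)"
  and b: "\<And>x. x \<in> carrier AA ==> P x ==> P (eb \<otimes>\<^sub>AA x)"
 shows "P x"
proof -
 obtain f where f: "f \<in> carrier FR" "x = rel_ideal p +>\<^bsub>FR\<^esub> f"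
  using AI.quot_elem assms(1) unfolding AA_eq by blast
 have "P (rel_ideal p +>\<^bsub>FR\<^esub> f)"
  using f(1) unfolding FR_eq
 proof (induct f rule: monoid_algebra_induct)
  case zero
  have "P (0 \<odot>\<^sub>AA \<one>\<^sub>AA)" by (rule smult[OF _ one]) simp
  moreover have "rel_ideal p +>\<^bsub>FR\<^esub> \<zero>\<^sub>FR = \<zero>\<^sub>AA"
   unfolding AA_eq AI.quot_sel using FR.a_coset_add_zero[OF AI.I.a_subset] by simp
  ultimately show ?case by (simp add: FR_eq)
 next
  case (add f g)
  then show ?case
   using assms(3)[OF AI.coset_closed[of f, folded AA_eq] AI.coset_closed[of g, folded AA_eq]] AI.coset_add[of f g, folded AA_eq]
   unfolding FR_eq by simp
 next
  case (smult c f)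
  have fc: "f \<in> carrier FR" using smult(1) by (simp only: FR_eq)
  have "P (c \<odot>\<^sub>AA (rel_ideal p +>\<^bsub>FR\<^esub> f))"
   by (rule assms(4)[OF AI.coset_closed[OF fc, folded AA_eq]]) (use smult(2) in \<open>simp only: FR_eq\<close>)
  also have "c \<odot>\<^sub>AA (rel_ideal p +>\<^bsub>FR\<^esub> f) = rel_ideal p +>\<^bsub>FR\<^esub> (c \<odot>\<^sub>FR f)"
   by (rule AI.coset_smult[OF fc, folded AA_eq])
  finally show ?case by (simp add: FR_eq)
 next
  case (basis w)
  have "P (wc w)"
  proof (induct w)
   case Nil
   then show ?case using one by (simp add: wc_gen)
  next
   case (Cons l w)
   have "wc (l # w) = wc [l] \<otimes>\<^sub>AA wc w" by (simp add: wc_mult)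
   then show ?case using a[of "wc w"] b[of "wc w"] Cons by (cases l) (simp_all add: wc_gen)
  qed
  then show ?case by (simp add: wc_def FR_eq)
 qed
 then show ?thesis by (simp add: f)
qed

text \<open>The letters extend to the free algebra by \<open>mext\<close>. The kernel is an ideal
  containing the three generating relations, hence all of \<open>rel_ideal p\<close>.\<close>

lemma A_universal:
 fixes D :: "('k, 'd) module"
 assumes D: "assoc_algebra D" and cl: "a' \<in> carrier D" "b' \<in> carrier D"
  and r: "a' [^]\<^sub>D p = \<zero>\<^sub>D" "b' [^]\<^sub>D p = \<zero>\<^sub>D"
   "b' \<otimes>\<^sub>D a' = a' \<otimes>\<^sub>D b' \<oplus>\<^sub>D (1/2) \<odot>\<^sub>D (a' \<otimes>\<^sub>D a')"
 shows "\<exists>\<phi>\<in>algebra_hom AA D. \<phi> ea = a' \<and> \<phi> eb = b'"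
proof -
 interpret D: assoc_algebra D by fact
 define F where "F = (\<lambda>w. foldr (\<lambda>l x. (case l of La \<Rightarrow> a' | Lb \<Rightarrow> b') \<otimes>\<^sub>D x) w \<one>\<^sub>D)"
 have Fc: "F w \<in> carrier D" for w by (induct w) (auto simp: F_def cl split: letter.split)
 have F: "F \<in> carrier words \<rightarrow> carrier D" using Fc by auto
 have Fm: "F (u @ v) = F u \<otimes>\<^sub>D F v" for u v
 proof (induct u)
  case Nil
  then show ?case using Fc[of v] by (simp add: F_def)
 next
  case (Cons l u)
  then show ?case using Fc[of u] Fc[of v] cl by (auto simp: F_def D.m_assoc split: letter.split)
 qed
 have F1: "F [La] = a'" "F [Lb] = b'" using cl by (simp_all add: F_def)
 have Fp: "F (replicate n l) = F [l] [^]\<^sub>D n" for l n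
 proof (induct n)
  case (Suc n)
  then show ?case using Fm[of "replicate n l" "[l]"] by (simp add: replicate_append_same)
 qed (simp add: F_def)
 let ?h = "mext D F"
 have hb: "?h (basis_elt w) = F w" for w by (rule D.mext_basis[of F w, OF Fc])
 have h: "?h \<in> algebra_hom FR D"
  unfolding FR_eq
 proof (rule algebra_homI[OF D.mext_linear[OF F]])
  show "?h (s \<otimes>\<^bsub>monoid_algebra words\<^esub> t) = ?h s \<otimes>\<^sub>D ?h t"
   if "s \<in> carrier (monoid_algebra words)" "t \<in> carrier (monoid_algebra words)" for s t
   by (rule D.mext_mult[OF monoid_words F _ that]) (simp add: Fm)
  show "?h \<one>\<^bsub>monoid_algebra words\<^esub> = \<one>\<^sub>D" using hb[of "[]"] by (simp add: F_def)
 qed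
 interpret hr: ring_hom_ring FR D ?h
  using h by (intro ring_hom_ringI2 FR.ring_axioms D.ring_axioms) (simp add: algebra_hom_def)
 have "rel_gens \<subseteq> a_kernel FR D ?h"
 proof
  fix x assume x: "x \<in> rel_gens"
  then consider "x = basis_elt (replicate p La)" | "x = basis_elt (replicate p Lb)"
   | "x = basis_elt [Lb, La] \<ominus>\<^sub>FR (basis_elt [La, Lb] \<oplus>\<^sub>FR (1/2) \<odot>\<^sub>FR basis_elt [La, La])"
   unfolding rel_gens_def rel3 by blast
  then have "?h x = \<zero>\<^sub>D"
  proof cases
   case 3
   have "F [Lb, La] = b' \<otimes>\<^sub>D a'" "F [La, Lb] = a' \<otimes>\<^sub>D b'" "F [La, La] = a' \<otimes>\<^sub>D a'"
    using cl by (simp_all add: F_def)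
   then show ?thesis unfolding 3
    using cl r(3)
    by (simp add: linear_maps_minus[OF FR.assoc_algebra_self D algebra_homD(1)[OF h]] algebra_homD[OF h] hb FR.smult_closed D.minus_eq D.r_neg D.smult_closed)
  qed (simp_all add: hb Fp F1 r)
  moreover have "x \<in> carrier FR" using x rel_gens_closed by blast
  ultimately show "x \<in> a_kernel FR D ?h" unfolding a_kernel_def' by blast
 qed
 then have "rel_ideal p \<subseteq> a_kernel FR D ?h"
  unfolding rel_ideal_eq by (intro FR.genideal_minimal hr.kernel_is_ideal)
 then have k: "\<And>i. i \<in> rel_ideal p ==> ?h i = \<zero>\<^sub>D" unfolding a_kernel_def' by blast
 let ?\<phi> = "\<lambda>X. the_elem (?h ` X)"
 have "?\<phi> \<in> algebra_hom AA D" unfolding AA_eq by (rule AI.quot_lift_hom[OF D h k])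
 moreover have "?\<phi> (wc w) = F w" for w
  unfolding wc_def using AI.the_elem_coset[OF D algebra_homD(1)[OF h] k wd_closed] by (simp add: hb)
 ultimately have "?\<phi> \<in> algebra_hom AA D \<and> ?\<phi> ea = a' \<and> ?\<phi> eb = b'" using F1 by (simp add: wc_gen)
 then show ?thesis by (rule_tac x = ?\<phi> in bexI) simp_all
qed

end

section \<open>The skew group algebra \<open>H\<close>: monomial basis and universal
  property\<close>

locale skew_setup = presented p ty + G: group G
 for p and ty :: "'k::field itself" and G :: "('g, 'c) monoid_scheme" +
 fixes gg :: 'g and act :: "'k presented \<Rightarrow> 'g \<Rightarrow> 'k presented"
 assumes order_G: "order G = p" and gg [simp]: "gg \<in> carrier G" and gen_G: "generate G {gg} = carrier G"
  and act: "right_action G (alg_A p) act"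
  and act_a: "act (gen_a p) gg = gen_a p" and act_b: "act (gen_b p) gg = gen_a p \<oplus>\<^bsub>alg_A p\<^esub> gen_b p"
begin

abbreviation la where "la \<equiv> left_of_right G act"

lemma finite_G: "finite (carrier G)"
 using order_G V.p0 by (simp add: order_def card_ge_0_finite)

lemma actD:
 "h \<in> carrier G ==> (\<lambda>x. act x h) \<in> algebra_hom AA AA"
 "x \<in> carrier AA ==> act x \<one>\<^sub>G = x"
 "x \<in> carrier AA ==> h \<in> carrier G ==> h' \<in> carrier G ==> act x (h \<otimes>\<^sub>G h') = act (act x h) h'"
 using act by (auto simp: right_action_def)

sublocale skew_data AA G la
proof unfold_locales
 fix h assume h: "h \<in> carrier G"
 then show "la h \<in> algebra_hom AA AA" using actD(1)[of "inv\<^bsub>G\<^esub> h"] by (simp add: left_of_right_def[abs_def])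
 fix h' x assume "x \<in> carrier AA" "h' \<in> carrier G"
 then show "la (h \<otimes>\<^sub>G h') x = la h (la h' x)" using h by (simp add: left_of_right_def G.inv_mult_group actD(3))
qed (auto simp: finite_G left_of_right_def actD(2))

sublocale H: assoc_algebra H by (rule assoc_algebra_H)

lemma la_a: "la gg ea = ea"
proof -
 have "la gg (act ea gg) = ea"
  using actD(3)[of ea gg "inv\<^bsub>G\<^esub> gg"] actD(2)[of ea] by (simp add: left_of_right_def)
 then show ?thesis by (simp add: act_a)
qed

text \<open>The left action of \<open>g\<close> undoes the right one: applied to
  \<open>act b g = a + b\<close> it gives back \<open>b\<close>.\<close>

lemma la_b: "la gg eb = eb \<ominus>\<^sub>AA ea"
proof -
 have "la gg (act eb gg) = eb"
  using actD(3)[of eb gg "inv\<^bsub>G\<^esub> gg"] actD(2)[of eb] by (simp add: left_of_right_def)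
 then have 1: "ea \<oplus>\<^sub>AA la gg eb = eb" by (simp add: act_b lact_simps la_a)
 have c: "la gg eb \<in> carrier AA" by (simp add: lact_simps)
 have "eb \<ominus>\<^sub>AA ea = (la gg eb \<oplus>\<^sub>AA ea) \<ominus>\<^sub>AA ea" using 1 c by (simp add: A.a_comm)
 also have "\<dots> = la gg eb" using c by (simp add: A.minus_eq A.a_assoc A.r_neg)
 finally show ?thesis by simp
qed

lemma gg_pow_p: "gg [^]\<^sub>G p = \<one>\<^sub>G"
 using G.pow_order_eq_1[OF gg] by (simp add: order_G)

lemma G_elem: "h \<in> carrier G ==> \<exists>k::nat. h = gg [^]\<^sub>G k"
proof -
 have "G.ord gg \<noteq> 0" using G.ord_ge_1[OF finite_G gg] by simp
 then have "generate G {gg} = {gg [^]\<^sub>G k |k. k \<in> (UNIV::nat set)}" by (rule G.generate_pow_nat[OF gg])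
 then show "h \<in> carrier G ==> \<exists>k::nat. h = gg [^]\<^sub>G k" unfolding gen_G by auto
qed

abbreviation aH where "aH \<equiv> skew_elt AA ea \<one>\<^sub>G"
abbreviation bH where "bH \<equiv> skew_elt AA eb \<one>\<^sub>G"
abbreviation gH where "gH \<equiv> skew_elt AA \<one>\<^sub>AA gg"

lemma gens_H [simp]: "aH \<in> carrier H" "bH \<in> carrier H" "gH \<in> carrier H"
 by (auto intro: skew_elt_closed)

lemma skew_pow: "x \<in> carrier AA ==> skew_elt AA x \<one>\<^sub>G [^]\<^sub>H (n::nat) = skew_elt AA (x [^]\<^sub>AA n) \<one>\<^sub>G"
 by (induct n) (simp_all add: H_sel skew_elt_mult lact_one)

lemma gH_pow: "gH [^]\<^sub>H (n::nat) = skew_elt AA \<one>\<^sub>AA (gg [^]\<^sub>G n)"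
 by (induct n) (simp_all add: H_sel skew_elt_mult lact_simps)

lemma skew_elt_zero: "skew_elt AA \<zero>\<^sub>AA h = \<zero>\<^sub>H"
 by (auto simp: skew_elt_def H_sel)

lemma skew_elt_add: "x \<in> carrier AA ==> y \<in> carrier AA ==> skew_elt AA (x \<oplus>\<^sub>AA y) h = skew_elt AA x h \<oplus>\<^sub>H skew_elt AA y h"
 by (simp add: skew_elt_def H_sel fun_eq_iff)

lemma skew_elt_smult: "x \<in> carrier AA ==> skew_elt AA (c \<odot>\<^sub>AA x) h = c \<odot>\<^sub>H skew_elt AA x h"
 by (simp add: skew_elt_def H_sel fun_eq_iff)

sublocale Hr: pbw_rels p ty H aH gH bH
proof unfold_locales
 show "aH [^]\<^sub>H p = \<zero>\<^sub>H" "bH [^]\<^sub>H p = \<zero>\<^sub>H"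
  by (simp_all add: skew_pow A_rels skew_elt_zero)
 show "gH [^]\<^sub>H p = \<one>\<^sub>H" by (simp add: gH_pow gg_pow_p H_sel)
 show "gH \<otimes>\<^sub>H aH = aH \<otimes>\<^sub>H gH" by (simp add: skew_elt_mult la_a lact_one)
 show "bH \<otimes>\<^sub>H aH = aH \<otimes>\<^sub>H bH \<oplus>\<^sub>H (1/2) \<odot>\<^sub>H (aH \<otimes>\<^sub>H aH)"
  by (simp add: skew_elt_mult lact_one A_rels skew_elt_add skew_elt_smult A.smult_closed)
 \<comment> \<open>In \<open>H\<close> one has \<open>g b = la(b) g\<close>, so this identity
   becomes \<open>g b + a g = b g\<close>.\<close>
 have "la gg eb \<oplus>\<^sub>AA ea = eb" by (simp add: la_b A.minus_eq A.a_assoc A.l_neg)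
 then show "bH \<otimes>\<^sub>H gH = gH \<otimes>\<^sub>H bH \<oplus>\<^sub>H aH \<otimes>\<^sub>H gH"
  by (simp add: skew_elt_mult lact_one skew_elt_add[symmetric] lact_simps)
qed auto

text \<open>Everything is reached from 1 by left multiplications and linear combinations: powers of
  \<open>g\<close> first, then coefficients from \<open>A\<close>, then sums over the support in
  \<open>G\<close>.\<close>

lemma H_induct [consumes 1, case_names one add smult a g b]:
 assumes "f \<in> carrier H" and one: "P \<one>\<^sub>H"
  and add: "\<And>x y. x \<in> carrier H ==> y \<in> carrier H ==> P x ==> P y ==> P (x \<oplus>\<^sub>H y)"
  and smult: "\<And>c x. x \<in> carrier H ==> P x ==> P (c \<odot>\<^sub>H x)"
  and a: "\<And>x. x \<in> carrier H ==> P x ==> P (aH \<otimes>\<^sub>H x)"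
  and g: "\<And>x. x \<in> carrier H ==> P x ==> P (gH \<otimes>\<^sub>H x)"
  and b: "\<And>x. x \<in> carrier H ==> P x ==> P (bH \<otimes>\<^sub>H x)"
 shows "P f"
proof -
 have zero: "P \<zero>\<^sub>H" using smult[OF H.one_closed one, of 0] by simp
 have pw: "P (skew_elt AA \<one>\<^sub>AA (gg [^]\<^sub>G n))" for n :: nat
 proof (induct n)
  case 0
  then show ?case using one by (simp add: H_sel)
 next
  case (Suc n)
  have "gH \<otimes>\<^sub>H skew_elt AA \<one>\<^sub>AA (gg [^]\<^sub>G n) = skew_elt AA \<one>\<^sub>AA (gg [^]\<^sub>G Suc n)"
   by (simp add: skew_elt_mult lact_simps G.nat_pow_Suc2[symmetric] del: G.nat_pow_Suc)
  then show ?case using g[OF _ Suc] by (simp add: skew_elt_closed del: G.nat_pow_Suc)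
 qed
 have se: "P (skew_elt AA x h)" if x: "x \<in> carrier AA" and h: "h \<in> carrier G" for x h
  using x
 proof (induct x rule: A_induct)
  case one
  then show ?case using G_elem[OF h] pw by auto
 next
  case (add x y)
  then show ?case using h by (simp add: skew_elt_add skew_elt_closed assms(3))
 next
  case (smult c x)
  then show ?case using h by (simp add: skew_elt_smult skew_elt_closed assms(4))
 next
  case (a x)
  have "aH \<otimes>\<^sub>H skew_elt AA x h = skew_elt AA (ea \<otimes>\<^sub>AA x) h" using a h by (simp add: skew_elt_mult lact_one)
  then show ?case using assms(5)[OF _ a(2)] a h by (simp add: skew_elt_closed)
 next
  case (b x)
  have "bH \<otimes>\<^sub>H skew_elt AA x h = skew_elt AA (eb \<otimes>\<^sub>AA x) h" using b h by (simp add: skew_elt_mult lact_one)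
  then show ?case using assms(7)[OF _ b(2)] b h by (simp add: skew_elt_closed)
 qed
 have "f \<in> carrier H \<longrightarrow> {h. f h \<noteq> \<zero>\<^sub>AA} \<subseteq> S \<longrightarrow> P f" if "finite S" "S \<subseteq> carrier G" for S f
  using that
 proof (induct S arbitrary: f rule: finite_induct)
  case empty
  show ?case
  proof (intro impI)
   assume "{h. f h \<noteq> \<zero>\<^sub>AA} \<subseteq> {}"
   then have "f = \<zero>\<^sub>H" by (auto simp: H_sel)
   then show "P f" using zero by simp
  qed
 next
  case (insert h S)
  show ?case
  proof (intro impI)
   assume f: "f \<in> carrier H" and s: "{u. f u \<noteq> \<zero>\<^sub>AA} \<subseteq> insert h S"
   let ?f = "f(h := \<zero>\<^sub>AA)"
   have fc: "?f \<in> carrier H" using f insert(4) by (intro H_memI) (auto simp: H_closed H_out)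
   have "{u. ?f u \<noteq> \<zero>\<^sub>AA} \<subseteq> S"
   proof
    fix u assume "u \<in> {u. ?f u \<noteq> \<zero>\<^sub>AA}"
    then have "u \<noteq> h" "f u \<noteq> \<zero>\<^sub>AA" by (auto split: if_splits)
    then show "u \<in> S" using s by blast
   qed
   then have "P ?f" using insert(3)[of ?f] fc insert(4) by blast
   moreover have "P (skew_elt AA (f h) h)" using se[OF H_closed[OF f]] insert(4) by auto
   moreover have "skew_elt AA (f h) h \<oplus>\<^sub>H ?f = f" using H_closed[OF f] by (simp add: H_sel skew_elt_def fun_eq_iff)
   moreover have "h \<in> carrier G" using insert(4) by blast
   ultimately show "P f" using add[OF skew_elt_closed[OF H_closed[OF f]] fc, of h h] by metis
  qed
 qed
 from this[OF finite_G subset_refl, of f] show ?thesis using assms(1) by (auto simp: carrier_H)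
qed

lemma psi_surj: "f \<in> carrier H ==> \<exists>x\<in>V.U. Hr.psi x = f"
proof (induct f rule: H_induct)
 case one
 show ?case by (intro bexI[of _ "V.mon 0 0 0"] Hr.psi_gens V.mon_U)
next
 case (add f f')
 then obtain x y where "x \<in> V.U" "y \<in> V.U" "Hr.psi x = f" "Hr.psi y = f'" by blast
 then show ?case by (intro bexI[of _ "x + y"]) (auto simp: Hr.psi_add V.U_add simp del: plus_fun_apply)
next
 case (smult c f)
 then obtain x where "x \<in> V.U" "Hr.psi x = f" by blast
 then show ?case by (intro bexI[of _ "sc c x"]) (auto simp: Hr.psi_sc V.U_sc)
next
 case (a f)
 then obtain x where "x \<in> V.U" "Hr.psi x = f" by blast
 then show ?case by (intro bexI[of _ "V.La x"]) (auto simp: Hr.psi_La)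
next
 case (g f)
 then obtain x where "x \<in> V.U" "Hr.psi x = f" by blast
 then show ?case by (intro bexI[of _ "V.Lg x"]) (auto simp: Hr.psi_Lg)
next
 case (b f)
 then obtain x where "x \<in> V.U" "Hr.psi x = f" by blast
 then show ?case by (intro bexI[of _ "V.Lb x"]) (auto simp: Hr.psi_Lb)
qed

definition phiA :: "'k presented \<Rightarrow> nat \<times> nat \<times> nat \<Rightarrow> 'k" where
 "phiA = (SOME \<phi>. \<phi> \<in> algebra_hom AA VA \<and> \<phi> ea = V.mon 1 0 0 \<and> \<phi> eb = V.mon 0 0 1)"

lemma phiA: "phiA \<in> algebra_hom AA VA" "phiA ea = V.mon 1 0 0" "phiA eb = V.mon 0 0 1"
proof -
 have "\<exists>\<phi>. \<phi> \<in> algebra_hom AA VA \<and> \<phi> ea = V.mon 1 0 0 \<and> \<phi> eb = V.mon 0 0 1"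
  using A_universal[OF assoc_algebra_VA _ _ VA_rels] by auto
 from someI_ex[OF this] show "phiA \<in> algebra_hom AA VA" "phiA ea = V.mon 1 0 0" "phiA eb = V.mon 0 0 1"
  unfolding phiA_def by blast+
qed

lemma phiA_simps: "x \<in> carrier AA ==> phiA x \<in> V.U" "x \<in> carrier AA ==> y \<in> carrier AA ==> phiA (x \<oplus>\<^sub>AA y) = phiA x + phiA y"
 "x \<in> carrier AA ==> phiA (c \<odot>\<^sub>AA x) = sc c (phiA x)"
 "x \<in> carrier AA ==> y \<in> carrier AA ==> phiA (x \<otimes>\<^sub>AA y) = V.Op (phiA x) (phiA y)" "phiA \<one>\<^sub>AA = V.mon 0 0 0"
 using algebra_homD[OF phiA(1)] by (simp_all del: plus_fun_apply)

text \<open>The inverse of \<open>psi\<close>: an element of \<open>H\<close> is the sum of the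
  \<open>f(g^k) g^k\<close>, and \<open>phiA\<close> carries the coefficients from \<open>A\<close>
  to the model.\<close>

definition lam :: "('g \<Rightarrow> 'k presented) \<Rightarrow> nat \<times> nat \<times> nat \<Rightarrow> 'k" where
 "lam f = (\<Sum>k<p. V.Op (phiA (f (gg [^]\<^sub>G k))) (V.mon 0 k 0))"

lemma Op_mon_left: "y \<in> V.U ==> V.Op (V.mon 1 0 0) y = V.La y" "y \<in> V.U ==> V.Op (V.mon 0 1 0) y = V.Lg y" "y \<in> V.U ==> V.Op (V.mon 0 0 1) y = V.Lb y"
 by (simp_all add: V.Op_mon V.T_def)

lemma lam_add: "f \<in> carrier H ==> f' \<in> carrier H ==> lam (f \<oplus>\<^sub>H f') = lam f + lam f'"
 unfolding lam_def by (simp add: H_sel phiA_simps H_closed lin_add[OF V.lin_Op1] sum.distrib del: plus_fun_apply)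

lemma lam_smult: "f \<in> carrier H ==> lam (c \<odot>\<^sub>H f) = sc c (lam f)"
 unfolding lam_def by (simp add: H_sel phiA_simps H_closed lin_scale[OF V.lin_Op1] vec.scale_sum_right)

lemma lam_A:
 assumes "f \<in> carrier H" "x \<in> carrier AA"
 shows "lam (skew_elt AA x \<one>\<^sub>G \<otimes>\<^sub>H f) = V.Op (phiA x) (lam f)"
 unfolding lam_def lin_sum[OF V.lin_Op2]
 using assms by (intro sum.cong refl) (simp add: skew_elt_mult_left lact_one H_closed phiA_simps V.Op_assoc)

text \<open>The rule \<open>la(x) g = g x\<close> of the skew product, verified inside the model;
  for the letter \<open>b\<close> it comes down to \<open>Lb_Lg\<close>.\<close>

lemma la_phi: "x \<in> carrier AA ==> y \<in> V.U ==> V.Op (phiA (la gg x)) (V.Lg y) = V.Lg (V.Op (phiA x) y)"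
proof (induct x rule: A_induct)
 case one
 then show ?case by (simp add: lact_simps phiA_simps V.Op_one_left)
next
 case (add u v)
 then show ?case by (simp add: lact_simps phiA_simps lin_add[OF V.lin_Op1] lin_add[OF V.lin_Lg] del: plus_fun_apply)
next
 case (smult c u)
 then show ?case by (simp add: lact_simps phiA_simps lin_scale[OF V.lin_Op1] lin_scale[OF V.lin_Lg])
next
 case (a u)
 then show ?case by (simp add: lact_simps la_a phiA_simps phiA(2) V.Op_assoc Op_mon_left[simplified] V.Lg_La V.Op_La)
next
 case (b u)
 have "phiA (la gg eb) = V.mon 0 0 1 - V.mon 1 0 0"
 proof -
  have "\<ominus>\<^sub>VA V.mon 1 0 0 = sc (-1) (V.mon 1 0 0)" using VA.smult_minus_left[of "V.mon 1 0 0" 1] by simp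
  then have "V.mon 0 0 1 \<ominus>\<^sub>VA V.mon 1 0 0 = V.mon 0 0 1 - V.mon 1 0 0"
   unfolding VA.minus_eq by (simp add: sc_def fun_eq_iff)
  then show ?thesis
   using linear_maps_minus[OF A.assoc_algebra_self assoc_algebra_VA algebra_homD(1)[OF phiA(1)], of eb ea]
   by (simp only: la_b phiA gen_closed)
 qed
 then have 1: "phiA (la gg (eb \<otimes>\<^sub>AA u)) = V.Op (V.mon 0 0 1 - V.mon 1 0 0) (phiA (la gg u))"
  using b(1) by (simp only: lact_simps gg gen_closed phiA_simps)
 have P: "phiA (la gg u) \<in> V.U" "phiA u \<in> V.U" using b(1) by (simp_all only: lact_simps gg phiA_simps)
 have U: "V.mon 0 0 1 - V.mon 1 0 0 \<in> V.U" using V.mon_U[of 0 0 1] V.mon_U[of 1 0 0] by (simp add: V.U_def)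
 let ?z = "V.Op (phiA u) y"
 have z: "?z \<in> V.U" using b by simp
 have "V.Op (phiA (la gg (eb \<otimes>\<^sub>AA u))) (V.Lg y) = V.Op (V.mon 0 0 1 - V.mon 1 0 0) (V.Lg ?z)"
  unfolding 1 V.Op_assoc[OF U P(1) V.L_U(2)] b(2)[OF b(3)] ..
 also have "\<dots> = V.Lb (V.Lg ?z) - V.La (V.Lg ?z)"
  unfolding module_hom.diff[OF V.lin_Op1] by (simp only: Op_mon_left V.L_U)
 also have "\<dots> = V.Lg (V.Lb ?z)" unfolding V.Lb_Lg[OF z] by (rule add_diff_cancel_right')
 also have "V.Lb ?z = V.Op (phiA (eb \<otimes>\<^sub>AA u)) y"
  using b(1,3) P by (simp only: phiA_simps gen_closed phiA(3) Op_mon_left V.Op_Lb)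
 finally show ?case .
qed

lemma lam_g:
 assumes f: "f \<in> carrier H"
 shows "lam (gH \<otimes>\<^sub>H f) = V.Lg (lam f)"
proof -
 let ?F = "\<lambda>k. V.Op (phiA (la gg (f (inv\<^bsub>G\<^esub> gg \<otimes>\<^sub>G gg [^]\<^sub>G k)))) (V.mon 0 k 0)"
 have "lam (gH \<otimes>\<^sub>H f) = (\<Sum>k<p. ?F k)"
  unfolding lam_def using f by (intro sum.cong refl) (simp add: skew_elt_mult_left lact_simps H_closed)
 also have "\<dots> = (\<Sum>k<p. ?F (Suc k))"
 proof -
  \<comment> \<open>A cyclic shift of the index: the terms for 0 and \<open>p\<close> agree because
    \<open>g^p = 1\<close> holds in \<open>G\<close> and in the model.\<close>
  have "?F 0 = ?F p" using V.mon_shift[of 0 0 0 1 0 0] by (simp add: gg_pow_p)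
  then have "?F 0 + (\<Sum>k<p. ?F (Suc k)) = (\<Sum>k<p. ?F k) + ?F 0"
   using sum.lessThan_Suc_shift[of ?F p] by (simp del: plus_fun_apply)
  then show ?thesis by (simp add: add.commute del: plus_fun_apply)
 qed
 also have "\<dots> = (\<Sum>k<p. V.Lg (V.Op (phiA (f (gg [^]\<^sub>G k))) (V.mon 0 k 0)))"
 proof (intro sum.cong refl)
  fix k
  have "inv\<^bsub>G\<^esub> gg \<otimes>\<^sub>G gg [^]\<^sub>G Suc k = gg [^]\<^sub>G k"
   unfolding G.nat_pow_Suc2[OF gg] by (simp add: G.m_assoc[symmetric])
  then show "?F (Suc k) = V.Lg (V.Op (phiA (f (gg [^]\<^sub>G k))) (V.mon 0 k 0))"
   using la_phi[of "f (gg [^]\<^sub>G k)" "V.mon 0 k 0"] H_closed[OF f] by (simp del: G.nat_pow_Suc)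
 qed
 finally show ?thesis by (simp add: lam_def lin_sum[OF V.lin_Lg])
qed

lemma lam_one: "lam \<one>\<^sub>H = V.mon 0 0 0"
proof -
 let ?F = "\<lambda>k. V.Op (phiA (\<one>\<^sub>H (gg [^]\<^sub>G k))) (V.mon 0 k 0)"
 have z: "V.Op (phiA \<zero>\<^sub>AA) y = 0" for y
 proof -
  have "phiA \<zero>\<^sub>AA = 0" using linear_maps_zero[OF A.assoc_algebra_self assoc_algebra_VA algebra_homD(1)[OF phiA(1)]] by simp
  then show ?thesis using module_hom.zero[OF V.lin_Op1, of y] by metis
 qed
 have ne: "gg [^]\<^sub>G k \<noteq> \<one>\<^sub>G" if "k < p" "k \<noteq> 0" for k
 proof -
  have "G.ord gg = p" using G.generate_pow_card[OF gg] by (simp add: gen_G order_G[symmetric] order_def)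
  then show ?thesis using G.pow_eq_id[OF gg, of k] that by (auto dest: dvd_imp_le)
 qed
 have "lam \<one>\<^sub>H = (\<Sum>k<p. if k = 0 then V.mon 0 0 0 else 0)"
  unfolding lam_def
 proof (intro sum.cong refl)
  fix k assume "k \<in> {..<p}"
  then show "?F k = (if k = 0 then V.mon 0 0 0 else 0)"
   using ne[of k] by (cases "k = 0") (simp_all add: H_sel skew_elt_def phiA_simps V.Op_one_left z)
 qed
 also have "\<dots> = V.mon 0 0 0" using V.p0 by (subst sum.delta) auto
 finally show ?thesis .
qed

lemma lam_pow: "f \<in> carrier H ==> lam (aH [^]\<^sub>H n \<otimes>\<^sub>H f) = (V.La ^^ n) (lam f)"
 "f \<in> carrier H ==> lam (bH [^]\<^sub>H n \<otimes>\<^sub>H f) = (V.Lb ^^ n) (lam f)"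
 "f \<in> carrier H ==> lam (gH [^]\<^sub>H n \<otimes>\<^sub>H f) = (V.Lg ^^ n) (lam f)" for n :: nat
proof -
 have lU: "lam f \<in> V.U" for f unfolding lam_def by (intro V.U_sum V.Op_U V.mon_U)
 have s: "lam (aH \<otimes>\<^sub>H f) = V.La (lam f)" "lam (bH \<otimes>\<^sub>H f) = V.Lb (lam f)" if "f \<in> carrier H" for f
  using that lU[of f] by (simp_all only: lam_A gen_closed phiA Op_mon_left)
 show "f \<in> carrier H ==> lam (aH [^]\<^sub>H n \<otimes>\<^sub>H f) = (V.La ^^ n) (lam f)"
  by (induct n arbitrary: f) (simp_all add: H.m_assoc s funpow_swap1)
 show "f \<in> carrier H ==> lam (bH [^]\<^sub>H n \<otimes>\<^sub>H f) = (V.Lb ^^ n) (lam f)"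
  by (induct n arbitrary: f) (simp_all add: H.m_assoc s funpow_swap1)
 show "f \<in> carrier H ==> lam (gH [^]\<^sub>H n \<otimes>\<^sub>H f) = (V.Lg ^^ n) (lam f)"
  by (induct n arbitrary: f) (simp_all add: H.m_assoc lam_g funpow_swap1)
qed

text \<open>Together with \<open>psi_surj\<close> this makes \<open>psi\<close> bijective. In
  particular the monomials are linearly independent in \<open>H\<close>, which spanning arguments
  alone cannot give.\<close>

lemma lam_psi: "x \<in> V.U ==> lam (Hr.psi x) = x"
proof -
 have m: "lam (Hr.mono i k j) = V.mon i k j" for i k j
 proof -
  have "lam (Hr.mono i k j) = lam (aH [^]\<^sub>H i \<otimes>\<^sub>H (gH [^]\<^sub>H k \<otimes>\<^sub>H (bH [^]\<^sub>H j \<otimes>\<^sub>H \<one>\<^sub>H)))"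
   by (simp add: Hr.mono_def)
  also have "\<dots> = (V.La ^^ i) ((V.Lg ^^ k) ((V.Lb ^^ j) (V.mon 0 0 0)))"
   using lam_pow(2)[OF H.one_closed, of j] by (simp add: lam_pow lam_one)
  finally show ?thesis by (simp add: V.La_pow_mon V.Lg_pow_mon V.Lb_pow_mon0)
 qed
 have z: "lam \<zero>\<^sub>H = 0" using lam_smult[of "\<one>\<^sub>H" 0] by simp
 have *: "lam (\<Oplus>\<^sub>H q\<in>S. F q) = (\<Sum>q\<in>S. lam (F q))" if "finite S" "F \<in> S \<rightarrow> carrier H" for S F
  using that by (induct S rule: finite_induct) (auto simp: z lam_add simp del: plus_fun_apply)
 have "lam (Hr.psi x) = (\<Sum>q\<in>V.B. lam (x q \<odot>\<^sub>H (case q of (i, k, j) \<Rightarrow> Hr.mono i k j)))"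
  unfolding Hr.psi_def by (rule *[OF V.finite_B]) (auto simp: H.smult_closed split: prod.splits)
 also have "\<dots> = (\<Sum>(i, k, j)\<in>V.B. sc (x (i, k, j)) (V.mon i k j))"
  by (intro sum.cong refl) (auto simp: lam_smult m)
 also assume "x \<in> V.U"
 then have "(\<Sum>(i, k, j)\<in>V.B. sc (x (i, k, j)) (V.mon i k j)) = x" by (rule V.U_expand[symmetric])
 finally show ?thesis .
qed

lemma psi_lam: "f \<in> carrier H ==> Hr.psi (lam f) = f"
 using psi_surj lam_psi by fastforce

lemma lam_U: "lam f \<in> V.U"
 unfolding lam_def by (intro V.U_sum V.Op_U V.mon_U)

lemma lam_mult: "f \<in> carrier H ==> f' \<in> carrier H ==> lam (f \<otimes>\<^sub>H f') = V.Op (lam f) (lam f')"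
proof -
 assume f: "f \<in> carrier H" "f' \<in> carrier H"
 have "Hr.psi (V.Op (lam f) (lam f')) = f \<otimes>\<^sub>H f'" using f by (simp add: Hr.psi_Op psi_lam)
 then show ?thesis using lam_psi[OF V.Op_U[OF lam_U]] by metis
qed

lemma lam_gens: "lam aH = V.mon 1 0 0" "lam gH = V.mon 0 1 0" "lam bH = V.mon 0 0 1"
 using lam_psi[of "V.mon 1 0 0"] lam_psi[of "V.mon 0 1 0"] lam_psi[of "V.mon 0 0 1"] by (simp_all only: Hr.psi_gens V.mon_U)

text \<open>Relations alone suffice for a map out of \<open>H\<close>: return to the model by
  \<open>lam\<close>, then leave it by the \<open>psi\<close> of the target.\<close>

lemma H_universal:
 fixes D :: "('k, 'd) module"
 assumes "pbw_rels p D a' g' b'"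
 shows "\<exists>\<phi>\<in>algebra_hom H D. \<phi> aH = a' \<and> \<phi> gH = g' \<and> \<phi> bH = b'"
proof -
 interpret Dr: pbw_rels p ty D a' g' b' using assms .
 have "(\<lambda>f. Dr.psi (lam f)) \<in> algebra_hom H D"
  by (intro algebra_homI linear_mapsI) (simp_all add: lam_add lam_smult Dr.psi_add Dr.psi_sc lam_mult Dr.psi_Op lam_one Dr.psi_gens del: plus_fun_apply)
 then show ?thesis using Dr.psi_gens lam_gens by (intro bexI[of _ "\<lambda>f. Dr.psi (lam f)"]) simp_all
qed

end

section \<open>Powers of sums in characteristic p\<close>

text \<open>The recursion has the shape of the one for the coefficients in
  \<open>triangular_sum\<close>, with weights \<open>n + r\<close>.\<close>

fun lah :: "nat \<Rightarrow> nat \<Rightarrow> nat" where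
 "lah 0 0 = 1"
| "lah 0 (Suc r) = 0"
| "lah (Suc n) 0 = 0"
| "lah (Suc n) (Suc r) = lah n r + (n + Suc r) * lah n (Suc r)"

lemma lah_gt: "n < r ==> lah n r = 0"
 by (induct n r rule: lah.induct) auto

lemma lah_diag: "lah n n = 1"
 by (induct n) (auto simp: lah_gt)

text \<open>This is \<open>L(n, r) = (n-1 choose r-1) n! / r!\<close>, shifted by one and multiplied
  out to avoid division and truncated subtraction.\<close>

lemma lah_closed_form: "lah (Suc n) (Suc r) * fact (Suc r) = (n choose r) * fact (Suc n)"
proof (induct n arbitrary: r)
 case 0
 then show ?case by (cases r) auto
next
 case (Suc n)
 show ?case
 proof (cases r)
  case 0
  then show ?thesis using Suc[of 0] by (simp add: algebra_simps)
 next
  case (Suc r')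
  have absorb: "Suc r' * (n choose Suc r') = (n - r') * (n choose r')"
   using binomial_absorption[of r' n] binomial_absorb_comp[of n r'] by simp
  \<comment> \<open>What remains of the recursion after factorials are cancelled. The surplus
    \<open>(r'+1) (n choose r'+1)\<close> turns into \<open>(n-r') (n choose r')\<close> by
    absorption.\<close>
  have key: "(r' + 2) * (n choose r') + (n + r' + 3) * (n choose Suc r') = (n + 2) * (Suc n choose Suc r')"
  proof (cases "r' \<le> n")
   case True
   have 1: "(n + r' + 3) * c = (n + 2) * c + Suc r' * c" for c :: nat by (simp add: distrib_right)
   have 2: "(n + 2) * c = (r' + 2) * c + (n - r') * c" for c :: nat
    using True by (simp add: distrib_right[symmetric])
   show ?thesis unfolding 1 absorb binomial_Suc_Suc distrib_left 2[of "n choose r'"] by (simp only: add_ac)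
  qed (simp add: binomial_eq_0)
  have f: "fact (Suc (Suc r')) = (r' + 2) * fact (Suc r')" by (simp only: fact_Suc[of "Suc r'"]) simp
  have l1: "lah (Suc (Suc n)) (Suc r) * fact (Suc r) =
    lah (Suc n) (Suc r') * fact (Suc (Suc r')) + (n + r' + 3) * (lah (Suc n) (Suc (Suc r')) * fact (Suc (Suc r')))"
  proof -
   have e: "Suc n + Suc (Suc r') = n + r' + 3" by simp
   show ?thesis unfolding Suc lah.simps(4)[of "Suc n" "Suc r'"] e by (simp only: distrib_right mult.assoc)
  qed
  have l2: "lah (Suc n) (Suc r') * fact (Suc (Suc r')) = (r' + 2) * (lah (Suc n) (Suc r') * fact (Suc r'))"
   unfolding f by (simp only: mult_ac)
  have "lah (Suc (Suc n)) (Suc r) * fact (Suc r) =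
    (r' + 2) * (lah (Suc n) (Suc r') * fact (Suc r')) + (n + r' + 3) * (lah (Suc n) (Suc (Suc r')) * fact (Suc (Suc r')))" unfolding l1 l2 ..
  also have "\<dots> = ((r' + 2) * (n choose r') + (n + r' + 3) * (n choose Suc r')) * fact (Suc n)"
   unfolding Suc.hyps by (simp only: distrib_right mult.assoc)
  also have "\<dots> = (Suc n choose Suc r') * ((n + 2) * fact (Suc n))"
   unfolding key by (simp only: mult_ac)
  finally show ?thesis unfolding Suc fact_Suc[of "Suc n"] by simp
 qed
qed

text \<open>In the closed form \<open>p\<close> divides \<open>p!\<close> but not
  \<open>r!\<close>.\<close>

lemma prime_dvd_lah:
 assumes "prime p" "r < p"
 shows "p dvd lah p r"
proof -
 obtain n where p: "p = Suc n" using assms prime_gt_0_nat by (cases p) auto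
 show ?thesis
 proof (cases r)
  case 0
  then show ?thesis unfolding p by simp
 next
  case (Suc r')
  have "p dvd (n choose r') * fact p" using assms(1) by (simp add: prime_dvd_fact_iff)
  then have "p dvd lah p r * fact r" unfolding Suc using lah_closed_form[of n r'] p by simp
  moreover have "\<not> p dvd fact r" using assms by (simp add: prime_dvd_fact_iff)
  ultimately show ?thesis using assms(1) prime_dvd_mult_iff by blast
 qed
qed

text \<open>\<open>F n\<close> moves \<open>M n r\<close> to the next row, splitting it between the
  columns \<open>r + 1\<close> and \<open>r\<close>. Hence the coefficients of the iterates obey a
  Pascal-type recursion with weights \<open>B\<close>.\<close>

lemma (in assoc_algebra) triangular_sum:
 fixes k B :: "nat \<Rightarrow> nat \<Rightarrow> 'k"
 assumes M: "\<And>n r. M n r \<in> carrier A" and F: "\<And>n. F n \<in> linear_maps A A"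
  and FM: "\<And>n r. r \<le> n ==> F n (M n r) = M (Suc n) (Suc r) \<oplus> B n r \<odot> M (Suc n) r"
  and k: "k 0 0 = 1" "\<And>n r. n < r ==> k n r = 0" "\<And>n. k (Suc n) 0 = B n 0 * k n 0"
   "\<And>n r. k (Suc n) (Suc r) = k n r + B n (Suc r) * k n (Suc r)"
  and Q: "Q 0 = M 0 0" "\<And>n. Q (Suc n) = F n (Q n)"
 shows "Q n = (\<Oplus>r\<in>{..n}. k n r \<odot> M n r)"
proof (induct n)
 case 0
 show ?case by (simp add: k Q M smult_one smult_closed)
next
 case (Suc n)
 note FD = linear_mapsD[OF F]
 let ?al = "\<lambda>r. (case r of 0 \<Rightarrow> 0 | Suc r' \<Rightarrow> k n r') \<odot> M (Suc n) r" and ?be = "\<lambda>r. (B n r * k n r) \<odot> M (Suc n) r"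
 have c: "?al r \<in> carrier A" "?be r \<in> carrier A" for r by (auto simp: M smult_closed)
 have "Q (Suc n) = (\<Oplus>r\<in>{..n}. F n (k n r \<odot> M n r))"
  unfolding Q(2) Suc by (rule linear_maps_finsum[OF assoc_algebra_self assoc_algebra_self F]) (auto simp: M smult_closed)
 also have "\<dots> = (\<Oplus>r\<in>{..n}. ?al (Suc r) \<oplus> ?be r)"
  by (intro finsum_cong') (auto simp: M smult_closed FD FM smult_r_distr smult_assoc1[symmetric] mult.commute)
 also have "\<dots> = (\<Oplus>r\<in>{..n}. ?al (Suc r)) \<oplus> (\<Oplus>r\<in>{..n}. ?be r)"
  by (intro finsum_addf) (auto simp: M smult_closed)
 also have "(\<Oplus>r\<in>{..n}. ?al (Suc r)) = (\<Oplus>r\<in>{..Suc n}. ?al r)"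
  by (subst finsum_Suc2) (use c in \<open>auto simp: M smult_closed\<close>)
 also have "(\<Oplus>r\<in>{..n}. ?be r) = (\<Oplus>r\<in>{..Suc n}. ?be r)"
  by (subst finsum_Suc) (use c in \<open>auto simp: M smult_closed k(2)\<close>)
 also have "(\<Oplus>r\<in>{..Suc n}. ?al r) \<oplus> (\<Oplus>r\<in>{..Suc n}. ?be r) = (\<Oplus>r\<in>{..Suc n}. ?al r \<oplus> ?be r)"
  by (intro finsum_addf[symmetric]) (use c in auto)
 also have "\<dots> = (\<Oplus>r\<in>{..Suc n}. k (Suc n) r \<odot> M (Suc n) r)"
  by (intro finsum_cong') (auto simp: M smult_closed smult_l_distr[symmetric] k split: nat.split)
 finally show ?case .
qed

lemma (in assoc_algebra) finsum_last:
 fixes n :: nat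
 assumes "\<And>r. r < n ==> k r = 0" "k n = (1 :: 'k)" "\<And>r. M r \<in> carrier A"
 shows "(\<Oplus>r\<in>{..n}. k r \<odot> M r) = M n"
proof -
 have "(\<Oplus>r\<in>{..n}. k r \<odot> M r) = (\<Oplus>r\<in>{n}. k r \<odot> M r)"
  using assms by (intro add.finprod_mono_neutral_cong_right) (auto simp: smult_closed)
 then show ?thesis using assms by (simp add: smult_one smult_closed)
qed

context pbw_field
begin

text \<open>The solution of the recursion in \<open>triangular_sum\<close> for the weights
  \<open>B n r = (n + r)/2\<close>, which occur in both power computations below.\<close>

definition lw :: "nat \<Rightarrow> nat \<Rightarrow> 'k" where "lw n r = (1/2) ^ (n - r) * of_nat (lah n r)"

lemma lw_rec: "lw 0 0 = 1" "n < r ==> lw n r = 0" "lw (Suc n) 0 = (of_nat (n + 0) * (1/2)) * lw n 0"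
 "lw (Suc n) (Suc r) = lw n r + (of_nat (n + Suc r) * (1/2)) * lw n (Suc r)"
proof -
 show "lw 0 0 = 1" "n < r ==> lw n r = 0" "lw (Suc n) 0 = (of_nat (n + 0) * (1/2)) * lw n 0"
  by (simp_all add: lw_def lah_gt, cases n, simp_all)
 show "lw (Suc n) (Suc r) = lw n r + (of_nat (n + Suc r) * (1/2)) * lw n (Suc r)"
 proof (cases "r < n")
  case True
  then have "n - r = Suc (n - Suc r)" by simp
  then show ?thesis by (simp add: lw_def distrib_left mult_ac)
 qed (simp add: lw_def lah_gt)
qed

lemma lw_p: "r < p ==> lw p r = 0" "lw p p = 1"
proof -
 assume "r < p"
 then obtain c where "lah p r = p * c" using prime_dvd_lah[OF prime_p'] by (auto elim: dvdE)
 then show "lw p r = 0" by (simp add: lw_def char_k)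
qed (simp add: lw_def lah_diag)

lemma binomial_p: "r < p ==> r \<noteq> 0 ==> of_nat (p choose r) = (0 :: 'k)"
proof -
 assume "r < p" "r \<noteq> 0"
 then have "p dvd (p choose r)" using prime_p' by (intro dvd_choose_prime) auto
 then obtain c where "p choose r = p * c" by (auto elim: dvdE)
 then show ?thesis by (simp add: char_k)
qed

end

locale jordan_pow = pbw_field p ty + jordan_rels D a g b s
 for p and ty :: "'k::field itself" and D :: "('k, 'd) module" (structure) and a g b s
begin

lemma b_mono2: "b \<otimes> (a [^] i \<otimes> g [^] r) = a [^] i \<otimes> g [^] r \<otimes> b \<oplus> (of_nat r + of_nat i * s) \<odot> (a [^] Suc i \<otimes> g [^] r)" for i r :: nat
proof -
 have "b \<otimes> (a [^] i \<otimes> g [^] r) = (b \<otimes> a [^] i) \<otimes> g [^] r" by (simp add: D.m_assoc)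
 also have "\<dots> = a [^] i \<otimes> (b \<otimes> g [^] r) \<oplus> (of_nat i * s) \<odot> (a [^] Suc i \<otimes> g [^] r)"
  unfolding b_pow_a by (simp add: D.l_distr D.smult_closed D.smult_mult_l D.m_assoc del: D.nat_pow_Suc)
 also have "a [^] i \<otimes> (b \<otimes> g [^] r) = a [^] i \<otimes> g [^] r \<otimes> b \<oplus> of_nat r \<odot> (a [^] Suc i \<otimes> g [^] r)"
  unfolding b_pow_g by (simp add: D.r_distr D.smult_closed D.smult_mult_r D.m_assoc)
 finally show ?thesis by (simp add: D.a_assoc D.smult_closed D.smult_l_distr del: D.nat_pow_Suc)
qed

text \<open>Left multiplication by \<open>g + b\<close> is the sum of
  \<open>q -> g q + (b q - q b)\<close>, whose iterates at 1 are the \<open>Q n\<close>, and of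
  right multiplication by \<open>b\<close>. The two commute, so \<open>(g + b)^n\<close> is the
  binomial sum of the \<open>Q r b^(n-r)\<close>. For \<open>n = p\<close> only the two ends
  survive, and \<open>Q p = g^p\<close> because the Lah weights vanish.\<close>

lemma pow_add_p:
 assumes s: "s = 1/2"
 shows "(g \<oplus> b) [^] p = g [^] p \<oplus> b [^] p"
proof -
 define Q where "Q = rec_nat \<one> (\<lambda>n q. g \<otimes> q \<oplus> (b \<otimes> q \<ominus> q \<otimes> b))"
 have Q0: "Q 0 = \<one>" and QS: "Q (Suc n) = g \<otimes> Q n \<oplus> (b \<otimes> Q n \<ominus> Q n \<otimes> b)" for n by (simp_all add: Q_def)
 have Qc [simp]: "Q n \<in> carrier D" for n by (induct n) (auto simp: Q0 QS)
 have Qp: "Q n = (\<Oplus>r\<in>{..n}. lw n r \<odot> (a [^] (n - r) \<otimes> g [^] r))" for n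
 proof (rule D.triangular_sum[where F = "\<lambda>_ q. g \<otimes> q \<oplus> (b \<otimes> q \<ominus> q \<otimes> b)" and B = "\<lambda>n r. of_nat (n + r) * (1/2)"])
  show "(\<lambda>q. g \<otimes> q \<oplus> (b \<otimes> q \<ominus> q \<otimes> b)) \<in> linear_maps D D"
  proof (rule linear_mapsI)
   fix x y c assume x: "x \<in> carrier D"
   show "g \<otimes> (c \<odot> x) \<oplus> (b \<otimes> (c \<odot> x) \<ominus> c \<odot> x \<otimes> b) = c \<odot> (g \<otimes> x \<oplus> (b \<otimes> x \<ominus> x \<otimes> b))"
    using x by (simp add: D.smult_mult_l D.smult_mult_r D.minus_eq D.smult_r_distr D.smult_closed D.smult_minus_right)
   assume y: "y \<in> carrier D"
   show "g \<otimes> (x \<oplus> y) \<oplus> (b \<otimes> (x \<oplus> y) \<ominus> (x \<oplus> y) \<otimes> b) = g \<otimes> x \<oplus> (b \<otimes> x \<ominus> x \<otimes> b) \<oplus> (g \<otimes> y \<oplus> (b \<otimes> y \<ominus> y \<otimes> b))"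
    using x y by (simp add: D.r_distr D.l_distr D.minus_eq D.minus_add D.a_ac)
  qed simp
  fix n r :: nat assume r: "r \<le> n"
  let ?z = "a [^] (n - r) \<otimes> g [^] r" and ?w = "(of_nat r + of_nat (n - r) * s) \<odot> (a [^] Suc (n - r) \<otimes> g [^] r)"
  have "g \<otimes> ?z = (g \<otimes> a [^] (n - r)) \<otimes> g [^] r" by (simp add: D.m_assoc)
  also have "\<dots> = a [^] (n - r) \<otimes> (g \<otimes> g [^] r)" unfolding g_pow_a by (simp add: D.m_assoc)
  finally have 1: "g \<otimes> ?z = a [^] (Suc n - Suc r) \<otimes> g [^] Suc r" using D.nat_pow_Suc2[of g r] by simp
  have wc: "?w \<in> carrier D" by (intro D.smult_closed) simp
  have "b \<otimes> ?z \<ominus> ?z \<otimes> b = ?w"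
   unfolding b_mono2 using wc by (simp add: D.minus_eq D.a_ac D.r_neg1 D.l_neg D.r_neg del: D.nat_pow_Suc)
    (metis D.a_ac(1) D.a_comm D.a_inv_closed D.l_neg D.l_zero D.m_closed D.nat_pow_closed cl wc)
  \<comment> \<open>The value \<open>s = 1/2\<close> enters here:
    \<open>r + (n - r)/2 = (n + r)/2\<close>.\<close>
  moreover have e: "of_nat r + of_nat (n - r) * s = of_nat (n + r) * (1/2 :: 'k)"
   using r two_nonzero by (simp add: s of_nat_diff field_simps)
  ultimately have 2: "b \<otimes> ?z \<ominus> ?z \<otimes> b = (of_nat (n + r) * (1/2)) \<odot> (a [^] Suc (n - r) \<otimes> g [^] r)"
   by (simp only: e)
  show "g \<otimes> ?z \<oplus> (b \<otimes> ?z \<ominus> ?z \<otimes> b) = a [^] (Suc n - Suc r) \<otimes> g [^] Suc r \<oplus> (of_nat (n + r) * (1/2)) \<odot> (a [^] (Suc n - r) \<otimes> g [^] r)"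
   unfolding 1 2 Suc_diff_le[OF r] ..
 qed (auto simp: lw_rec Q0 QS simp del: of_nat_add)
 have R: "(g \<oplus> b) [^] n = (\<Oplus>r\<in>{..n}. of_nat (n choose r) \<odot> (Q (n - (n - r)) \<otimes> b [^] (n - r)))" for n :: nat
 proof (rule D.triangular_sum[where F = "\<lambda>_ q. (g \<oplus> b) \<otimes> q" and B = "\<lambda>n r. 1" and M = "\<lambda>n r. Q (n - (n - r)) \<otimes> b [^] (n - r)"])
  show "(\<lambda>q. (g \<oplus> b) \<otimes> q) \<in> linear_maps D D"
   by (rule linear_mapsI) (simp_all add: D.r_distr D.smult_mult_r)
  show "(g \<oplus> b) [^] Suc n = (g \<oplus> b) \<otimes> (g \<oplus> b) [^] n" for n :: nat by (rule D.nat_pow_Suc2) simp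
  show "(g \<oplus> b) [^] (0::nat) = Q (0 - (0 - 0)) \<otimes> b [^] (0 - 0 :: nat)" by (simp add: Q0)
  fix n r :: nat assume r: "r \<le> n"
  have "(g \<oplus> b) \<otimes> Q r = Q (Suc r) \<oplus> Q r \<otimes> b"
   unfolding QS by (simp add: D.l_distr D.minus_eq D.a_assoc D.l_neg)
  then have "(g \<oplus> b) \<otimes> (Q r \<otimes> b [^] (n - r)) = (Q (Suc r) \<oplus> Q r \<otimes> b) \<otimes> b [^] (n - r)"
   by (simp add: D.m_assoc[symmetric])
  also have "\<dots> = Q (Suc r) \<otimes> b [^] (n - r) \<oplus> Q r \<otimes> b [^] (Suc n - r)"
   using D.nat_pow_Suc2[of b "n - r"] r by (simp add: D.l_distr D.m_assoc Suc_diff_le del: D.nat_pow_Suc)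
  finally show "(g \<oplus> b) \<otimes> (Q (n - (n - r)) \<otimes> b [^] (n - r)) = Q (Suc n - (Suc n - Suc r)) \<otimes> b [^] (Suc n - Suc r) \<oplus> 1 \<odot> (Q (Suc n - (Suc n - r)) \<otimes> b [^] (Suc n - r))"
   using r by (simp add: D.smult_one)
 qed (auto simp: binomial_eq_0 add.commute)
 have Qpp: "Q p = g [^] p"
  unfolding Qp using D.finsum_last[of p "lw p" "\<lambda>r. a [^] (p - r) \<otimes> g [^] r"] lw_p by simp
 have "(g \<oplus> b) [^] p = (\<Oplus>r\<in>{0, p}. of_nat (p choose r) \<odot> (Q (p - (p - r)) \<otimes> b [^] (p - r)))"
  unfolding R by (intro D.add.finprod_mono_neutral_cong_right) (auto simp: binomial_p D.smult_closed)
 also have "\<dots> = g [^] p \<oplus> b [^] p"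
  using V.p0 by (simp add: Q0 Qpp D.smult_one D.a_comm)
 finally show ?thesis .
qed

text \<open>Collecting the powers of \<open>g\<close> on the left gives
  \<open>(g b)^n = g^n Q n\<close>, since \<open>b g^n = g^n (b + n a)\<close>. The weights of
  \<open>Q\<close> are again \<open>(n + r)/2\<close>, now in the form
  \<open>n - (n - r)/2\<close>.\<close>

lemma pow_mult_p:
 assumes s: "s = - (1/2)" and gp: "g [^] p = \<one>"
 shows "(g \<otimes> b) [^] p = b [^] p"
proof -
 define Q where "Q = rec_nat \<one> (\<lambda>n q. (b \<oplus> of_nat n \<odot> a) \<otimes> q)"
 have Q0: "Q 0 = \<one>" and QS: "Q (Suc n) = (b \<oplus> of_nat n \<odot> a) \<otimes> Q n" for n by (simp_all add: Q_def)
 have Qc [simp]: "Q n \<in> carrier D" for n by (induct n) (auto simp: Q0 QS D.smult_closed)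
 have Qp: "Q n = (\<Oplus>r\<in>{..n}. lw n r \<odot> (a [^] (n - r) \<otimes> b [^] r))" for n
 proof (rule D.triangular_sum[where F = "\<lambda>n q. (b \<oplus> of_nat n \<odot> a) \<otimes> q" and B = "\<lambda>n r. of_nat (n + r) * (1/2)"])
  show "(\<lambda>q. (b \<oplus> of_nat n \<odot> a) \<otimes> q) \<in> linear_maps D D" for n
   by (rule linear_mapsI) (simp_all add: D.r_distr D.smult_mult_r D.smult_closed)
  fix n r :: nat assume r: "r \<le> n"
  let ?w = "a [^] Suc (n - r) \<otimes> b [^] r"
  have "b \<otimes> (a [^] (n - r) \<otimes> b [^] r) = (b \<otimes> a [^] (n - r)) \<otimes> b [^] r" by (simp add: D.m_assoc)
  also have "\<dots> = a [^] (n - r) \<otimes> b [^] Suc r \<oplus> (of_nat (n - r) * s) \<odot> ?w"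
   unfolding b_pow_a using D.nat_pow_Suc2[of b r] by (simp add: D.l_distr D.smult_closed D.smult_mult_l D.m_assoc del: D.nat_pow_Suc)
  finally have 1: "b \<otimes> (a [^] (n - r) \<otimes> b [^] r) = a [^] (n - r) \<otimes> b [^] Suc r \<oplus> (of_nat (n - r) * s) \<odot> ?w" .
  have 2: "(of_nat n \<odot> a) \<otimes> (a [^] (n - r) \<otimes> b [^] r) = of_nat n \<odot> ?w"
   using D.nat_pow_Suc2[of a "n - r"] by (simp add: D.smult_mult_l D.m_assoc del: D.nat_pow_Suc)
  have e: "of_nat (n - r) * s + of_nat n = of_nat (n + r) * (1/2 :: 'k)"
   using r two_nonzero by (simp add: s of_nat_diff field_simps)
  have 3: "(of_nat (n - r) * s) \<odot> ?w \<oplus> of_nat n \<odot> ?w = (of_nat (n + r) * (1/2)) \<odot> ?w"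
   unfolding e[symmetric] by (rule D.smult_l_distr[symmetric]) simp
  show "(b \<oplus> of_nat n \<odot> a) \<otimes> (a [^] (n - r) \<otimes> b [^] r) = a [^] (Suc n - Suc r) \<otimes> b [^] Suc r \<oplus> (of_nat (n + r) * (1/2)) \<odot> (a [^] (Suc n - r) \<otimes> b [^] r)"
   unfolding Suc_diff_le[OF r] 3[symmetric] by (simp add: D.l_distr D.smult_closed D.a_assoc 1 2 del: D.nat_pow_Suc of_nat_add)
 qed (auto simp: lw_rec Q0 QS simp del: of_nat_add)
 have R: "(g \<otimes> b) [^] n = g [^] n \<otimes> Q n" for n :: nat
 proof (induct n)
  case (Suc n)
  have "(g \<otimes> b) [^] Suc n = (g \<otimes> b) \<otimes> (g [^] n \<otimes> Q n)" using D.nat_pow_Suc2[of "g \<otimes> b" n] Suc by simp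
  also have "\<dots> = g \<otimes> ((b \<otimes> g [^] n) \<otimes> Q n)" by (simp add: D.m_assoc)
  also have "b \<otimes> g [^] n = g [^] n \<otimes> (b \<oplus> of_nat n \<odot> a)"
  proof -
   have "a \<otimes> g [^] n = g [^] n \<otimes> a"
   proof (induct n)
    case (Suc n)
    have "a \<otimes> g [^] Suc n = g [^] n \<otimes> (a \<otimes> g)" using Suc by (simp add: D.m_assoc[symmetric])
    then show ?case by (simp add: ga[symmetric] D.m_assoc)
   qed simp
   then show ?thesis unfolding b_pow_g by (simp add: D.r_distr D.smult_closed D.smult_mult_r)
  qed
  also have "g \<otimes> (g [^] n \<otimes> (b \<oplus> of_nat n \<odot> a) \<otimes> Q n) = g [^] Suc n \<otimes> Q (Suc n)"
   using D.nat_pow_Suc2[of g n] by (simp add: QS D.m_assoc D.smult_closed del: D.nat_pow_Suc)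
  finally show ?case .
 qed (simp add: Q0)
 have "Q p = b [^] p"
  unfolding Qp using D.finsum_last[of p "lw p" "\<lambda>r. a [^] (p - r) \<otimes> b [^] r"] lw_p by simp
 then show ?thesis by (simp add: R gp)
qed

end

section \<open>The Hopf algebra structure\<close>

lemma algebra_hom_comp:
 assumes "f \<in> algebra_hom A B" "h \<in> algebra_hom B C"
 shows "(\<lambda>x. h (f x)) \<in> algebra_hom A C"
 by (intro algebra_homI linear_mapsI) (simp_all add: algebra_homD[OF assms(1)] algebra_homD[OF assms(2)])

lemma algebra_hom_id: "(\<lambda>x. x) \<in> algebra_hom A A"
 by (intro algebra_homI linear_mapsI) auto

lemma assoc_algebra_ground: "assoc_algebra (ground_algebra :: ('k::field, 'k) module)"
proof -
 have "abelian_group (ground_algebra :: ('k, 'k) module)"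
  by (rule abelian_groupI) (auto simp: ground_algebra_def add_ac intro: exI[of _ "- _"] left_minus)
 moreover have "Group.monoid (ground_algebra :: ('k, 'k) module)"
  by (rule monoidI) (auto simp: ground_algebra_def mult_ac)
 ultimately have "Ring.ring (ground_algebra :: ('k, 'k) module)"
  by (rule ringI) (auto simp: ground_algebra_def algebra_simps)
 then show ?thesis
  unfolding assoc_algebra_def assoc_algebra_axioms_def by (simp add: ground_algebra_def algebra_simps)
qed

lemma ground_sel [simp]: "carrier ground_algebra = UNIV" "x \<otimes>\<^bsub>ground_algebra\<^esub> y = x * y" "\<one>\<^bsub>ground_algebra\<^esub> = 1"
 "\<zero>\<^bsub>ground_algebra\<^esub> = 0" "x \<oplus>\<^bsub>ground_algebra\<^esub> y = x + y" "c \<odot>\<^bsub>ground_algebra\<^esub> x = c * x"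
 by (simp_all add: ground_algebra_def)

lemma finsum_ground: "finite S ==> (\<Oplus>\<^bsub>ground_algebra\<^esub>s\<in>S. F s) = (\<Sum>s\<in>S. F s :: 'k::field)"
proof -
 interpret G: assoc_algebra "ground_algebra :: ('k, 'k) module" by (rule assoc_algebra_ground)
 show "finite S ==> (\<Oplus>\<^bsub>ground_algebra\<^esub>s\<in>S. F s) = (\<Sum>s\<in>S. F s)" by (induct S rule: finite_induct) auto
qed

text \<open>The antipode reverses products, so it is obtained as a homomorphism into the opposite
  algebra.\<close>

definition opp :: "('k, 'a) module \<Rightarrow> ('k, 'a) module" where
 "opp D = D\<lparr>mult := \<lambda>x y. y \<otimes>\<^sub>D x\<rparr>"

lemma opp_sel [simp]: "carrier (opp D) = carrier D" "x \<otimes>\<^bsub>opp D\<^esub> y = y \<otimes>\<^sub>D x" "\<one>\<^bsub>opp D\<^esub> = \<one>\<^sub>D"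
 "\<zero>\<^bsub>opp D\<^esub> = \<zero>\<^sub>D" "x \<oplus>\<^bsub>opp D\<^esub> y = x \<oplus>\<^sub>D y" "c \<odot>\<^bsub>opp D\<^esub> x = c \<odot>\<^sub>D x"
 by (simp_all add: opp_def)

context assoc_algebra
begin

lemma assoc_algebra_opp: "assoc_algebra (opp A)"
proof -
 have "abelian_group (opp A)"
 proof (rule abelian_groupI)
  fix x assume "x \<in> carrier (opp A)"
  then show "\<exists>y\<in>carrier (opp A). y \<oplus>\<^bsub>opp A\<^esub> x = \<zero>\<^bsub>opp A\<^esub>"
   by (intro bexI[of _ "\<ominus> x"]) (auto simp: l_neg)
 qed (simp_all add: a_assoc, simp add: a_comm)
 moreover have "Group.monoid (opp A)"
  by (rule monoidI) (simp_all add: m_assoc)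
 ultimately have "Ring.ring (opp A)"
  by (rule ringI) (simp_all add: l_distr r_distr)
 then show ?thesis
  unfolding assoc_algebra_def assoc_algebra_axioms_def
  by (simp add: smult_closed smult_l_distr smult_r_distr smult_assoc1 smult_one smult_mult_l smult_mult_r)
qed

lemma opp_pow: "x \<in> carrier A ==> x [^]\<^bsub>opp A\<^esub> (n::nat) = x [^] n"
proof (induct n)
 case (Suc n)
 interpret O: assoc_algebra "opp A" by (rule assoc_algebra_opp)
 have "x [^]\<^bsub>opp A\<^esub> Suc n = x \<otimes> x [^]\<^bsub>opp A\<^esub> n" by simp
 then show ?case using Suc nat_pow_Suc2[of x n] by simp
qed (simp add: nat_pow_def)

end

lemma tensor_map_bilinear:
 assumes "assoc_algebra B'" "assoc_algebra C'" "f \<in> linear_maps B B'" "h \<in> linear_maps C C'"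
 shows "(\<lambda>y z. pure_tensor B' C' (f y) (h z)) \<in> bilinear_maps B C (tensor_algebra B' C')"
proof -
 interpret T': two_algebras B' C' using assms by (simp add: two_algebras_def)
 show ?thesis
  by (rule bilinear_mapsI) (simp_all add: linear_mapsD[OF assms(3)] linear_mapsD[OF assms(4)] bilinear_mapsD[OF T'.pt_bilinear])
qed

lemma tensor_map_hom:
 assumes BC: "assoc_algebra B" "assoc_algebra C" and BC': "assoc_algebra B'" "assoc_algebra C'"
  and f: "f \<in> algebra_hom B B'" and h: "h \<in> algebra_hom C C'"
 shows "tensor_lift (tensor_algebra B' C') (\<lambda>y z. pure_tensor B' C' (f y) (h z)) \<in> algebra_hom (tensor_algebra B C) (tensor_algebra B' C')"
  and "x \<in> carrier B ==> y \<in> carrier C ==>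
   tensor_lift (tensor_algebra B' C') (\<lambda>y z. pure_tensor B' C' (f y) (h z)) (pure_tensor B C x y) = pure_tensor B' C' (f x) (h y)"
proof -
 interpret T: two_algebras B C using BC by (simp add: two_algebras_def)
 interpret T': two_algebras B' C' using BC' by (simp add: two_algebras_def)
 note b = tensor_map_bilinear[OF BC' algebra_homD(1)[OF f] algebra_homD(1)[OF h]]
 show "tensor_lift (tensor_algebra B' C') (\<lambda>y z. pure_tensor B' C' (f y) (h z)) \<in> algebra_hom (tensor_algebra B C) (tensor_algebra B' C')"
  by (rule T.tensor_lift_hom[OF T'.T.assoc_algebra_self b])
   (simp_all add: algebra_homD[OF f] algebra_homD[OF h] T'.pt_mult T'.pt_one)
 show "x \<in> carrier B ==> y \<in> carrier C ==>
   tensor_lift (tensor_algebra B' C') (\<lambda>y z. pure_tensor B' C' (f y) (h z)) (pure_tensor B C x y) = pure_tensor B' C' (f x) (h y)"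
  by (rule T.tensor_lift_pt[OF T'.T.assoc_algebra_self b])
qed

text \<open>\<open>tensor_assoc\<close> is a lift of lifts. Before the outer lift makes sense, the
  inner one must be shown bilinear in the tensor and in \<open>z\<close>, by induction on
  tensors.\<close>

lemma tensor_assoc_hom:
 assumes B: "assoc_algebra B" and C: "assoc_algebra C" and D: "assoc_algebra D"
 shows "tensor_assoc B C D \<in> algebra_hom (tensor_algebra (tensor_algebra B C) D) (tensor_algebra B (tensor_algebra C D))" (is ?hom)
  and "x \<in> carrier B ==> y \<in> carrier C ==> z \<in> carrier D ==>
   tensor_assoc B C D (pure_tensor (tensor_algebra B C) D (pure_tensor B C x y) z) =
   pure_tensor B (tensor_algebra C D) x (pure_tensor C D y z)"
proof -
 interpret BC: two_algebras B C using B C by (simp add: two_algebras_def)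
 interpret CD: two_algebras C D using C D by (simp add: two_algebras_def)
 interpret L: two_algebras "BC.T" D using BC.T.assoc_algebra_self D by (simp add: two_algebras_def)
 interpret R: two_algebras B "CD.T" using B CD.T.assoc_algebra_self by (simp add: two_algebras_def)
 let ?p = "\<lambda>x y z. R.pt x (CD.pt y z)"
 note ps = bilinear_mapsD[OF R.pt_bilinear] bilinear_mapsD[OF CD.pt_bilinear]
 have pb: "(\<lambda>x y. ?p x y z) \<in> bilinear_maps B C R.T" if z: "z \<in> carrier D" for z
  by (rule bilinear_mapsI) (simp_all add: ps z)
 let ?i = "\<lambda>t z. tensor_lift R.T (\<lambda>x y. ?p x y z) t"
 note il = linear_mapsD[OF BC.tensor_lift_linear[OF R.T.assoc_algebra_self pb]]
 note ip = BC.tensor_lift_pt[OF R.T.assoc_algebra_self pb]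
 have ib: "?i \<in> bilinear_maps BC.T D R.T"
 proof (rule bilinear_mapsI)
  show "?i t (z \<oplus>\<^sub>D z') = ?i t z \<oplus>\<^bsub>R.T\<^esub> ?i t z'" if t: "t \<in> carrier BC.T" and z: "z \<in> carrier D" "z' \<in> carrier D" for t z z'
   using t
  proof (induct t rule: BC.tensor_induct)
   case (pure x y)
   then show ?case using z by (simp add: ip ps)
  next
   case (add s t)
   then show ?case using z by (simp add: il R.T.a_ac)
  qed
  show "?i t (c \<odot>\<^sub>D z) = c \<odot>\<^bsub>R.T\<^esub> ?i t z" if t: "t \<in> carrier BC.T" and z: "z \<in> carrier D" for t z c
   using t
  proof (induct t rule: BC.tensor_induct)
   case (pure x y)
   then show ?case using z by (simp add: ip ps CD.C.smult_closed)
  next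
   case (add s t)
   then show ?case using z by (simp add: il R.T.smult_r_distr CD.C.smult_closed)
  qed
 qed (simp_all add: il)
 have ta: "tensor_assoc B C D = tensor_lift R.T ?i" by (simp add: tensor_assoc_def[abs_def])
 have im: "?i (s \<otimes>\<^bsub>BC.T\<^esub> t) (z \<otimes>\<^sub>D z') = ?i s z \<otimes>\<^bsub>R.T\<^esub> ?i t z'"
  if s: "s \<in> carrier BC.T" and t: "t \<in> carrier BC.T" and z: "z \<in> carrier D" "z' \<in> carrier D" for s t z z'
  using s
 proof (induct s rule: BC.tensor_induct)
  case (pure x y)
  note xy = pure
  show ?case using t
  proof (induct t rule: BC.tensor_induct)
   case (pure x' y')
   then show ?case using xy z by (simp add: BC.pt_mult ip R.pt_mult CD.pt_mult)
  next
   case (add u v)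
   then show ?case using xy z by (simp add: BC.T.r_distr il R.T.r_distr)
  qed
 next
  case (add u v)
  then show ?case using t z by (simp add: BC.T.l_distr il R.T.l_distr)
 qed
 show ?hom unfolding ta
  by (rule L.tensor_lift_hom[OF R.T.assoc_algebra_self ib]) (simp_all add: im BC.pt_one ip R.pt_one CD.pt_one)
 assume x: "x \<in> carrier B" "y \<in> carrier C" "z \<in> carrier D"
 show "tensor_assoc B C D (L.pt (BC.pt x y) z) = R.pt x (CD.pt y z)"
  unfolding ta using x by (subst L.tensor_lift_pt[OF R.T.assoc_algebra_self ib]) (simp_all add: ip)
qed

context skew_setup
begin

lemma H_hom_eq:
 assumes "assoc_algebra D" "f \<in> algebra_hom H D" "f' \<in> algebra_hom H D" "f aH = f' aH" "f gH = f' gH" "f bH = f' bH" "x \<in> carrier H"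
 shows "f x = f' x"
 using assms(7)
 by (induct x rule: H_induct) (simp_all add: assms(4-6) algebra_homD[OF assms(2)] algebra_homD[OF assms(3)])

sublocale HH: two_algebras H H by unfold_locales

abbreviation "TT \<equiv> tensor_algebra H H"
abbreviation "Da \<equiv> HH.pt aH \<one>\<^sub>H \<oplus>\<^sub>TT HH.pt gH aH"
abbreviation "Db \<equiv> HH.pt bH \<one>\<^sub>H \<oplus>\<^sub>TT HH.pt gH bH"
abbreviation "Dg \<equiv> HH.pt gH gH"

lemma half_add: "x \<in> carrier D ==> assoc_algebra D ==> (1/2) \<odot>\<^sub>D x \<oplus>\<^sub>D (1/2) \<odot>\<^sub>D x = x" for D :: "('k, 'd) module"
proof -
 assume x: "x \<in> carrier D" and "assoc_algebra D"
 then interpret D: assoc_algebra D by simp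
 have "(1/2 + 1/2 :: 'k) = 1" using two_nonzero by (simp add: field_simps)
 then show ?thesis using D.smult_l_distr[OF x, of "1/2" "1/2"] D.smult_one[OF x] by simp
qed

lemma pt_pow: "x \<in> carrier H ==> y \<in> carrier H ==> HH.pt x y [^]\<^sub>TT (n::nat) = HH.pt (x [^]\<^sub>H n) (y [^]\<^sub>H n)"
 by (induct n) (simp_all add: HH.pt_one HH.pt_mult)

lemma pt_zero: "x \<in> carrier H ==> HH.pt x \<zero>\<^sub>H = \<zero>\<^sub>TT" "x \<in> carrier H ==> HH.pt \<zero>\<^sub>H x = \<zero>\<^sub>TT"
 using bilinear_mapsD(5)[OF HH.pt_bilinear, of x "\<zero>\<^sub>H" 0] bilinear_mapsD(4)[OF HH.pt_bilinear, of "\<zero>\<^sub>H" x 0] by simp_all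

text \<open>By \<open>H_universal\<close>, a comultiplication exists as soon as the three prescribed
  images satisfy the defining relations of \<open>H\<close> in the tensor square.\<close>

lemma comult_rels: "pbw_rels p TT Da Dg Db"
proof (intro pbw_rels.intro pbw_field_axioms jordan_rels.intro HH.T.assoc_algebra_self jordan_rels_axioms.intro pbw_rels_axioms.intro)
 note ptb = bilinear_mapsD[OF HH.pt_bilinear]
 note ex = HH.T.l_distr HH.T.r_distr HH.pt_mult Hr.ga
 show "Da \<in> carrier TT" "Dg \<in> carrier TT" "Db \<in> carrier TT" by simp_all
 show "Dg \<otimes>\<^sub>TT Da = Da \<otimes>\<^sub>TT Dg" by (simp add: ex)
 show "Db \<otimes>\<^sub>TT Dg = Dg \<otimes>\<^sub>TT Db \<oplus>\<^sub>TT Da \<otimes>\<^sub>TT Dg"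
  by (simp add: ex Hr.bg ptb HH.T.a_ac)
 have sq: "HH.pt (aH \<otimes>\<^sub>H gH) aH \<in> carrier TT" by simp
 show "Db \<otimes>\<^sub>TT Da = Da \<otimes>\<^sub>TT Db \<oplus>\<^sub>TT (1/2) \<odot>\<^sub>TT (Da \<otimes>\<^sub>TT Da)"
  apply (simp add: ex Hr.ba Hr.bg ptb HH.T.smult_r_distr HH.T.smult_closed H.smult_closed HH.T.a_ac)
  \<comment> \<open>The term \<open>a g \<otimes> a\<close> occurs once on the left and as two
    halves on the right.\<close>
  apply (subst half_add[OF sq HH.T.assoc_algebra_self, symmetric])
  apply (simp add: HH.T.smult_closed HH.T.a_ac)
  done
 \<comment> \<open>The summands of \<open>Da\<close> commute, so 0 takes the place of
   \<open>a\<close> and the lemma is the additivity of the \<open>p\<close>-th power.\<close>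
 interpret J0: jordan_pow p ty TT "\<zero>\<^sub>TT" "HH.pt gH aH" "HH.pt aH \<one>\<^sub>H" "1/2"
  by unfold_locales (simp_all add: HH.pt_mult Hr.ga)
 have "(HH.pt gH aH \<oplus>\<^sub>TT HH.pt aH \<one>\<^sub>H) [^]\<^sub>TT p = \<zero>\<^sub>TT"
  unfolding J0.pow_add_p[OF refl] by (simp add: pt_pow Hr.ap pt_zero)
 then show "Da [^]\<^sub>TT p = \<zero>\<^sub>TT" by (simp add: HH.T.a_comm)
 \<comment> \<open>The summands of \<open>Db\<close> do not commute. The role of \<open>g\<close> is
   played by \<open>g \<otimes> b\<close>, those of \<open>a\<close> and \<open>b\<close> by
   \<open>a \<otimes> 1\<close> and \<open>b \<otimes> 1\<close>.\<close>
 interpret J: jordan_pow p ty TT "HH.pt aH \<one>\<^sub>H" "HH.pt gH bH" "HH.pt bH \<one>\<^sub>H" "1/2"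
  by unfold_locales (simp_all add: HH.pt_mult Hr.ga Hr.ba Hr.bg ptb H.smult_closed)
 have "(HH.pt gH bH \<oplus>\<^sub>TT HH.pt bH \<one>\<^sub>H) [^]\<^sub>TT p = \<zero>\<^sub>TT"
  unfolding J.pow_add_p[OF refl] by (simp add: pt_pow Hr.bp pt_zero)
 then show "Db [^]\<^sub>TT p = \<zero>\<^sub>TT" by (simp add: HH.T.a_comm)
 show "Dg [^]\<^sub>TT p = \<one>\<^sub>TT" by (simp add: pt_pow Hr.gp HH.pt_one)
qed

text \<open>The inverse of \<open>g\<close>, as a power; \<open>p - Suc 0\<close> is the form to
  which the simplifier brings \<open>p - 1\<close>.\<close>

abbreviation gi where "gi \<equiv> gH [^]\<^sub>H (p - Suc 0)"

lemma gi: "gH \<otimes>\<^sub>H gi = \<one>\<^sub>H" "gi \<otimes>\<^sub>H gH = \<one>\<^sub>H"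
proof -
 have "Suc (p - Suc 0) = p" using V.p0 by simp
 then show "gH \<otimes>\<^sub>H gi = \<one>\<^sub>H" "gi \<otimes>\<^sub>H gH = \<one>\<^sub>H"
  using H.nat_pow_Suc2[of gH "p - Suc 0"] H.nat_pow_Suc[of gH "p - Suc 0"] Hr.gp by simp_all
qed

lemma gi_cancel: "x \<in> carrier H ==> gH \<otimes>\<^sub>H (gi \<otimes>\<^sub>H x) = x" "x \<in> carrier H ==> gi \<otimes>\<^sub>H (gH \<otimes>\<^sub>H x) = x"
 using gi by (simp_all add: H.m_assoc[symmetric])

lemma gi_a: "gi \<otimes>\<^sub>H aH = aH \<otimes>\<^sub>H gi"
proof -
 have "gi \<otimes>\<^sub>H aH = gi \<otimes>\<^sub>H ((aH \<otimes>\<^sub>H gH) \<otimes>\<^sub>H gi)" by (simp add: H.m_assoc gi)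
 also have "\<dots> = gi \<otimes>\<^sub>H (gH \<otimes>\<^sub>H (aH \<otimes>\<^sub>H gi))" by (simp add: Hr.ga[symmetric] H.m_assoc)
 finally show ?thesis by (simp add: gi_cancel)
qed

lemma b_gi: "gi \<otimes>\<^sub>H bH = bH \<otimes>\<^sub>H gi \<oplus>\<^sub>H aH \<otimes>\<^sub>H gi"
proof -
 have "gi \<otimes>\<^sub>H bH = gi \<otimes>\<^sub>H ((bH \<otimes>\<^sub>H gH) \<otimes>\<^sub>H gi)" by (simp add: H.m_assoc gi)
 also have "\<dots> = gi \<otimes>\<^sub>H (gH \<otimes>\<^sub>H (bH \<otimes>\<^sub>H gi) \<oplus>\<^sub>H gH \<otimes>\<^sub>H (aH \<otimes>\<^sub>H gi))"
  unfolding Hr.bg Hr.ga[symmetric] by (simp add: H.m_assoc H.l_distr)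
 also have "\<dots> = bH \<otimes>\<^sub>H gi \<oplus>\<^sub>H aH \<otimes>\<^sub>H gi" by (simp add: H.r_distr gi_cancel)
 finally show ?thesis .
qed

lemma gi_pow: "gi [^]\<^sub>H p = \<one>\<^sub>H"
proof -
 have "gi [^]\<^sub>H p = (gH [^]\<^sub>H p) [^]\<^sub>H (p - Suc 0)" by (simp add: H.nat_pow_pow mult.commute)
 then show ?thesis by (simp add: Hr.gp)
qed

lemma neg_pow: "x \<in> carrier H ==> x [^]\<^sub>H (n::nat) = \<zero>\<^sub>H ==> (\<ominus>\<^sub>H x) [^]\<^sub>H n = \<zero>\<^sub>H"
proof -
 assume x: "x \<in> carrier H" "x [^]\<^sub>H n = \<zero>\<^sub>H"
 have "(\<ominus>\<^sub>H x) [^]\<^sub>H n = x [^]\<^sub>H n \<or> (\<ominus>\<^sub>H x) [^]\<^sub>H n = \<ominus>\<^sub>H (x [^]\<^sub>H n)" for n :: nat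
  by (induct n) (use x(1) in \<open>auto simp: H.l_minus H.r_minus\<close>)
 from this[of n] show ?thesis using x by auto
qed

text \<open>The antipode law at \<open>\<Delta>(a) = a \<otimes> 1 + g \<otimes> a\<close> forces
  \<open>S(a) = - g^(-1) a\<close>, and likewise for \<open>b\<close>. These values have to satisfy
  the relations with products reversed.\<close>

lemma antipode_rels: "pbw_rels p (opp H) (\<ominus>\<^sub>H (gi \<otimes>\<^sub>H aH)) gi (\<ominus>\<^sub>H (gi \<otimes>\<^sub>H bH))"
proof (intro pbw_rels.intro pbw_field_axioms jordan_rels.intro H.assoc_algebra_opp jordan_rels_axioms.intro pbw_rels_axioms.intro)
 \<comment> \<open>The elements \<open>- a\<close>, \<open>g^(-1)\<close>, \<open>b\<close> satisfy
   the relations with \<open>s = - (1/2)\<close>, so \<open>pow_mult_p\<close> gives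
   \<open>(g^(-1) b)^p = b^p = 0\<close>.\<close>
 interpret J: jordan_pow p ty H "\<ominus>\<^sub>H aH" gi bH "- (1/2)"
 proof unfold_locales
  show "gi \<otimes>\<^sub>H \<ominus>\<^sub>H aH = \<ominus>\<^sub>H aH \<otimes>\<^sub>H gi" by (simp add: H.l_minus H.r_minus gi_a)
  show "bH \<otimes>\<^sub>H \<ominus>\<^sub>H aH = \<ominus>\<^sub>H aH \<otimes>\<^sub>H bH \<oplus>\<^sub>H (- (1/2)) \<odot>\<^sub>H (\<ominus>\<^sub>H aH \<otimes>\<^sub>H \<ominus>\<^sub>H aH)"
   by (simp add: H.l_minus H.r_minus Hr.ba H.minus_add H.smult_closed H.smult_minus_left)
  show "bH \<otimes>\<^sub>H gi = gi \<otimes>\<^sub>H bH \<oplus>\<^sub>H \<ominus>\<^sub>H aH \<otimes>\<^sub>H gi"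
   by (simp add: b_gi H.l_minus H.a_assoc H.r_neg)
 qed simp_all
 have "(gi \<otimes>\<^sub>H bH) [^]\<^sub>H p = \<zero>\<^sub>H"
  unfolding J.pow_mult_p[OF refl gi_pow] by (rule Hr.bp)
 then show "\<ominus>\<^sub>H (gi \<otimes>\<^sub>H bH) [^]\<^bsub>opp H\<^esub> p = \<zero>\<^bsub>opp H\<^esub>"
  by (simp add: H.opp_pow neg_pow)
 have "(gi \<otimes>\<^sub>H aH) [^]\<^sub>H p = gi [^]\<^sub>H p \<otimes>\<^sub>H aH [^]\<^sub>H p"
  by (rule H.pow_mult_distrib[OF gi_a]) simp_all
 then show "\<ominus>\<^sub>H (gi \<otimes>\<^sub>H aH) [^]\<^bsub>opp H\<^esub> p = \<zero>\<^bsub>opp H\<^esub>"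
  by (simp add: H.opp_pow neg_pow Hr.ap gi_pow)
 show "gi [^]\<^bsub>opp H\<^esub> p = \<one>\<^bsub>opp H\<^esub>" by (simp add: H.opp_pow gi_pow)
 show "\<ominus>\<^sub>H (gi \<otimes>\<^sub>H aH) \<in> carrier (opp H)" "gi \<in> carrier (opp H)" "\<ominus>\<^sub>H (gi \<otimes>\<^sub>H bH) \<in> carrier (opp H)" by simp_all
 have gia: "gi \<otimes>\<^sub>H (aH \<otimes>\<^sub>H x) = aH \<otimes>\<^sub>H (gi \<otimes>\<^sub>H x)" if "x \<in> carrier H" for x
  using that gi_a by (simp add: H.m_assoc[symmetric])
 show "gi \<otimes>\<^bsub>opp H\<^esub> \<ominus>\<^sub>H (gi \<otimes>\<^sub>H aH) = \<ominus>\<^sub>H (gi \<otimes>\<^sub>H aH) \<otimes>\<^bsub>opp H\<^esub> gi"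
  by (simp add: H.l_minus H.r_minus H.m_assoc gi_a gia)
 have gib: "gi \<otimes>\<^sub>H (bH \<otimes>\<^sub>H x) = bH \<otimes>\<^sub>H (gi \<otimes>\<^sub>H x) \<oplus>\<^sub>H aH \<otimes>\<^sub>H (gi \<otimes>\<^sub>H x)" if "x \<in> carrier H" for x
  using that b_gi by (simp add: H.m_assoc[symmetric] H.l_distr)
 show "\<ominus>\<^sub>H (gi \<otimes>\<^sub>H bH) \<otimes>\<^bsub>opp H\<^esub> gi = gi \<otimes>\<^bsub>opp H\<^esub> \<ominus>\<^sub>H (gi \<otimes>\<^sub>H bH) \<oplus>\<^bsub>opp H\<^esub> \<ominus>\<^sub>H (gi \<otimes>\<^sub>H aH) \<otimes>\<^bsub>opp H\<^esub> gi"
  by (simp add: H.l_minus H.r_minus H.m_assoc b_gi gi_a gia gib H.r_distr H.l_distr H.minus_add H.a_ac)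
 let ?x = "aH \<otimes>\<^sub>H (aH \<otimes>\<^sub>H (gi \<otimes>\<^sub>H gi))"
 have x: "?x \<in> carrier H" by simp
 have ba': "bH \<otimes>\<^sub>H (aH \<otimes>\<^sub>H x) = aH \<otimes>\<^sub>H (bH \<otimes>\<^sub>H x) \<oplus>\<^sub>H (1/2) \<odot>\<^sub>H (aH \<otimes>\<^sub>H (aH \<otimes>\<^sub>H x))" if "x \<in> carrier H" for x
  using that Hr.ba by (simp add: H.m_assoc[symmetric] H.l_distr H.smult_closed H.smult_mult_l)
 show "\<ominus>\<^sub>H (gi \<otimes>\<^sub>H bH) \<otimes>\<^bsub>opp H\<^esub> \<ominus>\<^sub>H (gi \<otimes>\<^sub>H aH) =
   \<ominus>\<^sub>H (gi \<otimes>\<^sub>H aH) \<otimes>\<^bsub>opp H\<^esub> \<ominus>\<^sub>H (gi \<otimes>\<^sub>H bH) \<oplus>\<^bsub>opp H\<^esub>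
   (1/2) \<odot>\<^bsub>opp H\<^esub> (\<ominus>\<^sub>H (gi \<otimes>\<^sub>H aH) \<otimes>\<^bsub>opp H\<^esub> \<ominus>\<^sub>H (gi \<otimes>\<^sub>H aH))"
 proof -
  have h1: "(1/2) \<odot>\<^sub>H ?x \<oplus>\<^sub>H (1/2) \<odot>\<^sub>H ?x = ?x" by (rule half_add[OF x H.assoc_algebra_self])
  have h2: "(1/2) \<odot>\<^sub>H ?x \<oplus>\<^sub>H ((1/2) \<odot>\<^sub>H ?x \<oplus>\<^sub>H y) = ?x \<oplus>\<^sub>H y" if "y \<in> carrier H" for y
   using that h1 x by (simp add: H.a_assoc[symmetric] H.smult_closed)
  show ?thesis
   by (simp add: H.l_minus H.r_minus H.m_assoc b_gi gi_a gia gib ba' H.r_distr H.l_distr H.minus_add H.smult_closed H.a_ac h1 h2)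
 qed
qed

end

locale skew_hopf = skew_setup p ty G gg act
 for p and ty :: "'k::field itself" and G :: "('g, 'c) monoid_scheme" and gg act +
 fixes \<epsilon> :: "'k presented \<Rightarrow> 'k"
 assumes eps: "\<epsilon> \<in> algebra_hom (alg_A p) ground_algebra" and eps_gens: "\<epsilon> (gen_a p) = 0" "\<epsilon> (gen_b p) = 0"
begin

abbreviation eH where "eH \<equiv> skew_augmentation AA \<epsilon>"

lemmas eps_simps = algebra_homD(2-)[OF eps, simplified]

lemma eps_zero: "\<epsilon> \<zero>\<^sub>AA = 0"
 using linear_maps_zero[OF A.assoc_algebra_self assoc_algebra_ground algebra_homD(1)[OF eps]] by simp

text \<open>The action of \<open>g\<close> only replaces \<open>b\<close> by \<open>b - a\<close>,
  and \<epsilon> kills both letters; every element of \<open>G\<close> is a power of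
  \<open>g\<close>.\<close>

lemma eps_la: "x \<in> carrier AA ==> h \<in> carrier G ==> \<epsilon> (la h x) = \<epsilon> x"
proof -
 have gen: "\<epsilon> (la gg x) = \<epsilon> x" if "x \<in> carrier AA" for x
  using that
 proof (induct x rule: A_induct)
  case (b x)
  have "\<epsilon> (eb \<ominus>\<^sub>AA ea) = 0"
  proof -
   interpret K: assoc_algebra "ground_algebra :: ('k, 'k) module" by (rule assoc_algebra_ground)
   have "(0 :: 'k) \<ominus>\<^bsub>ground_algebra\<^esub> 0 = 0" using K.r_neg[of 0] unfolding K.minus_eq by simp
   then show ?thesis
    using linear_maps_minus[OF A.assoc_algebra_self assoc_algebra_ground algebra_homD(1)[OF eps], of eb ea] by (simp add: eps_gens)
  qed
  then show ?case using b by (simp add: lact_simps eps_simps la_b eps_gens)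
 qed (simp_all add: lact_simps eps_simps la_a eps_gens)
 have "\<epsilon> (la (gg [^]\<^sub>G k) x) = \<epsilon> x" if x: "x \<in> carrier AA" for x and k :: nat
  using x
 proof (induct k arbitrary: x)
  case 0
  then show ?case by (simp add: lact_one)
 next
  case (Suc k)
  have c: "la gg x \<in> carrier AA" using Suc(2) by (simp add: lact_simps)
  show ?case using Suc(1)[OF c] gen[OF Suc(2)] Suc(2) by (simp add: lact_mult)
 qed
 then show "x \<in> carrier AA ==> h \<in> carrier G ==> \<epsilon> (la h x) = \<epsilon> x" using G_elem by blast
qed

lemma eH_sum: "f \<in> carrier H ==> eH f = (\<Sum>h\<in>carrier G. \<epsilon> (f h))"
 unfolding skew_augmentation_def using finite_G
 by (intro sum.mono_neutral_left) (auto simp: eps_zero H_out)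

lemma eH_hom: "eH \<in> algebra_hom H ground_algebra"
proof (intro algebra_homI linear_mapsI)
 fix f f' c assume f: "f \<in> carrier H"
 show "eH f \<in> carrier ground_algebra" by simp
 have "eH (c \<odot>\<^sub>H f) = (\<Sum>h\<in>carrier G. c * \<epsilon> (f h))"
  using f by (simp add: eH_sum H.smult_closed) (simp add: H_sel eps_simps H_closed)
 then show "eH (c \<odot>\<^sub>H f) = c \<odot>\<^bsub>ground_algebra\<^esub> eH f" using f by (simp add: eH_sum sum_distrib_left)
 assume f': "f' \<in> carrier H"
 have "eH (f \<oplus>\<^sub>H f') = (\<Sum>h\<in>carrier G. \<epsilon> (f h) + \<epsilon> (f' h))"
  using f f' by (simp add: eH_sum) (simp add: H_sel eps_simps H_closed)
 then show "eH (f \<oplus>\<^sub>H f') = eH f \<oplus>\<^bsub>ground_algebra\<^esub> eH f'" using f f' by (simp add: eH_sum sum.distrib)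
 have "eH (f \<otimes>\<^sub>H f') = (\<Sum>u\<in>carrier G. \<Sum>h\<in>carrier G. \<epsilon> (f h) * \<epsilon> (f' (inv\<^bsub>G\<^esub> h \<otimes>\<^sub>G u)))"
  unfolding eH_sum[OF H.m_closed[OF f f']]
 proof (intro sum.cong refl)
  fix u assume u: "u \<in> carrier G"
  show "\<epsilon> ((f \<otimes>\<^sub>H f') u) = (\<Sum>h\<in>carrier G. \<epsilon> (f h) * \<epsilon> (f' (inv\<^bsub>G\<^esub> h \<otimes>\<^sub>G u)))"
   unfolding H_mult[OF f f' u]
   using linear_maps_finsum[OF A.assoc_algebra_self assoc_algebra_ground algebra_homD(1)[OF eps] finite_G, of "\<lambda>h. f h \<otimes>\<^sub>AA la h (f' (inv\<^bsub>G\<^esub> h \<otimes>\<^sub>G u))"]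
   by (simp add: finsum_ground[OF finite_G] term_closed f f' eps_simps H_closed lact_simps eps_la)
 qed
 also have "\<dots> = (\<Sum>h\<in>carrier G. \<Sum>u\<in>carrier G. \<epsilon> (f h) * \<epsilon> (f' (inv\<^bsub>G\<^esub> h \<otimes>\<^sub>G u)))" by (rule sum.swap)
 also have "\<dots> = (\<Sum>h\<in>carrier G. \<epsilon> (f h) * eH f')"
 proof (intro sum.cong refl)
  fix h assume h: "h \<in> carrier G"
  then have bij: "bij_betw (\<lambda>m. inv\<^bsub>G\<^esub> h \<otimes>\<^sub>G m) (carrier G) (carrier G)"
   using G.inj_on_cmult[of "inv\<^bsub>G\<^esub> h"] G.surj_const_mult[of "inv\<^bsub>G\<^esub> h"] by (simp add: bij_betw_def)
  show "(\<Sum>u\<in>carrier G. \<epsilon> (f h) * \<epsilon> (f' (inv\<^bsub>G\<^esub> h \<otimes>\<^sub>G u))) = \<epsilon> (f h) * eH f'"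
   unfolding sum_distrib_left[symmetric] eH_sum[OF f']
   using sum.reindex_bij_betw[OF bij, of "\<lambda>u. \<epsilon> (f' u)"] by simp
 qed
 finally show "eH (f \<otimes>\<^sub>H f') = eH f \<otimes>\<^bsub>ground_algebra\<^esub> eH f'"
  using f by (simp add: eH_sum sum_distrib_right)
next
 show "eH \<one>\<^sub>H = \<one>\<^bsub>ground_algebra\<^esub>"
  using finite_G by (simp add: eH_sum) (simp add: H_sel skew_elt_def if_distrib eps_simps eps_zero sum.delta cong: if_cong)
qed

lemmas eH_simps = algebra_homD(2-)[OF eH_hom, simplified]

lemma eH_gens: "eH aH = 0" "eH bH = 0" "eH gH = 1"
 using finite_G by (simp_all add: eH_sum) (simp_all add: skew_elt_def if_distrib eps_simps eps_gens eps_zero sum.delta cong: if_cong)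

text \<open>Coassociativity and the counit laws compare algebra homomorphisms, so generators
  suffice. The antipode laws are not of this kind and are propagated along products.\<close>

theorem hopf_structure:
 "\<exists>\<Delta> S. hopf_algebra H \<Delta> eH S \<and> \<Delta> gH = HH.pt gH gH \<and> \<Delta> aH = Da \<and> \<Delta> bH = Db"
proof -
 obtain \<Delta> where D: "\<Delta> \<in> algebra_hom H TT" and Dgens: "\<Delta> aH = Da" "\<Delta> gH = Dg" "\<Delta> bH = Db"
  using H_universal[OF comult_rels] by blast
 obtain S where S: "S \<in> algebra_hom H (opp H)"
  and Sgens: "S aH = \<ominus>\<^sub>H (gi \<otimes>\<^sub>H aH)" "S gH = gi" "S bH = \<ominus>\<^sub>H (gi \<otimes>\<^sub>H bH)"
  using H_universal[OF antipode_rels] by blast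
 note Dh = algebra_homD[OF D] and Sh = algebra_homD(2-)[OF S, simplified]
 note HA = H.assoc_algebra_self and TA = HH.T.assoc_algebra_self
 note ptb = bilinear_mapsD[OF HH.pt_bilinear]
 interpret L: two_algebras TT H using TA HA by (simp add: two_algebras_def)
 interpret R: two_algebras H TT using TA HA by (simp add: two_algebras_def)
 note Lm = tensor_map_hom[OF HA HA TA HA D algebra_hom_id] and Rm = tensor_map_hom[OF HA HA HA TA algebra_hom_id D]
 note As = tensor_assoc_hom[OF HA HA HA]
 note lp = bilinear_mapsD[OF L.pt_bilinear] and rp = bilinear_mapsD[OF R.pt_bilinear]
 have co: "tensor_assoc H H H (tensor_lift L.T (\<lambda>y z. L.pt (\<Delta> y) z) (\<Delta> x)) = tensor_lift R.T (\<lambda>y z. R.pt y (\<Delta> z)) (\<Delta> x)"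
  if "x \<in> carrier H" for x
 proof (rule H_hom_eq[OF R.T.assoc_algebra_self _ _ _ _ _ that])
  show "(\<lambda>x. tensor_assoc H H H (tensor_lift L.T (\<lambda>y z. L.pt (\<Delta> y) z) (\<Delta> x))) \<in> algebra_hom H R.T"
   by (rule algebra_hom_comp[OF algebra_hom_comp[OF D Lm(1)] As(1)])
  show "(\<lambda>x. tensor_lift R.T (\<lambda>y z. R.pt y (\<Delta> z)) (\<Delta> x)) \<in> algebra_hom H R.T"
   by (rule algebra_hom_comp[OF D Rm(1)])
 qed (simp_all add: Dgens algebra_homD[OF Lm(1)] Lm(2) algebra_homD[OF Rm(1)] Rm(2) algebra_homD[OF As(1)] As(2) lp rp Dh(6) HH.pt_one L.T.a_closed R.T.a_ac)
 have smc: "c \<odot>\<^sub>H (d \<odot>\<^sub>H x) = d \<odot>\<^sub>H (c \<odot>\<^sub>H x)" if "x \<in> carrier H" for c d x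
  using H.smult_assoc1[OF that, of c d] H.smult_assoc1[OF that, of d c] by (simp add: mult.commute)
 have cl: "(\<lambda>y z. eH y \<odot>\<^sub>H z) \<in> bilinear_maps H H H"
  by (rule bilinear_mapsI) (simp_all add: H.smult_closed eH_simps H.smult_l_distr H.smult_r_distr H.smult_assoc1 smc)
 have clh: "tensor_lift H (\<lambda>y z. eH y \<odot>\<^sub>H z) \<in> algebra_hom TT H"
  by (rule HH.tensor_lift_hom[OF HA cl]) (simp_all add: eH_simps H.smult_mult_l H.smult_mult_r H.smult_assoc1 H.smult_closed H.smult_one smc)
 have cr: "(\<lambda>y z. eH z \<odot>\<^sub>H y) \<in> bilinear_maps H H H"
  by (rule bilinear_mapsI) (simp_all add: H.smult_closed eH_simps H.smult_l_distr H.smult_r_distr H.smult_assoc1 smc)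
 have crh: "tensor_lift H (\<lambda>y z. eH z \<odot>\<^sub>H y) \<in> algebra_hom TT H"
  by (rule HH.tensor_lift_hom[OF HA cr]) (simp_all add: eH_simps H.smult_mult_l H.smult_mult_r H.smult_assoc1 H.smult_closed H.smult_one smc)
 have cleft: "tensor_lift H (\<lambda>y z. eH y \<odot>\<^sub>H z) (\<Delta> x) = x" if "x \<in> carrier H" for x
  by (rule H_hom_eq[OF HA algebra_hom_comp[OF D clh] algebra_hom_id _ _ _ that])
   (simp_all add: Dgens algebra_homD[OF clh] HH.tensor_lift_pt[OF HA cl] eH_gens H.smult_one)
 have cright: "tensor_lift H (\<lambda>y z. eH z \<odot>\<^sub>H y) (\<Delta> x) = x" if "x \<in> carrier H" for x
  by (rule H_hom_eq[OF HA algebra_hom_comp[OF D crh] algebra_hom_id _ _ _ that])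
   (simp_all add: Dgens algebra_homD[OF crh] HH.tensor_lift_pt[OF HA cr] eH_gens eH_simps H.smult_one)
 have sl: "(\<lambda>y z. S y \<otimes>\<^sub>H z) \<in> bilinear_maps H H H"
  by (rule bilinear_mapsI) (simp_all add: Sh H.l_distr H.r_distr H.smult_mult_l H.smult_mult_r)
 have sr: "(\<lambda>y z. y \<otimes>\<^sub>H S z) \<in> bilinear_maps H H H"
  by (rule bilinear_mapsI) (simp_all add: Sh H.l_distr H.r_distr H.smult_mult_l H.smult_mult_r)
 let ?l = "tensor_lift H (\<lambda>y z. S y \<otimes>\<^sub>H z)" and ?r = "tensor_lift H (\<lambda>y z. y \<otimes>\<^sub>H S z)"
 note ll = linear_mapsD[OF HH.tensor_lift_linear[OF HA sl]] and lpt = HH.tensor_lift_pt[OF HA sl]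
 note rl = linear_mapsD[OF HH.tensor_lift_linear[OF HA sr]] and rpt = HH.tensor_lift_pt[OF HA sr]
 \<comment> \<open>\<open>?l\<close> is not multiplicative; on a product it wraps the pure factor
   around its value at the other factor. When that value is a scalar it can be pulled out, which is
   \<open>lm2\<close>.\<close>
 have lm: "?l (X \<otimes>\<^sub>TT HH.pt y z) = S y \<otimes>\<^sub>H ?l X \<otimes>\<^sub>H z" if "X \<in> carrier TT" "y \<in> carrier H" "z \<in> carrier H" for X y z
  using that
  by (induct X rule: HH.tensor_induct) (simp_all add: HH.pt_mult lpt Sh H.m_assoc HH.T.l_distr ll H.l_distr H.r_distr)
 have rm: "?r (HH.pt y z \<otimes>\<^sub>TT X) = y \<otimes>\<^sub>H ?r X \<otimes>\<^sub>H S z" if "X \<in> carrier TT" "y \<in> carrier H" "z \<in> carrier H" for X y z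
  using that
  by (induct X rule: HH.tensor_induct) (simp_all add: HH.pt_mult rpt Sh H.m_assoc HH.T.r_distr rl H.l_distr H.r_distr)
 have lm2: "?l (X \<otimes>\<^sub>TT Y) = c \<odot>\<^sub>H ?l Y" if "X \<in> carrier TT" "Y \<in> carrier TT" "?l X = c \<odot>\<^sub>H \<one>\<^sub>H" for X Y c
  using that(2)
 proof (induct Y rule: HH.tensor_induct)
  case (pure y z)
  then show ?case using that(1,3) by (simp add: lm lpt Sh H.smult_mult_r H.smult_mult_l)
 next
  case (add u v)
  then show ?case using that(1) by (simp add: HH.T.r_distr ll H.smult_r_distr)
 qed
 have rm2: "?r (X \<otimes>\<^sub>TT Y) = c \<odot>\<^sub>H ?r X" if "X \<in> carrier TT" "Y \<in> carrier TT" "?r Y = c \<odot>\<^sub>H \<one>\<^sub>H" for X Y c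
  using that(1)
 proof (induct X rule: HH.tensor_induct)
  case (pure y z)
  then show ?case using that(2,3) by (simp add: rm rpt Sh H.smult_mult_r H.smult_mult_l)
 next
  case (add u v)
  then show ?case using that(2) by (simp add: HH.T.l_distr rl H.smult_r_distr)
 qed
 have lgen: "?l Da = \<zero>\<^sub>H" "?l Db = \<zero>\<^sub>H" "?l Dg = \<one>\<^sub>H" "?l \<one>\<^sub>TT = \<one>\<^sub>H"
  by (simp_all add: ll lpt Sgens Sh gi HH.pt_one H.l_neg)
 have rgen: "?r Da = \<zero>\<^sub>H" "?r Db = \<zero>\<^sub>H" "?r Dg = \<one>\<^sub>H" "?r \<one>\<^sub>TT = \<one>\<^sub>H"
  by (simp_all add: rl rpt Sgens Sh gi HH.pt_one H.r_minus gi_cancel H.r_neg)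
 \<comment> \<open>The left law puts the left factor of a product innermost, the right law the right
   factor. So the induction uses the value at the generator here, and the induction hypothesis for
   \<open>\<Delta> x\<close> in \<open>ar\<close>.\<close>
 have al: "?l (\<Delta> x) = eH x \<odot>\<^sub>H \<one>\<^sub>H" if "x \<in> carrier H" for x
  using that
 proof (induct x rule: H_induct)
  case (a x)
  have "?l Da = 0 \<odot>\<^sub>H \<one>\<^sub>H" by (simp add: lgen)
  from lm2[OF _ _ this] show ?case using a by (simp add: Dh Dgens eH_simps eH_gens H.smult_closed)
 next
  case (b x)
  have "?l Db = 0 \<odot>\<^sub>H \<one>\<^sub>H" by (simp add: lgen)
  from lm2[OF _ _ this] show ?case using b by (simp add: Dh Dgens eH_simps eH_gens H.smult_closed)
 next
  case (g x)
  have "?l Dg = 1 \<odot>\<^sub>H \<one>\<^sub>H" by (simp add: lgen H.smult_one)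
  from lm2[OF _ _ this] show ?case using g by (simp add: Dh Dgens eH_simps eH_gens H.smult_one H.smult_closed)
 qed (simp_all add: Dh ll lgen eH_simps H.smult_one H.smult_l_distr H.smult_assoc1)
 have ar: "?r (\<Delta> x) = eH x \<odot>\<^sub>H \<one>\<^sub>H" if "x \<in> carrier H" for x
  using that
 proof (induct x rule: H_induct)
  case (a x)
  then have "?r (Da \<otimes>\<^sub>TT \<Delta> x) = eH x \<odot>\<^sub>H ?r Da" by (intro rm2) (simp_all add: Dh)
  then show ?case using a by (simp add: Dh Dgens eH_simps eH_gens rgen)
 next
  case (b x)
  then have "?r (Db \<otimes>\<^sub>TT \<Delta> x) = eH x \<odot>\<^sub>H ?r Db" by (intro rm2) (simp_all add: Dh)
  then show ?case using b by (simp add: Dh Dgens eH_simps eH_gens rgen)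
 next
  case (g x)
  then have "?r (Dg \<otimes>\<^sub>TT \<Delta> x) = eH x \<odot>\<^sub>H ?r Dg" by (intro rm2) (simp_all add: Dh)
  then show ?case using g by (simp add: Dh Dgens eH_simps eH_gens rgen)
 qed (simp_all add: Dh rl rgen eH_simps H.smult_one H.smult_l_distr H.smult_assoc1)
 have "S \<in> linear_maps H H" using algebra_homD(1)[OF S] by (simp add: linear_maps_def)
 then have "hopf_algebra H \<Delta> eH S"
  by (intro hopf_algebra.intro HA hopf_algebra_axioms.intro D eH_hom co cleft cright al ar)
 then show ?thesis using Dgens by blast
qed

end

section \<open>Projective modules\<close>

lemma mod_homI:
 assumes "\<And>x. x \<in> carrier M ==> f x \<in> carrier N"
  "\<And>x y. x \<in> carrier M ==> y \<in> carrier M ==> f (x \<oplus>\<^sub>M y) = f x \<oplus>\<^sub>N f y"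
  "\<And>r x. r \<in> carrier R ==> x \<in> carrier M ==> f (r \<odot>\<^sub>M x) = r \<odot>\<^sub>N f x"
  "left_module R M"
 shows "restrict f (carrier M) \<in> mod_hom R M N"
proof -
 interpret M: left_module R M by fact
 show ?thesis using assms(1-3) by (auto simp: mod_hom_def M.M.a_closed M.smult_closed)
qed

lemma mod_homD:
 assumes "f \<in> mod_hom R M N"
 shows "x \<in> carrier M ==> f x \<in> carrier N"
  "x \<in> carrier M ==> y \<in> carrier M ==> f (x \<oplus>\<^sub>M y) = f x \<oplus>\<^sub>N f y"
  "r \<in> carrier R ==> x \<in> carrier M ==> f (r \<odot>\<^sub>M x) = r \<odot>\<^sub>N f x"
  "f \<in> extensional (carrier M)"
 using assms by (auto simp: mod_hom_def PiE_iff)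

lemma mod_hom_eqI:
 assumes "f \<in> mod_hom R M N" "f' \<in> mod_hom R M N" "\<And>x. x \<in> carrier M ==> f x = f' x"
 shows "f = f'"
 using mod_homD(4)[OF assms(1)] mod_homD(4)[OF assms(2)] assms(3) by (rule extensionalityI)

lemma mod_hom_zero:
 assumes "f \<in> mod_hom R M N" "left_module R M" "left_module R N"
 shows "f \<zero>\<^sub>M = \<zero>\<^sub>N"
proof -
 interpret M: left_module R M by fact
 interpret N: left_module R N by fact
 have "f \<zero>\<^sub>M \<oplus>\<^sub>N f \<zero>\<^sub>M = f \<zero>\<^sub>M" using mod_homD(2)[OF assms(1), of "\<zero>\<^sub>M" "\<zero>\<^sub>M"] by simp
 then show ?thesis using mod_homD(1)[OF assms(1) M.M.zero_closed] by (metis N.M.add.r_cancel_one')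
qed

lemma mod_hom_comp:
 assumes "f \<in> mod_hom R M N" "h \<in> mod_hom R N L" "left_module R M"
 shows "compose (carrier M) h f \<in> mod_hom R M L"
 unfolding compose_def
 by (rule mod_homI[OF _ _ _ assms(3)]) (simp_all add: mod_homD[OF assms(1)] mod_homD[OF assms(2)])

lemma mod_hom_add:
 assumes "f \<in> mod_hom R M N" "h \<in> mod_hom R M N" "left_module R M" "left_module R N"
 shows "(\<lambda>x\<in>carrier M. f x \<oplus>\<^sub>N h x) \<in> mod_hom R M N"
proof -
 interpret N: left_module R N by fact
 show ?thesis
  by (rule mod_homI[OF _ _ _ assms(3)]) (simp_all add: mod_homD[OF assms(1)] mod_homD[OF assms(2)] N.M.a_ac N.smult_r_distr)
qed

lemma (in left_module) smult_minus: "r \<in> carrier R ==> x \<in> carrier M ==> r \<odot>\<^sub>M (\<ominus>\<^sub>M x) = \<ominus>\<^sub>M (r \<odot>\<^sub>M x)"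
 and smult_zero: "r \<in> carrier R ==> r \<odot>\<^sub>M \<zero>\<^sub>M = \<zero>\<^sub>M"
 and zero_smult: "x \<in> carrier M ==> \<zero>\<^sub>R \<odot>\<^sub>M x = \<zero>\<^sub>M"
proof -
 show z: "r \<odot>\<^sub>M \<zero>\<^sub>M = \<zero>\<^sub>M" if "r \<in> carrier R" for r
 proof -
  have "r \<odot>\<^sub>M \<zero>\<^sub>M \<oplus>\<^sub>M r \<odot>\<^sub>M \<zero>\<^sub>M = r \<odot>\<^sub>M \<zero>\<^sub>M" using smult_r_distr[of r "\<zero>\<^sub>M" "\<zero>\<^sub>M"] that by simp
  then show ?thesis using smult_closed[OF that, of "\<zero>\<^sub>M"] by (metis M.add.r_cancel_one' M.zero_closed)
 qed
 show "\<zero>\<^sub>R \<odot>\<^sub>M x = \<zero>\<^sub>M" if "x \<in> carrier M"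
 proof -
  have "\<zero>\<^sub>R \<odot>\<^sub>M x \<oplus>\<^sub>M \<zero>\<^sub>R \<odot>\<^sub>M x = \<zero>\<^sub>R \<odot>\<^sub>M x" using smult_l_distr[of "\<zero>\<^sub>R" "\<zero>\<^sub>R" x] that by simp
  then show ?thesis using smult_closed[of "\<zero>\<^sub>R" x] that by (metis M.add.r_cancel_one' R.zero_closed)
 qed
 assume r: "r \<in> carrier R" and x: "x \<in> carrier M"
 have "r \<odot>\<^sub>M (\<ominus>\<^sub>M x) \<oplus>\<^sub>M r \<odot>\<^sub>M x = \<zero>\<^sub>M" using smult_r_distr[of r "\<ominus>\<^sub>M x" x] r x z by (simp add: M.l_neg)
 then show "r \<odot>\<^sub>M (\<ominus>\<^sub>M x) = \<ominus>\<^sub>M (r \<odot>\<^sub>M x)" using r x smult_closed by (intro M.minus_equality[symmetric]) auto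
qed

lemma mod_hom_uminus:
 assumes "f \<in> mod_hom R M N" "left_module R M" "left_module R N" "x \<in> carrier M"
 shows "f (\<ominus>\<^sub>M x) = \<ominus>\<^sub>N f x"
proof -
 interpret M: left_module R M by fact
 interpret N: left_module R N by fact
 have "f (\<ominus>\<^sub>M x) \<oplus>\<^sub>N f x = \<zero>\<^sub>N"
  using mod_homD(2)[OF assms(1), of "\<ominus>\<^sub>M x" x] mod_hom_zero[OF assms(1-3)] assms(4) by (simp add: M.M.l_neg)
 then show ?thesis using mod_homD(1)[OF assms(1)] assms(4) by (intro N.M.minus_equality[symmetric]) auto
qed

lemma mod_hom_diff:
 assumes "f \<in> mod_hom R M N" "h \<in> mod_hom R M N" "left_module R M" "left_module R N"
 shows "(\<lambda>x\<in>carrier M. f x \<ominus>\<^sub>N h x) \<in> mod_hom R M N"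
proof -
 interpret N: left_module R N by fact
 show ?thesis
  by (rule mod_homI[OF _ _ _ assms(3)])
   (simp_all add: mod_homD[OF assms(1)] mod_homD[OF assms(2)] N.M.minus_eq N.smult_r_distr N.smult_minus N.M.minus_add N.M.a_ac)
qed

definition single :: "('r, 'c) ring_scheme \<Rightarrow> 'x \<Rightarrow> 'r \<Rightarrow> 'x \<Rightarrow> 'r" where
 "single R e r = (\<lambda>x. if x = e then r else \<zero>\<^sub>R)"

text \<open>\<open>u e\<close> is merely additive in the coefficient: besides linear extensions this
  serves the maps \<open>r -> a' r (w e)\<close> built from a twisted action.\<close>

definition usum :: "('r, 'c) ring_scheme \<Rightarrow> ('r, 'n) module \<Rightarrow> ('x \<Rightarrow> 'r \<Rightarrow> 'n) \<Rightarrow> ('x \<Rightarrow> 'r) \<Rightarrow> 'n" where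
 "usum R N u x = (\<Oplus>\<^sub>N e\<in>{e. x e \<noteq> \<zero>\<^sub>R}. u e (x e))"

locale free_mod = R: ring R for R :: "('r, 'c) ring_scheme" and X :: "'x set"
begin

abbreviation F where "F \<equiv> free_left_module R X"

lemma F_sel: "x \<oplus>\<^sub>F y = (\<lambda>e. x e \<oplus>\<^sub>R y e)" "r \<odot>\<^sub>F x = (\<lambda>e. r \<otimes>\<^sub>R x e)" "\<zero>\<^sub>F = (\<lambda>_. \<zero>\<^sub>R)"
 by (simp_all add: free_left_module_def)

lemma F_mem: "x \<in> carrier F \<longleftrightarrow> (\<forall>e. x e \<in> carrier R) \<and> (\<forall>e. e \<notin> X \<longrightarrow> x e = \<zero>\<^sub>R) \<and> finite {e. x e \<noteq> \<zero>\<^sub>R}"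
 by (auto simp: free_left_module_def)

lemma F_add: "x \<in> carrier F ==> y \<in> carrier F ==> x \<oplus>\<^sub>F y \<in> carrier F"
proof -
 assume x: "x \<in> carrier F" and y: "y \<in> carrier F"
 have "{e. x e \<oplus>\<^sub>R y e \<noteq> \<zero>\<^sub>R} \<subseteq> {e. x e \<noteq> \<zero>\<^sub>R} \<union> {e. y e \<noteq> \<zero>\<^sub>R}" by auto
 moreover have "finite ({e. x e \<noteq> \<zero>\<^sub>R} \<union> {e. y e \<noteq> \<zero>\<^sub>R})" using x y by (simp add: F_mem)
 ultimately have "finite {e. x e \<oplus>\<^sub>R y e \<noteq> \<zero>\<^sub>R}" by (rule finite_subset)
 then show ?thesis using x y by (simp add: F_mem F_sel)
qed

lemma F_map: "x \<in> carrier F ==> h \<zero>\<^sub>R = \<zero>\<^sub>R ==> (\<And>r. r \<in> carrier R ==> h r \<in> carrier R) ==> (\<lambda>e. h (x e)) \<in> carrier F"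
proof -
 assume x: "x \<in> carrier F" and h: "h \<zero>\<^sub>R = \<zero>\<^sub>R" "\<And>r. r \<in> carrier R ==> h r \<in> carrier R"
 have "{e. h (x e) \<noteq> \<zero>\<^sub>R} \<subseteq> {e. x e \<noteq> \<zero>\<^sub>R}" using h by auto
 then have "finite {e. h (x e) \<noteq> \<zero>\<^sub>R}" using x finite_subset by (auto simp: F_mem)
 then show ?thesis using x h by (simp add: F_mem)
qed

lemma F_smult: "r \<in> carrier R ==> x \<in> carrier F ==> r \<odot>\<^sub>F x \<in> carrier F"
 unfolding F_sel by (rule F_map) auto

lemma F_single: "e \<in> X ==> r \<in> carrier R ==> single R e r \<in> carrier F"
 by (auto simp: F_mem single_def)

lemma F_induct [consumes 1, case_names zero single add]:
 assumes x: "x \<in> carrier F" and z: "Q \<zero>\<^sub>F" and s: "\<And>e r. e \<in> X ==> r \<in> carrier R ==> Q (single R e r)"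
  and a: "\<And>x y. x \<in> carrier F ==> y \<in> carrier F ==> Q x ==> Q y ==> Q (x \<oplus>\<^sub>F y)"
 shows "Q x"
proof -
 have "x \<in> carrier F \<longrightarrow> {e. x e \<noteq> \<zero>\<^sub>R} \<subseteq> S \<longrightarrow> Q x" if "finite S" "S \<subseteq> X" for S x
  using that
 proof (induct S arbitrary: x rule: finite_induct)
  case empty
  show ?case
  proof (intro impI)
   assume "{e. x e \<noteq> \<zero>\<^sub>R} \<subseteq> {}"
   then have "x = \<zero>\<^sub>F" by (simp add: F_sel fun_eq_iff)
   then show "Q x" using z by simp
  qed
 next
  case (insert e S)
  show ?case
  proof (intro impI)
   assume xc: "x \<in> carrier F" and sub: "{u. x u \<noteq> \<zero>\<^sub>R} \<subseteq> insert e S"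
   let ?y = "x(e := \<zero>\<^sub>R)"
   have e: "e \<in> X" "S \<subseteq> X" using insert(4) by auto
   have xe: "x e \<in> carrier R" using xc by (simp add: F_mem)
   have "{u. ?y u \<noteq> \<zero>\<^sub>R} \<subseteq> {u. x u \<noteq> \<zero>\<^sub>R}" by auto
   then have "finite {u. ?y u \<noteq> \<zero>\<^sub>R}" using xc finite_subset unfolding F_mem by blast
   then have yc: "?y \<in> carrier F" using xc by (simp add: F_mem)
   have "{u. ?y u \<noteq> \<zero>\<^sub>R} \<subseteq> S" using sub by (auto split: if_splits)
   then have "Q ?y" using insert(3)[of ?y] yc e by blast
   then have "Q (single R e (x e) \<oplus>\<^sub>F ?y)" by (intro a F_single e xe s yc)
   moreover have "single R e (x e) \<oplus>\<^sub>F ?y = x" using xc by (simp add: F_sel single_def fun_eq_iff F_mem)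
   ultimately show "Q x" by simp
  qed
 qed
 moreover have "finite {e. x e \<noteq> \<zero>\<^sub>R}" "{e. x e \<noteq> \<zero>\<^sub>R} \<subseteq> X" using x by (auto simp: F_mem)
 ultimately show ?thesis using x by blast
qed

end

locale free_usum = free_mod R X + N: abelian_group N
 for R :: "('r, 'c) ring_scheme" and X :: "'x set" and N :: "('r, 'n) module" +
 fixes u :: "'x \<Rightarrow> 'r \<Rightarrow> 'n"
 assumes u_closed: "e \<in> X ==> r \<in> carrier R ==> u e r \<in> carrier N"
  and u_add: "e \<in> X ==> r \<in> carrier R ==> s \<in> carrier R ==> u e (r \<oplus>\<^sub>R s) = u e r \<oplus>\<^sub>N u e s"
begin

lemma u_zero: "e \<in> X ==> u e \<zero>\<^sub>R = \<zero>\<^sub>N"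
 using u_add[of e "\<zero>\<^sub>R" "\<zero>\<^sub>R"] u_closed[of e "\<zero>\<^sub>R"] by (metis N.add.r_cancel_one' R.r_zero R.zero_closed)

lemma usum_superset: "finite S ==> {e. x e \<noteq> \<zero>\<^sub>R} \<subseteq> S ==> S \<subseteq> X ==> x \<in> carrier F ==> usum R N u x = (\<Oplus>\<^sub>N e\<in>S. u e (x e))"
 unfolding usum_def
 by (intro N.add.finprod_mono_neutral_cong_left) (auto simp: u_zero F_mem subset_iff intro!: u_closed)

lemma supp: "x \<in> carrier F ==> finite {e. x e \<noteq> \<zero>\<^sub>R}" "x \<in> carrier F ==> {e. x e \<noteq> \<zero>\<^sub>R} \<subseteq> X"
 by (auto simp: F_mem)

lemma usum_closed: "x \<in> carrier F ==> usum R N u x \<in> carrier N"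
 unfolding usum_def using supp(2)[of x] by (intro N.finsum_closed) (auto simp: F_mem intro!: u_closed)

lemma usum_single: "e \<in> X ==> r \<in> carrier R ==> usum R N u (single R e r) = u e r"
 by (subst usum_superset[of "{e}"]) (auto simp: F_single, auto simp: single_def u_closed split: if_splits)

lemma usum_zero: "usum R N u \<zero>\<^sub>F = \<zero>\<^sub>N"
 by (simp add: usum_def F_sel)

lemma usum_add: "x \<in> carrier F ==> y \<in> carrier F ==> usum R N u (x \<oplus>\<^sub>F y) = usum R N u x \<oplus>\<^sub>N usum R N u y"
proof -
 assume x: "x \<in> carrier F" and y: "y \<in> carrier F"
 let ?S = "{e. x e \<noteq> \<zero>\<^sub>R} \<union> {e. y e \<noteq> \<zero>\<^sub>R}"
 have S: "finite ?S" "?S \<subseteq> X" using supp[OF x] supp[OF y] by auto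
 have c: "\<And>e. x e \<in> carrier R" "\<And>e. y e \<in> carrier R" using x y by (auto simp: F_mem)
 have "usum R N u (x \<oplus>\<^sub>F y) = (\<Oplus>\<^sub>N e\<in>?S. u e ((x \<oplus>\<^sub>F y) e))"
  by (rule usum_superset[OF S(1) _ S(2) F_add[OF x y]]) (auto simp: F_sel)
 also have "\<dots> = (\<Oplus>\<^sub>N e\<in>?S. u e (x e) \<oplus>\<^sub>N u e (y e))"
  using S c by (intro N.finsum_cong') (auto simp: F_sel subset_iff u_add intro!: u_closed)
 also have "\<dots> = (\<Oplus>\<^sub>N e\<in>?S. u e (x e)) \<oplus>\<^sub>N (\<Oplus>\<^sub>N e\<in>?S. u e (y e))"
  using S c by (intro N.finsum_addf) (auto simp: subset_iff intro!: u_closed)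
 also have "(\<Oplus>\<^sub>N e\<in>?S. u e (x e)) = usum R N u x" using S x by (intro usum_superset[symmetric]) auto
 also have "(\<Oplus>\<^sub>N e\<in>?S. u e (y e)) = usum R N u y" using S y by (intro usum_superset[symmetric]) auto
 finally show ?thesis .
qed

end

lemma projective_moduleD:
 assumes "projective_module R (N :: ('r, 'm) module)"
 shows "left_module R N" "\<exists>X :: 'm set. \<exists>i \<in> mod_hom R N (free_left_module R X).
    \<exists>q \<in> mod_hom R (free_left_module R X) N. \<forall>x\<in>carrier N. q (i x) = x"
 using assms by (auto simp: projective_module_def)

text \<open>Preimages are chosen for the images of basis elements of the free module and transported
  along \<open>i\<close> and \<open>q\<close>. The condition concerns the image of \<open>g\<close>,
  which is how exactness of a resolution supplies it.\<close>

lemma projective_lift: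
 fixes N :: "('r, 'm) module" and A :: "('r, 'n) module" and B :: "('r, 'l) module"
 assumes N: "projective_module R N" and A: "left_module R A" and B: "left_module R B"
  and g: "g \<in> mod_hom R N B" and \<pi>: "\<pi> \<in> mod_hom R A B"
  and im: "\<And>x. x \<in> carrier N ==> g x \<in> \<pi> ` carrier A"
 shows "\<exists>\<phi>\<in>mod_hom R N A. \<forall>x\<in>carrier N. \<pi> (\<phi> x) = g x"
proof -
 interpret N: left_module R N by (rule projective_moduleD[OF N])
 interpret A: left_module R A by fact
 interpret B: left_module R B by fact
 obtain X :: "'m set" and i q where i: "i \<in> mod_hom R N (free_left_module R X)" and q: "q \<in> mod_hom R (free_left_module R X) N"
  and qi: "\<And>x. x \<in> carrier N ==> q (i x) = x"
  using projective_moduleD(2)[OF N] by blast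
 interpret F: free_mod R X by unfold_locales
 have "\<exists>y. \<forall>e\<in>X. y e \<in> carrier A \<and> \<pi> (y e) = g (q (single R e \<one>\<^sub>R))"
 proof (rule bchoice, rule ballI)
  fix e assume "e \<in> X"
  then have "q (single R e \<one>\<^sub>R) \<in> carrier N" using mod_homD(1)[OF q] F.F_single by auto
  from im[OF this] show "\<exists>y. y \<in> carrier A \<and> \<pi> y = g (q (single R e \<one>\<^sub>R))" by auto
 qed
 then obtain y where y: "\<And>e. e \<in> X ==> y e \<in> carrier A" "\<And>e. e \<in> X ==> \<pi> (y e) = g (q (single R e \<one>\<^sub>R))" by blast
 interpret U: free_usum R X A "\<lambda>e r. r \<odot>\<^sub>A y e"
  by unfold_locales (auto simp: y A.smult_closed A.smult_l_distr)
 let ?u = "usum R A (\<lambda>e r. r \<odot>\<^sub>A y e)"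
 have ul: "?u (r \<odot>\<^bsub>F.F\<^esub> x) = r \<odot>\<^sub>A ?u x" if "r \<in> carrier R" "x \<in> carrier F.F" for r x
  using that(2)
 proof (induct x rule: F.F_induct)
  case zero
  have "r \<odot>\<^bsub>F.F\<^esub> \<zero>\<^bsub>F.F\<^esub> = \<zero>\<^bsub>F.F\<^esub>" using that(1) by (simp add: F.F_sel)
  then show ?case using that(1) by (simp add: U.usum_zero A.smult_zero)
 next
  case (single e s)
  have "r \<odot>\<^bsub>F.F\<^esub> single R e s = single R e (r \<otimes>\<^sub>R s)" using that(1) by (simp add: F.F_sel single_def fun_eq_iff)
  then show ?case using that(1) single y by (simp add: U.usum_single A.smult_assoc)
 next
  case (add x x')
  have "r \<odot>\<^bsub>F.F\<^esub> (x \<oplus>\<^bsub>F.F\<^esub> x') = r \<odot>\<^bsub>F.F\<^esub> x \<oplus>\<^bsub>F.F\<^esub> r \<odot>\<^bsub>F.F\<^esub> x'"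
   using add(1,2) that(1) by (simp add: F.F_sel F.F_mem N.R.r_distr)
  then show ?case using add that(1) by (simp add: U.usum_add F.F_smult U.usum_closed A.smult_r_distr)
 qed
 have pu: "\<pi> (?u x) = g (q x)" if "x \<in> carrier F.F" for x
  using that
 proof (induct x rule: F.F_induct)
  case zero
  have "q \<zero>\<^bsub>F.F\<^esub> = \<zero>\<^sub>N"
  proof -
   have z: "\<zero>\<^bsub>F.F\<^esub> \<in> carrier F.F" "\<zero>\<^sub>R \<odot>\<^bsub>F.F\<^esub> \<zero>\<^bsub>F.F\<^esub> = \<zero>\<^bsub>F.F\<^esub>" by (simp_all add: F.F_sel F.F_mem)
   show ?thesis using mod_homD(3)[OF q N.R.zero_closed z(1)] z N.zero_smult mod_homD(1)[OF q z(1)] by simp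
  qed
  then show ?case by (simp add: U.usum_zero mod_hom_zero[OF \<pi> A B] mod_hom_zero[OF g N.left_module_axioms B])
 next
  case (single e r)
  have "single R e r = r \<odot>\<^bsub>F.F\<^esub> single R e \<one>\<^sub>R" using single by (simp add: F.F_sel single_def fun_eq_iff)
  then have "g (q (single R e r)) = r \<odot>\<^sub>B g (q (single R e \<one>\<^sub>R))"
   using single by (simp add: mod_homD(3)[OF q] mod_homD(3)[OF g] mod_homD(1)[OF q] F.F_single)
  then show ?case using single y by (simp add: U.usum_single mod_homD(3)[OF \<pi>])
 next
  case (add x x')
  then show ?case by (simp add: U.usum_add U.usum_closed mod_homD(2)[OF \<pi>] mod_homD(1,2)[OF q] mod_homD(2)[OF g])
 qed
 let ?\<phi> = "restrict (\<lambda>x. ?u (i x)) (carrier N)"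
 have "?\<phi> \<in> mod_hom R N A"
  by (rule mod_homI[OF _ _ _ N.left_module_axioms])
   (simp_all add: mod_homD[OF i] U.usum_closed U.usum_add ul)
 moreover have "\<forall>x\<in>carrier N. \<pi> (?\<phi> x) = g x" using pu qi mod_homD(1)[OF i] by simp
 ultimately show ?thesis by blast
qed

section \<open>The Yoneda ring of the trivial module\<close>

locale trivial_resolution = R: assoc_algebra R for R :: "('k::field, 'r) module" +
 fixes \<epsilon> :: "'r \<Rightarrow> 'k" and P :: "('r, 'm, 'k) aug_complex"
 assumes eps: "\<epsilon> \<in> algebra_hom R ground_algebra"
  and res: "projective_resolution R (trivial_module \<epsilon>) P"
begin

abbreviation M where "M \<equiv> trivial_module \<epsilon>"
abbreviation C where "C n \<equiv> carrier (obj P n)"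
abbreviation hom where "hom i j \<equiv> mod_hom R (obj P i) (obj P j)"
abbreviation coh where "coh n \<equiv> mod_hom R (obj P n) M"
abbreviation Z where "Z n \<equiv> cocycles R M P n"
abbreviation B where "B n \<equiv> coboundaries R M P n"

lemma eps_simps: "x \<in> carrier R ==> y \<in> carrier R ==> \<epsilon> (x \<oplus>\<^sub>R y) = \<epsilon> x + \<epsilon> y"
 "x \<in> carrier R ==> \<epsilon> (c \<odot>\<^sub>R x) = c * \<epsilon> x" "x \<in> carrier R ==> y \<in> carrier R ==> \<epsilon> (x \<otimes>\<^sub>R y) = \<epsilon> x * \<epsilon> y" "\<epsilon> \<one>\<^sub>R = 1"
 using algebra_homD[OF eps] by simp_all

lemma M_sel [simp]: "carrier M = UNIV" "x \<oplus>\<^sub>M y = x + y" "\<zero>\<^sub>M = 0" "r \<odot>\<^sub>M x = \<epsilon> r * x"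
 by (simp_all add: trivial_module_def)

lemma M_module: "left_module R M"
proof -
 have "abelian_group M" by (rule abelian_groupI) (auto simp: add_ac intro: exI[of _ "- _"] left_minus)
 then show ?thesis
  by (intro left_module.intro R.ring_axioms left_module_axioms.intro) (auto simp: eps_simps algebra_simps)
qed

lemma proj: "projective_module R (obj P n)" and bd_hom: "bd P n \<in> hom (Suc n) n" and aug_hom: "aug P \<in> coh 0"
 and aug_surj: "aug P ` C 0 = UNIV"
 and ex0: "{x \<in> C 0. aug P x = 0} = bd P 0 ` C (Suc 0)"
 and ex: "{x \<in> C (Suc n). bd P n x = \<zero>\<^bsub>obj P n\<^esub>} = bd P (Suc n) ` C (Suc (Suc n))"
 using res by (auto simp: projective_resolution_def)

lemma obj_module: "left_module R (obj P n)"
 using projective_moduleD(1)[OF proj] .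

sublocale O: left_module R "obj P n" for n by (rule obj_module)

lemmas bd = mod_homD[OF bd_hom] and aug = mod_homD[OF aug_hom, simplified]

lemma bd_bd: "x \<in> C (Suc (Suc n)) ==> bd P n (bd P (Suc n) x) = \<zero>\<^bsub>obj P n\<^esub>"
 using ex[of n] by blast
lemma aug_bd: "x \<in> C (Suc 0) ==> aug P (bd P 0 x) = 0"
 using ex0 by blast

lemma cohI: "(\<And>x. x \<notin> C n ==> f x = undefined) ==> (\<And>x y. x \<in> C n ==> y \<in> C n ==> f (x \<oplus>\<^bsub>obj P n\<^esub> y) = f x + f y) ==>
  (\<And>r x. r \<in> carrier R ==> x \<in> C n ==> f (r \<odot>\<^bsub>obj P n\<^esub> x) = \<epsilon> r * f x) ==> f \<in> coh n"
 by (auto simp: mod_hom_def extensional_def PiE_def)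

lemma cohD: "f \<in> coh n ==> x \<in> C n ==> y \<in> C n ==> f (x \<oplus>\<^bsub>obj P n\<^esub> y) = f x + f y"
 "f \<in> coh n ==> r \<in> carrier R ==> x \<in> C n ==> f (r \<odot>\<^bsub>obj P n\<^esub> x) = \<epsilon> r * f x"
 "f \<in> coh n ==> x \<notin> C n ==> f x = undefined"
 by (auto simp: mod_hom_def extensional_def)

lemma coh_zero: "f \<in> coh n ==> f \<zero>\<^bsub>obj P n\<^esub> = 0"
 using mod_hom_zero[OF _ obj_module M_module, of f n] by simp
lemma coh_uminus: "f \<in> coh n ==> x \<in> C n ==> f (\<ominus>\<^bsub>obj P n\<^esub> x) = - f x"
 using cohD(1)[of f n "\<ominus>\<^bsub>obj P n\<^esub> x" x] coh_zero[of f n] by (simp add: O.M.l_neg eq_neg_iff_add_eq_0)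
lemma coh_minus: "f \<in> coh n ==> x \<in> C n ==> y \<in> C n ==> f (x \<ominus>\<^bsub>obj P n\<^esub> y) = f x - f y"
 by (simp add: O.M.minus_eq cohD(1) coh_uminus)

text \<open>Closure of cochains, cocycles and coboundaries is proved once for linear combinations;
  \<open>pa\<close>, \<open>pd\<close>, \<open>pc\<close> are the instances used later.\<close>

definition lc :: "nat \<Rightarrow> 'i set \<Rightarrow> ('i \<Rightarrow> 'k) \<Rightarrow> ('i \<Rightarrow> 'm \<Rightarrow> 'k) \<Rightarrow> 'm \<Rightarrow> 'k" where
 "lc n I c f = (\<lambda>x\<in>C n. \<Sum>i\<in>I. c i * f i x)"

lemma lc_coh: "(\<And>i. i \<in> I ==> f i \<in> coh n) ==> lc n I c f \<in> coh n"
 by (rule cohI) (simp_all add: lc_def O.M.a_closed O.smult_closed cohD sum.distrib[symmetric] distrib_left sum_distrib_left mult.left_commute)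

lemma Z_iff: "f \<in> Z n \<longleftrightarrow> f \<in> coh n \<and> (\<forall>x\<in>C (Suc n). f (bd P n x) = 0)"
 by (simp add: cocycles_def)

lemma B_0: "B 0 = {\<lambda>x\<in>C 0. 0}" and B_Suc: "B (Suc n) = (\<lambda>f. compose (C (Suc n)) f (bd P n)) ` coh n"
 by (simp_all add: coboundaries_def)

lemma comp_coh: "h \<in> hom m n ==> f \<in> coh n ==> compose (C m) f h \<in> coh m"
 using mod_hom_comp[OF _ _ obj_module] by blast

lemma zero_coh: "(\<lambda>x\<in>C n. 0) \<in> coh n"
 by (rule cohI) (simp_all add: O.M.a_closed O.smult_closed)

lemma B_Z: "f \<in> B n ==> f \<in> Z n"
proof (cases n)
 case (Suc m)
 assume "f \<in> B n"
 then obtain h where h: "h \<in> coh m" "f = compose (C (Suc m)) h (bd P m)" using Suc B_Suc by auto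
 then show ?thesis using Suc comp_coh[OF bd_hom h(1)] coh_zero[OF h(1)] bd(1) by (simp add: Z_iff compose_eq bd_bd)
qed (use zero_coh[of 0] bd(1)[of _ 0] in \<open>auto simp: Z_iff B_0\<close>)

lemma lc_Z: "(\<And>i. i \<in> I ==> f i \<in> Z n) ==> lc n I c f \<in> Z n"
 using lc_coh[of I f n c] bd(1)[of _ n] by (simp add: Z_iff) (simp add: lc_def)

lemma lc_B: "(\<And>i. i \<in> I ==> f i \<in> B n) ==> lc n I c f \<in> B n"
proof (cases n)
 case 0
 assume "\<And>i. i \<in> I ==> f i \<in> B n"
 then show ?thesis using 0 by (auto simp: B_0 lc_def fun_eq_iff restrict_def)
next
 case (Suc m)
 assume "\<And>i. i \<in> I ==> f i \<in> B n"
 then have "\<And>i. i \<in> I ==> f i \<in> (\<lambda>f. compose (C (Suc m)) f (bd P m)) ` coh m" unfolding Suc B_Suc .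
 then have "\<forall>i\<in>I. \<exists>h. h \<in> coh m \<and> f i = compose (C (Suc m)) h (bd P m)" by blast
 from bchoice[OF this] obtain h where h: "\<And>i. i \<in> I ==> h i \<in> coh m" "\<And>i. i \<in> I ==> f i = compose (C (Suc m)) (h i) (bd P m)" by blast
 have "lc n I c f = compose (C (Suc m)) (lc m I c h) (bd P m)"
  using h(2) bd(1)[of _ m] by (auto simp: lc_def compose_def Suc fun_eq_iff restrict_def intro!: sum.cong)
 then show ?thesis using lc_coh[of I h m c] h(1) Suc B_Suc by auto
qed

definition pa :: "nat \<Rightarrow> ('m \<Rightarrow> 'k) \<Rightarrow> ('m \<Rightarrow> 'k) \<Rightarrow> 'm \<Rightarrow> 'k" where "pa n f g = (\<lambda>x\<in>C n. f x + g x)"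
definition pd :: "nat \<Rightarrow> ('m \<Rightarrow> 'k) \<Rightarrow> ('m \<Rightarrow> 'k) \<Rightarrow> 'm \<Rightarrow> 'k" where "pd n f g = (\<lambda>x\<in>C n. f x - g x)"
definition pc :: "nat \<Rightarrow> 'k \<Rightarrow> ('m \<Rightarrow> 'k) \<Rightarrow> 'm \<Rightarrow> 'k" where "pc n c f = (\<lambda>x\<in>C n. c * f x)"

lemma pa_lc: "pa n f g = lc n {True, False} (\<lambda>_. 1) (\<lambda>b. if b then f else g)"
 and pd_lc: "pd n f g = lc n {True, False} (\<lambda>b. if b then 1 else -1) (\<lambda>b. if b then f else g)"
 and pc_lc: "pc n c f = lc n {()} (\<lambda>_. c) (\<lambda>_. f)"
 by (simp_all add: pa_def pd_def pc_def lc_def)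

lemma Z_lin: "f \<in> Z n ==> g \<in> Z n ==> pa n f g \<in> Z n" "f \<in> Z n ==> g \<in> Z n ==> pd n f g \<in> Z n" "f \<in> Z n ==> pc n c f \<in> Z n"
 unfolding pa_lc pd_lc pc_lc by (rule lc_Z; simp)+
lemma B_lin: "f \<in> B n ==> g \<in> B n ==> pa n f g \<in> B n" "f \<in> B n ==> g \<in> B n ==> pd n f g \<in> B n" "f \<in> B n ==> pc n c f \<in> B n"
 unfolding pa_lc pd_lc pc_lc by (rule lc_B; simp)+
lemma coh_lin: "f \<in> coh n ==> g \<in> coh n ==> pa n f g \<in> coh n" "f \<in> coh n ==> g \<in> coh n ==> pd n f g \<in> coh n" "f \<in> coh n ==> pc n c f \<in> coh n"
 unfolding pa_lc pd_lc pc_lc by (rule lc_coh; simp)+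
lemma zero_B: "(\<lambda>x\<in>C n. 0) \<in> B n"
 using lc_B[of "{}" _ n] by (simp add: lc_def)

abbreviation ZG where "ZG n \<equiv> cocycle_grp R M P n"
abbreviation EG where "EG n \<equiv> Ext_grp R M P n"

lemma ZG_sel: "carrier (ZG n) = Z n" "f \<otimes>\<^bsub>ZG n\<^esub> g = pa n f g" "\<one>\<^bsub>ZG n\<^esub> = (\<lambda>x\<in>C n. 0)"
 by (simp_all add: cocycle_grp_def pa_def)

lemma Z_ext: "f \<in> Z n ==> f = (\<lambda>x\<in>C n. f x)"
 by (auto simp: Z_iff fun_eq_iff cohD(3))

lemma ZG_group: "comm_group (ZG n)"
proof (rule comm_groupI)
 fix f assume f: "f \<in> carrier (ZG n)"
 show "\<one>\<^bsub>ZG n\<^esub> \<otimes>\<^bsub>ZG n\<^esub> f = f" using f Z_ext[of f n] by (simp add: ZG_sel pa_def cong: restrict_cong)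
 show "\<exists>g\<in>carrier (ZG n). g \<otimes>\<^bsub>ZG n\<^esub> f = \<one>\<^bsub>ZG n\<^esub>"
 proof (rule bexI)
  show "pc n (-1) f \<in> carrier (ZG n)" using f by (simp only: ZG_sel Z_lin)
 qed (simp add: ZG_sel pa_def pc_def cong: restrict_cong)
next
 show "\<one>\<^bsub>ZG n\<^esub> \<in> carrier (ZG n)" using B_Z[OF zero_B] by (simp add: ZG_sel)
qed (auto simp: ZG_sel Z_lin, auto simp: pa_def add_ac)

lemma B_subgroup: "subgroup (B n) (ZG n)"
proof -
 interpret ZG: comm_group "ZG n" by (rule ZG_group)
 show ?thesis
 proof (rule ZG.subgroupI)
  fix f assume f: "f \<in> B n"
  have "inv\<^bsub>ZG n\<^esub> f = pc n (-1) f"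
  proof (rule ZG.inv_equality)
   show "pc n (-1) f \<in> carrier (ZG n)" "f \<in> carrier (ZG n)" using B_Z[OF f] by (simp_all only: ZG_sel Z_lin)
  qed (simp add: ZG_sel pa_def pc_def cong: restrict_cong)
  then show "inv\<^bsub>ZG n\<^esub> f \<in> B n" using f B_lin by simp
 next
  show "B n \<noteq> {}" using zero_B by blast
 qed (use B_Z B_lin in \<open>auto simp: ZG_sel\<close>)
qed

lemma B_normal: "B n \<lhd> ZG n"
 using comm_group.subgroup_imp_normal[OF ZG_group B_subgroup] .

lemma EG_group: "comm_group (EG n)"
 unfolding Ext_grp_def using comm_group.abelian_FactGroup[OF ZG_group B_subgroup] .

definition cls :: "nat \<Rightarrow> ('m \<Rightarrow> 'k) \<Rightarrow> ('m \<Rightarrow> 'k) set" where "cls n f = B n #>\<^bsub>ZG n\<^esub> f"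

lemma EG_carrier: "carrier (EG n) = cls n ` Z n"
 by (simp add: Ext_grp_def carrier_FactGroup cls_def ZG_sel)

lemma cls_mem: "f \<in> Z n ==> g \<in> cls n f \<longleftrightarrow> g \<in> Z n \<and> pd n g f \<in> B n"
proof
 assume f: "f \<in> Z n"
 { assume "g \<in> cls n f"
  then obtain b where b: "b \<in> B n" "g = pa n b f" by (auto simp: cls_def r_coset_def ZG_sel)
  have "pd n g f = b" using b Z_ext[OF B_Z[OF b(1)]] by (simp add: pd_def pa_def cong: restrict_cong)
  then show "g \<in> Z n \<and> pd n g f \<in> B n" using b f Z_lin B_Z by simp }
 assume g: "g \<in> Z n \<and> pd n g f \<in> B n"
 then have "g = pa n (pd n g f) f" using Z_ext[of g n] by (simp add: pd_def pa_def cong: restrict_cong)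
 then show "g \<in> cls n f" using g by (auto simp: cls_def r_coset_def ZG_sel)
qed

lemma cls_eq: "f \<in> Z n ==> g \<in> Z n ==> cls n f = cls n g \<longleftrightarrow> pd n f g \<in> B n"
proof -
 assume f: "f \<in> Z n" and g: "g \<in> Z n"
 interpret ZG: comm_group "ZG n" by (rule ZG_group)
 have self: "f \<in> cls n f" using ZG.rcos_self[OF _ B_subgroup, of f] f by (simp add: cls_def ZG_sel)
 have "cls n f = cls n g \<longleftrightarrow> f \<in> cls n g"
 proof
  assume "f \<in> cls n g"
  then show "cls n f = cls n g" unfolding cls_def using ZG.repr_independence[OF _ _ B_subgroup] g by (simp add: ZG_sel)
 qed (use self in simp)
 then show ?thesis using cls_mem[OF g] f by simp
qed

lemma cls_self: "f \<in> Z n ==> f \<in> cls n f"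
 by (simp add: cls_mem) (simp add: pd_def zero_B)

lemma cls_mult: "f \<in> Z n ==> g \<in> Z n ==> cls n f \<otimes>\<^bsub>EG n\<^esub> cls n g = cls n (pa n f g)"
 unfolding Ext_grp_def cls_def using normal.rcos_sum[OF B_normal] by (simp add: ZG_sel)

lemma EG_one: "\<one>\<^bsub>EG n\<^esub> = cls n (\<lambda>x\<in>C n. 0)"
proof -
 interpret ZG: comm_group "ZG n" by (rule ZG_group)
 have "cls n (\<lambda>x\<in>C n. 0) = B n"
  unfolding cls_def using ZG.coset_join2[OF _ B_subgroup zero_B] B_Z[OF zero_B] by (simp add: ZG_sel)
 then show ?thesis by (simp add: Ext_grp_def)
qed

lemma cls_sum: "finite I ==> (\<And>i. i \<in> I ==> f i \<in> Z n) ==>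
  (\<Otimes>\<^bsub>EG n\<^esub>i\<in>I. cls n (f i)) = cls n (\<lambda>x\<in>C n. \<Sum>i\<in>I. f i x)"
proof (induct I rule: finite_induct)
 case empty
 interpret EG: comm_group "EG n" by (rule EG_group)
 show ?case by (simp add: EG_one restrict_def)
next
 case (insert i I)
 interpret EG: comm_group "EG n" by (rule EG_group)
 have s: "(\<lambda>x\<in>C n. \<Sum>i\<in>I. f i x) \<in> Z n" using lc_Z[of I f n "\<lambda>_. 1"] insert by (simp add: lc_def)
 have "(\<Otimes>\<^bsub>EG n\<^esub>i\<in>insert i I. cls n (f i)) = cls n (f i) \<otimes>\<^bsub>EG n\<^esub> (\<Otimes>\<^bsub>EG n\<^esub>i\<in>I. cls n (f i))"
  using insert(1,2,4) by (intro EG.finprod_insert) (auto simp: EG_carrier)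
 also have "(\<Otimes>\<^bsub>EG n\<^esub>i\<in>I. cls n (f i)) = cls n (\<lambda>x\<in>C n. \<Sum>i\<in>I. f i x)"
  by (rule insert(3)) (simp add: insert(4))
 also have "cls n (f i) \<otimes>\<^bsub>EG n\<^esub> cls n (\<lambda>x\<in>C n. \<Sum>i\<in>I. f i x) = cls n (\<lambda>x\<in>C n. \<Sum>i\<in>insert i I. f i x)"
  using insert s by (simp add: cls_mult pa_def cong: restrict_cong)
 finally show ?case .
qed

end

section \<open>Lifts of cocycles to chain maps, unique up to homotopy\<close>

context trivial_resolution
begin

abbreviation lifts where "lifts n g \<equiv> chain_lifts R P n g"

text \<open>The comparison theorem for projective resolutions, by dependent choice of one degree
  after the other.\<close>

lemma lift_exists:
 assumes g: "g \<in> Z n"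
 shows "\<exists>\<phi>. \<phi> \<in> lifts n g"
proof -
 have g': "g \<in> coh n" "\<And>x. x \<in> C (Suc n) ==> g (bd P n x) = 0" using g by (auto simp: Z_iff)
 \<comment> \<open>The last conjunct keeps the next lifting problem solvable.\<close>
 let ?P = "\<lambda>i \<phi>. \<phi> \<in> hom (i + n) i \<and> (i = 0 \<longrightarrow> (\<forall>x\<in>C n. aug P (\<phi> x) = g x)) \<and>
  (\<forall>x\<in>C (Suc (i + n)). \<phi> (bd P (i + n) x) \<in> bd P i ` C (Suc i))"
 let ?Q = "\<lambda>i \<phi> \<phi>'. \<forall>x\<in>C (Suc i + n). bd P i (\<phi>' x) = \<phi> (bd P (i + n) x)"
 have "\<exists>\<phi>. \<forall>i. ?P i (\<phi> i) \<and> ?Q i (\<phi> i) (\<phi> (Suc i))"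
 proof (rule dependent_nat_choice)
  have "\<exists>\<phi>\<in>hom n 0. \<forall>x\<in>C n. aug P (\<phi> x) = g x"
   by (rule projective_lift[OF proj obj_module M_module g'(1) aug_hom]) (simp add: aug_surj)
  then obtain \<phi> where p: "\<phi> \<in> hom n 0" "\<forall>x\<in>C n. aug P (\<phi> x) = g x" by blast
  have "\<phi> (bd P n x) \<in> bd P 0 ` C (Suc 0)" if "x \<in> C (Suc n)" for x
   using p mod_homD(1)[OF p(1)] bd(1)[OF that] g'(2)[OF that] unfolding ex0[symmetric] by simp
  then show "\<exists>\<phi>. ?P 0 \<phi>" using p by auto
 next
  fix \<phi> i assume p: "?P i \<phi>"
  have c: "compose (C (Suc i + n)) \<phi> (bd P (i + n)) \<in> hom (Suc i + n) i"
   using mod_hom_comp[OF bd_hom[of "i + n"] conjunct1[OF p] obj_module] by simp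
  have "\<exists>\<psi>\<in>hom (Suc i + n) (Suc i). \<forall>x\<in>C (Suc i + n). bd P i (\<psi> x) = compose (C (Suc i + n)) \<phi> (bd P (i + n)) x"
   by (rule projective_lift[OF proj obj_module obj_module c bd_hom]) (use p in \<open>simp add: compose_eq\<close>)
  then obtain \<psi> where q: "\<psi> \<in> hom (Suc i + n) (Suc i)" "?Q i \<phi> \<psi>" by (auto simp: compose_eq)
  have "\<psi> (bd P (Suc i + n) x) \<in> bd P (Suc i) ` C (Suc (Suc i))" if x: "x \<in> C (Suc (Suc i + n))" for x
  proof -
   have "bd P i (\<psi> (bd P (Suc i + n) x)) = \<phi> (bd P (i + n) (bd P (Suc i + n) x))"
    using q(2) bd(1)[OF x] by simp
   also have "\<dots> = \<zero>\<^bsub>obj P i\<^esub>" using bd_bd[of x "i + n"] x mod_hom_zero[OF conjunct1[OF p] obj_module obj_module] by simp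
   finally show ?thesis using mod_homD(1)[OF q(1)] bd(1)[OF x] unfolding ex[symmetric] by simp
  qed
  then show "\<exists>\<psi>. ?P (Suc i) \<psi> \<and> ?Q i \<phi> \<psi>" using q by auto
 qed
 then show ?thesis by (auto simp: chain_lifts_def)
qed

lemma liftsD:
 assumes "\<phi> \<in> lifts n g"
 shows "\<phi> i \<in> hom (i + n) i" "x \<in> C n ==> aug P (\<phi> 0 x) = g x"
  "x \<in> C (Suc i + n) ==> bd P i (\<phi> (Suc i) x) = \<phi> i (bd P (i + n) x)"
 using assms by (auto simp: chain_lifts_def)

text \<open>A lift of a coboundary is homotopic to a map \<open>e\<close> concentrated in degree 0,
  and the homotopy \<open>s\<close> exhibits the composite with \<open>f\<close> as a
  coboundary.\<close>

lemma lift_coboundary: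
 assumes \<psi>: "\<psi> \<in> lifts n g" and g: "g \<in> B n" and f: "f \<in> Z m"
 shows "compose (C (m + n)) f (\<psi> m) \<in> B (m + n)"
proof -
 note L = liftsD[OF \<psi>]
 note Lh = mod_homD[OF L(1)]
 have f': "f \<in> coh m" "\<And>x. x \<in> C (Suc m) ==> f (bd P m x) = 0" using f by (auto simp: Z_iff)
 \<comment> \<open>For \<open>n = 0\<close> the cocycle \<open>g\<close> is 0 and so is
   \<open>e\<close>. Otherwise \<open>g\<close> is \<open>h\<close> after \<open>bd\<close>, and
   \<open>e\<close> is \<open>t\<close> after \<open>bd\<close> for a lift \<open>t\<close> of
   \<open>h\<close>.\<close>
 have "\<exists>e\<in>hom n 0. (\<forall>x\<in>C n. aug P (e x) = g x) \<and> (\<forall>x\<in>C (Suc n). e (bd P n x) = \<zero>\<^bsub>obj P 0\<^esub>) \<and>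
   (\<forall>f\<in>coh 0. compose (C n) f e \<in> B n)"
 proof (cases n)
  case 0
  let ?e = "\<lambda>x\<in>C n. \<zero>\<^bsub>obj P 0\<^esub>"
  have "?e \<in> hom n 0" by (rule mod_homI[OF _ _ _ obj_module]) (simp_all add: O.smult_zero)
  moreover have "compose (C n) f ?e \<in> B n" if "f \<in> coh 0" for f
  proof -
   have "compose (C n) f ?e = (\<lambda>x\<in>C n. 0)" using coh_zero[OF that] by (auto simp: compose_def fun_eq_iff)
   then show ?thesis using zero_B by simp
  qed
  ultimately show ?thesis using g 0 bd(1) mod_hom_zero[OF aug_hom obj_module M_module]
   by (intro bexI[of _ ?e]) (simp_all add: B_0)
 next
  case (Suc k)
  then obtain h where h: "h \<in> coh k" "g = compose (C (Suc k)) h (bd P k)" using g B_Suc by auto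
  have "\<exists>t\<in>hom k 0. \<forall>x\<in>C k. aug P (t x) = h x"
   by (rule projective_lift[OF proj obj_module M_module h(1) aug_hom]) (simp add: aug_surj)
  then obtain t where t: "t \<in> hom k 0" "\<And>x. x \<in> C k ==> aug P (t x) = h x" by blast
  let ?e = "compose (C n) t (bd P k)"
  have "?e \<in> hom n 0" using mod_hom_comp[OF bd_hom t(1) obj_module] Suc by simp
  moreover have "compose (C n) f ?e \<in> B n" if "f \<in> coh 0" for f
  proof -
   have "compose (C n) f ?e = compose (C n) (compose (C k) f t) (bd P k)"
    using bd(1)[of _ k] Suc by (auto simp: compose_def fun_eq_iff)
   then show ?thesis using comp_coh[OF t(1) that] Suc B_Suc by auto
  qed
  ultimately show ?thesis using Suc t bd(1) h mod_hom_zero[OF t(1) obj_module obj_module]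
   by (intro bexI[of _ ?e]) (simp_all add: compose_eq bd_bd)
 qed
 then obtain e where e: "e \<in> hom n 0" "\<And>x. x \<in> C n ==> aug P (e x) = g x" "\<And>x. x \<in> C (Suc n) ==> e (bd P n x) = \<zero>\<^bsub>obj P 0\<^esub>"
  "\<And>f. f \<in> coh 0 ==> compose (C n) f e \<in> B n" by blast
 note eh = mod_homD[OF e(1)]
 \<comment> \<open>The middle conjunct says that \<open>\<psi> i\<close> and \<open>bd P i\<close>
   after \<open>s\<close> agree on boundaries, which makes the next \<open>s\<close> exist.\<close>
 let ?P = "\<lambda>i s. s \<in> hom (i + n) (Suc i) \<and> (\<forall>x\<in>C (Suc (i + n)). bd P i (s (bd P (i + n) x)) = \<psi> i (bd P (i + n) x))
  \<and> (i = 0 \<longrightarrow> (\<forall>x\<in>C n. \<psi> 0 x = bd P 0 (s x) \<oplus>\<^bsub>obj P 0\<^esub> e x))"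
 let ?Q = "\<lambda>i s s'. \<forall>x\<in>C (Suc i + n). \<psi> (Suc i) x = bd P (Suc i) (s' x) \<oplus>\<^bsub>obj P (Suc i)\<^esub> s (bd P (i + n) x)"
 have cancel: "(a \<ominus>\<^bsub>obj P i\<^esub> b) \<oplus>\<^bsub>obj P i\<^esub> b = a" if "a \<in> C i" "b \<in> C i" for a b i
  using that by (simp add: O.M.minus_eq O.M.a_assoc O.M.l_neg)
 have subself: "a \<ominus>\<^bsub>obj P i\<^esub> a = \<zero>\<^bsub>obj P i\<^esub>" if "a \<in> C i" for a i
  using that by (simp add: O.M.minus_eq O.M.r_neg)
 have "\<exists>s. \<forall>i. ?P i (s i) \<and> ?Q i (s i) (s (Suc i))"
 proof (rule dependent_nat_choice)
  let ?d = "\<lambda>x\<in>C n. \<psi> 0 x \<ominus>\<^bsub>obj P 0\<^esub> e x"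
  have d: "?d \<in> hom n 0" using mod_hom_diff[OF L(1)[of 0, unfolded add_0] e(1) obj_module obj_module] .
  have "\<exists>s\<in>hom n (Suc 0). \<forall>x\<in>C n. bd P 0 (s x) = ?d x"
  proof (rule projective_lift[OF proj obj_module obj_module d bd_hom])
   fix x assume x: "x \<in> C n"
   then show "?d x \<in> bd P 0 ` C (Suc 0)"
    unfolding ex0[symmetric] using Lh(1)[of x 0] eh(1)[of x] L(2)[OF x] e(2)[OF x] by (simp add: coh_minus[OF aug_hom])
  qed
  then obtain s where s: "s \<in> hom n (Suc 0)" "\<And>x. x \<in> C n ==> bd P 0 (s x) = ?d x" by blast
  have "bd P 0 (s (bd P n x)) = \<psi> 0 (bd P n x)" if "x \<in> C (Suc n)" for x
   using s(2)[OF bd(1)[OF that]] bd(1)[OF that] e(3)[OF that] Lh(1)[of "bd P n x" 0] by (simp add: O.M.minus_eq)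
  then show "\<exists>s. ?P 0 s" using s Lh(1)[of _ 0] eh(1) by (intro exI[of _ s]) (auto simp: cancel)
 next
  fix s i assume s: "?P i s"
  have sh: "s \<in> hom (i + n) (Suc i)" using s by blast
  let ?c = "compose (C (Suc i + n)) s (bd P (i + n))"
  let ?d = "\<lambda>x\<in>C (Suc i + n). \<psi> (Suc i) x \<ominus>\<^bsub>obj P (Suc i)\<^esub> ?c x"
  have c: "?c \<in> hom (Suc i + n) (Suc i)" using mod_hom_comp[OF bd_hom sh obj_module] by simp
  have d: "?d \<in> hom (Suc i + n) (Suc i)" by (rule mod_hom_diff[OF L(1) c obj_module obj_module])
  have cl: "\<psi> (Suc i) x \<in> C (Suc i)" "s (bd P (i + n) x) \<in> C (Suc i)" if "x \<in> C (Suc i + n)" for x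
   using that Lh(1)[OF that] mod_homD(1)[OF sh] bd(1)[of x "i + n"] by auto
  have "\<exists>s'\<in>hom (Suc i + n) (Suc (Suc i)). \<forall>x\<in>C (Suc i + n). bd P (Suc i) (s' x) = ?d x"
  proof (rule projective_lift[OF proj obj_module obj_module d bd_hom])
   fix x assume x: "x \<in> C (Suc i + n)"
   have "bd P i (?d x) = bd P i (\<psi> (Suc i) x) \<ominus>\<^bsub>obj P i\<^esub> bd P i (s (bd P (i + n) x))"
    using x cl[OF x] bd(2)[of _ i] mod_hom_uminus[OF bd_hom obj_module obj_module, of _ i] by (simp add: compose_eq O.M.minus_eq)
   also have "\<dots> = \<zero>\<^bsub>obj P i\<^esub>" using s x L(3)[OF x] bd(1)[OF cl(2)[OF x]] by (simp add: subself)
   finally show "?d x \<in> bd P (Suc i) ` C (Suc (Suc i))"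
    unfolding ex[symmetric] using mod_homD(1)[OF d x] by simp
  qed
  then obtain s' where s': "s' \<in> hom (Suc i + n) (Suc (Suc i))" "\<And>x. x \<in> C (Suc i + n) ==> bd P (Suc i) (s' x) = ?d x" by blast
  have "bd P (Suc i) (s' (bd P (Suc i + n) x)) = \<psi> (Suc i) (bd P (Suc i + n) x)" if x: "x \<in> C (Suc (Suc i + n))" for x
  proof -
   have "s (bd P (i + n) (bd P (Suc i + n) x)) = \<zero>\<^bsub>obj P (Suc i)\<^esub>"
    using bd_bd[of x "i + n"] x mod_hom_zero[OF sh obj_module obj_module] by simp
   then show ?thesis
    using s'(2)[OF bd(1)[OF x]] bd(1)[OF x] Lh(1)[OF bd(1)[OF x]] by (simp add: compose_eq O.M.minus_eq)
  qed
  moreover have "?Q i s s'" using s'(2) cl by (simp add: compose_eq cancel)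
  ultimately show "\<exists>s'. ?P (Suc i) s' \<and> ?Q i s s'" using s'(1) by auto
 qed
 then obtain s where s0: "\<forall>i. ?P i (s i) \<and> ?Q i (s i) (s (Suc i))" by (elim exE)
 have s: "s i \<in> hom (i + n) (Suc i)" "y \<in> C n ==> \<psi> 0 y = bd P 0 (s 0 y) \<oplus>\<^bsub>obj P 0\<^esub> e y"
  "x \<in> C (Suc i + n) ==> \<psi> (Suc i) x = bd P (Suc i) (s (Suc i) x) \<oplus>\<^bsub>obj P (Suc i)\<^esub> s i (bd P (i + n) x)" for i x y
  using spec[OF s0, of i] spec[OF s0, of 0] by simp_all
 note sh = mod_homD[OF s(1)]
 show ?thesis
 proof (cases m)
  case 0
  have "compose (C (m + n)) f (\<psi> m) = compose (C n) f e"
  proof (rule ext)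
   fix x
   show "compose (C (m + n)) f (\<psi> m) x = compose (C n) f e x"
    using 0 s(2)[of x] f'(2)[of "s 0 x"] sh(1)[of x 0] bd(1)[of "s 0 x" 0] eh(1)[of x] cohD(1)[OF f'(1), of "bd P 0 (s 0 x)" "e x"]
    by (auto simp: compose_def)
  qed
  then show ?thesis using e(4)[of f] f'(1) 0 by simp
 next
  case (Suc i)
  have "compose (C (m + n)) f (\<psi> m) = compose (C (Suc (i + n))) (compose (C (i + n)) f (s i)) (bd P (i + n))"
  proof (rule ext)
   fix x
   show "compose (C (m + n)) f (\<psi> m) x = compose (C (Suc (i + n))) (compose (C (i + n)) f (s i)) (bd P (i + n)) x"
    using Suc s(3)[of x i] f'(2)[of "s m x"] sh(1)[of x "Suc i"] bd(1)[of "s m x" m] bd(1)[of x "i + n"] sh(1)[of "bd P (i + n) x" i]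
     cohD(1)[OF f'(1), of "bd P m (s m x)" "s i (bd P (i + n) x)"]
    by (auto simp: compose_def)
  qed
  then show ?thesis using comp_coh[OF s(1)[of i], of f] f'(1) Suc B_Suc[of "i + n"] by auto
 qed
qed

lemma lifts_add:
 assumes "\<phi> \<in> lifts n g" "\<psi> \<in> lifts n h"
 shows "(\<lambda>i. \<lambda>x\<in>C (i + n). \<phi> i x \<oplus>\<^bsub>obj P i\<^esub> \<psi> i x) \<in> lifts n (pa n g h)"
proof -
 note p = liftsD[OF assms(1)] and q = liftsD[OF assms(2)]
 note ph = mod_homD[OF p(1)] and qh = mod_homD[OF q(1)]
 have "(\<lambda>x\<in>C (i + n). \<phi> i x \<oplus>\<^bsub>obj P i\<^esub> \<psi> i x) \<in> hom (i + n) i" for i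
  by (rule mod_hom_add[OF p(1) q(1) obj_module obj_module])
 moreover have "aug P (\<phi> 0 x \<oplus>\<^bsub>obj P 0\<^esub> \<psi> 0 x) = g x + h x" if "x \<in> C n" for x
  using that p(2) q(2) ph(1)[of x 0] qh(1)[of x 0] by (simp add: cohD[OF aug_hom])
 moreover have "bd P i (\<phi> (Suc i) x \<oplus>\<^bsub>obj P (Suc i)\<^esub> \<psi> (Suc i) x) = \<phi> i (bd P (i + n) x) \<oplus>\<^bsub>obj P i\<^esub> \<psi> i (bd P (i + n) x)" if "x \<in> C (Suc i + n)" for x i
  using that p(3)[OF that] q(3)[OF that] ph(1)[OF that] qh(1)[OF that] by (simp add: bd(2))
 ultimately show ?thesis using bd(1) unfolding chain_lifts_def by (simp add: pa_def)
qed

lemma lifts_uminus: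
 assumes "\<phi> \<in> lifts n g"
 shows "(\<lambda>i. \<lambda>x\<in>C (i + n). \<ominus>\<^bsub>obj P i\<^esub> \<phi> i x) \<in> lifts n (pc n (-1) g)"
proof -
 note p = liftsD[OF assms(1)]
 note ph = mod_homD[OF p(1)]
 have "(\<lambda>x\<in>C (i + n). \<ominus>\<^bsub>obj P i\<^esub> \<phi> i x) \<in> hom (i + n) i" for i
  by (rule mod_homI[OF _ _ _ obj_module]) (simp_all add: ph O.M.minus_add O.smult_minus)
 moreover have "aug P (\<ominus>\<^bsub>obj P 0\<^esub> \<phi> 0 x) = - g x" if "x \<in> C n" for x
  using that p(2) ph(1)[of x 0] by (simp add: coh_uminus[OF aug_hom])
 moreover have "bd P i (\<ominus>\<^bsub>obj P (Suc i)\<^esub> \<phi> (Suc i) x) = \<ominus>\<^bsub>obj P i\<^esub> \<phi> i (bd P (i + n) x)" if "x \<in> C (Suc i + n)" for x i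
  using that p(3)[OF that] ph(1)[OF that] mod_hom_uminus[OF bd_hom obj_module obj_module, of _ i] by simp
 ultimately show ?thesis using bd(1) unfolding chain_lifts_def by (simp add: pc_def)
qed

lemma comp_lift_Z:
 assumes "\<phi> \<in> lifts n g" "f \<in> Z m"
 shows "compose (C (m + n)) f (\<phi> m) \<in> Z (m + n)"
proof -
 note p = liftsD[OF assms(1)]
 have f: "f \<in> coh m" "\<And>x. x \<in> C (Suc m) ==> f (bd P m x) = 0" using assms(2) by (auto simp: Z_iff)
 have "f (\<phi> m (bd P (m + n) x)) = 0" if x: "x \<in> C (Suc (m + n))" for x
  using p(3)[of x m] f(2)[of "\<phi> (Suc m) x"] mod_homD(1)[OF p(1)[of "Suc m"], of x] x by simp
 then show ?thesis using comp_coh[OF p(1) f(1)] bd(1)[of _ "m + n"] by (simp add: Z_iff compose_eq)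
qed

text \<open>The difference of two lifts lifts the difference, so \<open>lift_coboundary\<close>
  handles the change of \<open>g\<close>; a change of \<open>f\<close> by a coboundary passes
  through the chain map.\<close>

lemma lift_indep:
 assumes \<phi>: "\<phi> \<in> lifts n g" and \<phi>': "\<phi>' \<in> lifts n g'" and g: "pd n g g' \<in> B n"
  and f: "f \<in> Z m" and f': "f' \<in> Z m" and ff: "pd m f f' \<in> B m"
 shows "pd (m + n) (compose (C (m + n)) f (\<phi> m)) (compose (C (m + n)) f' (\<phi>' m)) \<in> B (m + n)"
proof -
 let ?u = "compose (C (m + n)) (pd m f f') (\<phi> m)"
 let ?\<psi> = "\<lambda>i. \<lambda>x\<in>C (i + n). \<phi> i x \<oplus>\<^bsub>obj P i\<^esub> (\<lambda>i. \<lambda>x\<in>C (i + n). \<ominus>\<^bsub>obj P i\<^esub> \<phi>' i x) i x"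
 let ?v = "compose (C (m + n)) f' (?\<psi> m)"
 have ph: "\<phi> i x \<in> C i" "\<phi>' i x \<in> C i" if "x \<in> C (i + n)" for i x
  using mod_homD(1)[OF liftsD(1)[OF \<phi>] that] mod_homD(1)[OF liftsD(1)[OF \<phi>'] that] by auto
 have u: "?u \<in> B (m + n)"
 proof (cases m)
  case 0
  then have "pd m f f' = (\<lambda>x\<in>C 0. 0)" using ff B_0 by auto
  then have "?u = (\<lambda>x\<in>C (m + n). 0)" using ph(1)[of _ m] 0 by (auto simp: compose_def fun_eq_iff)
  then show ?thesis using zero_B by simp
 next
  case (Suc i)
  then obtain h where h: "h \<in> coh i" "pd m f f' = compose (C (Suc i)) h (bd P i)" using ff B_Suc by auto
  have "?u = compose (C (Suc (i + n))) (compose (C (i + n)) h (\<phi> i)) (bd P (i + n))"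
   unfolding h(2) using Suc ph(1)[of _ "Suc i"] liftsD(3)[OF \<phi>, of _ i] bd(1)[of _ "i + n"] by (auto simp: compose_def fun_eq_iff)
  then show ?thesis using Suc B_Suc[of "i + n"] comp_coh[OF liftsD(1)[OF \<phi>] h(1)] by auto
 qed
 have gg: "pa n g (pc n (-1) g') = pd n g g'" by (auto simp: pa_def pc_def pd_def)
 have v: "?v \<in> B (m + n)"
  by (rule lift_coboundary[OF lifts_add[OF \<phi> lifts_uminus[OF \<phi>'], unfolded gg] g f'])
 have "pd (m + n) (compose (C (m + n)) f (\<phi> m)) (compose (C (m + n)) f' (\<phi>' m)) = pa (m + n) ?u ?v"
 proof (rule ext)
  fix x
  have fc: "f' \<in> coh m" using f' by (simp add: Z_iff)
  show "pd (m + n) (compose (C (m + n)) f (\<phi> m)) (compose (C (m + n)) f' (\<phi>' m)) x = pa (m + n) ?u ?v x"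
   using ph[of x m] by (auto simp: pa_def pd_def compose_def cohD(1)[OF fc] coh_uminus[OF fc])
 qed
 then show ?thesis using B_lin(1)[OF u v] by simp
qed

text \<open>By \<open>lift_indep\<close> all members of the union defining \<open>yoneda\<close>
  coincide, and the given lift shows that there is one.\<close>

lemma yoneda_cls:
 assumes f: "f \<in> Z m" and g: "g \<in> Z n" and \<phi>: "\<phi> \<in> lifts n g"
 shows "yoneda R M P m n (cls m f) (cls n g) = cls (m + n) (compose (C (m + n)) f (\<phi> m))"
proof -
 have "coboundaries R M P (m + n) #>\<^bsub>ZG (m + n)\<^esub> compose (C (m + n)) f' (\<phi>' m) = cls (m + n) (compose (C (m + n)) f (\<phi> m))"
  if f': "f' \<in> cls m f" and g': "g' \<in> cls n g" and \<phi>': "\<phi>' \<in> lifts n g'" for f' g' \<phi>'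
 proof -
  have a: "f' \<in> Z m" "pd m f' f \<in> B m" "g' \<in> Z n" "pd n g' g \<in> B n" using cls_mem f g f' g' by auto
  have "cls (m + n) (compose (C (m + n)) f' (\<phi>' m)) = cls (m + n) (compose (C (m + n)) f (\<phi> m))"
   using cls_eq[OF comp_lift_Z[OF \<phi>' a(1)] comp_lift_Z[OF \<phi> f]] lift_indep[OF \<phi>' \<phi> a(4) a(1) f a(2)] by simp
  then show ?thesis by (simp add: cls_def)
 qed
 then have "yoneda R M P m n (cls m f) (cls n g) =
  (\<Union>f'\<in>cls m f. \<Union>g'\<in>cls n g. \<Union>\<phi>'\<in>lifts n g'. cls (m + n) (compose (C (m + n)) f (\<phi> m)))"
  unfolding yoneda_def by (intro SUP_cong refl) simp
 also have "\<dots> = cls (m + n) (compose (C (m + n)) f (\<phi> m))"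
 proof (intro equalityI subsetI)
  fix h assume "h \<in> cls (m + n) (compose (C (m + n)) f (\<phi> m))"
  then show "h \<in> (\<Union>f'\<in>cls m f. \<Union>g'\<in>cls n g. \<Union>\<phi>'\<in>lifts n g'. cls (m + n) (compose (C (m + n)) f (\<phi> m)))"
   by (intro UN_I[OF cls_self[OF f]] UN_I[OF cls_self[OF g]] UN_I[OF \<phi>])
 qed (elim UN_E)
 finally show ?thesis .
qed

section \<open>The Ext ring is a ring\<close>

abbreviation E where "E \<equiv> Ext_ring R M P"

definition rp :: "(nat \<Rightarrow> 'm \<Rightarrow> 'k) \<Rightarrow> nat \<Rightarrow> ('m \<Rightarrow> 'k) set" where
 "rp f = (\<lambda>n. cls n (f n))"

text \<open>Finiteness concerns the classes: in almost all degrees the representative is a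
  coboundary, not necessarily 0.\<close>

definition Zs :: "(nat \<Rightarrow> 'm \<Rightarrow> 'k) set" where
 "Zs = {f. (\<forall>n. f n \<in> Z n) \<and> finite {n. f n \<notin> B n}}"

lemma cls_one_iff: "f \<in> Z n ==> cls n f = \<one>\<^bsub>EG n\<^esub> \<longleftrightarrow> f \<in> B n"
proof -
 assume f: "f \<in> Z n"
 have "pd n f (\<lambda>x\<in>C n. 0) = f" using Z_ext[OF f] by (simp add: pd_def cong: restrict_cong)
 then show ?thesis unfolding EG_one using cls_eq[OF f B_Z[OF zero_B]] by simp
qed

lemma EGg: "group (EG n)" using EG_group comm_group.axioms(2) by blast

lemma E_carrier: "carrier E = rp ` Zs"
proof -
 have "carrier E = {x \<in> \<Pi>\<^sub>E i\<in>UNIV. carrier (EG i). finite {i \<in> UNIV. x i \<noteq> \<one>\<^bsub>EG i\<^esub>}}"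
  by (simp add: Ext_ring_def carrier_sum_group[OF EGg])
 also have "\<dots> = rp ` Zs"
 proof (intro equalityI subsetI)
  fix x assume x: "x \<in> {x \<in> \<Pi>\<^sub>E i\<in>UNIV. carrier (EG i). finite {i \<in> UNIV. x i \<noteq> \<one>\<^bsub>EG i\<^esub>}}"
  then have "\<forall>n. \<exists>f. f \<in> Z n \<and> x n = cls n f" by (auto simp: EG_carrier PiE_iff)
  from choice[OF this] obtain f where f: "\<And>n. f n \<in> Z n" "\<And>n. x n = cls n (f n)" by blast
  have "{n. f n \<notin> B n} = {i \<in> UNIV. x i \<noteq> \<one>\<^bsub>EG i\<^esub>}" using f cls_one_iff by auto
  then have "f \<in> Zs" using f x by (simp add: Zs_def)
  moreover have "x = rp f" using f by (auto simp: rp_def)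
  ultimately show "x \<in> rp ` Zs" by blast
 next
  fix x assume "x \<in> rp ` Zs"
  then obtain f where f: "f \<in> Zs" "x = rp f" by blast
  have "{i \<in> UNIV. x i \<noteq> \<one>\<^bsub>EG i\<^esub>} = {n. f n \<notin> B n}" using f cls_one_iff by (auto simp: rp_def Zs_def)
  then show "x \<in> {x \<in> \<Pi>\<^sub>E i\<in>UNIV. carrier (EG i). finite {i \<in> UNIV. x i \<noteq> \<one>\<^bsub>EG i\<^esub>}}"
   using f by (auto simp: Zs_def rp_def EG_carrier)
 qed
 finally show ?thesis .
qed

lemma ZsD: "f \<in> Zs ==> f n \<in> Z n" by (simp add: Zs_def)

lemma Zs_add: "f \<in> Zs ==> g \<in> Zs ==> (\<lambda>n. pa n (f n) (g n)) \<in> Zs"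
proof -
 assume f: "f \<in> Zs" and g: "g \<in> Zs"
 have "{n. pa n (f n) (g n) \<notin> B n} \<subseteq> {n. f n \<notin> B n} \<union> {n. g n \<notin> B n}" using B_lin by auto
 moreover have "finite ({n. f n \<notin> B n} \<union> {n. g n \<notin> B n})" using f g by (simp add: Zs_def)
 ultimately have "finite {n. pa n (f n) (g n) \<notin> B n}" by (rule finite_subset)
 then show ?thesis using f g by (simp add: Zs_def Z_lin)
qed

lemma E_add: "f \<in> Zs ==> g \<in> Zs ==> rp f \<oplus>\<^sub>E rp g = rp (\<lambda>n. pa n (f n) (g n))"
 by (simp add: Ext_ring_def rp_def cls_mult ZsD restrict_def)

lemma E_zero: "\<zero>\<^sub>E = rp (\<lambda>n. \<lambda>x\<in>C n. 0)"
 by (simp add: Ext_ring_def rp_def EG_one restrict_def)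

lemma zero_Zs: "(\<lambda>n. \<lambda>x\<in>C n. 0) \<in> Zs"
proof -
 have "(\<lambda>x\<in>C n. 0) \<in> B n" for n by (rule zero_B)
 then show ?thesis using B_Z by (simp add: Zs_def)
qed

text \<open>Convolution of representatives, where \<open>\<phi> n\<close> is meant to lift the
  component of degree \<open>n\<close> of the right factor.\<close>

definition cv :: "(nat \<Rightarrow> 'm \<Rightarrow> 'k) \<Rightarrow> (nat \<Rightarrow> nat \<Rightarrow> 'm \<Rightarrow> 'm) \<Rightarrow> nat \<Rightarrow> 'm \<Rightarrow> 'k" where
 "cv f \<phi> = (\<lambda>n. \<lambda>x\<in>C n. \<Sum>i\<le>n. f i (\<phi> (n - i) i x))"

lemma cv_lc: "cv f \<phi> n = (\<lambda>x\<in>C n. \<Sum>i\<in>{..n}. compose (C (i + (n - i))) (f i) (\<phi> (n - i) i) x)"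
 by (auto simp: cv_def compose_def fun_eq_iff intro!: sum.cong)

lemma comp_lift_Z': "\<phi> \<in> lifts (n - i) g ==> f \<in> Z i ==> i \<le> n ==> compose (C n) f (\<phi> i) \<in> Z n"
 using comp_lift_Z[of \<phi> "n - i" g f i] by simp

lemma E_mult:
 assumes f: "f \<in> Zs" and g: "g \<in> Zs" and \<phi>: "\<And>n. \<phi> n \<in> lifts n (g n)"
 shows "rp f \<otimes>\<^sub>E rp g = rp (cv f \<phi>)" and "cv f \<phi> \<in> Zs"
proof -
 have c: "compose (C (i + (n - i))) (f i) (\<phi> (n - i) i) \<in> Z n" if "i \<le> n" for i n
  using comp_lift_Z'[OF \<phi> ZsD[OF f] that] that by simp
 have Zc: "cv f \<phi> n \<in> Z n" for n
  unfolding cv_lc using lc_Z[of "{..n}" "\<lambda>i. compose (C (i + (n - i))) (f i) (\<phi> (n - i) i)" n "\<lambda>_. 1"] c by (simp add: lc_def)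
 have "(rp f \<otimes>\<^sub>E rp g) n = rp (cv f \<phi>) n" for n
 proof -
  interpret EG: comm_group "EG n" by (rule EG_group)
  have "(rp f \<otimes>\<^sub>E rp g) n = (\<Otimes>\<^bsub>EG n\<^esub>i\<in>{..n}. yoneda R M P i (n - i) (rp f i) (rp g (n - i)))"
   by (simp add: Ext_ring_def)
  also have "\<dots> = (\<Otimes>\<^bsub>EG n\<^esub>i\<in>{..n}. cls n (compose (C (i + (n - i))) (f i) (\<phi> (n - i) i)))"
   by (intro EG.finprod_cong') (use c in \<open>auto simp: rp_def yoneda_cls[OF ZsD[OF f] ZsD[OF g] \<phi>] EG_carrier\<close>)
  also have "\<dots> = cls n (cv f \<phi> n)"
   unfolding cv_lc by (rule cls_sum) (use c in auto)
  finally show ?thesis by (simp add: rp_def)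
 qed
 then show "rp f \<otimes>\<^sub>E rp g = rp (cv f \<phi>)" by blast
 obtain N where N: "\<And>n. f n \<notin> B n ==> n \<le> N" using f finite_nat_set_iff_bounded_le[of "{n. f n \<notin> B n}"] by (auto simp: Zs_def)
 obtain K where K: "\<And>n. g n \<notin> B n ==> n \<le> K" using g finite_nat_set_iff_bounded_le[of "{n. g n \<notin> B n}"] by (auto simp: Zs_def)
 \<comment> \<open>Beyond \<open>N + K\<close>, one of the two factors of each term is a
   coboundary.\<close>
 have "cv f \<phi> n \<in> B n" if n: "n > N + K" for n
 proof -
  have "compose (C (i + (n - i))) (f i) (\<phi> (n - i) i) \<in> B (i + (n - i))" if i: "i \<le> n" for i
  proof (cases "f i \<in> B i")
   case True
   have z: "(\<lambda>x\<in>C i. 0) \<in> Z i" using B_Z[OF zero_B] .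
   have e: "pd i (f i) (\<lambda>x\<in>C i. 0) = f i" using Z_ext[OF ZsD[OF f, of i]] by (simp add: pd_def cong: restrict_cong)
   have g0: "pd (n - i) (g (n - i)) (g (n - i)) \<in> B (n - i)" using zero_B[of "n - i"] by (simp add: pd_def)
   have "pd (i + (n - i)) (compose (C (i + (n - i))) (f i) (\<phi> (n - i) i)) (compose (C (i + (n - i))) (\<lambda>x\<in>C i. 0) (\<phi> (n - i) i)) \<in> B (i + (n - i))"
    using lift_indep[OF \<phi> \<phi> g0 ZsD[OF f] z] True e by simp
   also have "pd (i + (n - i)) (compose (C (i + (n - i))) (f i) (\<phi> (n - i) i)) (compose (C (i + (n - i))) (\<lambda>x\<in>C i. 0) (\<phi> (n - i) i))
    = compose (C (i + (n - i))) (f i) (\<phi> (n - i) i)"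
    using mod_homD(1)[OF liftsD(1)[OF \<phi>[of "n - i"], of i]] by (auto simp: pd_def compose_def fun_eq_iff)
   finally show ?thesis .
  next
   case False
   then have "n - i > K" using N[of i] n by simp
   then have "g (n - i) \<in> B (n - i)" using K[of "n - i"] by auto
   then show ?thesis using lift_coboundary[OF \<phi> _ ZsD[OF f]] by simp
  qed
  then show ?thesis
   unfolding cv_lc using lc_B[of "{..n}" "\<lambda>i. compose (C (i + (n - i))) (f i) (\<phi> (n - i) i)" n "\<lambda>_. 1"] by (simp add: lc_def)
 qed
 then have "{n. cv f \<phi> n \<notin> B n} \<subseteq> {..N + K}" by (auto simp: not_le[symmetric])
 then show "cv f \<phi> \<in> Zs" using Zc finite_subset by (auto simp: Zs_def)
qed

lemma lifts_choice: "g \<in> Zs ==> \<exists>\<phi>. \<forall>n. \<phi> n \<in> lifts n (g n)"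
 by (rule choice) (use lift_exists ZsD in blast)

text \<open>The values of cochains on the lift are recorded as well, because associativity needs one
  specific lift of a product.\<close>

lemma lift_sum:
 assumes "finite I" "\<And>i. i \<in> I ==> \<phi> i \<in> lifts n (g i)"
 shows "\<exists>\<Phi>\<in>lifts n (\<lambda>x\<in>C n. \<Sum>i\<in>I. g i x). \<forall>j. \<forall>f\<in>coh j. \<forall>x\<in>C (j + n). f (\<Phi> j x) = (\<Sum>i\<in>I. f (\<phi> i j x))"
 using assms
proof (induct I rule: finite_induct)
 case empty
 have "(\<lambda>x\<in>C (j + n). \<zero>\<^bsub>obj P j\<^esub>) \<in> hom (j + n) j" for j
  by (rule mod_homI[OF _ _ _ obj_module]) (simp_all add: O.smult_zero)
 then show ?case
  by (intro bexI[of _ "\<lambda>j. \<lambda>x\<in>C (j + n). \<zero>\<^bsub>obj P j\<^esub>"])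
   (simp_all add: coh_zero chain_lifts_def coh_zero[OF aug_hom] mod_hom_zero[OF bd_hom obj_module obj_module] bd(1))
next
 case (insert i I)
 have "\<exists>\<Phi>\<in>lifts n (\<lambda>x\<in>C n. \<Sum>i\<in>I. g i x). \<forall>j. \<forall>f\<in>coh j. \<forall>x\<in>C (j + n). f (\<Phi> j x) = (\<Sum>i\<in>I. f (\<phi> i j x))"
  by (rule insert(3)) (simp add: insert(4))
 then obtain \<Phi> where \<Phi>: "\<Phi> \<in> lifts n (\<lambda>x\<in>C n. \<Sum>i\<in>I. g i x)" "\<forall>j. \<forall>f\<in>coh j. \<forall>x\<in>C (j + n). f (\<Phi> j x) = (\<Sum>i\<in>I. f (\<phi> i j x))"
  by (elim bexE)
 have i: "\<phi> i \<in> lifts n (g i)" using insert by auto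
 let ?\<Phi> = "\<lambda>j. \<lambda>x\<in>C (j + n). \<phi> i j x \<oplus>\<^bsub>obj P j\<^esub> \<Phi> j x"
 have "pa n (g i) (\<lambda>x\<in>C n. \<Sum>i\<in>I. g i x) = (\<lambda>x\<in>C n. \<Sum>i\<in>insert i I. g i x)"
  using insert by (auto simp: pa_def)
 then have a: "?\<Phi> \<in> lifts n (\<lambda>x\<in>C n. \<Sum>i\<in>insert i I. g i x)" using lifts_add[OF i \<Phi>(1)] by simp
 have b: "f (?\<Phi> j x) = (\<Sum>i\<in>insert i I. f (\<phi> i j x))" if "f \<in> coh j" "x \<in> C (j + n)" for f j x
  using that insert(1,2) \<Phi>(2) mod_homD(1)[OF liftsD(1)[OF i] that(2)] mod_homD(1)[OF liftsD(1)[OF \<Phi>(1)] that(2)]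
  by (simp add: cohD(1))
 show ?case by (intro bexI[OF _ a] allI ballI b)
qed

text \<open>Level \<open>j\<close> of the outer lift starts in degree \<open>j + l\<close>, so it is
  preceded by level \<open>j + l\<close> of the inner one.\<close>

lemma lift_comp:
 assumes \<phi>: "\<phi> \<in> lifts l g" and \<psi>: "\<psi> \<in> lifts k h" and g: "g \<in> Z l"
 shows "(\<lambda>j. compose (C (j + (l + k))) (\<phi> j) (\<psi> (j + l))) \<in> lifts (l + k) (compose (C (l + k)) g (\<psi> l))"
proof -
 note p = liftsD[OF \<phi>] and q = liftsD[OF \<psi>]
 have "compose (C (j + (l + k))) (\<phi> j) (\<psi> (j + l)) \<in> hom (j + (l + k)) j" for j
  using mod_hom_comp[OF q(1)[of "j + l"] p(1)[of j] obj_module] by (simp add: add.assoc)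
 moreover have "aug P (\<phi> 0 (\<psi> l x)) = g (\<psi> l x)" if "x \<in> C (l + k)" for x
  using p(2) mod_homD(1)[OF q(1) that] by simp
 moreover have "bd P j (\<phi> (Suc j) (\<psi> (Suc j + l) x)) = \<phi> j (\<psi> (j + l) (bd P (j + (l + k)) x))" if x: "x \<in> C (Suc j + (l + k))" for j x
 proof -
  have x': "x \<in> C (Suc (j + l) + k)" using x by (simp add: add.assoc)
  show ?thesis using q(3)[OF x'] p(3)[of "\<psi> (Suc j + l) x" j] mod_homD(1)[OF q(1) x'] by (simp add: add.assoc)
 qed
 ultimately show ?thesis using bd(1) unfolding chain_lifts_def by (simp add: compose_eq)
qed

lemma triangle_sum:
 fixes F :: "nat \<Rightarrow> nat \<Rightarrow> 'k"
 shows "(\<Sum>i\<le>n. \<Sum>j\<le>i. F j (i - j)) = (\<Sum>j\<le>n. \<Sum>l\<le>n - j. F j l)"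
 unfolding sum.Sigma[OF finite_atMost ballI[OF finite_atMost]]
 by (rule sum.reindex_bij_witness[of _ "\<lambda>(j, l). (j + l, j)" "\<lambda>(i, j). (j, i - j)"]) auto

text \<open>When the lift of the product of \<open>g\<close> and \<open>h\<close> is assembled from
  composites of their lifts, the two bracketings agree as functions, not only up to
  coboundaries.\<close>

lemma E_assoc:
 assumes f: "f \<in> Zs" and g: "g \<in> Zs" and h: "h \<in> Zs"
 shows "rp f \<otimes>\<^sub>E rp g \<otimes>\<^sub>E rp h = rp f \<otimes>\<^sub>E (rp g \<otimes>\<^sub>E rp h)"
proof -
 obtain \<phi> where \<phi>: "\<And>n. \<phi> n \<in> lifts n (g n)" using lifts_choice[OF g] by blast
 obtain \<psi> where \<psi>: "\<And>n. \<psi> n \<in> lifts n (h n)" using lifts_choice[OF h] by blast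
 let ?gh = "cv g \<psi>"
 have "\<exists>\<Phi>. \<Phi> \<in> lifts m (?gh m) \<and> (\<forall>j. \<forall>f\<in>coh j. \<forall>x\<in>C (j + m). f (\<Phi> j x) = (\<Sum>l\<le>m. f (\<phi> l j (\<psi> (m - l) (j + l) x))))" for m
 proof -
  have "(\<lambda>j. compose (C (j + m)) (\<phi> l j) (\<psi> (m - l) (j + l))) \<in> lifts m (compose (C m) (g l) (\<psi> (m - l) l))" if "l \<in> {..m}" for l
   using lift_comp[OF \<phi>[of l] \<psi>[of "m - l"] ZsD[OF g]] that by simp
  then have "\<exists>\<Phi>\<in>lifts m (\<lambda>x\<in>C m. \<Sum>l\<in>{..m}. compose (C m) (g l) (\<psi> (m - l) l) x). \<forall>j. \<forall>f\<in>coh j. \<forall>x\<in>C (j + m).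
    f (\<Phi> j x) = (\<Sum>l\<in>{..m}. f (compose (C (j + m)) (\<phi> l j) (\<psi> (m - l) (j + l)) x))"
   by (rule lift_sum[OF finite_atMost])
  then obtain \<Phi> where
   \<Phi>: "\<Phi> \<in> lifts m (\<lambda>x\<in>C m. \<Sum>l\<in>{..m}. compose (C m) (g l) (\<psi> (m - l) l) x)"
   "\<forall>j. \<forall>f\<in>coh j. \<forall>x\<in>C (j + m). f (\<Phi> j x) = (\<Sum>l\<in>{..m}. f (compose (C (j + m)) (\<phi> l j) (\<psi> (m - l) (j + l)) x))"
   by (elim bexE)
  have "(\<lambda>x\<in>C m. \<Sum>l\<in>{..m}. compose (C m) (g l) (\<psi> (m - l) l) x) = ?gh m"
   by (auto simp: cv_def compose_def fun_eq_iff)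
  then show ?thesis using \<Phi> by (intro exI[of _ \<Phi>]) (simp add: compose_eq)
 qed
 then have "\<exists>\<Phi>. \<forall>m. \<Phi> m \<in> lifts m (?gh m) \<and> (\<forall>j. \<forall>f\<in>coh j. \<forall>x\<in>C (j + m). f (\<Phi> m j x) = (\<Sum>l\<le>m. f (\<phi> l j (\<psi> (m - l) (j + l) x))))"
  by (intro choice allI)
 then obtain \<Phi> where \<Phi>0: "\<forall>m. \<Phi> m \<in> lifts m (?gh m) \<and> (\<forall>j. \<forall>f\<in>coh j. \<forall>x\<in>C (j + m). f (\<Phi> m j x) = (\<Sum>l\<le>m. f (\<phi> l j (\<psi> (m - l) (j + l) x))))"
  by (elim exE)
 have \<Phi>: "\<Phi> m \<in> lifts m (?gh m)"
  "f \<in> coh j ==> x \<in> C (j + m) ==> f (\<Phi> m j x) = (\<Sum>l\<le>m. f (\<phi> l j (\<psi> (m - l) (j + l) x)))" for m j f x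
  using \<Phi>0 by simp_all
 note fg = E_mult[OF f g \<phi>] and gh = E_mult[OF g h \<psi>]
 have "cv (cv f \<phi>) \<psi> n x = cv f \<Phi> n x" for n x
 proof (cases "x \<in> C n")
  case True
  have px: "\<psi> (n - i) i x \<in> C i" if "i \<le> n" for i
   using mod_homD(1)[OF liftsD(1)[OF \<psi>[of "n - i"], of i]] that True by simp
  let ?F = "\<lambda>j l. f j (\<phi> l j (\<psi> (n - (j + l)) (j + l) x))"
  have "cv (cv f \<phi>) \<psi> n x = (\<Sum>i\<le>n. \<Sum>j\<le>i. ?F j (i - j))"
   using True px by (auto simp: cv_def intro!: sum.cong)
  also have "\<dots> = (\<Sum>j\<le>n. \<Sum>l\<le>n - j. ?F j l)" by (rule triangle_sum)
  also have "\<dots> = (\<Sum>j\<le>n. f j (\<Phi> (n - j) j x))"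
  proof (intro sum.cong refl)
   fix j assume j: "j \<in> {..n}"
   have fj: "f j \<in> coh j" using ZsD[OF f] by (simp add: Z_iff)
   show "(\<Sum>l\<le>n - j. ?F j l) = f j (\<Phi> (n - j) j x)"
    using \<Phi>(2)[OF fj, of x "n - j"] True j by simp
  qed
  finally show ?thesis using True by (simp add: cv_def)
 qed (simp add: cv_def)
 then have "cv (cv f \<phi>) \<psi> = cv f \<Phi>" by blast
 then show ?thesis
  unfolding fg(1) gh(1) using E_mult(1)[OF fg(2) h \<psi>] E_mult(1)[OF f gh(2) \<Phi>(1)] by simp
qed

definition onef :: "nat \<Rightarrow> 'm \<Rightarrow> 'k" where
 "onef n = (if n = 0 then aug P else (\<lambda>x\<in>C n. 0))"

lemma aug_Z: "aug P \<in> Z 0"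
 using aug_hom aug_bd by (simp add: Z_iff)

lemma one_Zs: "onef \<in> Zs"
proof -
 have "finite {n. onef n \<notin> B n}" by (rule finite_subset[of _ "{0}"]) (auto simp: onef_def zero_B)
 then show ?thesis using aug_Z B_Z[OF zero_B] by (simp add: Zs_def onef_def)
qed

lemma E_one: "\<one>\<^sub>E = rp onef"
 by (simp add: Ext_ring_def rp_def onef_def EG_one cls_def fun_eq_iff)

lemma E_one_left:
 assumes f: "f \<in> Zs"
 shows "\<one>\<^sub>E \<otimes>\<^sub>E rp f = rp f"
proof -
 obtain \<phi> where \<phi>: "\<And>n. \<phi> n \<in> lifts n (f n)" using lifts_choice[OF f] by blast
 have "cv onef \<phi> n x = f n x" for n x
 proof (cases "x \<in> C n")
  case True
  have px: "\<phi> (n - i) i x \<in> C i" if "i \<le> n" for i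
   using mod_homD(1)[OF liftsD(1)[OF \<phi>[of "n - i"], of i]] that True by simp
  have "(\<Sum>i\<le>n. onef i (\<phi> (n - i) i x)) = (\<Sum>i\<in>{0}. onef i (\<phi> (n - i) i x))"
   using px by (intro sum.mono_neutral_right) (auto simp: onef_def)
  then show ?thesis using True liftsD(2)[OF \<phi>[of n]] by (simp add: cv_def onef_def)
 next
  case False
  then show ?thesis using cohD(3)[of "f n" n x] ZsD[OF f, of n] by (simp add: cv_def Z_iff)
 qed
 then have "cv onef \<phi> = f" by blast
 then show ?thesis unfolding E_one using E_mult(1)[OF one_Zs f \<phi>] by simp
qed

lemma E_one_right:
 assumes f: "f \<in> Zs"
 shows "rp f \<otimes>\<^sub>E \<one>\<^sub>E = rp f"
proof -
 \<comment> \<open>The identity lifts the augmentation, and zero maps lift the remaining components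
   of the unit.\<close>
 let ?\<phi> = "\<lambda>n i. if n = 0 then (\<lambda>x\<in>C i. x) else (\<lambda>x\<in>C (i + n). \<zero>\<^bsub>obj P i\<^esub>)"
 have "(\<lambda>x\<in>C i. x) \<in> hom i i" "(\<lambda>x\<in>C (i + n). \<zero>\<^bsub>obj P i\<^esub>) \<in> hom (i + n) i" for i n
  by (rule mod_homI[OF _ _ _ obj_module]; simp add: O.smult_zero)+
 then have \<phi>: "?\<phi> n \<in> lifts n (onef n)" for n
  by (auto simp: chain_lifts_def onef_def bd(1) coh_zero[OF aug_hom] mod_hom_zero[OF bd_hom obj_module obj_module])
 have "cv f ?\<phi> n x = f n x" for n x
 proof (cases "x \<in> C n")
  case True
  have fc: "f i \<in> coh i" for i using ZsD[OF f, of i] by (simp add: Z_iff)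
  have "(\<Sum>i\<le>n. f i (?\<phi> (n - i) i x)) = (\<Sum>i\<in>{n}. f i (?\<phi> (n - i) i x))"
   using True coh_zero[OF fc] by (intro sum.mono_neutral_right) auto
  then show ?thesis using True by (simp add: cv_def)
 next
  case False
  then show ?thesis using cohD(3)[of "f n" n x] ZsD[OF f, of n] by (simp add: cv_def Z_iff)
 qed
 then have "cv f ?\<phi> = f" by blast
 then show ?thesis unfolding E_one using E_mult(1)[OF f one_Zs \<phi>] by simp
qed

lemma E_distrib:
 assumes f: "f \<in> Zs" and g: "g \<in> Zs" and h: "h \<in> Zs"
 shows "(rp f \<oplus>\<^sub>E rp g) \<otimes>\<^sub>E rp h = rp f \<otimes>\<^sub>E rp h \<oplus>\<^sub>E rp g \<otimes>\<^sub>E rp h"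
  and "rp h \<otimes>\<^sub>E (rp f \<oplus>\<^sub>E rp g) = rp h \<otimes>\<^sub>E rp f \<oplus>\<^sub>E rp h \<otimes>\<^sub>E rp g"
proof -
 obtain \<chi> where \<chi>: "\<And>n. \<chi> n \<in> lifts n (h n)" using lifts_choice[OF h] by blast
 obtain \<phi> where \<phi>: "\<And>n. \<phi> n \<in> lifts n (f n)" using lifts_choice[OF f] by blast
 obtain \<psi> where \<psi>: "\<And>n. \<psi> n \<in> lifts n (g n)" using lifts_choice[OF g] by blast
 have px: "\<chi> (n - i) i x \<in> C i" "\<phi> (n - i) i x \<in> C i" "\<psi> (n - i) i x \<in> C i" if "i \<le> n" "x \<in> C n" for i n x
  using mod_homD(1)[OF liftsD(1)[OF \<chi>[of "n - i"], of i]] mod_homD(1)[OF liftsD(1)[OF \<phi>[of "n - i"], of i]]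
   mod_homD(1)[OF liftsD(1)[OF \<psi>[of "n - i"], of i]] that by simp_all
 have "cv (\<lambda>n. pa n (f n) (g n)) \<chi> = (\<lambda>n. pa n (cv f \<chi> n) (cv g \<chi> n))"
 proof (intro ext)
  fix n x
  show "cv (\<lambda>n. pa n (f n) (g n)) \<chi> n x = pa n (cv f \<chi> n) (cv g \<chi> n) x"
  proof (cases "x \<in> C n")
   case True
   have "cv (\<lambda>n. pa n (f n) (g n)) \<chi> n x = (\<Sum>i\<le>n. f i (\<chi> (n - i) i x) + g i (\<chi> (n - i) i x))"
    using True px by (auto simp: cv_def pa_def intro!: sum.cong)
   then show ?thesis using True by (simp add: cv_def pa_def sum.distrib)
  qed (simp add: cv_def pa_def)
 qed
 then show "(rp f \<oplus>\<^sub>E rp g) \<otimes>\<^sub>E rp h = rp f \<otimes>\<^sub>E rp h \<oplus>\<^sub>E rp g \<otimes>\<^sub>E rp h"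
  by (simp add: E_add f g E_mult[OF Zs_add[OF f g] h \<chi>] E_mult[OF f h \<chi>] E_mult[OF g h \<chi>])
 let ?s = "\<lambda>n i. \<lambda>x\<in>C (i + n). \<phi> n i x \<oplus>\<^bsub>obj P i\<^esub> \<psi> n i x"
 have s: "?s n \<in> lifts n (pa n (f n) (g n))" for n by (rule lifts_add[OF \<phi> \<psi>])
 have hc: "h i \<in> coh i" for i using ZsD[OF h, of i] by (simp add: Z_iff)
 have "cv h ?s = (\<lambda>n. pa n (cv h \<phi> n) (cv h \<psi> n))"
 proof (intro ext)
  fix n x
  show "cv h ?s n x = pa n (cv h \<phi> n) (cv h \<psi> n) x"
  proof (cases "x \<in> C n")
   case True
   have "cv h ?s n x = (\<Sum>i\<le>n. h i (\<phi> (n - i) i x) + h i (\<psi> (n - i) i x))"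
    using True px by (auto simp: cv_def cohD(1)[OF hc] intro!: sum.cong)
   then show ?thesis using True by (simp add: cv_def pa_def sum.distrib)
  qed (simp add: cv_def pa_def)
 qed
 then show "rp h \<otimes>\<^sub>E (rp f \<oplus>\<^sub>E rp g) = rp h \<otimes>\<^sub>E rp f \<oplus>\<^sub>E rp h \<otimes>\<^sub>E rp g"
  by (simp add: E_add f g E_mult[OF h Zs_add[OF f g] s] E_mult[OF h f \<phi>] E_mult[OF h g \<psi>])
qed

theorem ring_E: "Ring.ring E"
proof (rule ringI)
 show "abelian_group E"
 proof (rule abelian_groupI)
  fix x assume "x \<in> carrier E"
  then obtain f where f: "f \<in> Zs" "x = rp f" by (auto simp: E_carrier)
  have m: "(\<lambda>n. pc n (-1) (f n)) \<in> Zs"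
  proof -
   have "{n. pc n (-1) (f n) \<notin> B n} \<subseteq> {n. f n \<notin> B n}" using B_lin by auto
   then show ?thesis using f finite_subset[of _ "{n. f n \<notin> B n}"] unfolding Zs_def by (simp add: Z_lin(3))
  qed
  have "(\<lambda>n. pa n (pc n (-1) (f n)) (f n)) = (\<lambda>n. \<lambda>x\<in>C n. 0)" by (auto simp: pa_def pc_def fun_eq_iff)
  then have "rp (\<lambda>n. pc n (-1) (f n)) \<oplus>\<^sub>E x = \<zero>\<^sub>E" using f by (simp only: E_add m E_zero)
  then show "\<exists>y\<in>carrier E. y \<oplus>\<^sub>E x = \<zero>\<^sub>E" using m E_carrier by blast
  have "(\<lambda>n. pa n (\<lambda>x\<in>C n. 0) (f n)) = f" using Z_ext[OF ZsD[OF f(1)]] by (simp add: pa_def cong: restrict_cong)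
  then show "\<zero>\<^sub>E \<oplus>\<^sub>E x = x" using f E_add[OF zero_Zs f(1)] by (simp add: E_zero)
  fix y assume "y \<in> carrier E"
  then obtain g where g: "g \<in> Zs" "y = rp g" by (auto simp: E_carrier)
  show "x \<oplus>\<^sub>E y \<in> carrier E" using f g Zs_add[OF f(1) g(1)] by (simp add: E_add E_carrier)
  have "(\<lambda>n. pa n (f n) (g n)) = (\<lambda>n. pa n (g n) (f n))" by (simp add: pa_def add.commute)
  then show "x \<oplus>\<^sub>E y = y \<oplus>\<^sub>E x" using f g by (simp add: E_add)
  fix z assume "z \<in> carrier E"
  then obtain h where h: "h \<in> Zs" "z = rp h" by (auto simp: E_carrier)
  have "(\<lambda>n. pa n (pa n (f n) (g n)) (h n)) = (\<lambda>n. pa n (f n) (pa n (g n) (h n)))" by (auto simp: pa_def add.assoc fun_eq_iff)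
  then show "x \<oplus>\<^sub>E y \<oplus>\<^sub>E z = x \<oplus>\<^sub>E (y \<oplus>\<^sub>E z)"
   using f g h Zs_add[OF f(1) g(1)] Zs_add[OF g(1) h(1)] by (simp add: E_add)
 next
  show "\<zero>\<^sub>E \<in> carrier E" unfolding E_zero E_carrier using zero_Zs by (rule imageI)
 qed
 show "Group.monoid E"
 proof (rule monoidI)
  show "\<one>\<^sub>E \<in> carrier E" unfolding E_one E_carrier using one_Zs by (rule imageI)
  fix x assume "x \<in> carrier E"
  then obtain f where f: "f \<in> Zs" "x = rp f" by (auto simp: E_carrier)
  show "\<one>\<^sub>E \<otimes>\<^sub>E x = x" "x \<otimes>\<^sub>E \<one>\<^sub>E = x" using f by (simp_all add: E_one_left E_one_right)
  fix y assume "y \<in> carrier E"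
  then obtain g where g: "g \<in> Zs" "y = rp g" by (auto simp: E_carrier)
  obtain \<phi> where \<phi>: "\<And>n. \<phi> n \<in> lifts n (g n)" using lifts_choice[OF g(1)] by blast
  show "x \<otimes>\<^sub>E y \<in> carrier E" using E_mult[OF f(1) g(1) \<phi>] f g by (simp add: E_carrier)
  fix z assume "z \<in> carrier E"
  then obtain h where h: "h \<in> Zs" "z = rp h" by (auto simp: E_carrier)
  show "x \<otimes>\<^sub>E y \<otimes>\<^sub>E z = x \<otimes>\<^sub>E (y \<otimes>\<^sub>E z)" using f g h by (simp add: E_assoc)
 qed
qed (auto simp: E_carrier E_distrib)

end

section \<open>Ascending chains of stable families\<close>

definition acc :: "'a::order set \<Rightarrow> bool" where
 "acc K \<longleftrightarrow> (\<forall>F :: nat \<Rightarrow> 'a. range F \<subseteq> K \<and> mono F \<longrightarrow> (\<exists>N. \<forall>n\<ge>N. F n = F N))"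

lemma accD: "acc K ==> (\<And>n. F n \<in> K) ==> mono F ==> \<exists>N. \<forall>n\<ge>N. F n = F (N :: nat)"
 unfolding acc_def by blast

text \<open>Once the diagonal is constant from \<open>N\<close> on, monotonicity squeezes every
  \<open>F s m\<close> with \<open>s, m \<ge> N\<close> to the same value, and only the finitely
  many \<open>m < N\<close> remain. This is the combinatorial core of Hilbert's basis
  theorem.\<close>

lemma acc_double:
 fixes F :: "nat \<Rightarrow> nat \<Rightarrow> 'a::order"
 assumes K: "acc K" and F: "\<And>s m. F s m \<in> K" and mono: "\<And>s s' m m'. s \<le> s' ==> m \<le> m' ==> F s m \<le> F s' m'"
 shows "\<exists>N. \<forall>s\<ge>N. \<forall>m. F s m = F N m"
proof -
 have "\<exists>N. \<forall>s\<ge>N. F s s = F N N" by (rule accD[OF K]) (auto intro: F mono monoI)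
 then obtain N where N: "\<And>s. s \<ge> N ==> F s s = F N N" by blast
 have "\<exists>N'. \<forall>s\<ge>N'. F s m = F N' m" for m by (rule accD[OF K]) (auto intro: F mono monoI)
 then obtain f where f: "\<And>m s. s \<ge> f m ==> F s m = F (f m) m" by metis
 define M where "M = N + (\<Sum>m<N. f m)"
 have "F s m = F M m" if s: "s \<ge> M" for s m
 proof (cases "m < N")
  case True
  then have "f m \<le> M" unfolding M_def using member_le_sum[of m "{..<N}" f] by simp
  then show ?thesis using f[of m s] f[of m M] s by simp
 next
  case False
  have "F s' m = F N N" if "s' \<ge> N" for s'
  proof (rule antisym)
   show "F s' m \<le> F N N" using mono[of s' "max s' m" m "max s' m"] N[of "max s' m"] that by simp
   show "F N N \<le> F s' m" using mono[of N s' N m] that False by simp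
  qed
  then show ?thesis using s by (simp add: M_def)
 qed
 then show ?thesis by blast
qed

text \<open>The index \<open>m\<close> plays the part of the degree in Hilbert's basis theorem,
  \<open>R1 m\<close> and \<open>R2 m\<close> that of ideals of leading coefficients.\<close>

lemma acc_transfer:
 fixes R1 R2 :: "nat \<Rightarrow> 'b::order \<Rightarrow> 'a::order"
 assumes K: "acc K" and R: "\<And>m W. W \<in> K' ==> R1 m W \<in> K" "\<And>m W. W \<in> K' ==> R2 m W \<in> K"
  and mono: "\<And>m m' W W'. W \<in> K' ==> W' \<in> K' ==> m \<le> m' ==> W \<le> W' ==> R1 m W \<le> R1 m' W'"
   "\<And>m m' W W'. W \<in> K' ==> W' \<in> K' ==> m \<le> m' ==> W \<le> W' ==> R2 m W \<le> R2 m' W'"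
  and inj: "\<And>W W'. W \<in> K' ==> W' \<in> K' ==> W \<le> W' ==> (\<And>m. R1 m W = R1 m W') ==> (\<And>m. R2 m W = R2 m W') ==> W = W'"
 shows "acc K'"
 unfolding acc_def
proof (intro allI impI, elim conjE)
 fix W :: "nat \<Rightarrow> 'b" assume W: "range W \<subseteq> K'" and m: "mono W"
 have WK: "W s \<in> K'" for s using W by blast
 obtain N1 where N1: "\<forall>s\<ge>N1. \<forall>m. R1 m (W s) = R1 m (W N1)" by (rule exE[OF acc_double[of K "\<lambda>s m. R1 m (W s)", OF K R(1)[OF WK]]]) (intro mono WK monoD[OF m])
 obtain N2 where N2: "\<forall>s\<ge>N2. \<forall>m. R2 m (W s) = R2 m (W N2)" by (rule exE[OF acc_double[of K "\<lambda>s m. R2 m (W s)", OF K R(2)[OF WK]]]) (intro mono WK monoD[OF m])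
 have "W s = W (N1 + N2)" if "s \<ge> N1 + N2" for s
 proof (rule inj[symmetric, OF WK WK monoD[OF m that]])
  fix i
  show "R1 i (W (N1 + N2)) = R1 i (W s)" using N1[rule_format, of s i] N1[rule_format, of "N1 + N2" i] that by simp
  show "R2 i (W (N1 + N2)) = R2 i (W s)" using N2[rule_format, of s i] N2[rule_format, of "N1 + N2" i] that by simp
 qed
 then show "\<exists>N. \<forall>n\<ge>N. W n = W N" by blast
qed

definition cyc :: "(nat \<Rightarrow> 'v::ab_group_add \<Rightarrow> 'v) \<Rightarrow> (nat \<Rightarrow> 'v set) \<Rightarrow> nat \<Rightarrow> 'v set" where
 "cyc D V n = {x \<in> V n. D n x = 0}"

definition bnd :: "(nat \<Rightarrow> 'v::ab_group_add \<Rightarrow> 'v) \<Rightarrow> (nat \<Rightarrow> 'v set) \<Rightarrow> nat \<Rightarrow> 'v set" where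
 "bnd D V n = (case n of 0 \<Rightarrow> {0} | Suc m \<Rightarrow> D m ` V m)"

lemma bnd_simps: "bnd D V 0 = {0}" "bnd D V (Suc m) = D m ` V m"
 by (simp_all add: bnd_def)

text \<open>Such a family is the full preimage, in the cycles, of a graded subgroup of the
  cohomology that is stable under \<open>\<Omega>\<close>. Scalars are not built in; they enter as
  operators of degree 0.\<close>

definition fam :: "(nat \<Rightarrow> 'v::ab_group_add \<Rightarrow> 'v) \<Rightarrow> (nat \<Rightarrow> 'v set) \<Rightarrow> (nat \<times> (nat \<Rightarrow> 'v \<Rightarrow> 'v)) set \<Rightarrow> (nat \<Rightarrow> 'v set) set" where
 "fam D V \<Omega> = {W. \<forall>n. bnd D V n \<subseteq> W n \<and> W n \<subseteq> cyc D V n \<and> (\<forall>x\<in>W n. \<forall>y\<in>W n. x - y \<in> W n) \<and>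
   (\<forall>(k, \<omega>)\<in>\<Omega>. \<forall>x\<in>W n. \<omega> n x \<in> W (n + k))}"

lemma famD:
 assumes "W \<in> fam D V \<Omega>"
 shows "x \<in> bnd D V n ==> x \<in> W n" "x \<in> W n ==> x \<in> V n" "x \<in> W n ==> D n x = 0"
  "x \<in> W n ==> y \<in> W n ==> x - y \<in> W n" "(k, \<omega>) \<in> \<Omega> ==> x \<in> W n ==> \<omega> n x \<in> W (n + k)"
proof -
 have a: "bnd D V n \<subseteq> W n" "W n \<subseteq> cyc D V n" "\<forall>x\<in>W n. \<forall>y\<in>W n. x - y \<in> W n" "\<forall>z\<in>\<Omega>. case z of (k, \<omega>) \<Rightarrow> \<forall>x\<in>W n. \<omega> n x \<in> W (n + k)"
  using assms by (simp_all add: fam_def)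
 show "(k, \<omega>) \<in> \<Omega> ==> x \<in> W n ==> \<omega> n x \<in> W (n + k)" using bspec[OF a(4), of "(k, \<omega>)"] by simp
qed (use assms in \<open>auto simp: fam_def cyc_def\<close>)

lemma famI:
 assumes "\<And>n x. x \<in> bnd D V n ==> x \<in> W n" "\<And>n x. x \<in> W n ==> x \<in> cyc D V n"
  "\<And>n x y. x \<in> W n ==> y \<in> W n ==> x - y \<in> W n" "\<And>n k \<omega> x. (k, \<omega>) \<in> \<Omega> ==> x \<in> W n ==> \<omega> n x \<in> W (n + k)"
 shows "W \<in> fam D V \<Omega>"
 using assms unfolding fam_def by blast

text \<open>
 In the application \<open>T\<close> and \<open>T'\<close> are the actions of \<open>t\<close> and \<open>t'\<close> with \<open>t t' = t' t = 0\<close>, and \<open>zigzag\<close> says that \<open>\<chi>\<close> is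
 represented by a two-step path through the kernels of \<open>T\<close> and \<open>T'\<close>.
\<close>

locale acc_step =
 fixes X :: "nat \<Rightarrow> 'v::ab_group_add set" and D T T' \<chi> :: "nat \<Rightarrow> 'v \<Rightarrow> 'v" and \<Omega> :: "(nat \<times> (nat \<Rightarrow> 'v \<Rightarrow> 'v)) set"
 assumes X_zero: "0 \<in> X n" and X_diff: "x \<in> X n ==> y \<in> X n ==> x - y \<in> X n"
  and op_X: "x \<in> X n ==> D n x \<in> X (Suc n)" "x \<in> X n ==> T n x \<in> X n" "x \<in> X n ==> T' n x \<in> X n"
   "x \<in> X n ==> \<chi> n x \<in> X (Suc (Suc n))" "(k, \<omega>) \<in> \<Omega> ==> x \<in> X n ==> \<omega> n x \<in> X (n + k)"
  and op_diff: "D n (x - y) = D n x - D n y" "T n (x - y) = T n x - T n y" "T' n (x - y) = T' n x - T' n y"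
   "\<chi> n (x - y) = \<chi> n x - \<chi> n y" "(k, \<omega>) \<in> \<Omega> ==> \<omega> n (x - y) = \<omega> n x - \<omega> n y"
  and DD: "x \<in> X n ==> D (Suc n) (D n x) = 0"
  and D_comm: "x \<in> X n ==> D n (T n x) = T (Suc n) (D n x)" "x \<in> X n ==> D n (T' n x) = T' (Suc n) (D n x)"
   "x \<in> X n ==> D (Suc (Suc n)) (\<chi> n x) = \<chi> (Suc n) (D n x)" "(k, \<omega>) \<in> \<Omega> ==> x \<in> X n ==> D (n + k) (\<omega> n x) = \<omega> (Suc n) (D n x)"
  and T_comm: "x \<in> X n ==> T (Suc (Suc n)) (\<chi> n x) = \<chi> n (T n x)" "(k, \<omega>) \<in> \<Omega> ==> x \<in> X n ==> T (n + k) (\<omega> n x) = \<omega> n (T n x)"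
  and TT: "x \<in> X n ==> T n (T' n x) = 0" "x \<in> X n ==> T' n (T n x) = 0"
  and \<chi>_comm: "(k, \<omega>) \<in> \<Omega> ==> x \<in> X n ==> T n x = 0 ==> D n x = 0 ==>
   \<exists>y\<in>X (Suc (n + k)). T (Suc (n + k)) y = 0 \<and> \<chi> (n + k) (\<omega> n x) - \<omega> (Suc (Suc n)) (\<chi> n x) = D (Suc (n + k)) y"
  and ker_T': "x \<in> X n ==> T' n x = 0 ==> \<exists>w\<in>X n. x = T n w"
  and zigzag: "x \<in> X n ==> T n x = 0 ==> D n x = 0 ==>
   \<exists>u\<in>X n. \<exists>v\<in>X (Suc n). x = T' n u \<and> D n u = T (Suc n) v \<and> D (Suc n) v = \<chi> n x"
begin

definition Y where "Y n = {x \<in> X n. T n x = 0}"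

lemma additive:
 assumes "\<And>x y. f (x - y) = f x - f (y :: 'v)"
 shows "f 0 = (0 :: 'v)" "f (x + y) = f x + f y"
proof -
 show z: "f 0 = 0" using assms[of 0 0] by simp
 have "f (- y) = - f y" using assms[of 0 y] z by simp
 then show "f (x + y) = f x + f y" using assms[of x "- y"] by simp
qed

lemmas ops = op_diff additive[of "D n" for n, OF op_diff(1)] additive[of "T n" for n, OF op_diff(2)]
 additive[of "T' n" for n, OF op_diff(3)] additive[of "\<chi> n" for n, OF op_diff(4)]

lemma \<omega>_zero: "(k, \<omega>) \<in> \<Omega> ==> \<omega> n 0 = 0"
 using op_diff(5)[of k \<omega> n 0 0] by simp

lemma Y_zero: "0 \<in> Y n" and Y_diff: "x \<in> Y n ==> y \<in> Y n ==> x - y \<in> Y n" and D_Y: "x \<in> Y n ==> D n x \<in> Y (Suc n)"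
 and \<chi>_Y: "x \<in> Y n ==> \<chi> n x \<in> Y (Suc (Suc n))" and \<omega>_Y: "(k, \<omega>) \<in> \<Omega> ==> x \<in> Y n ==> \<omega> n x \<in> Y (n + k)"
 using \<omega>_zero by (auto simp: Y_def X_zero X_diff op_X ops D_comm[symmetric] T_comm)

text \<open>Any zigzag through \<open>T' n u\<close> computes \<chi> up to a boundary of
  \<open>Y\<close>: two choices of \<open>u\<close> differ by some \<open>T n w\<close>, and
  \<open>D n w\<close> corrects the difference between the choices of \<open>v\<close>.\<close>

lemma connecting:
 assumes u: "u \<in> X n" and v: "v \<in> X (Suc n)" and uv: "D n u = T (Suc n) v"
 shows "T' n u \<in> cyc D Y n" "\<exists>y\<in>Y (Suc n). D (Suc n) v - \<chi> n (T' n u) = D (Suc n) y"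
proof -
 show f: "T' n u \<in> cyc D Y n" using u v uv by (simp add: cyc_def Y_def op_X TT D_comm)
 obtain u' v' where *: "u' \<in> X n" "v' \<in> X (Suc n)" "T' n u = T' n u'" "D n u' = T (Suc n) v'" "D (Suc n) v' = \<chi> n (T' n u)"
  using zigzag[of "T' n u" n] f by (auto simp: cyc_def Y_def)
 obtain w where w: "w \<in> X n" "u - u' = T n w" using ker_T'[of "u - u'" n] * u by (auto simp: X_diff ops)
 let ?y = "v - v' - D n w"
 have "T (Suc n) ?y = D n (u - u') - D n (T n w)" using w(1) * uv by (simp add: ops(1-4) D_comm)
 then have "?y \<in> Y (Suc n)" using w * v by (simp add: Y_def X_diff op_X)
 moreover have "D (Suc n) v - \<chi> n (T' n u) = D (Suc n) ?y" using w * by (simp add: ops DD)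
 ultimately show "\<exists>y\<in>Y (Suc n). D (Suc n) v - \<chi> n (T' n u) = D (Suc n) y" by blast
qed

abbreviation FX where "FX \<equiv> fam D X \<Omega>"
abbreviation FY where "FY \<equiv> fam D Y (insert (2, \<chi>) \<Omega>)"

text \<open>For a stable \<open>W\<close> the iterated preimages under \<chi> ascend; they take the
  place of leading coefficient ideals of growing degree.\<close>

definition pull where "pull W n = {v \<in> cyc D Y n. \<chi> n v \<in> W (Suc (Suc n))}"
definition rho where "rho W n = {z \<in> cyc D X n. \<exists>v\<in>W n. z - v \<in> bnd D X n}"
text \<open>The short exact sequence of \<open>Y\<close>, \<open>X\<close> and the image of
  \<open>T\<close> has the connecting map \<open>T y -> D y\<close>. This collects the classes in
  the cohomology of \<open>X\<close> of those \<open>T y\<close> whose image lies in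
  \<open>W\<close>, and so sees the part of \<open>W\<close> that becomes a boundary in
  \<open>X\<close>, to which \<open>rho\<close> is blind.\<close>

definition del where "del W n = {z \<in> cyc D X n. \<exists>y\<in>X n. D n y \<in> W (Suc n) \<and> z - T n y \<in> bnd D X n}"

lemma bnd_diff: "(\<And>n. 0 \<in> V n) ==> (\<And>n x y. x \<in> V n ==> y \<in> V n ==> x - y \<in> V n) ==> x \<in> bnd D V n ==> y \<in> bnd D V n ==> x - y \<in> bnd D V n"
 by (cases n) (auto simp: bnd_simps image_iff ops(1)[symmetric])

lemma bX_diff: "x \<in> bnd D X n ==> y \<in> bnd D X n ==> x - y \<in> bnd D X n"
 by (rule bnd_diff[of X]) (auto intro: X_zero X_diff)

lemma b_zero: "0 \<in> bnd D X n" "0 \<in> bnd D Y n"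
 by (cases n; force simp: bnd_simps ops X_zero Y_zero image_iff intro: X_zero Y_zero)+

lemma bX_cyc: "x \<in> bnd D X n ==> x \<in> cyc D X n" and bY_cyc: "x \<in> bnd D Y n ==> x \<in> cyc D Y n"
 using D_Y by (cases n; auto simp: bnd_simps cyc_def X_zero Y_zero ops op_X DD Y_def)+

lemma \<omega>_bX: "(k, \<omega>) \<in> \<Omega> ==> x \<in> bnd D X n ==> \<omega> n x \<in> bnd D X (n + k)"
proof (cases n)
 case 0
 assume "(k, \<omega>) \<in> \<Omega>" "x \<in> bnd D X n"
 then show ?thesis using 0 \<omega>_zero[of k \<omega> 0] b_zero(1)[of k] by (auto simp: bnd_simps)
qed (auto simp: bnd_simps D_comm(4)[symmetric] op_X)

lemma \<chi>_bY: "x \<in> bnd D Y n ==> \<chi> n x \<in> bnd D Y (Suc (Suc n))"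
proof (cases n)
 case (Suc m)
 assume "x \<in> bnd D Y n"
 then obtain y where y: "y \<in> Y m" "x = D m y" using Suc by (auto simp: bnd_simps)
 have "\<chi> n x = D (Suc (Suc m)) (\<chi> m y)" using y Suc D_comm(3)[of y m] by (simp add: Y_def)
 then show ?thesis using \<chi>_Y[OF y(1)] Suc by (simp add: bnd_simps)
qed (use b_zero[of "Suc (Suc n)"] in \<open>auto simp: bnd_simps ops\<close>)

lemma FYD:
 assumes W: "W \<in> FY"
 shows "x \<in> bnd D Y n ==> x \<in> W n" "x \<in> W n ==> x \<in> cyc D Y n" "x \<in> W n ==> y \<in> W n ==> x - y \<in> W n"
  "(k, \<omega>) \<in> \<Omega> ==> x \<in> W n ==> \<omega> n x \<in> W (n + k)" "x \<in> W n ==> \<chi> n x \<in> W (Suc (Suc n))" "0 \<in> W n"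
  "x \<in> W n ==> y \<in> W n ==> x + y \<in> W n"
proof -
 note d = famD[OF W]
 show 1: "x - y \<in> W n" if "x \<in> W n" "y \<in> W n" for x y using d(4) that .
 show 2: "0 \<in> W n" using d(1)[OF b_zero(2)] .
 show "x \<in> W n ==> y \<in> W n ==> x + y \<in> W n" using 1[of x "0 - y"] 1[OF 2, of y] by simp
 show "x \<in> W n ==> \<chi> n x \<in> W (Suc (Suc n))" using d(5)[of 2 \<chi> x n] by simp
qed (use famD[OF W] in \<open>auto simp: cyc_def\<close>)

lemma pull_FY:
 assumes W: "W \<in> FY"
 shows "pull W \<in> FY" "W \<le> pull W"
proof -
 note d = FYD[OF W]
 show le: "W \<le> pull W" using d(2,5) by (auto simp: le_fun_def pull_def)
 show "pull W \<in> FY"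
 proof (rule famI)
  fix n x
  show "x \<in> bnd D Y n ==> x \<in> pull W n" using bY_cyc \<chi>_bY d(1) by (simp add: pull_def)
  show "x \<in> pull W n ==> x \<in> cyc D Y n" by (simp add: pull_def)
  fix y assume "x \<in> pull W n" "y \<in> pull W n"
  then show "x - y \<in> pull W n" using d(3) by (simp add: pull_def cyc_def Y_diff ops)
 next
  fix n k \<omega> x assume o: "(k, \<omega>) \<in> insert (2, \<chi>) \<Omega>" and x: "x \<in> pull W n"
  show "\<omega> n x \<in> pull W (n + k)"
  proof (cases "(k, \<omega>) = (2, \<chi>)")
   case True
   then have "k = 2" "\<omega> = \<chi>" by auto
   moreover have "\<chi> n x \<in> W (Suc (Suc n))" using x by (simp add: pull_def)
   then have "\<chi> n x \<in> pull W (Suc (Suc n))" using le by (auto simp: le_fun_def)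
   ultimately show ?thesis by simp
  next
   case False
   then have o: "(k, \<omega>) \<in> \<Omega>" using o by blast
   have xc: "x \<in> Y n" "D n x = 0" "x \<in> X n" "T n x = 0" "\<chi> n x \<in> W (Suc (Suc n))" using x by (auto simp: pull_def cyc_def Y_def)
   have oc: "\<omega> n x \<in> cyc D Y (n + k)" using \<omega>_Y[OF o xc(1)] D_comm(4)[OF o xc(3)] xc(2) \<omega>_zero[OF o] by (simp add: cyc_def)
   \<comment> \<open>\<chi> and \<omega> commute on \<open>x\<close> up to a boundary of
     \<open>Y\<close>, and \<open>W\<close> contains all of these.\<close>
   obtain y where y: "y \<in> X (Suc (n + k))" "T (Suc (n + k)) y = 0" "\<chi> (n + k) (\<omega> n x) - \<omega> (Suc (Suc n)) (\<chi> n x) = D (Suc (n + k)) y"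
    using \<chi>_comm[OF o xc(3,4,2)] by blast
   have "D (Suc (n + k)) y \<in> W (Suc (Suc (n + k)))" using y by (intro d(1)) (auto simp: bnd_simps Y_def)
   moreover have "\<omega> (Suc (Suc n)) (\<chi> n x) \<in> W (Suc (Suc (n + k)))" using d(4)[OF o xc(5)] by simp
   moreover have "\<chi> (n + k) (\<omega> n x) = D (Suc (n + k)) y + \<omega> (Suc (Suc n)) (\<chi> n x)" using y(3) by (simp add: algebra_simps)
   ultimately have "\<chi> (n + k) (\<omega> n x) \<in> W (Suc (Suc (n + k)))" using d(7) by simp
   then show ?thesis using oc by (simp add: pull_def)
  qed
 qed
qed

lemma rho_FX:
 assumes W: "W \<in> FY"
 shows "rho W \<in> FX"
proof (rule famI)
 note d = FYD[OF W]
 fix n x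
 show "x \<in> bnd D X n ==> x \<in> rho W n" using bX_cyc d(6)[of n] by (force simp: rho_def)
 show "x \<in> rho W n ==> x \<in> cyc D X n" by (simp add: rho_def)
 { fix y assume "x \<in> rho W n" "y \<in> rho W n"
  then obtain v w where *: "x \<in> cyc D X n" "y \<in> cyc D X n" "v \<in> W n" "w \<in> W n" "x - v \<in> bnd D X n" "y - w \<in> bnd D X n" by (auto simp: rho_def)
  have "(x - y) - (v - w) = (x - v) - (y - w)" by simp
  then have "(x - y) - (v - w) \<in> bnd D X n" using bX_diff[OF *(5,6)] by metis
  then show "x - y \<in> rho W n" using * d(3) by (auto simp: rho_def cyc_def X_diff ops) }
 fix k \<omega> assume o: "(k, \<omega>) \<in> \<Omega>" and x: "x \<in> rho W n"
 then obtain v where *: "x \<in> X n" "D n x = 0" "v \<in> W n" "x - v \<in> bnd D X n" by (auto simp: rho_def cyc_def)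
 have "\<omega> n x - \<omega> n v \<in> bnd D X (n + k)" using \<omega>_bX[OF o *(4)] op_diff(5)[OF o] by simp
 moreover have "\<omega> n x \<in> cyc D X (n + k)" using op_X(5)[OF o *(1)] D_comm(4)[OF o *(1)] *(2) \<omega>_zero[OF o] by (simp add: cyc_def)
 ultimately show "\<omega> n x \<in> rho W (n + k)" using d(4)[OF o *(3)] by (auto simp: rho_def)
qed

lemma del_FX:
 assumes W: "W \<in> FY"
 shows "del W \<in> FX"
proof (rule famI)
 note d = FYD[OF W]
 fix n x
 show "x \<in> bnd D X n ==> x \<in> del W n"
  using bX_cyc d(6)[of "Suc n"] X_zero[of n] by (auto simp: del_def ops intro!: bexI[of _ 0])
 show "x \<in> del W n ==> x \<in> cyc D X n" by (simp add: del_def)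
 { fix y assume "x \<in> del W n" "y \<in> del W n"
  then obtain v w where *: "x \<in> cyc D X n" "y \<in> cyc D X n" "v \<in> X n" "w \<in> X n" "D n v \<in> W (Suc n)" "D n w \<in> W (Suc n)"
   "x - T n v \<in> bnd D X n" "y - T n w \<in> bnd D X n" by (auto simp: del_def)
  have "(x - y) - T n (v - w) = (x - T n v) - (y - T n w)" by (simp add: ops)
  then have "(x - y) - T n (v - w) \<in> bnd D X n" using bX_diff[OF *(7,8)] by metis
  moreover have "D n (v - w) \<in> W (Suc n)" using d(3) * by (simp add: ops)
  moreover have "x - y \<in> cyc D X n" using * by (simp add: cyc_def X_diff ops)
  ultimately show "x - y \<in> del W n" using X_diff[OF *(3,4)] unfolding del_def by blast }
 fix k \<omega> assume o: "(k, \<omega>) \<in> \<Omega>" and x: "x \<in> del W n"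
 then obtain v where *: "x \<in> X n" "D n x = 0" "v \<in> X n" "D n v \<in> W (Suc n)" "x - T n v \<in> bnd D X n" by (auto simp: del_def cyc_def)
 have "\<omega> n x - T (n + k) (\<omega> n v) \<in> bnd D X (n + k)" using \<omega>_bX[OF o *(5)] T_comm(2)[OF o *(3)] by (simp add: op_diff(5)[OF o])
 moreover have "\<omega> n x \<in> cyc D X (n + k)" using op_X(5)[OF o *(1)] D_comm(4)[OF o *(1)] *(2) \<omega>_zero[OF o] by (simp add: cyc_def)
 moreover have "D (n + k) (\<omega> n v) \<in> W (Suc (n + k))" using D_comm(4)[OF o *(3)] d(4)[OF o *(4)] by simp
 ultimately show "\<omega> n x \<in> del W (n + k)" using op_X(5)[OF o *(3)] unfolding del_def by blast
qed

lemma pull_mono: "W \<le> W' ==> pull W \<le> pull W'" and rho_mono: "W \<le> W' ==> rho W \<le> rho W'"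
 and del_mono: "W \<le> W' ==> del W \<le> del W'"
 unfolding le_fun_def pull_def rho_def del_def by blast+

lemma pulls_FY: "W \<in> FY ==> (pull ^^ m) W \<in> FY"
 by (induct m) (auto intro: pull_FY)

lemma pulls_mono:
 assumes W: "W \<in> FY" and le: "W \<le> W'" "m \<le> m'"
 shows "(pull ^^ m) W \<le> (pull ^^ m') W'"
proof -
 have 1: "(pull ^^ m) W \<le> (pull ^^ (m + j)) W" for j
 proof (induct j)
  case (Suc j)
  then show ?case using pull_FY(2)[OF pulls_FY[OF W, of "m + j"]] by simp
 qed simp
 have 2: "(pull ^^ i) W \<le> (pull ^^ i) W'" for i using le(1) by (induct i) (auto intro: pull_mono)
 show ?thesis using 1[of "m' - m"] 2[of m'] le(2) by simp
qed

text \<open>Induction on the degree, for all iterates of \<open>pull\<close> at once. Equality under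
  \<open>rho\<close> reduces an element of the larger family to a boundary of \<open>X\<close>,
  equality under \<open>del\<close> reduces this to a zigzag, and what is left is \<chi> of an
  element two degrees lower in the next iterate.\<close>

lemma separate:
 assumes W: "W \<in> FY" and W': "W' \<in> FY" and le: "W \<le> W'"
  and r: "\<And>m. rho ((pull ^^ m) W) = rho ((pull ^^ m) W')" and e: "\<And>m. del ((pull ^^ m) W) = del ((pull ^^ m) W')"
 shows "W = W'"
proof -
 have "(pull ^^ m) W' n \<subseteq> (pull ^^ m) W n" for n m
 proof (induct n arbitrary: m rule: less_induct)
  case (less n)
  let ?V = "(pull ^^ m) W" and ?V' = "(pull ^^ m) W'"
  note d = FYD[OF pulls_FY[OF W, of m]] and d' = FYD[OF pulls_FY[OF W', of m]]
  have VV: "x \<in> ?V i ==> x \<in> ?V' i" for x i using pulls_mono[OF W le order_refl, of m] by (auto simp: le_fun_def)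
  have main: "z \<in> ?V n" if z: "z \<in> ?V' n" "z \<in> bnd D X n" for z
  proof (cases n)
   case 0
   then show ?thesis using z d(6)[of 0] by (simp add: bnd_simps)
  next
   case (Suc n')
   then obtain y where y: "y \<in> X n'" "z = D n' y" using z by (auto simp: bnd_simps)
   have Tz: "T n z = 0" using d'(2)[OF z(1)] by (simp add: cyc_def Y_def)
   have "T n' y \<in> del ?V' n'"
    using y z Suc Tz b_zero[of n'] by (auto simp: del_def cyc_def op_X D_comm intro!: bexI[of _ y])
   then have "T n' y \<in> del ?V n'" by (simp only: e)
   \<comment> \<open>The class of \<open>T n' y\<close> is already accounted for by the smaller
     family, through a \<open>y2\<close> with \<open>D n' y2\<close> in it; \<open>y - y2\<close>
     remains to be handled.\<close>
   then obtain y2 where y2: "y2 \<in> X n'" "D n' y2 \<in> ?V n" "T n' y - T n' y2 \<in> bnd D X n'" using Suc by (auto simp: del_def)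
   let ?v = "y - y2"
   have v: "?v \<in> X n'" "T n' ?v \<in> bnd D X n'" using y y2 by (simp_all add: X_diff ops)
   have Dv': "D n' ?v \<in> ?V' n" using d'(3)[OF z(1) VV[OF y2(2)]] y by (simp add: ops)
   have "D n' ?v \<in> ?V n"
   proof (cases n')
    case 0
    then have "?v \<in> Y n'" using v by (simp add: Y_def bnd_simps)
    then show ?thesis using Suc by (intro d(1)) (auto simp: bnd_simps)
   next
    case (Suc l)
    \<comment> \<open>\<open>T\<close> sends \<open>?v\<close> to a boundary \<open>D l u\<close>,
      so \<open>u\<close> and \<open>?v\<close> form a zigzag to which \<open>connecting\<close>
      applies.\<close>
    then obtain u where u: "u \<in> X l" "D l u = T (Suc l) ?v" using v(2) by (auto simp: bnd_simps)
    have n: "n = Suc (Suc l)" using Suc \<open>n = Suc n'\<close> by simp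
    let ?f = "T' l u"
    have f: "?f \<in> cyc D Y l" and "\<exists>x\<in>Y (Suc l). D (Suc l) ?v - \<chi> l ?f = D (Suc l) x"
     using connecting[OF u(1) _ u(2)] v(1) Suc by auto
    then obtain x where x: "x \<in> Y (Suc l)" "D (Suc l) ?v - \<chi> l ?f = D (Suc l) x" by blast
    have bx: "D (Suc l) x \<in> bnd D Y n" using x n by (simp add: bnd_simps)
    have "\<chi> l ?f = D (Suc l) ?v - D (Suc l) x" using x(2) by (simp add: algebra_simps)
    then have "\<chi> l ?f \<in> ?V' n" using d'(3)[OF Dv' d'(1)[OF bx]] Suc by simp
    then have "?f \<in> (pull ^^ Suc m) W' l" using f n by (simp add: pull_def)
    \<comment> \<open>The degree has dropped by 2 at the price of one more \<open>pull\<close>,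
      which the induction hypothesis permits.\<close>
    then have "?f \<in> (pull ^^ Suc m) W l" using subsetD[OF less[of l "Suc m"]] n by simp
    then have "\<chi> l ?f \<in> ?V n" using n by (simp add: pull_def)
    moreover have "D (Suc l) ?v = \<chi> l ?f + D (Suc l) x" using x(2) by (simp add: algebra_simps)
    ultimately show ?thesis using d(7)[OF _ d(1)[OF bx]] Suc by simp
   qed
   then have "D n' ?v + D n' y2 \<in> ?V n" using d(7) y2(2) by blast
   then show ?thesis using y by (simp add: ops)
  qed
  show ?case
  proof
   fix w assume w: "w \<in> ?V' n"
   then have "w \<in> rho ?V' n" using d'(2)[OF w] b_zero(1)[of n] by (auto simp: rho_def cyc_def Y_def intro!: bexI[of _ w])
   then have "w \<in> rho ?V n" by (simp only: r)
   then obtain v where v: "v \<in> ?V n" "w - v \<in> bnd D X n" by (auto simp: rho_def)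
   have "w - v \<in> ?V n" using main[OF d'(3)[OF w VV[OF v(1)]] v(2)] .
   then have "w - v + v \<in> ?V n" using d(7) v(1) by blast
   then show "w \<in> ?V n" by simp
  qed
 qed
 from this[of 0] have "W' n \<subseteq> W n" for n by simp
 then show ?thesis using le by (auto simp: le_fun_def intro!: antisym)
qed

theorem acc_step: "acc FX ==> acc FY"
 by (rule acc_transfer[where ?R1.0 = "\<lambda>m W. rho ((pull ^^ m) W)" and ?R2.0 = "\<lambda>m W. del ((pull ^^ m) W)"])
  (auto intro: rho_FX del_FX pulls_FY rho_mono del_mono pulls_mono separate)

end

section \<open>Twisted actions of a Hochschild cocycle\<close>

text \<open>The right ideal generated by \<open>S\<close>.\<close>

inductive_set rid :: "('r, 'c) ring_scheme \<Rightarrow> 'r set \<Rightarrow> 'r set" for R S where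
 rid_zero: "\<zero>\<^sub>R \<in> rid R S"
| rid_gen: "s \<in> S ==> s \<in> rid R S"
| rid_add: "x \<in> rid R S ==> y \<in> rid R S ==> x \<oplus>\<^sub>R y \<in> rid R S"
| rid_mult: "x \<in> rid R S ==> r \<in> carrier R ==> x \<otimes>\<^sub>R r \<in> rid R S"

lemma (in ring) rid_carrier: "x \<in> rid R S ==> S \<subseteq> carrier R ==> x \<in> carrier R"
 by (induct rule: rid.induct) auto

text \<open>Biadditivity is enough: the cocycle identity with a scalar multiple of 1 as first or
  last argument, where \<open>c\<close> vanishes, yields linearity over the field.\<close>

locale hochschild = R: assoc_algebra R for R :: "('k::field, 'r) module" +
 fixes c :: "'r \<Rightarrow> 'r \<Rightarrow> 'r"
 assumes c_closed: "x \<in> carrier R ==> y \<in> carrier R ==> c x y \<in> carrier R"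
  and c_addl: "x \<in> carrier R ==> y \<in> carrier R ==> z \<in> carrier R ==> c (x \<oplus>\<^sub>R y) z = c x z \<oplus>\<^sub>R c y z"
  and c_addr: "x \<in> carrier R ==> y \<in> carrier R ==> z \<in> carrier R ==> c x (y \<oplus>\<^sub>R z) = c x y \<oplus>\<^sub>R c x z"
  and c_cocycle: "x \<in> carrier R ==> y \<in> carrier R ==> z \<in> carrier R ==>
   c (x \<otimes>\<^sub>R y) z \<oplus>\<^sub>R c x y \<otimes>\<^sub>R z = c x (y \<otimes>\<^sub>R z) \<oplus>\<^sub>R x \<otimes>\<^sub>R c y z"
  and c_scalar: "x \<in> carrier R ==> c (l \<odot>\<^sub>R \<one>\<^sub>R) x = \<zero>\<^sub>R" "x \<in> carrier R ==> c x (l \<odot>\<^sub>R \<one>\<^sub>R) = \<zero>\<^sub>R"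
begin

lemma c_zero: "x \<in> carrier R ==> c \<zero>\<^sub>R x = \<zero>\<^sub>R" "x \<in> carrier R ==> c x \<zero>\<^sub>R = \<zero>\<^sub>R"
 using c_scalar[of x 0] by (simp_all add: R.smult_zero_left)

text \<open>
 Over the dual numbers, \<open>h + \<tau> a h\<close> is an action of the algebra deformed by \<open>c\<close>, and \<open>d + \<tau> \<gamma>\<close> intertwines two such actions.
\<close>

definition is_twist :: "('r, 'm) module \<Rightarrow> ('r \<Rightarrow> 'm \<Rightarrow> 'm) \<Rightarrow> bool" where
 "is_twist N a \<longleftrightarrow> (\<forall>h\<in>carrier R. \<forall>x\<in>carrier N. a h x \<in> carrier N) \<and>
   (\<forall>h\<in>carrier R. \<forall>x\<in>carrier N. \<forall>y\<in>carrier N. a h (x \<oplus>\<^sub>N y) = a h x \<oplus>\<^sub>N a h y) \<and>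
   (\<forall>h\<in>carrier R. \<forall>h'\<in>carrier R. \<forall>x\<in>carrier N. a (h \<oplus>\<^sub>R h') x = a h x \<oplus>\<^sub>N a h' x) \<and>
   (\<forall>h\<in>carrier R. \<forall>h'\<in>carrier R. \<forall>x\<in>carrier N. a (h \<otimes>\<^sub>R h') x \<oplus>\<^sub>N c h h' \<odot>\<^sub>N x = a h (h' \<odot>\<^sub>N x) \<oplus>\<^sub>N h \<odot>\<^sub>N a h' x) \<and>
   (\<forall>h\<in>carrier R. (\<forall>r\<in>carrier R. c h r = \<zero>\<^sub>R) \<longrightarrow> (\<forall>x\<in>carrier N. a h x = \<zero>\<^sub>N))"

lemma is_twistD:
 assumes "is_twist N a"
 shows "h \<in> carrier R ==> x \<in> carrier N ==> a h x \<in> carrier N"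
  "h \<in> carrier R ==> x \<in> carrier N ==> y \<in> carrier N ==> a h (x \<oplus>\<^sub>N y) = a h x \<oplus>\<^sub>N a h y"
  "h \<in> carrier R ==> h' \<in> carrier R ==> x \<in> carrier N ==> a (h \<oplus>\<^sub>R h') x = a h x \<oplus>\<^sub>N a h' x"
  "h \<in> carrier R ==> h' \<in> carrier R ==> x \<in> carrier N ==> a (h \<otimes>\<^sub>R h') x \<oplus>\<^sub>N c h h' \<odot>\<^sub>N x = a h (h' \<odot>\<^sub>N x) \<oplus>\<^sub>N h \<odot>\<^sub>N a h' x"
  "h \<in> carrier R ==> (\<And>r. r \<in> carrier R ==> c h r = \<zero>\<^sub>R) ==> x \<in> carrier N ==> a h x = \<zero>\<^sub>N"
 using assms unfolding is_twist_def by blast+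

definition is_gam :: "('r, 'm) module \<Rightarrow> ('r, 'n) module \<Rightarrow> ('r \<Rightarrow> 'm \<Rightarrow> 'm) \<Rightarrow> ('r \<Rightarrow> 'n \<Rightarrow> 'n) \<Rightarrow> ('m \<Rightarrow> 'n) \<Rightarrow> ('m \<Rightarrow> 'n) \<Rightarrow> bool" where
 "is_gam N N' a a' d \<gamma> \<longleftrightarrow> (\<forall>x\<in>carrier N. \<gamma> x \<in> carrier N') \<and>
   (\<forall>x\<in>carrier N. \<forall>y\<in>carrier N. \<gamma> (x \<oplus>\<^sub>N y) = \<gamma> x \<oplus>\<^sub>N' \<gamma> y) \<and>
   (\<forall>h\<in>carrier R. \<forall>x\<in>carrier N. \<gamma> (h \<odot>\<^sub>N x) \<oplus>\<^sub>N' d (a h x) = a' h (d x) \<oplus>\<^sub>N' h \<odot>\<^sub>N' \<gamma> x)"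

text \<open>On a free module \<open>c\<close> acts coefficientwise, and a direct summand inherits
  this through \<open>i\<close> and \<open>q\<close>. An intertwiner out of a free module is
  prescribed on coefficients as \<open>r -> a' r (w e)\<close>, with \<open>w e\<close> the image of
  the basis element, so any twisted target is allowed.\<close>

lemma twist_exists:
 fixes N :: "('r, 'm) module"
 assumes N: "projective_module R N"
 shows "\<exists>a. is_twist N a \<and> (\<forall>(N' :: ('r, 'm) module) a' d. left_module R N' \<longrightarrow> is_twist N' a' \<longrightarrow> d \<in> mod_hom R N N' \<longrightarrow> (\<exists>\<gamma>. is_gam N N' a a' d \<gamma>))"
proof -
 interpret N: left_module R N by (rule projective_moduleD[OF N])
 obtain X :: "'m set" and i q where i: "i \<in> mod_hom R N (free_left_module R X)" and q: "q \<in> mod_hom R (free_left_module R X) N"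
  and qi: "\<And>x. x \<in> carrier N ==> q (i x) = x"
  using projective_moduleD(2)[OF N] by blast
 interpret F: free_mod R X by unfold_locales
 note I = mod_homD[OF i] and Q = mod_homD[OF q]
 define aF where "aF h y = (\<lambda>e :: 'm. c h (y e))" for h and y :: "'m \<Rightarrow> 'r"
 have aF: "h \<in> carrier R ==> y \<in> carrier F.F ==> aF h y \<in> carrier F.F" for h y
  unfolding aF_def by (rule F.F_map) (auto simp: c_zero c_closed)
 have Fc: "y e \<in> carrier R" if "y \<in> carrier F.F" for y e using that by (simp add: F.F_mem)
 have aF_add: "aF h (x \<oplus>\<^bsub>F.F\<^esub> y) = aF h x \<oplus>\<^bsub>F.F\<^esub> aF h y" if "h \<in> carrier R" "x \<in> carrier F.F" "y \<in> carrier F.F" for h x y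
  using that by (simp add: aF_def F.F_sel c_addr Fc)
 have q0: "q \<zero>\<^bsub>F.F\<^esub> = \<zero>\<^sub>N"
 proof -
  have z: "\<zero>\<^bsub>F.F\<^esub> \<in> carrier F.F" "\<zero>\<^sub>R \<odot>\<^bsub>F.F\<^esub> \<zero>\<^bsub>F.F\<^esub> = \<zero>\<^bsub>F.F\<^esub>" by (simp_all add: F.F_sel F.F_mem)
  show ?thesis using Q(3)[OF R.zero_closed z(1)] z N.zero_smult Q(1)[OF z(1)] by simp
 qed
 define a where "a h x = q (aF h (i x))" for h x
 have tw: "is_twist N a"
  unfolding is_twist_def
 proof (intro conjI ballI impI)
  fix h x assume h: "h \<in> carrier R" and x: "x \<in> carrier N"
  show "a h x \<in> carrier N" using h x by (simp add: a_def Q I aF)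
  show "a h (x \<oplus>\<^sub>N y) = a h x \<oplus>\<^sub>N a h y" if "y \<in> carrier N" for y using h x that by (simp add: a_def Q I aF aF_add)
  fix h' assume h': "h' \<in> carrier R"
  have "aF (h \<oplus>\<^sub>R h') (i x) = aF h (i x) \<oplus>\<^bsub>F.F\<^esub> aF h' (i x)" using h h' I(1)[OF x] by (simp add: aF_def F.F_sel c_addl Fc)
  then show "a (h \<oplus>\<^sub>R h') x = a h x \<oplus>\<^sub>N a h' x" using h h' x by (simp add: a_def Q I aF)
  have "aF (h \<otimes>\<^sub>R h') (i x) \<oplus>\<^bsub>F.F\<^esub> c h h' \<odot>\<^bsub>F.F\<^esub> i x = aF h (h' \<odot>\<^bsub>F.F\<^esub> i x) \<oplus>\<^bsub>F.F\<^esub> h \<odot>\<^bsub>F.F\<^esub> aF h' (i x)"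
   using h h' I(1)[OF x] by (simp add: aF_def F.F_sel c_cocycle Fc)
  then have "q (aF (h \<otimes>\<^sub>R h') (i x) \<oplus>\<^bsub>F.F\<^esub> c h h' \<odot>\<^bsub>F.F\<^esub> i x) = q (aF h (h' \<odot>\<^bsub>F.F\<^esub> i x) \<oplus>\<^bsub>F.F\<^esub> h \<odot>\<^bsub>F.F\<^esub> aF h' (i x))" by simp
  then show "a (h \<otimes>\<^sub>R h') x \<oplus>\<^sub>N c h h' \<odot>\<^sub>N x = a h (h' \<odot>\<^sub>N x) \<oplus>\<^sub>N h \<odot>\<^sub>N a h' x"
   using h h' x by (simp add: a_def Q I aF F.F_smult c_closed qi)
 next
  fix h x assume h: "h \<in> carrier R" "\<forall>r\<in>carrier R. c h r = \<zero>\<^sub>R" and x: "x \<in> carrier N"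
  have "aF h (i x) = \<zero>\<^bsub>F.F\<^esub>" using h I(1)[OF x] by (simp add: aF_def F.F_sel Fc)
  then show "a h x = \<zero>\<^sub>N" by (simp add: a_def q0)
 qed
 moreover have "\<exists>\<gamma>. is_gam N N' a a' d \<gamma>" if N': "left_module R N'" and a': "is_twist N' a'" and d: "d \<in> mod_hom R N N'"
  for N' :: "('r, 'm) module" and a' d
 proof -
  interpret N': left_module R N' by fact
  note A = is_twistD[OF a'] and D = mod_homD[OF d]
  define w where "w e = d (q (single R e \<one>\<^sub>R))" for e
  have w: "w e \<in> carrier N'" if "e \<in> X" for e using that by (simp add: w_def D Q F.F_single)
  interpret U: free_usum R X N' "\<lambda>e r. a' r (w e)" by unfold_locales (auto simp: w A)
  let ?G = "usum R N' (\<lambda>e r. a' r (w e))"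
  have ds: "d (q (single R e r)) = r \<odot>\<^sub>N' w e" if "e \<in> X" "r \<in> carrier R" for e r
  proof -
   have "single R e r = r \<odot>\<^bsub>F.F\<^esub> single R e \<one>\<^sub>R" using that by (simp add: F.F_sel single_def fun_eq_iff)
   then show ?thesis using that by (simp add: w_def D Q F.F_single)
  qed
  \<comment> \<open>On \<open>r\<close> times a basis element this is the twist identity of
    \<open>a'\<close> for the pair \<open>h\<close>, \<open>r\<close>.\<close>
  have G: "?G (h \<odot>\<^bsub>F.F\<^esub> y) \<oplus>\<^sub>N' d (q (aF h y)) = a' h (d (q y)) \<oplus>\<^sub>N' h \<odot>\<^sub>N' ?G y"
   if h: "h \<in> carrier R" and y: "y \<in> carrier F.F" for h y
   using y
  proof (induct y rule: F.F_induct)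
   case zero
   have e: "h \<odot>\<^bsub>F.F\<^esub> \<zero>\<^bsub>F.F\<^esub> = \<zero>\<^bsub>F.F\<^esub>" "aF h \<zero>\<^bsub>F.F\<^esub> = \<zero>\<^bsub>F.F\<^esub>" using h by (simp_all add: F.F_sel aF_def c_zero)
   have d0: "d \<zero>\<^sub>N = \<zero>\<^sub>N'" using mod_hom_zero[OF d] N.left_module_axioms N' by blast
   have "a' h \<zero>\<^sub>N' = \<zero>\<^sub>N'" using A(2)[OF h, of "\<zero>\<^sub>N'" "\<zero>\<^sub>N'"] A(1)[OF h, of "\<zero>\<^sub>N'"] by (metis N'.M.add.r_cancel_one' N'.M.r_zero N'.M.zero_closed)
   then show ?case using h by (simp add: e q0 d0 U.usum_zero N'.smult_zero)
  next
   case (single e r)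
   have e: "h \<odot>\<^bsub>F.F\<^esub> single R e r = single R e (h \<otimes>\<^sub>R r)" "aF h (single R e r) = single R e (c h r)"
    using h single by (simp_all add: F.F_sel single_def aF_def fun_eq_iff c_zero)
   show ?case using h single by (simp add: e ds U.usum_single A c_closed w)
  next
   case (add x y)
   have e: "h \<odot>\<^bsub>F.F\<^esub> (x \<oplus>\<^bsub>F.F\<^esub> y) = h \<odot>\<^bsub>F.F\<^esub> x \<oplus>\<^bsub>F.F\<^esub> h \<odot>\<^bsub>F.F\<^esub> y"
    using add(1,2) h by (simp add: F.F_sel F.F_mem R.r_distr)
   have cl: "?G (h \<odot>\<^bsub>F.F\<^esub> x) \<in> carrier N'" "?G (h \<odot>\<^bsub>F.F\<^esub> y) \<in> carrier N'" "d (q (aF h x)) \<in> carrier N'" "d (q (aF h y)) \<in> carrier N'"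
    "a' h (d (q x)) \<in> carrier N'" "a' h (d (q y)) \<in> carrier N'" "h \<odot>\<^sub>N' ?G x \<in> carrier N'" "h \<odot>\<^sub>N' ?G y \<in> carrier N'"
    using h add(1,2) by (simp_all add: U.usum_closed F.F_smult D Q aF A N'.smult_closed)
   have "?G (h \<odot>\<^bsub>F.F\<^esub> (x \<oplus>\<^bsub>F.F\<^esub> y)) \<oplus>\<^sub>N' d (q (aF h (x \<oplus>\<^bsub>F.F\<^esub> y))) =
    (?G (h \<odot>\<^bsub>F.F\<^esub> x) \<oplus>\<^sub>N' d (q (aF h x))) \<oplus>\<^sub>N' (?G (h \<odot>\<^bsub>F.F\<^esub> y) \<oplus>\<^sub>N' d (q (aF h y)))"
    using h add(1,2) cl by (simp add: e aF_add D Q aF U.usum_add F.F_smult N'.M.a_ac)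
   also have "\<dots> = a' h (d (q (x \<oplus>\<^bsub>F.F\<^esub> y))) \<oplus>\<^sub>N' h \<odot>\<^sub>N' ?G (x \<oplus>\<^bsub>F.F\<^esub> y)"
    unfolding add(3,4) using h add(1,2) cl by (simp add: D Q A U.usum_add U.usum_closed N'.smult_r_distr N'.M.a_ac)
   finally show ?case .
  qed
  have "is_gam N N' a a' d (\<lambda>x. ?G (i x))"
   unfolding is_gam_def using G[OF _ I(1)] by (simp add: I U.usum_closed U.usum_add a_def qi)
  then show ?thesis by blast
 qed
 ultimately show ?thesis by blast
qed

text \<open>The cocycle identity expresses \<open>c (x r') r\<close> by \<open>c x (r' r)\<close>,
  \<open>x\<close> and \<open>c x r'\<close>, the last two multiplied on the right.\<close>

lemma c_rid:
 assumes S: "S \<subseteq> carrier R" and cS: "\<And>s r. s \<in> S ==> r \<in> carrier R ==> c s r = \<zero>\<^sub>R"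
  and "y \<in> rid R S" "r \<in> carrier R"
 shows "c y r \<in> rid R S"
 using assms(3,4)
proof (induct arbitrary: r rule: rid.induct)
 case (rid_mult x r' r)
 have x: "x \<in> carrier R" using R.rid_carrier[OF rid_mult(1) S] .
 have "c (x \<otimes>\<^sub>R r') r = c x (r' \<otimes>\<^sub>R r) \<oplus>\<^sub>R x \<otimes>\<^sub>R c r' r \<oplus>\<^sub>R c x r' \<otimes>\<^sub>R (((-1) \<odot>\<^sub>R \<one>\<^sub>R) \<otimes>\<^sub>R r)"
 proof -
  have "c x r' \<otimes>\<^sub>R (((-1) \<odot>\<^sub>R \<one>\<^sub>R) \<otimes>\<^sub>R r) = \<ominus>\<^sub>R (c x r' \<otimes>\<^sub>R r)"
   using x rid_mult by (simp add: R.smult_mult_l c_closed R.smult_minus_left R.smult_one R.r_minus R.l_minus)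
  then show ?thesis using c_cocycle[OF x rid_mult(3,4)] x rid_mult(3,4)
   by (simp add: c_closed R.a_assoc R.r_neg flip: c_cocycle)
 qed
 then show ?case
  using x rid_mult by (simp add: rid.intros c_closed R.smult_closed)
qed (use R.rid_carrier[OF _ S] S in \<open>auto simp: c_zero c_addl cS intro: rid.intros\<close>)

end

section \<open>Chain maps acting on functionals\<close>

text \<open>Functionals are total functions that vanish off the carrier, whereas cochains are
  \<open>undefined\<close> there. They thus form subgroups of one function type, as
  \<open>acc_step\<close> requires.\<close>

definition pb :: "'m set \<Rightarrow> ('m \<Rightarrow> 'n) \<Rightarrow> ('n \<Rightarrow> 'k::field) \<Rightarrow> 'm \<Rightarrow> 'k" where
 "pb V \<phi> f = (\<lambda>x. if x \<in> V then f (\<phi> x) else 0)"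

lemma pb_diff: "pb V \<phi> (f - g) = pb V \<phi> f - pb V \<phi> g" and pb_zero: "pb V \<phi> 0 = 0"
 by (auto simp: pb_def fun_eq_iff)

context trivial_resolution
begin

abbreviation sca :: "'k \<Rightarrow> 'r" where "sca l \<equiv> l \<odot>\<^sub>R \<one>\<^sub>R"

lemma sca_closed: "sca l \<in> carrier R" by (simp add: R.smult_closed)
lemma sca_comm: "h \<in> carrier R ==> h \<otimes>\<^sub>R sca l = sca l \<otimes>\<^sub>R h"
 by (simp add: R.smult_mult_l R.smult_mult_r)
lemma sca_smult: "h \<in> carrier R ==> x \<in> C n ==> h \<odot>\<^bsub>obj P n\<^esub> (sca l \<odot>\<^bsub>obj P n\<^esub> x) = sca l \<odot>\<^bsub>obj P n\<^esub> (h \<odot>\<^bsub>obj P n\<^esub> x)"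
 by (simp add: O.smult_assoc[symmetric] sca_closed sca_comm)

text \<open>\<open>L {} n\<close> is the full dual of the vector space \<open>P n\<close>. When
  \<open>S\<close> generates the augmentation ideal as a right ideal, \<open>L S n\<close> is
  \<open>Hom(P n, k)\<close> with \<open>undefined\<close> replaced by 0; see
  \<open>pb_id_coh\<close> and \<open>restrict_L\<close>.\<close>

definition L :: "'r set \<Rightarrow> nat \<Rightarrow> ('m \<Rightarrow> 'k) set" where
 "L S n = {f. (\<forall>x. x \<notin> C n \<longrightarrow> f x = 0) \<and> (\<forall>x\<in>C n. \<forall>y\<in>C n. f (x \<oplus>\<^bsub>obj P n\<^esub> y) = f x + f y) \<and>
   (\<forall>l. \<forall>x\<in>C n. f (sca l \<odot>\<^bsub>obj P n\<^esub> x) = l * f x) \<and> (\<forall>s\<in>S. \<forall>x\<in>C n. f (s \<odot>\<^bsub>obj P n\<^esub> x) = 0)}"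

lemma LI: "(\<And>x. x \<notin> C n ==> f x = 0) ==> (\<And>x y. x \<in> C n ==> y \<in> C n ==> f (x \<oplus>\<^bsub>obj P n\<^esub> y) = f x + f y) ==>
  (\<And>l x. x \<in> C n ==> f (sca l \<odot>\<^bsub>obj P n\<^esub> x) = l * f x) ==> (\<And>s x. s \<in> S ==> x \<in> C n ==> f (s \<odot>\<^bsub>obj P n\<^esub> x) = 0) ==> f \<in> L S n"
 by (simp add: L_def)

lemma LD:
 assumes "f \<in> L S n"
 shows "x \<notin> C n ==> f x = 0" "x \<in> C n ==> y \<in> C n ==> f (x \<oplus>\<^bsub>obj P n\<^esub> y) = f x + f y"
  "x \<in> C n ==> f (sca l \<odot>\<^bsub>obj P n\<^esub> x) = l * f x" "s \<in> S ==> x \<in> C n ==> f (s \<odot>\<^bsub>obj P n\<^esub> x) = 0" "f \<zero>\<^bsub>obj P n\<^esub> = 0"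
proof -
 show a: "f (x \<oplus>\<^bsub>obj P n\<^esub> y) = f x + f y" if "x \<in> C n" "y \<in> C n" for x y using assms that by (simp add: L_def)
 show "f \<zero>\<^bsub>obj P n\<^esub> = 0" using a[of "\<zero>\<^bsub>obj P n\<^esub>" "\<zero>\<^bsub>obj P n\<^esub>"] by (metis O.M.r_zero O.M.zero_closed add_cancel_right_right)
qed (use assms in \<open>simp_all add: L_def\<close>)

lemma L_zero: "0 \<in> L S n" and L_diff: "f \<in> L S n ==> g \<in> L S n ==> f - g \<in> L S n"
 by (simp_all add: L_def algebra_simps)

lemma L_rid: "f \<in> L S n ==> S \<subseteq> carrier R ==> r \<in> rid R S ==> x \<in> C n ==> f (r \<odot>\<^bsub>obj P n\<^esub> x) = 0"
proof -
 assume f: "f \<in> L S n" and S: "S \<subseteq> carrier R" and "r \<in> rid R S" and x: "x \<in> C n"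
 note rc = R.rid_carrier[OF _ S]
 from \<open>r \<in> rid R S\<close> x show ?thesis
  by (induct arbitrary: x rule: rid.induct) (simp_all add: O.zero_smult LD[OF f] O.smult_l_distr O.smult_assoc O.smult_closed rc)
qed

lemma pb_L:
 assumes "\<And>x. x \<in> C m ==> \<phi> x \<in> C n" "\<And>x y. x \<in> C m ==> y \<in> C m ==> \<phi> (x \<oplus>\<^bsub>obj P m\<^esub> y) = \<phi> x \<oplus>\<^bsub>obj P n\<^esub> \<phi> y"
  and "\<And>x l. x \<in> C m ==> \<phi> (sca l \<odot>\<^bsub>obj P m\<^esub> x) = sca l \<odot>\<^bsub>obj P n\<^esub> \<phi> x"
  and "\<And>x s. x \<in> C m ==> s \<in> S ==> f (\<phi> (s \<odot>\<^bsub>obj P m\<^esub> x)) = 0" and f: "f \<in> L S' n" and S: "S \<subseteq> carrier R"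
 shows "pb (C m) \<phi> f \<in> L S m"
 by (rule LI) (use S in \<open>auto simp: pb_def assms(1-4) LD[OF f] O.smult_closed sca_closed subset_iff\<close>)

lemma hom_L: "\<phi> \<in> hom m n ==> f \<in> L S n ==> S \<subseteq> carrier R ==> pb (C m) \<phi> f \<in> L S m"
 by (rule pb_L[where S' = S]) (auto simp: mod_homD[of \<phi> R "obj P m" "obj P n"] sca_closed subset_iff LD(4)[of f S n])

abbreviation D where "D n \<equiv> pb (C (Suc n)) (bd P n)"
abbreviation T where "T t n \<equiv> pb (C n) (\<lambda>x. t \<odot>\<^bsub>obj P n\<^esub> x)"

lemma DD: "f \<in> L S n ==> D (Suc n) (D n f) = 0"
 by (auto simp: pb_def fun_eq_iff bd_bd bd(1) LD(5))

text \<open>\<open>T t n f\<close> is killed by \<open>s\<close> because \<open>t s\<close> lies in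
  the right ideal of \<open>S\<close>, on which \<open>f\<close> vanishes.\<close>

lemma T_L: "t \<in> carrier R ==> S \<subseteq> carrier R ==> (\<And>s. s \<in> S ==> t \<otimes>\<^sub>R s \<in> rid R S) ==> f \<in> L S n ==> T t n f \<in> L S n"
 by (rule pb_L[where S' = S])
  (auto simp: O.smult_closed O.smult_r_distr sca_smult O.smult_assoc[symmetric] subset_iff L_rid)

lemma T_hom: "\<phi> \<in> hom m n ==> t \<in> carrier R ==> pb (C m) \<phi> (T t n f) = T t m (pb (C m) \<phi> f)"
 by (auto simp: pb_def fun_eq_iff mod_homD[of \<phi> R "obj P m" "obj P n"] O.smult_closed)

lemma L_insert: "L (insert t S) n = {f \<in> L S n. T t n f = 0}"
 by (auto simp: L_def pb_def fun_eq_iff)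

definition chain_map :: "nat \<Rightarrow> (nat \<Rightarrow> 'm \<Rightarrow> 'm) \<Rightarrow> bool" where
 "chain_map k \<phi> \<longleftrightarrow> (\<forall>n. \<phi> n \<in> hom (n + k) n) \<and> (\<forall>n. \<forall>x\<in>C (Suc n + k). bd P n (\<phi> (Suc n) x) = \<phi> n (bd P (n + k) x))"

definition op :: "nat \<Rightarrow> (nat \<Rightarrow> 'm \<Rightarrow> 'm) \<Rightarrow> nat \<Rightarrow> ('m \<Rightarrow> 'k) \<Rightarrow> 'm \<Rightarrow> 'k" where
 "op k \<phi> n = pb (C (n + k)) (\<phi> n)"

lemma chain_mapD: "chain_map k \<phi> ==> \<phi> n \<in> hom (n + k) n" "chain_map k \<phi> ==> x \<in> C (Suc n + k) ==> bd P n (\<phi> (Suc n) x) = \<phi> n (bd P (n + k) x)"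
 by (auto simp: chain_map_def)

lemma op_D: "chain_map k \<phi> ==> D (n + k) (op k \<phi> n f) = op k \<phi> (Suc n) (D n f)"
 using chain_mapD(2)[of k \<phi> _ n] mod_homD(1)[OF chain_mapD(1)[of k \<phi> "Suc n"]] bd(1)[of _ "n + k"]
 by (auto simp: op_def pb_def fun_eq_iff)

text \<open>The boundary must come from \<open>L S\<close> for the \<open>S\<close> at hand:
  centrality of a new operator is applied on the kernel of \<open>T t\<close>, that of all the
  operators at the last stage.\<close>

definition central :: "nat \<Rightarrow> (nat \<Rightarrow> 'm \<Rightarrow> 'm) \<Rightarrow> bool" where
 "central k \<phi> \<longleftrightarrow> chain_map k \<phi> \<and> (\<forall>j \<psi> S m f. chain_map j \<psi> \<longrightarrow> S \<subseteq> carrier R \<longrightarrow> f \<in> L S m \<longrightarrow> D m f = 0 \<longrightarrow>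
   op k \<phi> (m + j) (op j \<psi> m f) - op j \<psi> (m + k) (op k \<phi> m f) \<in> bnd D (L S) (m + k + j))"

definition ops :: "(nat \<times> (nat \<Rightarrow> 'm \<Rightarrow> 'm)) set \<Rightarrow> (nat \<times> (nat \<Rightarrow> ('m \<Rightarrow> 'k) \<Rightarrow> 'm \<Rightarrow> 'k)) set" where
 "ops \<Omega> = (\<lambda>(k, \<phi>). (k, op k \<phi>)) ` \<Omega>"

text \<open>The set of operators is existentially quantified because each step enlarges it. It
  contains the scalars since families are closed under differences only.\<close>

definition noeth :: "'r set \<Rightarrow> bool" where
 "noeth S \<longleftrightarrow> S \<subseteq> carrier R \<and> (\<exists>\<Omega>. (\<forall>(k, \<phi>)\<in>\<Omega>. central k \<phi>) \<and> (\<forall>l. (0, \<lambda>n. \<lambda>x\<in>C n. sca l \<odot>\<^bsub>obj P n\<^esub> x) \<in> \<Omega>) \<and> acc (fam D (L S) (ops \<Omega>)))"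

end

locale twisted = trivial_resolution R \<epsilon> P + hochschild R c
 for R :: "('k::field, 'r) module" and \<epsilon> and P :: "('r, 'm, 'k) aug_complex" and c
begin

definition tw :: "nat \<Rightarrow> 'r \<Rightarrow> 'm \<Rightarrow> 'm" where
 "tw n = (SOME a. is_twist (obj P n) a \<and>
   (\<forall>(N' :: ('r, 'm) module) a' d. left_module R N' \<longrightarrow> is_twist N' a' \<longrightarrow> d \<in> mod_hom R (obj P n) N' \<longrightarrow> (\<exists>\<gamma>. is_gam (obj P n) N' a a' d \<gamma>)))"

lemmas tw_ex = someI_ex[OF twist_exists[OF proj], folded tw_def]
lemmas tw = is_twistD[OF conjunct1[OF tw_ex]]

definition gm :: "nat \<Rightarrow> nat \<Rightarrow> ('m \<Rightarrow> 'm) \<Rightarrow> 'm \<Rightarrow> 'm" where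
 "gm m n d = (SOME \<gamma>. is_gam (obj P m) (obj P n) (tw m) (tw n) d \<gamma>)"

lemma gm:
 assumes "d \<in> hom m n"
 shows "x \<in> C m ==> gm m n d x \<in> C n" "x \<in> C m ==> y \<in> C m ==> gm m n d (x \<oplus>\<^bsub>obj P m\<^esub> y) = gm m n d x \<oplus>\<^bsub>obj P n\<^esub> gm m n d y"
  "h \<in> carrier R ==> x \<in> C m ==> gm m n d (h \<odot>\<^bsub>obj P m\<^esub> x) \<oplus>\<^bsub>obj P n\<^esub> d (tw m h x) = tw n h (d x) \<oplus>\<^bsub>obj P n\<^esub> h \<odot>\<^bsub>obj P n\<^esub> gm m n d x"
proof -
 have "\<exists>\<gamma>. is_gam (obj P m) (obj P n) (tw m) (tw n) d \<gamma>" using tw_ex[of m] tw_ex[of n] obj_module[of n] assms by blast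
 then have "is_gam (obj P m) (obj P n) (tw m) (tw n) d (gm m n d)" unfolding gm_def by (rule someI_ex)
 then show "x \<in> C m ==> gm m n d x \<in> C n" "x \<in> C m ==> y \<in> C m ==> gm m n d (x \<oplus>\<^bsub>obj P m\<^esub> y) = gm m n d x \<oplus>\<^bsub>obj P n\<^esub> gm m n d y"
  "h \<in> carrier R ==> x \<in> C m ==> gm m n d (h \<odot>\<^bsub>obj P m\<^esub> x) \<oplus>\<^bsub>obj P n\<^esub> d (tw m h x) = tw n h (d x) \<oplus>\<^bsub>obj P n\<^esub> h \<odot>\<^bsub>obj P n\<^esub> gm m n d x"
  unfolding is_gam_def by blast+
qed

lemma tw_zero: "h \<in> carrier R ==> tw n h \<zero>\<^bsub>obj P n\<^esub> = \<zero>\<^bsub>obj P n\<^esub>"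
 using tw(2)[of h "\<zero>\<^bsub>obj P n\<^esub>" n "\<zero>\<^bsub>obj P n\<^esub>"] tw(1)[of h "\<zero>\<^bsub>obj P n\<^esub>" n] by (metis O.M.add.r_cancel_one' O.M.r_zero O.M.zero_closed)

lemma tw_null: "x \<in> C n ==> tw n \<zero>\<^sub>R x = \<zero>\<^bsub>obj P n\<^esub>" "x \<in> C n ==> tw n (sca l) x = \<zero>\<^bsub>obj P n\<^esub>"
 by (simp_all add: tw(5) c_zero c_scalar sca_closed)

lemma tw_sca: "h \<in> carrier R ==> x \<in> C n ==> tw n h (sca l \<odot>\<^bsub>obj P n\<^esub> x) = sca l \<odot>\<^bsub>obj P n\<^esub> tw n h x"
 using tw(4)[of h "sca l" x n] tw(4)[of "sca l" h x n]
 by (simp add: sca_closed c_scalar O.zero_smult tw_null O.smult_zero O.smult_closed tw(1) sca_comm)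

lemma gm_zero: "d \<in> hom m n ==> gm m n d \<zero>\<^bsub>obj P m\<^esub> = \<zero>\<^bsub>obj P n\<^esub>"
 using gm(2)[of d m n "\<zero>\<^bsub>obj P m\<^esub>" "\<zero>\<^bsub>obj P m\<^esub>"] gm(1)[of d m n "\<zero>\<^bsub>obj P m\<^esub>"] by (metis O.M.add.r_cancel_one' O.M.r_zero O.M.zero_closed)

lemma gm_sca: "d \<in> hom m n ==> x \<in> C m ==> gm m n d (sca l \<odot>\<^bsub>obj P m\<^esub> x) = sca l \<odot>\<^bsub>obj P n\<^esub> gm m n d x"
 using gm(3)[of d m n "sca l" x] mod_homD(1)[of d R "obj P m" "obj P n" x]
 by (simp add: sca_closed tw_null mod_hom_zero[OF _ obj_module obj_module] gm(1) O.smult_closed)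

abbreviation ga where "ga n \<equiv> gm (Suc n) n (bd P n)"
lemmas ga = gm[OF bd_hom]

text \<open>Over the dual numbers
  \<open>(d + \<tau> \<gamma>)^2 = \<tau> (\<gamma> d + d \<gamma>)\<close>: this measures how far
  the lifted differential is from squaring to 0.\<close>

definition chi :: "nat \<Rightarrow> 'm \<Rightarrow> 'm" where
 "chi n = (\<lambda>x\<in>C (Suc (Suc n)). ga n (bd P (Suc n) x) \<oplus>\<^bsub>obj P n\<^esub> bd P n (ga (Suc n) x))"

lemma chi_eq: "x \<in> C (Suc (Suc n)) ==> chi n x = ga n (bd P (Suc n) x) \<oplus>\<^bsub>obj P n\<^esub> bd P n (ga (Suc n) x)"
 by (simp add: chi_def)

text \<open>Neither summand is linear by itself. Moving \<open>h\<close> out costs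
  \<open>\<gamma> d\<close> the term \<open>- d (tw h (d x))\<close> and \<open>d \<gamma>\<close>
  the same term with the opposite sign.\<close>

lemma chi_hom: "chi n \<in> hom (Suc (Suc n)) n"
 unfolding chi_def
proof (rule mod_homI[OF _ _ _ obj_module])
 fix h x assume h: "h \<in> carrier R" and x: "x \<in> C (Suc (Suc n))"
 have "ga n (h \<odot>\<^bsub>obj P (Suc n)\<^esub> bd P (Suc n) x) \<oplus>\<^bsub>obj P n\<^esub> bd P n (tw (Suc n) h (bd P (Suc n) x)) = h \<odot>\<^bsub>obj P n\<^esub> ga n (bd P (Suc n) x)"
  using ga(3)[OF h bd(1)[OF x]] bd_bd[OF x] h x ga(1)[OF bd(1)[OF x]] by (simp add: tw_zero O.smult_closed)
 moreover have "bd P n (ga (Suc n) (h \<odot>\<^bsub>obj P (Suc (Suc n))\<^esub> x)) = bd P n (tw (Suc n) h (bd P (Suc n) x)) \<oplus>\<^bsub>obj P n\<^esub> h \<odot>\<^bsub>obj P n\<^esub> bd P n (ga (Suc n) x)"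
 proof -
  have "bd P n (ga (Suc n) (h \<odot>\<^bsub>obj P (Suc (Suc n))\<^esub> x) \<oplus>\<^bsub>obj P (Suc n)\<^esub> bd P (Suc n) (tw (Suc (Suc n)) h x))
   = bd P n (tw (Suc n) h (bd P (Suc n) x) \<oplus>\<^bsub>obj P (Suc n)\<^esub> h \<odot>\<^bsub>obj P (Suc n)\<^esub> ga (Suc n) x)"
   using ga(3)[OF h x] by simp
  then show ?thesis using h x by (simp add: bd ga(1) O.smult_closed tw(1) bd_bd)
 qed
 ultimately show "ga n (bd P (Suc n) (h \<odot>\<^bsub>obj P (Suc (Suc n))\<^esub> x)) \<oplus>\<^bsub>obj P n\<^esub> bd P n (ga (Suc n) (h \<odot>\<^bsub>obj P (Suc (Suc n))\<^esub> x))
   = h \<odot>\<^bsub>obj P n\<^esub> (ga n (bd P (Suc n) x) \<oplus>\<^bsub>obj P n\<^esub> bd P n (ga (Suc n) x))"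
  using h x by (simp add: bd(3) O.smult_r_distr bd(1) ga(1) O.smult_closed tw(1) O.M.a_assoc[symmetric])
qed (simp_all add: bd ga O.M.a_ac)

lemma chi_chain: "chain_map 2 chi"
proof -
 have "bd P n (chi (Suc n) x) = chi n (bd P (Suc (Suc n)) x)" if x: "x \<in> C (Suc (Suc (Suc n)))" for n x
  using x by (simp add: chi_eq bd ga(1) bd_bd gm_zero[OF bd_hom] )
 then show ?thesis using chi_hom by (simp add: chain_map_def)
qed

lemma gm_f:
 assumes f: "f \<in> L S n" and d: "d \<in> hom m n" and h: "h \<in> carrier R" and x: "x \<in> C m"
 shows "f (gm m n d (h \<odot>\<^bsub>obj P m\<^esub> x)) + f (d (tw m h x)) = f (tw n h (d x)) + f (h \<odot>\<^bsub>obj P n\<^esub> gm m n d x)"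
 using arg_cong[OF gm(3)[OF d h x], of f] h x
 by (simp add: LD(2)[OF f] gm(1)[OF d] mod_homD(1)[OF d] tw(1) O.smult_closed)

text \<open>Let \<gamma>' be the intertwiner of \<phi>. The homotopy is \<open>f\<close> applied to
  the first-order term of the commutator of \<open>\<phi> + \<tau> \<gamma>'\<close> with
  \<open>d + \<tau> \<gamma>\<close>; the summand \<open>d \<gamma>'\<close> is dropped because
  \<open>f\<close> is a cocycle.\<close>

lemma chi_central: "central 2 chi"
 unfolding central_def
proof (intro conjI chi_chain allI impI)
 fix k \<phi> S m f assume \<phi>: "chain_map k \<phi>" and S: "S \<subseteq> carrier R" and f: "f \<in> L S m" and Df: "D m f = 0"
 note ph = chain_mapD(1)[OF \<phi>] and pd = chain_mapD(2)[OF \<phi>, simplified]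
 note phD = mod_homD[OF ph]
 have ph': "\<phi> (Suc n) \<in> hom (Suc (n + k)) (Suc n)" for n using ph[of "Suc n"] by simp
 note ph'D = mod_homD[OF ph']
 have ph2D: "x \<in> C (Suc (Suc (n + k))) ==> \<phi> (Suc (Suc n)) x \<in> C (Suc (Suc n))" for n x using mod_homD(1)[OF ph[of "Suc (Suc n)"], of x] by simp
 have fd: "f (bd P m x) = 0" if "x \<in> C (Suc m)" for x using fun_cong[OF Df, of x] that by (simp add: pb_def)
 let ?g = "gm (m + k) m (\<phi> m)"
 let ?y = "\<lambda>x. if x \<in> C (Suc (m + k)) then f (?g (bd P (m + k) x)) + f (\<phi> m (ga (m + k) x)) - f (ga m (\<phi> (Suc m) x)) else 0"
 have y: "?y \<in> L S (Suc (m + k))"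
 proof (rule LI)
  fix s x assume s: "s \<in> S" and x: "x \<in> C (Suc (m + k))"
  have sc: "s \<in> carrier R" using s S by blast
  \<comment> \<open>None of the three terms of \<open>?y\<close> is killed by \<open>s\<close>
    alone; facts 1 to 3 show that their twist contributions cancel.\<close>
  have 1: "f (ga m (s \<odot>\<^bsub>obj P (Suc m)\<^esub> \<phi> (Suc m) x)) = f (tw m s (bd P m (\<phi> (Suc m) x)))"
   using gm_f[OF f bd_hom sc ph'D(1)[OF x]] LD(4)[OF f s] ga(1) ph'D(1)[OF x] fd tw(1)[OF sc] by simp
  have 2: "f (?g (s \<odot>\<^bsub>obj P (m + k)\<^esub> bd P (m + k) x)) + f (\<phi> m (tw (m + k) s (bd P (m + k) x))) = f (tw m s (\<phi> m (bd P (m + k) x)))"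
   using gm_f[OF f ph sc bd(1)[OF x]] LD(4)[OF f s] gm(1)[OF ph bd(1)[OF x]] by simp
  have 3: "f (\<phi> m (ga (m + k) (s \<odot>\<^bsub>obj P (Suc (m + k))\<^esub> x))) = f (\<phi> m (tw (m + k) s (bd P (m + k) x)))"
  proof -
   have "f (\<phi> m (ga (m + k) (s \<odot>\<^bsub>obj P (Suc (m + k))\<^esub> x) \<oplus>\<^bsub>obj P (m + k)\<^esub> bd P (m + k) (tw (Suc (m + k)) s x)))
    = f (\<phi> m (tw (m + k) s (bd P (m + k) x) \<oplus>\<^bsub>obj P (m + k)\<^esub> s \<odot>\<^bsub>obj P (m + k)\<^esub> ga (m + k) x))"
    using ga(3)[OF sc x] by simp
   then show ?thesis using x sc s
    by (simp add: phD ga(1) tw(1) bd(1) O.smult_closed LD(2,4)[OF f] pd[symmetric] fd ph'D(1))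
  qed
  show "?y (s \<odot>\<^bsub>obj P (Suc (m + k))\<^esub> x) = 0"
   using x sc by (simp add: O.smult_closed ph'D bd(3) 1 3 pd 2[symmetric])
 next
  fix l x assume x: "x \<in> C (Suc (m + k))"
  then show "?y (sca l \<odot>\<^bsub>obj P (Suc (m + k))\<^esub> x) = l * ?y x"
   using bd(1)[OF x] ph'D(1)[OF x]
   by (simp add: O.smult_closed sca_closed ph'D(3) bd(3) phD gm_sca[OF bd_hom] gm_sca[OF ph] LD(3)[OF f] ga(1) gm(1)[OF ph] right_diff_distrib distrib_left)
 qed (simp_all add: ph'D bd phD ga gm[OF ph] LD(2)[OF f])
 have "op 2 chi (m + k) (op k \<phi> m f) x - op k \<phi> (m + 2) (op 2 chi m f) x = D (Suc (m + k)) ?y x" for x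
 proof (cases "x \<in> C (Suc (Suc (m + k)))")
  case True
  have "\<phi> m (chi (m + k) x) = \<phi> m (ga (m + k) (bd P (Suc (m + k)) x)) \<oplus>\<^bsub>obj P m\<^esub> bd P m (\<phi> (Suc m) (ga (Suc (m + k)) x))"
   using True by (simp add: chi_eq phD bd(1) ga(1) pd)
  moreover have "bd P (Suc m) (\<phi> (Suc (Suc m)) x) = \<phi> (Suc m) (bd P (Suc (m + k)) x)" using chain_mapD(2)[OF \<phi>, of x "Suc m"] True by simp
  moreover have "chi (m + k) x \<in> C (m + k)" using mod_homD(1)[OF chi_hom True] .
  ultimately show ?thesis
   using True ph2D[OF True] bd(1)[OF True] ph'D(1)[OF ga(1)[OF True]] ph'D(1)[OF bd(1)[OF True]]
   by (simp add: op_def pb_def chi_eq bd_bd gm_zero[OF ph] LD[OF f] fd ga(1) bd(1) phD)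
 next
  case False
  then show ?thesis by (simp add: op_def pb_def)
 qed
 then have "op 2 chi (m + k) (op k \<phi> m f) - op k \<phi> (m + 2) (op 2 chi m f) = D (Suc (m + k)) ?y" by (simp add: fun_eq_iff)
 then show "op 2 chi (m + k) (op k \<phi> m f) - op k \<phi> (m + 2) (op 2 chi m f) \<in> bnd D (L S) (m + 2 + k)" using y by (simp add: bnd_simps)
qed

end

context twisted
begin

text \<open>On \<open>S\<close> the last clause of \<open>is_twist\<close> makes \<open>tw\<close>
  vanish. Along a product \<open>y r\<close> the twist identity adds the action of
  \<open>c y r\<close>, which stays in the right ideal by \<open>c_rid\<close>.\<close>

lemma tw_rid:
 assumes S: "S \<subseteq> carrier R" "\<And>s r. s \<in> S ==> r \<in> carrier R ==> c s r = \<zero>\<^sub>R" and f: "f \<in> L S n"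
  and "r \<in> rid R S" "x \<in> C n"
 shows "f (tw n r x) = 0"
 using assms(4,5)
proof (induct arbitrary: x rule: rid.induct)
 case (rid_mult y r)
 have y: "y \<in> carrier R" using R.rid_carrier[OF rid_mult(1) S(1)] .
 have "f (tw n (y \<otimes>\<^sub>R r) x \<oplus>\<^bsub>obj P n\<^esub> c y r \<odot>\<^bsub>obj P n\<^esub> x) = f (tw n y (r \<odot>\<^bsub>obj P n\<^esub> x) \<oplus>\<^bsub>obj P n\<^esub> y \<odot>\<^bsub>obj P n\<^esub> tw n r x)"
  using tw(4)[OF y rid_mult(3,4)] by simp
 then show ?case
  using y rid_mult(2)[of "r \<odot>\<^bsub>obj P n\<^esub> x"] rid_mult(3,4) L_rid[OF f S(1) c_rid[OF S rid_mult(1,3)] rid_mult(4)] L_rid[OF f S(1) rid_mult(1), of "tw n r x"]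
  by (simp add: LD(2)[OF f] tw(1) O.smult_closed c_closed)
qed (use R.rid_carrier[OF _ S(1)] S in \<open>auto simp: tw_null LD[OF f] tw(1,3,5) subset_iff\<close>)

text \<open>In \<open>tw (h h') + c h h' = tw h h' + h tw h'\<close> the first term is 0 when
  \<open>h h' = 0\<close>, and \<open>f\<close> kills the last one. So acting by \<open>h'\<close>
  on \<open>f\<close> after \<open>tw h\<close> returns \<open>f\<close>: the twist contracts the
  sequence formed by \<open>h\<close> and \<open>h'\<close>.\<close>

lemma tw_L:
 assumes S: "S \<subseteq> carrier R" "\<And>s r. s \<in> S ==> r \<in> carrier R ==> c s r = \<zero>\<^sub>R" and f: "f \<in> L S n"
  and h: "h \<in> carrier R" "\<And>s. s \<in> S ==> c h s = \<zero>\<^sub>R" "\<And>s. s \<in> S ==> h \<otimes>\<^sub>R s \<in> rid R S" "\<And>x. x \<in> C n ==> f (h \<odot>\<^bsub>obj P n\<^esub> x) = 0"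
 shows "pb (C n) (tw n h) f \<in> L S n"
  and "h' \<in> carrier R ==> h \<otimes>\<^sub>R h' = \<zero>\<^sub>R ==> c h h' = \<one>\<^sub>R ==> T h' n (pb (C n) (tw n h) f) = f"
proof -
 have e: "f (tw n (h \<otimes>\<^sub>R r) x) + f (c h r \<odot>\<^bsub>obj P n\<^esub> x) = f (tw n h (r \<odot>\<^bsub>obj P n\<^esub> x))" if "r \<in> carrier R" "x \<in> C n" for r x
  using arg_cong[OF tw(4)[OF h(1) that], of f] h that by (simp add: LD(2)[OF f] tw(1) O.smult_closed c_closed)
 show "pb (C n) (tw n h) f \<in> L S n"
 proof (rule pb_L[OF _ _ _ _ f S(1)])
  fix x s assume x: "x \<in> C n" and s: "s \<in> S"
  show "f (tw n h (s \<odot>\<^bsub>obj P n\<^esub> x)) = 0"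
   using e[of s x] s x S(1) tw_rid[OF S f h(3)[OF s] x] by (auto simp: h(2) O.zero_smult LD(5)[OF f])
 qed (simp_all add: tw(1,2) h(1) tw_sca)
 assume h': "h' \<in> carrier R" "h \<otimes>\<^sub>R h' = \<zero>\<^sub>R" "c h h' = \<one>\<^sub>R"
 have "f (tw n h (h' \<odot>\<^bsub>obj P n\<^esub> x)) = f x" if "x \<in> C n" for x
  using e[OF h'(1) that] that by (simp add: h' tw_null LD(5)[OF f] O.smult_one)
 then show "T h' n (pb (C n) (tw n h) f) = f" using h'(1) LD(1)[OF f] by (auto simp: pb_def fun_eq_iff O.smult_closed)
qed

text \<open>Instantiates \<open>acc_step\<close>. Exactness comes from \<open>tw_L\<close> with the
  roles of \<open>t\<close> and \<open>t'\<close> played both ways.\<close>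

theorem noeth_step:
 assumes N: "noeth S" and cS: "\<And>s r. s \<in> S ==> r \<in> carrier R ==> c s r = \<zero>\<^sub>R"
  and t: "t \<in> carrier R" "t' \<in> carrier R" "t \<otimes>\<^sub>R t' = \<zero>\<^sub>R" "t' \<otimes>\<^sub>R t = \<zero>\<^sub>R" "c t t' = \<one>\<^sub>R" "c t' t = \<one>\<^sub>R"
  and tS: "\<And>s. s \<in> S ==> c t s = \<zero>\<^sub>R" "\<And>s. s \<in> S ==> c t' s = \<zero>\<^sub>R"
   "\<And>s. s \<in> S ==> t \<otimes>\<^sub>R s \<in> rid R S" "\<And>s. s \<in> S ==> t' \<otimes>\<^sub>R s \<in> rid R S"
 shows "noeth (insert t S)"
proof -
 obtain \<Omega> where S: "S \<subseteq> carrier R" and \<Omega>: "\<And>k \<phi>. (k, \<phi>) \<in> \<Omega> ==> central k \<phi>"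
  and sc: "\<forall>l. (0, \<lambda>n. \<lambda>x\<in>C n. sca l \<odot>\<^bsub>obj P n\<^esub> x) \<in> \<Omega>" and acc: "acc (fam D (L S) (ops \<Omega>))"
  using N unfolding noeth_def by blast
 have om: "\<exists>\<phi>. \<omega> = op k \<phi> \<and> chain_map k \<phi>" if "(k, \<omega>) \<in> ops \<Omega>" for k \<omega>
  using that \<Omega> by (auto simp: ops_def central_def)
 have opL: "op k \<phi> n f \<in> L S (n + k)" if "chain_map k \<phi>" "f \<in> L S n" for k \<phi> n f
  using hom_L[OF chain_mapD(1)[OF that(1)] that(2) S] by (simp add: op_def)
 have opT: "T t (n + k) (op k \<phi> n f) = op k \<phi> n (T t n f)" if "chain_map k \<phi>" for k \<phi> n f
  unfolding op_def by (rule T_hom[symmetric, OF chain_mapD(1)[OF that] t(1)])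
 have tt: "T r n (T r' n f) = 0" if "r' \<otimes>\<^sub>R r = \<zero>\<^sub>R" "r \<in> carrier R" "r' \<in> carrier R" "f \<in> L S n" for r r' n f
  using that by (auto simp: pb_def fun_eq_iff O.smult_closed O.smult_assoc[symmetric] O.zero_smult LD(5))
 have kill: "f (r \<odot>\<^bsub>obj P n\<^esub> x) = 0" if "T r n f = 0" "x \<in> C n" for r f n x
  using fun_cong[OF that(1), of x] that(2) by (simp add: pb_def)
 interpret A: acc_step "L S" D "T t" "T t'" "op 2 chi" "ops \<Omega>"
 proof
  fix n f assume f: "f \<in> L S n"
  show "D n f \<in> L S (Suc n)" by (rule hom_L[OF bd_hom f S])
  show "T t n f \<in> L S n" "T t' n f \<in> L S n" using T_L S t tS f by simp_all
  show "op 2 chi n f \<in> L S (Suc (Suc n))" using opL[OF chi_chain f] by simp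
  show "D n (T t n f) = T t (Suc n) (D n f)" "D n (T t' n f) = T t' (Suc n) (D n f)" by (rule T_hom[OF bd_hom t(1)], rule T_hom[OF bd_hom t(2)])
  show "D (Suc (Suc n)) (op 2 chi n f) = op 2 chi (Suc n) (D n f)" using op_D[OF chi_chain, of n f] by simp
  show "T t (Suc (Suc n)) (op 2 chi n f) = op 2 chi n (T t n f)" using opT[OF chi_chain, of n f] by simp
  show "T t n (T t' n f) = 0" "T t' n (T t n f) = 0" using tt t f by simp_all
  show "\<exists>w\<in>L S n. f = T t n w" if "T t' n f = 0"
   using tw_L[OF S cS f t(2) tS(2,4) kill[OF that]] t by (intro bexI[of _ "pb (C n) (tw n t') f"]) simp_all
  assume Tf: "T t n f = 0" and Df: "D n f = 0"
  have fd: "f (bd P n x) = 0" if "x \<in> C (Suc n)" for x using fun_cong[OF Df, of x] that by (simp add: pb_def)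
  have ga_f: "f (ga n (h \<odot>\<^bsub>obj P (Suc n)\<^esub> x)) = f (tw n h (bd P n x)) + f (h \<odot>\<^bsub>obj P n\<^esub> ga n x)" if "h \<in> carrier R" "x \<in> C (Suc n)" for h x
   using gm_f[OF f bd_hom that] fd tw(1)[OF that] by simp
  \<comment> \<open>The zigzag is \<open>f\<close> composed with \<open>tw t\<close> and with
    \<gamma>. The intertwining identity at \<open>t\<close> gives \<open>D u = T v\<close>, and
    since \<open>f\<close> kills boundaries only \<open>\<gamma> d\<close> of \<open>chi\<close>
    survives, giving \<open>D v\<close>.\<close>
  let ?u = "pb (C n) (tw n t) f" and ?v = "pb (C (Suc n)) (ga n) f"
  have u: "?u \<in> L S n" "f = T t' n ?u" using tw_L[OF S cS f t(1) tS(1,3) kill[OF Tf]] t by simp_all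
  have v: "?v \<in> L S (Suc n)"
   by (rule pb_L[OF _ _ _ _ f S]) (use S in \<open>auto simp: ga gm_sca[OF bd_hom] ga_f subset_iff tw_rid[OF S cS f rid_gen] bd(1) LD(4)[OF f]\<close>)
  have "D n ?u = T t (Suc n) ?v"
   using t(1) ga_f[OF t(1)] kill[OF Tf] ga(1) bd(1)[of _ n] by (auto simp: pb_def fun_eq_iff O.smult_closed)
  moreover have "D (Suc n) ?v = op 2 chi n f"
   using bd(1)[of _ "Suc n"] bd(1)[of _ n] fd ga(1) LD(2)[OF f] by (auto simp: pb_def op_def fun_eq_iff chi_eq)
  ultimately show "\<exists>u\<in>L S n. \<exists>v\<in>L S (Suc n). f = T t' n u \<and> D n u = T t (Suc n) v \<and> D (Suc n) v = op 2 chi n f"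
   using u v by blast
 next
  fix n f k \<omega> assume o: "(k, \<omega>) \<in> ops \<Omega>" and f: "f \<in> L S n"
  obtain \<phi> where \<phi>: "\<omega> = op k \<phi>" "chain_map k \<phi>" using om[OF o] by blast
  show "\<omega> n f \<in> L S (n + k)" using opL f \<phi> by simp
  show "D (n + k) (\<omega> n f) = \<omega> (Suc n) (D n f)" using op_D \<phi> by simp
  show "T t (n + k) (\<omega> n f) = \<omega> n (T t n f)" using opT \<phi> by simp
  assume "T t n f = 0" and Df: "D n f = 0"
  then have "f \<in> L (insert t S) n" using f by (simp add: L_insert)
  moreover have "insert t S \<subseteq> carrier R" using t S by simp
  \<comment> \<open>Centrality is applied to \<open>insert t S\<close>, so that the homotopy itself
    lies in the kernel of \<open>T t\<close>.\<close>
  ultimately have "op 2 chi (n + k) (op k \<phi> n f) - op k \<phi> (n + 2) (op 2 chi n f) \<in> bnd D (L (insert t S)) (n + 2 + k)"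
   using chi_central \<phi>(2) Df unfolding central_def by blast
  then show "\<exists>y\<in>L S (Suc (n + k)). T t (Suc (n + k)) y = 0 \<and> op 2 chi (n + k) (\<omega> n f) - \<omega> (Suc (Suc n)) (op 2 chi n f) = D (Suc (n + k)) y"
   by (auto simp: bnd_simps \<phi>(1) L_insert)
 next
  fix n f g k \<omega> assume "(k, \<omega>) \<in> ops \<Omega>"
  then show "\<omega> n (f - g) = \<omega> n f - \<omega> n g" using om[of k \<omega>] by (auto simp: op_def pb_diff)
 qed (simp_all add: L_zero L_diff pb_diff op_def DD)
 have "A.Y = L (insert t S)" by (auto simp: A.Y_def L_insert fun_eq_iff)
 moreover have "ops (insert (2, chi) \<Omega>) = insert (2, op 2 chi) (ops \<Omega>)" by (simp add: ops_def)
 ultimately have "acc (fam D (L (insert t S)) (ops (insert (2, chi) \<Omega>)))" using A.acc_step[OF acc] by simp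
 then show ?thesis
  unfolding noeth_def using S t(1) sc \<Omega> chi_central by (intro conjI exI[of _ "insert (2, chi) \<Omega>"]) auto
qed

end

section \<open>The base of the filtration: the dual of an exact complex of vector spaces\<close>

context trivial_resolution
begin

lemma sca_simps: "x \<in> C n ==> sca l \<odot>\<^bsub>obj P n\<^esub> x \<in> C n" "x \<in> C n ==> y \<in> C n ==> sca l \<odot>\<^bsub>obj P n\<^esub> (x \<oplus>\<^bsub>obj P n\<^esub> y) = sca l \<odot>\<^bsub>obj P n\<^esub> x \<oplus>\<^bsub>obj P n\<^esub> sca l \<odot>\<^bsub>obj P n\<^esub> y"
 "x \<in> C n ==> sca l \<odot>\<^bsub>obj P n\<^esub> (sca l' \<odot>\<^bsub>obj P n\<^esub> x) = sca (l * l') \<odot>\<^bsub>obj P n\<^esub> x"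
 "x \<in> C n ==> sca (l + l') \<odot>\<^bsub>obj P n\<^esub> x = sca l \<odot>\<^bsub>obj P n\<^esub> x \<oplus>\<^bsub>obj P n\<^esub> sca l' \<odot>\<^bsub>obj P n\<^esub> x"
 "x \<in> C n ==> sca 0 \<odot>\<^bsub>obj P n\<^esub> x = \<zero>\<^bsub>obj P n\<^esub>" "x \<in> C n ==> sca 1 \<odot>\<^bsub>obj P n\<^esub> x = x"
 "x \<in> C n ==> \<zero>\<^sub>R \<odot>\<^bsub>obj P n\<^esub> x = \<zero>\<^bsub>obj P n\<^esub>" "x \<in> C n ==> \<one>\<^sub>R \<odot>\<^bsub>obj P n\<^esub> x = x"
 by (simp_all add: O.smult_closed sca_closed O.smult_r_distr O.smult_assoc[symmetric] R.smult_mult_l R.smult_assoc1 R.smult_l_distr O.smult_l_distr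
   R.smult_zero_left O.zero_smult R.smult_one O.smult_one)

text \<open>Graphs of partially defined linear functionals, ordered by inclusion for Zorn's lemma.
  Single-valuedness is required at 0 only and follows elsewhere by linearity.\<close>

definition lin_graph :: "nat \<Rightarrow> ('m \<times> 'k) set \<Rightarrow> bool" where
 "lin_graph n G \<longleftrightarrow> G \<subseteq> C n \<times> UNIV \<and> (\<zero>\<^bsub>obj P n\<^esub>, 0) \<in> G \<and> (\<forall>x u y v. (x, u) \<in> G \<longrightarrow> (y, v) \<in> G \<longrightarrow> (x \<oplus>\<^bsub>obj P n\<^esub> y, u + v) \<in> G) \<and>
   (\<forall>l x u. (x, u) \<in> G \<longrightarrow> (sca l \<odot>\<^bsub>obj P n\<^esub> x, l * u) \<in> G) \<and> (\<forall>v. (\<zero>\<^bsub>obj P n\<^esub>, v) \<in> G \<longrightarrow> v = 0)"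

lemma lin_graphD:
 assumes "lin_graph n G"
 shows "(x, u) \<in> G ==> x \<in> C n" "(\<zero>\<^bsub>obj P n\<^esub>, 0) \<in> G" "(x, u) \<in> G ==> (y, v) \<in> G ==> (x \<oplus>\<^bsub>obj P n\<^esub> y, u + v) \<in> G"
  "(x, u) \<in> G ==> (sca l \<odot>\<^bsub>obj P n\<^esub> x, l * u) \<in> G" "(\<zero>\<^bsub>obj P n\<^esub>, v) \<in> G ==> v = 0"
 using assms unfolding lin_graph_def by blast+

text \<open>The new vector is sent to 0; the extension stays single-valued because \<open>x\<close>
  is outside the old domain.\<close>

lemma lin_graph_adjoin:
 assumes G: "lin_graph n G" and x: "x \<in> C n" "x \<notin> fst ` G"
 shows "lin_graph n {(y \<oplus>\<^bsub>obj P n\<^esub> sca l \<odot>\<^bsub>obj P n\<^esub> x, u) | y l u. (y, u) \<in> G}" (is "lin_graph n ?G'")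
 unfolding lin_graph_def
proof (intro conjI allI impI)
 note g = lin_graphD[OF G]
 show "?G' \<subseteq> C n \<times> UNIV" using g(1) x(1) by (auto simp: sca_simps)
 have e: "\<zero>\<^bsub>obj P n\<^esub> = \<zero>\<^bsub>obj P n\<^esub> \<oplus>\<^bsub>obj P n\<^esub> sca 0 \<odot>\<^bsub>obj P n\<^esub> x" using x(1) by (simp add: sca_simps)
 show "(\<zero>\<^bsub>obj P n\<^esub>, 0) \<in> ?G'"
  by (intro CollectI exI[of _ "\<zero>\<^bsub>obj P n\<^esub>"] exI[of _ "0 :: 'k"] conjI g(2)) (subst e[symmetric], rule refl)
 { fix a u b v assume "(a, u) \<in> ?G'" "(b, v) \<in> ?G'"
  then obtain y l y' l' where *: "a = y \<oplus>\<^bsub>obj P n\<^esub> sca l \<odot>\<^bsub>obj P n\<^esub> x" "(y, u) \<in> G" "b = y' \<oplus>\<^bsub>obj P n\<^esub> sca l' \<odot>\<^bsub>obj P n\<^esub> x" "(y', v) \<in> G" by blast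
  have "a \<oplus>\<^bsub>obj P n\<^esub> b = (y \<oplus>\<^bsub>obj P n\<^esub> y') \<oplus>\<^bsub>obj P n\<^esub> sca (l + l') \<odot>\<^bsub>obj P n\<^esub> x"
   using *(1,3) g(1)[OF *(2)] g(1)[OF *(4)] x(1) by (simp add: sca_simps O.M.a_ac)
  then show "(a \<oplus>\<^bsub>obj P n\<^esub> b, u + v) \<in> ?G'" using g(3)[OF *(2,4)] by blast }
 { fix k a u assume "(a, u) \<in> ?G'"
  then obtain y l where *: "a = y \<oplus>\<^bsub>obj P n\<^esub> sca l \<odot>\<^bsub>obj P n\<^esub> x" "(y, u) \<in> G" by blast
  have "sca k \<odot>\<^bsub>obj P n\<^esub> a = sca k \<odot>\<^bsub>obj P n\<^esub> y \<oplus>\<^bsub>obj P n\<^esub> sca (k * l) \<odot>\<^bsub>obj P n\<^esub> x" using *(1) g(1)[OF *(2)] x(1) by (simp add: sca_simps)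
  then show "(sca k \<odot>\<^bsub>obj P n\<^esub> a, k * u) \<in> ?G'" using g(4)[OF *(2)] by blast }
 fix u assume "(\<zero>\<^bsub>obj P n\<^esub>, u) \<in> ?G'"
 then obtain y l where *: "\<zero>\<^bsub>obj P n\<^esub> = y \<oplus>\<^bsub>obj P n\<^esub> sca l \<odot>\<^bsub>obj P n\<^esub> x" "(y, u) \<in> G" by blast
 have y: "y \<in> C n" using g(1)[OF *(2)] .
 show "u = 0"
 proof (cases "l = 0")
  case True
  then show ?thesis using * x(1) y g(5) by (simp add: sca_simps)
 next
  case False
  \<comment> \<open>With a nonzero coefficient the equation could be solved for \<open>x\<close>,
    which would put \<open>x\<close> into the domain.\<close>
  have "x = sca (inverse l) \<odot>\<^bsub>obj P n\<^esub> (sca l \<odot>\<^bsub>obj P n\<^esub> x)" using False x(1) by (simp add: sca_simps)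
  also have "sca l \<odot>\<^bsub>obj P n\<^esub> x = sca (-1) \<odot>\<^bsub>obj P n\<^esub> y"
  proof -
   have "sca (-1) \<odot>\<^bsub>obj P n\<^esub> y \<oplus>\<^bsub>obj P n\<^esub> y = \<zero>\<^bsub>obj P n\<^esub>" using sca_simps(4)[OF y, of "-1" 1] y by (simp add: sca_simps)
   moreover have "sca l \<odot>\<^bsub>obj P n\<^esub> x \<oplus>\<^bsub>obj P n\<^esub> y = \<zero>\<^bsub>obj P n\<^esub>" using * x(1) y by (simp add: O.M.a_comm sca_simps)
   ultimately show ?thesis using y x(1) by (metis O.M.add.right_cancel sca_simps(1))
  qed
  finally have "x \<in> fst ` G" using g(4)[OF g(4)[OF *(2), of "-1"], of "inverse l"] by force
  then show ?thesis using x by simp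
 qed
qed

lemma extend_functional:
 assumes G0: "lin_graph n G0"
 shows "\<exists>f\<in>L {} n. \<forall>x u. (x, u) \<in> G0 \<longrightarrow> f x = u"
proof -
 let ?A = "{G. lin_graph n G \<and> G0 \<subseteq> G}"
 have "\<exists>M\<in>?A. \<forall>X\<in>?A. M \<subseteq> X \<longrightarrow> X = M"
 proof (rule subset_Zorn_nonempty)
  show "?A \<noteq> {}" using G0 by blast
  fix K assume K: "K \<noteq> {}" "subset.chain ?A K"
  have A: "G \<in> K ==> lin_graph n G" "G \<in> K ==> G0 \<subseteq> G" for G using K(2) by (auto simp: subset.chain_def)
  note g = lin_graphD[OF A(1)]
  have two: "\<exists>G\<in>K. a \<in> G \<and> b \<in> G" if ab: "a \<in> \<Union>K" "b \<in> \<Union>K" for a b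
  proof -
   obtain G G' where G: "G \<in> K" "a \<in> G" "G' \<in> K" "b \<in> G'" using ab by (elim UnionE)
   moreover have "G \<subseteq> G' \<or> G' \<subseteq> G" using G(1,3) K(2) unfolding subset_chain_def by blast
   ultimately show ?thesis by blast
  qed
  obtain G1 where G1: "G1 \<in> K" using K(1) by blast
  have "lin_graph n (\<Union>K)"
   unfolding lin_graph_def
  proof (intro conjI allI impI)
   show "\<Union>K \<subseteq> C n \<times> UNIV" using A(1) by (intro Union_least) (simp add: lin_graph_def)
   show "(\<zero>\<^bsub>obj P n\<^esub>, 0) \<in> \<Union>K" using g(2)[OF G1] G1 by blast
   show "(x \<oplus>\<^bsub>obj P n\<^esub> y, u + v) \<in> \<Union>K" if xy: "(x, u) \<in> \<Union>K" "(y, v) \<in> \<Union>K" for x y u v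
   proof -
    obtain G where "G \<in> K" "(x, u) \<in> G" "(y, v) \<in> G" using two[OF xy] by blast
    then show ?thesis using g(3)[of G] by blast
   qed
   show "(sca l \<odot>\<^bsub>obj P n\<^esub> x, l * u) \<in> \<Union>K" if "(x, u) \<in> \<Union>K" for x u l using that g(4) by blast
   show "v = 0" if "(\<zero>\<^bsub>obj P n\<^esub>, v) \<in> \<Union>K" for v using that g(5) by blast
  qed
  then show "\<Union>K \<in> ?A" using A(2)[OF G1] G1 by blast
 qed
 then obtain M where M0: "M \<in> ?A" "\<forall>X\<in>?A. M \<subseteq> X \<longrightarrow> X = M" by (elim bexE)
 have M: "lin_graph n M" "G0 \<subseteq> M" "lin_graph n X ==> M \<subseteq> X ==> X = M" for X
  using M0(1) M0(2)[rule_format, of X] by (auto dest: order_trans)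
 note g = lin_graphD[OF M(1)]
 have ex: "\<exists>u. (x, u) \<in> M" if x: "x \<in> C n" for x
 proof (rule ccontr)
  assume no: "\<nexists>u. (x, u) \<in> M"
  let ?M' = "{(y \<oplus>\<^bsub>obj P n\<^esub> sca l \<odot>\<^bsub>obj P n\<^esub> x, u) | y l u. (y, u) \<in> M}"
  have "lin_graph n ?M'" by (rule lin_graph_adjoin[OF M(1) x]) (use no in auto)
  moreover have "M \<subseteq> ?M'"
  proof (rule subrelI)
   fix y u assume yu: "(y, u) \<in> M"
   have "y \<oplus>\<^bsub>obj P n\<^esub> sca 0 \<odot>\<^bsub>obj P n\<^esub> x = y" using x g(1)[OF yu] by (simp add: sca_simps)
   then show "(y, u) \<in> ?M'" using yu by (metis (mono_tags, lifting) mem_Collect_eq)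
  qed
  ultimately have "?M' = M" by (rule M(3))
  moreover have "(\<zero>\<^bsub>obj P n\<^esub> \<oplus>\<^bsub>obj P n\<^esub> sca 1 \<odot>\<^bsub>obj P n\<^esub> x, 0) \<in> ?M'" using g(2) by blast
  ultimately have "(\<zero>\<^bsub>obj P n\<^esub> \<oplus>\<^bsub>obj P n\<^esub> sca 1 \<odot>\<^bsub>obj P n\<^esub> x, 0) \<in> M" by (simp only:)
  then show False using no x by (simp add: sca_simps)
 qed
 have uniq: "u = v" if uv: "(x, u) \<in> M" "(x, v) \<in> M" for x u v
 proof -
  have x: "x \<in> C n" using g(1) uv by blast
  have "(x \<oplus>\<^bsub>obj P n\<^esub> sca (-1) \<odot>\<^bsub>obj P n\<^esub> x, u + -1 * v) \<in> M" by (rule g(3)[OF uv(1) g(4)[OF uv(2)]])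
  moreover have "x \<oplus>\<^bsub>obj P n\<^esub> sca (-1) \<odot>\<^bsub>obj P n\<^esub> x = \<zero>\<^bsub>obj P n\<^esub>" using sca_simps(4)[OF x, of 1 "-1"] x by (simp add: sca_simps)
  ultimately show ?thesis using g(5)[of "u + -1 * v"] by simp
 qed
 define f where "f x = (if x \<in> C n then THE u. (x, u) \<in> M else 0)" for x
 have f: "f x = u" if "(x, u) \<in> M" for x u
  using that g(1)[OF that] uniq by (auto simp: f_def intro!: the_equality)
 have fM: "(x, f x) \<in> M" if "x \<in> C n" for x using ex[OF that] f by blast
 have "f \<in> L {} n"
 proof (rule LI)
  show "f (x \<oplus>\<^bsub>obj P n\<^esub> y) = f x + f y" if "x \<in> C n" "y \<in> C n" for x y by (rule f[OF g(3)[OF fM fM]]) (use that in auto)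
  show "f (sca l \<odot>\<^bsub>obj P n\<^esub> x) = l * f x" if "x \<in> C n" for x l by (rule f[OF g(4)[OF fM]]) (use that in auto)
 qed (simp_all add: f_def)
 then show ?thesis using f M(2) by blast
qed

text \<open>On boundaries \<open>bd x -> f x\<close> is well defined, because \<open>f\<close> kills
  the image of the next boundary map and this is the kernel of \<open>bd\<close>. Any linear
  extension is a primitive of \<open>f\<close>.\<close>

lemma exact_functionals:
 assumes f: "f \<in> L {} (Suc n)" and Df: "D (Suc n) f = 0"
 shows "f \<in> bnd D (L {}) (Suc n)"
proof -
 have fd: "f (bd P (Suc n) x) = 0" if "x \<in> C (Suc (Suc n))" for x using fun_cong[OF Df, of x] that by (simp add: pb_def)
 have "lin_graph n ((\<lambda>x. (bd P n x, f x)) ` C (Suc n))"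
  unfolding lin_graph_def
 proof (intro conjI allI impI)
  show "(\<zero>\<^bsub>obj P n\<^esub>, 0) \<in> (\<lambda>x. (bd P n x, f x)) ` C (Suc n)"
   using mod_hom_zero[OF bd_hom obj_module obj_module] LD(5)[OF f] by (intro image_eqI[of _ _ "\<zero>\<^bsub>obj P (Suc n)\<^esub>"]) auto
  show "v = 0" if v: "(\<zero>\<^bsub>obj P n\<^esub>, v) \<in> (\<lambda>x. (bd P n x, f x)) ` C (Suc n)" for v
  proof -
   obtain x where x': "x \<in> C (Suc n)" "(\<zero>\<^bsub>obj P n\<^esub>, v) = (bd P n x, f x)" using v by (elim imageE)
   then have x: "x \<in> C (Suc n)" "bd P n x = \<zero>\<^bsub>obj P n\<^esub>" "v = f x" by simp_all
   then obtain y where "y \<in> C (Suc (Suc n))" "x = bd P (Suc n) y" using ex[of n] by blast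
   then show ?thesis using fd x by simp
  qed
  show "(x \<oplus>\<^bsub>obj P n\<^esub> y, u + v) \<in> (\<lambda>x. (bd P n x, f x)) ` C (Suc n)"
   if uv: "(x, u) \<in> (\<lambda>x. (bd P n x, f x)) ` C (Suc n)" "(y, v) \<in> (\<lambda>x. (bd P n x, f x)) ` C (Suc n)" for x u y v
  proof -
   obtain x' y' where "x' \<in> C (Suc n)" "y' \<in> C (Suc n)" "x = bd P n x'" "u = f x'" "y = bd P n y'" "v = f y'" using uv by auto
   then show ?thesis by (intro image_eqI[of _ _ "x' \<oplus>\<^bsub>obj P (Suc n)\<^esub> y'"]) (simp_all add: bd(2) LD(2)[OF f])
  qed
  show "(sca l \<odot>\<^bsub>obj P n\<^esub> x, l * u) \<in> (\<lambda>x. (bd P n x, f x)) ` C (Suc n)" if u: "(x, u) \<in> (\<lambda>x. (bd P n x, f x)) ` C (Suc n)" for l x u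
  proof -
   obtain x' where "x' \<in> C (Suc n)" "x = bd P n x'" "u = f x'" using u by auto
   then show ?thesis by (intro image_eqI[of _ _ "sca l \<odot>\<^bsub>obj P (Suc n)\<^esub> x'"]) (simp_all add: bd(3) LD(3)[OF f] sca_closed sca_simps)
  qed
 qed (use bd(1) in auto)
 from extend_functional[OF this] obtain g where g: "g \<in> L {} n" "\<forall>x u. (x, u) \<in> (\<lambda>x. (bd P n x, f x)) ` C (Suc n) \<longrightarrow> g x = u" by (elim bexE)
 have "g (bd P n x) = f x" if "x \<in> C (Suc n)" for x by (rule g(2)[rule_format]) (rule imageI[OF that])
 then have "f = D n g" using LD(1)[OF f] by (auto simp: pb_def fun_eq_iff)
 then show ?thesis using g(1) by (auto simp: bnd_simps)
qed

text \<open>The kernel of \<open>aug\<close> consists of boundaries, so \<open>f\<close> is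
  determined by its value at one \<open>e\<close> with augmentation 1.\<close>

lemma functionals_0:
 assumes f: "f \<in> L {} 0" and Df: "D 0 f = 0"
 shows "\<exists>l. f = (\<lambda>x. l * (if x \<in> C 0 then aug P x else 0))"
proof -
 have fd: "f (bd P 0 x) = 0" if "x \<in> C (Suc 0)" for x using fun_cong[OF Df, of x] that by (simp add: pb_def)
 have "1 \<in> aug P ` C 0" unfolding aug_surj by simp
 then obtain e where e: "e \<in> C 0" "aug P e = 1" by auto
 have "f x = f e * aug P x" if x: "x \<in> C 0" for x
 proof -
  let ?y = "x \<oplus>\<^bsub>obj P 0\<^esub> sca (- aug P x) \<odot>\<^bsub>obj P 0\<^esub> e"
  have y: "?y \<in> C 0" using x e by (simp add: sca_simps)
  have "aug P ?y = 0" using x e by (simp add: cohD[OF aug_hom] sca_simps sca_closed eps_simps)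
  then have "?y \<in> bd P 0 ` C (Suc 0)" using y ex0 by blast
  then have "f ?y = 0" using fd by auto
  then show ?thesis using x e by (simp add: LD(2,3)[OF f] sca_simps)
 qed
 then show ?thesis using LD(1)[OF f] by (intro exI[of _ "f e"]) (auto simp: fun_eq_iff)
qed

abbreviation scal where "scal l \<equiv> \<lambda>n. \<lambda>x\<in>C n. sca l \<odot>\<^bsub>obj P n\<^esub> x"

lemma scal_central: "central 0 (scal l)"
proof -
 have c: "chain_map 0 (scal l)"
  unfolding chain_map_def
 proof (intro conjI allI ballI)
  show "scal l n \<in> hom (n + 0) n" for n
   by (simp, rule mod_homI[OF _ _ _ obj_module]) (simp_all add: sca_simps sca_smult)
 qed (simp add: bd(1,3) sca_closed)
 have z: "0 \<in> bnd D (L S) n" for S n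
 proof (cases n)
  case (Suc m)
  have "0 = D m 0" by (simp add: pb_zero)
  then show ?thesis using Suc L_zero[of S m] by (simp only: bnd_simps) (rule image_eqI)
 qed (simp add: bnd_simps)
 have "op 0 (scal l) (m + j) (op j \<psi> m f) - op j \<psi> (m + 0) (op 0 (scal l) m f) = 0" if \<psi>: "chain_map j \<psi>" for j \<psi> m f
  using mod_homD[OF chain_mapD(1)[OF \<psi>, of m]] by (auto simp: op_def pb_def fun_eq_iff sca_simps sca_closed)
 then show ?thesis unfolding central_def using c z by simp
qed

text \<open>The dual complex has cohomology in degree 0 only, spanned there by the augmentation. A
  family is thus determined by whether it contains the augmentation, and a chain changes at most
  once.\<close>

theorem noeth_base: "noeth {}"
proof -
 let ?\<Omega> = "range (\<lambda>l. (0 :: nat, scal l))"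
 let ?F = "fam D (L {}) (ops ?\<Omega>)"
 let ?a = "\<lambda>x. if x \<in> C 0 then aug P x else 0"
 have "acc ?F"
  unfolding acc_def
 proof (intro allI impI, elim conjE)
  fix W :: "nat \<Rightarrow> nat \<Rightarrow> ('m \<Rightarrow> 'k) set" assume W: "range W \<subseteq> ?F" and m: "mono W"
  have WF: "W s \<in> ?F" for s using W by blast
  note w = famD[OF WF]
  have Suc: "W s (Suc n) = bnd D (L {}) (Suc n)" for s n
  proof (intro equalityI subsetI)
   fix f assume f: "f \<in> W s (Suc n)"
   show "f \<in> bnd D (L {}) (Suc n)" using exact_functionals[OF w(2)[OF f] w(3)[OF f]] .
  qed (rule w(1))
  have sc: "(\<lambda>x. k * f x) \<in> W s 0" if f: "f \<in> W s 0" for f k s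
  proof -
   have "(0, op 0 (scal k)) \<in> ops ?\<Omega>" unfolding ops_def by (rule image_eqI[of _ _ "(0, scal k)"], simp, rule rangeI)
   from w(5)[OF this f] have "op 0 (scal k) 0 f \<in> W s 0" by simp
   also have "op 0 (scal k) 0 f = (\<lambda>x. k * f x)" using LD(1,3)[OF w(2)[OF f]] by (auto simp: op_def pb_def fun_eq_iff)
   finally show ?thesis .
  qed
  have zero: "0 \<in> W s 0" for s by (rule w(1)) (simp add: bnd_simps)
  have a: "\<exists>l. f = (\<lambda>x. l * ?a x)" if "f \<in> W s 0" for f s using functionals_0[OF w(2,3)[OF that]] .
  show "\<exists>N. \<forall>n\<ge>N. W n = W N"
  proof (cases "\<exists>N. ?a \<in> W N 0")
   case True
   then obtain N where N: "?a \<in> W N 0" by blast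
   have eq: "W s 0 = range (\<lambda>l x. l * ?a x)" if "s \<ge> N" for s
   proof -
    have "?a \<in> W s 0" using N monoD[OF m that] by (auto simp: le_fun_def)
    then show ?thesis using a sc by blast
   qed
   have "W s n = W N n" if "s \<ge> N" for s n by (cases n) (simp_all only: Suc eq[OF that] eq[OF order_refl])
   then show ?thesis by blast
  next
   case False
   have eq: "W s 0 = {0}" for s
   proof (intro equalityI subsetI)
    fix f assume f: "f \<in> W s 0"
    obtain l where l: "f = (\<lambda>x. l * ?a x)" using a[OF f] by blast
    have "l = 0"
    proof (rule ccontr)
     assume "l \<noteq> 0"
     then have "(\<lambda>x. inverse l * f x) = ?a" by (simp add: l fun_eq_iff)
     then show False using sc[OF f, of "inverse l"] False by metis
    qed
    then show "f \<in> {0}" by (simp add: l fun_eq_iff)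
   qed (use zero in simp)
   have "W s n = W 0 n" for s n by (cases n) (simp_all only: Suc eq)
   then show ?thesis by blast
  qed
 qed
 then show ?thesis unfolding noeth_def using scal_central by (intro conjI exI[of _ ?\<Omega>]) auto
qed

end

section \<open>From stable families to left ideals\<close>

lemma left_idealI:
 assumes "Ring.ring R" "I \<subseteq> carrier R" "\<zero>\<^sub>R \<in> I" "\<And>x y. x \<in> I ==> y \<in> I ==> x \<oplus>\<^sub>R y \<in> I" "\<And>r x. r \<in> carrier R ==> x \<in> I ==> r \<otimes>\<^sub>R x \<in> I"
 shows "left_ideal I R"
proof -
 interpret ring R by fact
 have m: "\<ominus>\<^sub>R x \<in> I" if x: "x \<in> I" for x
 proof -
  have "(\<ominus>\<^sub>R \<one>\<^sub>R) \<otimes>\<^sub>R x = \<ominus>\<^sub>R x" using x assms(2) by (auto simp: l_minus)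
  then show ?thesis using assms(5)[of "\<ominus>\<^sub>R \<one>\<^sub>R" x] x by simp
 qed
 have "subgroup I (add_monoid R)"
  by (rule add.subgroupI) (use assms m in \<open>auto simp: a_inv_def\<close>)
 then show ?thesis using assms(5) unfolding left_ideal_def by (simp add: additive_subgroupI)
qed

lemma left_idealD:
 assumes "left_ideal I R" "Ring.ring R"
 shows "I \<subseteq> carrier R" "\<zero>\<^sub>R \<in> I" "x \<in> I ==> y \<in> I ==> x \<oplus>\<^sub>R y \<in> I" "x \<in> I ==> y \<in> I ==> x \<ominus>\<^sub>R y \<in> I"
  "r \<in> carrier R ==> x \<in> I ==> r \<otimes>\<^sub>R x \<in> I"
proof -
 interpret ring R by fact
 interpret additive_subgroup I R using assms(1) by (simp add: left_ideal_def)
 show "x \<in> I ==> y \<in> I ==> x \<ominus>\<^sub>R y \<in> I" by (simp add: minus_eq a_inv_closed)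
qed (use assms in \<open>auto simp: left_ideal_def additive_subgroup.a_closed additive_subgroup.zero_closed dest: additive_subgroup.a_subset\<close>)

lemma left_noetherian_if_acc:
 assumes R: "Ring.ring R" and acc: "acc {I. left_ideal I R}"
 shows "left_noetherian_ring R"
proof -
 interpret ring R by fact
 let ?g = "\<lambda>S. \<Inter>{J. left_ideal J R \<and> S \<subseteq> J}"
 have g: "left_ideal (?g S) R" if "S \<subseteq> carrier R" for S
 proof (rule left_idealI[OF R])
  have "left_ideal (carrier R) R" by (rule left_idealI[OF R]) auto
  then show "?g S \<subseteq> carrier R" using that by blast
  show "\<zero>\<^sub>R \<in> ?g S" using left_idealD(2)[OF _ R] by blast
  show "x \<oplus>\<^sub>R y \<in> ?g S" if "x \<in> ?g S" "y \<in> ?g S" for x y using that left_idealD(3)[OF _ R] by blast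
  show "r \<otimes>\<^sub>R x \<in> ?g S" if "r \<in> carrier R" "x \<in> ?g S" for r x using that left_idealD(5)[OF _ R] by blast
 qed
 show ?thesis
 proof (unfold_locales, rule ccontr)
  fix I assume I: "left_ideal I R" and no: "\<not> (\<exists>S\<subseteq>carrier R. finite S \<and> I = ?g S)"
  have ex: "\<exists>x. x \<in> I \<and> x \<notin> ?g S" if "finite S" "S \<subseteq> I" for S
  proof -
   have "?g S \<subseteq> I" using I that(2) by blast
   moreover have "?g S \<noteq> I" using no that left_idealD(1)[OF I R] by blast
   ultimately show ?thesis by blast
  qed
  \<comment> \<open>Finite subsets of \<open>I\<close>, each enlarged by an element outside the left
    ideal it generates; their left ideals ascend strictly.\<close>
  define F where "F = rec_nat {} (\<lambda>_ S. insert (SOME x. x \<in> I \<and> x \<notin> ?g S) S)"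
  have F_Suc: "F (Suc n) = insert (SOME x. x \<in> I \<and> x \<notin> ?g (F n)) (F n)" for n by (simp add: F_def)
  have F: "finite (F n) \<and> F n \<subseteq> I" for n
  proof (induct n)
   case (Suc n)
   then show ?case using someI_ex[OF ex[of "F n"]] by (simp add: F_Suc)
  qed (simp add: F_def)
  have "mono (\<lambda>n. ?g (F n))" by (rule incseq_SucI) (auto simp: F_Suc)
  moreover have "?g (F n) \<in> {I. left_ideal I R}" for n using g[of "F n"] subset_trans[OF conjunct2[OF F[of n]] left_idealD(1)[OF I R]] by simp
  ultimately have "\<exists>N. \<forall>n\<ge>N. ?g (F n) = ?g (F N)" by (intro accD[OF acc])
  then obtain N where N: "\<forall>n\<ge>N. ?g (F n) = ?g (F N)" by (elim exE)
  have "?g (F (Suc N)) = ?g (F N)" using N[rule_format, of "Suc N"] by simp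
  moreover have "(SOME x. x \<in> I \<and> x \<notin> ?g (F N)) \<in> ?g (F (Suc N))" by (auto simp: F_Suc)
  moreover have "(SOME x. x \<in> I \<and> x \<notin> ?g (F N)) \<notin> ?g (F N)" using someI_ex[OF ex[of "F N"]] F by blast
  ultimately show False by simp
 qed
qed

section \<open>Leading components of left ideals of the Ext ring\<close>

context trivial_resolution
begin

lemma pb_id_coh:
 assumes S: "S \<subseteq> carrier R" "\<And>s. s \<in> S ==> \<epsilon> s = 0" and f: "f \<in> coh n"
 shows "pb (C n) (\<lambda>x. x) f \<in> L S n"
 by (rule LI) (use S in \<open>auto simp: pb_def cohD[OF f] O.smult_closed sca_closed eps_simps subset_iff\<close>)

text \<open>Split \<open>h\<close> into \<open>h - \<epsilon>(h)\<close> and a scalar: the first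
  part lies in the right ideal of \<open>S\<close>, which \<open>f\<close> kills.\<close>

lemma restrict_L:
 assumes S: "S \<subseteq> carrier R" "\<And>h. h \<in> carrier R ==> h \<ominus>\<^sub>R sca (\<epsilon> h) \<in> rid R S" and f: "f \<in> L S n"
 shows "restrict f (C n) \<in> coh n"
proof (rule cohI)
 fix h x assume h: "h \<in> carrier R" and x: "x \<in> C n"
 have "h = (h \<ominus>\<^sub>R sca (\<epsilon> h)) \<oplus>\<^sub>R sca (\<epsilon> h)" using h sca_closed by (simp add: R.minus_eq R.a_assoc R.l_neg)
 then have "f (h \<odot>\<^bsub>obj P n\<^esub> x) = f ((h \<ominus>\<^sub>R sca (\<epsilon> h)) \<odot>\<^bsub>obj P n\<^esub> x) + f (sca (\<epsilon> h) \<odot>\<^bsub>obj P n\<^esub> x)"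
  using h x sca_closed by (metis LD(2)[OF f] O.smult_closed O.smult_l_distr R.minus_closed)
 then show "restrict f (C n) (h \<odot>\<^bsub>obj P n\<^esub> x) = \<epsilon> h * restrict f (C n) x"
  using h x L_rid[OF f S(1) S(2)[OF h] x] by (simp add: O.smult_closed LD(3)[OF f])
qed (simp_all add: LD(2)[OF f])

text \<open>Leading components in degree \<open>n\<close>, from elements of \<open>I\<close> that
  vanish as classes above \<open>n\<close>. Representatives are kept and extended by 0 to fit the
  format of \<open>fam\<close>.\<close>

definition top_components :: "(nat \<Rightarrow> ('m \<Rightarrow> 'k) set) set \<Rightarrow> nat \<Rightarrow> ('m \<Rightarrow> 'k) set" where
 "top_components I n = {pb (C n) (\<lambda>x. x) (F n) | F. F \<in> Zs \<and> rp F \<in> I \<and> (\<forall>j>n. F j \<in> B j)}"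

lemma top_componentsI: "F \<in> Zs ==> rp F \<in> I ==> (\<And>j. j > n ==> F j \<in> B j) ==> x = pb (C n) (\<lambda>x. x) (F n) ==> x \<in> top_components I n"
 unfolding top_components_def by blast

lemma E_diff:
 assumes F: "F \<in> Zs" and G: "G \<in> Zs"
 shows "(\<lambda>j. pd j (F j) (G j)) \<in> Zs" "rp (\<lambda>j. pd j (F j) (G j)) = rp F \<ominus>\<^sub>E rp G"
proof -
 interpret E: ring E by (rule ring_E)
 have sub: "x = z \<ominus>\<^sub>E y" if "x \<oplus>\<^sub>E y = z" "x \<in> carrier E" "y \<in> carrier E" for x y z
  using that by (auto simp: E.minus_eq E.a_assoc E.r_neg)
 have "{n. pd n (F n) (G n) \<notin> B n} \<subseteq> {n. F n \<notin> B n} \<union> {n. G n \<notin> B n}" using B_lin by auto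
 moreover have "finite ({n. F n \<notin> B n} \<union> {n. G n \<notin> B n})" using F G by (simp add: Zs_def)
 ultimately have "finite {n. pd n (F n) (G n) \<notin> B n}" by (rule finite_subset)
 then show H: "(\<lambda>j. pd j (F j) (G j)) \<in> Zs" using F G by (simp add: Zs_def Z_lin)
 have "(\<lambda>j. pa j (pd j (F j) (G j)) (G j)) = F" using Z_ext[OF ZsD[OF F]] by (simp add: pa_def pd_def cong: restrict_cong)
 then have "rp (\<lambda>j. pd j (F j) (G j)) \<oplus>\<^sub>E rp G = rp F" using E_add[OF H G] by simp
 then show "rp (\<lambda>j. pd j (F j) (G j)) = rp F \<ominus>\<^sub>E rp G" by (rule sub) (simp_all only: E_carrier imageI[OF H] imageI[OF G])
qed

lemma rp_zero: "(\<And>j. F j \<in> B j) ==> rp F = \<zero>\<^sub>E"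
 unfolding E_zero rp_def using cls_one_iff[OF B_Z] by (simp add: EG_one[symmetric])

text \<open>Subtracting an element of \<open>I\<close> with the same leading component lowers the
  bound \<open>N\<close> on the degree, until the class is 0.\<close>

lemma top_components_inj:
 assumes I: "left_ideal I E" and J: "left_ideal J E" and le: "I \<subseteq> J" and eq: "top_components J = top_components I"
 shows "I = J"
proof -
 note i = left_idealD[OF I ring_E] and j = left_idealD[OF J ring_E]
 have "F \<in> Zs \<longrightarrow> rp F \<in> J \<longrightarrow> (\<forall>j\<ge>N. F j \<in> B j) \<longrightarrow> rp F \<in> I" for F N
 proof (induct N arbitrary: F)
  case 0
  show ?case using rp_zero[of F] i(2) by auto
 next
  case (Suc N)
  show ?case
  proof (intro impI)
   assume F: "F \<in> Zs" "rp F \<in> J" "\<forall>j\<ge>Suc N. F j \<in> B j"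
   have "pb (C N) (\<lambda>x. x) (F N) \<in> top_components J N" by (rule top_componentsI[OF F(1,2) _ refl]) (use F(3) in auto)
   then obtain G where G: "G \<in> Zs" "rp G \<in> I" "\<forall>j>N. G j \<in> B j" "pb (C N) (\<lambda>x. x) (F N) = pb (C N) (\<lambda>x. x) (G N)"
    unfolding eq top_components_def by blast
   have FG: "F N x = G N x" if "x \<in> C N" for x using fun_cong[OF G(4), of x] that by (simp add: pb_def)
   then have "pd N (F N) (G N) \<in> B N" using zero_B[of N] by (simp add: pd_def cong: restrict_cong)
   then have "pd l (F l) (G l) \<in> B l" if "l \<ge> N" for l
    using that F(3) G(3) B_lin(2) by (cases "l = N") auto
   moreover have "rp (\<lambda>j. pd j (F j) (G j)) \<in> J" using E_diff(2)[OF F(1) G(1)] j(4)[OF F(2)] G(2) le by auto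
   ultimately have "rp (\<lambda>j. pd j (F j) (G j)) \<in> I" using Suc E_diff(1)[OF F(1) G(1)] by blast
   then have "rp (\<lambda>j. pd j (F j) (G j)) \<oplus>\<^sub>E rp G \<in> I" using i(3) G(2) by blast
   moreover have "(\<lambda>j. pa j (pd j (F j) (G j)) (G j)) = F" using Z_ext[OF ZsD[OF F(1)]] by (simp add: pa_def pd_def cong: restrict_cong)
   ultimately show "rp F \<in> I" using E_add[OF E_diff(1)[OF F(1) G(1)] G(1)] by simp
  qed
 qed
 note main = this
 have "x \<in> I" if x: "x \<in> J" for x
 proof -
  obtain F where F: "F \<in> Zs" "x = rp F" using x j(1) E_carrier by blast
  obtain N where N: "\<And>n. F n \<notin> B n ==> n < N" using F(1) finite_nat_set_iff_bounded[of "{n. F n \<notin> B n}"] by (auto simp: Zs_def)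
  have "\<forall>j\<ge>N. F j \<in> B j" using N by (meson not_le)
  then show ?thesis using main F x by blast
 qed
 then show ?thesis using le by blast
qed

text \<open>Stability under a central operator has to be expressed as multiplication by an element
  of the ring. That element is the image of the augmentation under the operator, and centrality
  exchanges the operator with the lift of \<open>F n\<close>.\<close>

lemma top_components_fam:
 assumes S: "S \<subseteq> carrier R" "\<And>s. s \<in> S ==> \<epsilon> s = 0" "\<And>h. h \<in> carrier R ==> h \<ominus>\<^sub>R sca (\<epsilon> h) \<in> rid R S"
  and \<Omega>: "\<And>k \<phi>. (k, \<phi>) \<in> \<Omega> ==> central k \<phi>" and I: "left_ideal I E"
 shows "top_components I \<in> fam D (L S) (ops \<Omega>)"
proof (rule famI)
 note i = left_idealD[OF I ring_E]
 have cohL: "f \<in> coh n ==> pb (C n) (\<lambda>x. x) f \<in> L S n" for f n by (rule pb_id_coh[OF S(1,2)])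
 have Lcoh: "f \<in> L S n ==> restrict f (C n) \<in> coh n" for f n by (rule restrict_L[OF S(1,3)])
 show bnd: "x \<in> top_components I n" if x: "x \<in> bnd D (L S) n" for n x
 proof -
  have rB: "restrict x (C n) \<in> B n \<and> pb (C n) (\<lambda>x. x) x = x"
  proof (cases n)
   case 0
   then show ?thesis using x zero_B[of 0] by (simp_all add: bnd_simps zero_fun_def pb_def)
  next
   case (Suc m)
   then obtain y where y: "y \<in> L S m" "x = D m y" using x by (auto simp: bnd_simps)
   have "restrict x (C n) = compose (C (Suc m)) (restrict y (C m)) (bd P m)"
    using y(2) Suc bd(1)[of _ m] by (auto simp: pb_def compose_def fun_eq_iff)
   then have "restrict x (C n) \<in> B n" using Lcoh[OF y(1)] Suc B_Suc by auto
   moreover have "pb (C n) (\<lambda>x. x) x = x" using y(2) Suc by (auto simp: pb_def fun_eq_iff)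
   ultimately show ?thesis ..
  qed
  let ?F = "\<lambda>j. if j = n then restrict x (C n) else (\<lambda>x\<in>C j. 0)"
  have F: "?F j \<in> B j" for j using rB zero_B by simp
  show ?thesis
  proof (rule top_componentsI)
   show "?F \<in> Zs" unfolding Zs_def using F B_Z[OF F] by simp
   show "rp ?F \<in> I" using rp_zero[of ?F] F i(2) by simp
   have "pb (C n) (\<lambda>x. x) (restrict x (C n)) = pb (C n) (\<lambda>x. x) x" by (auto simp: pb_def fun_eq_iff)
   then show "x = pb (C n) (\<lambda>x. x) (?F n)" using rB by simp
  qed (rule F)
 qed
 show diff: "x - y \<in> top_components I n" if xy: "x \<in> top_components I n" "y \<in> top_components I n" for n x y
 proof -
  obtain F G where F: "F \<in> Zs" "rp F \<in> I" "\<forall>j>n. F j \<in> B j" "x = pb (C n) (\<lambda>x. x) (F n)"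
   and G: "G \<in> Zs" "rp G \<in> I" "\<forall>j>n. G j \<in> B j" "y = pb (C n) (\<lambda>x. x) (G n)"
   using xy unfolding top_components_def by blast
  show ?thesis
  proof (rule top_componentsI[OF E_diff(1)[OF F(1) G(1)]])
   show "rp (\<lambda>j. pd j (F j) (G j)) \<in> I" using E_diff(2)[OF F(1) G(1)] i(4) F(2) G(2) by simp
   show "pd j (F j) (G j) \<in> B j" if "j > n" for j using F(3) G(3) B_lin(2) that by blast
   show "x - y = pb (C n) (\<lambda>x. x) (pd n (F n) (G n))" by (auto simp: F(4) G(4) pb_def pd_def fun_eq_iff)
  qed
 qed
 show "x \<in> cyc D (L S) n" if x: "x \<in> top_components I n" for n x
 proof -
  obtain F where F: "F \<in> Zs" "x = pb (C n) (\<lambda>x. x) (F n)" using x unfolding top_components_def by blast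
  have "F n \<in> coh n" "\<And>y. y \<in> C (Suc n) ==> F n (bd P n y) = 0" using ZsD[OF F(1), of n] by (auto simp: Z_iff)
  then show ?thesis using cohL[of "F n" n] bd(1)[of _ n] unfolding cyc_def F(2) by (auto simp: pb_def fun_eq_iff)
 qed
 fix n k \<omega> x assume o: "(k, \<omega>) \<in> ops \<Omega>" and x: "x \<in> top_components I n"
 obtain \<phi> where \<phi>: "\<omega> = op k \<phi>" "central k \<phi>" using o \<Omega> by (auto simp: ops_def)
 have cm: "chain_map k \<phi>" using \<phi>(2) by (simp add: central_def)
 note ph = chain_mapD[OF cm]
 obtain F where F: "F \<in> Zs" "rp F \<in> I" "\<forall>j>n. F j \<in> B j" "x = pb (C n) (\<lambda>x. x) (F n)" using x unfolding top_components_def by blast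
 obtain \<Phi> where \<Phi>: "\<And>n. \<Phi> n \<in> lifts n (F n)" using lifts_choice[OF F(1)] by blast
 \<comment> \<open>The cocycle of degree \<open>k\<close> by which \<open>F\<close> is multiplied,
   from the left as \<open>I\<close> is a left ideal.\<close>
 let ?\<eta> = "compose (C k) (aug P) (\<phi> 0)"
 have \<eta>: "?\<eta> \<in> Z k"
  using comp_coh[of "\<phi> 0" k 0 "aug P"] ph(1)[of 0] aug_hom ph(2)[of _ 0] aug_bd mod_homD(1)[OF ph(1)[of "Suc 0"]] bd(1)[of _ k]
  by (auto simp: Z_iff compose_eq) (metis aug_bd)
 let ?H = "\<lambda>j. if j = k then ?\<eta> else (\<lambda>x\<in>C j. 0)"
 have "finite {j. ?H j \<notin> B j}" by (rule finite_subset[of _ "{k}"]) (auto simp: zero_B)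
 then have H: "?H \<in> Zs" unfolding Zs_def using \<eta> B_Z[OF zero_B] by simp
 note K = E_mult[OF H F(1) \<Phi>]
 let ?K = "cv ?H \<Phi>"
 have Kc: "?K j = compose (C j) ?\<eta> (\<Phi> (j - k) k)" if j: "k \<le> j" for j
 proof (rule ext)
  fix y
  show "?K j y = compose (C j) ?\<eta> (\<Phi> (j - k) k) y"
  proof (cases "y \<in> C j")
   case True
   have "?K j y = (\<Sum>i\<le>j. ?H i (\<Phi> (j - i) i y))" using True by (simp add: cv_def)
   also have "\<dots> = (\<Sum>i\<in>{k}. ?H i (\<Phi> (j - i) i y))"
   proof (rule sum.mono_neutral_right)
    show "\<forall>i\<in>{..j} - {k}. ?H i (\<Phi> (j - i) i y) = 0"
    proof
     fix i assume i: "i \<in> {..j} - {k}"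
     have "\<Phi> (j - i) i y \<in> C i" using mod_homD(1)[OF liftsD(1)[OF \<Phi>[of "j - i"], of i], of y] i True by simp
     then show "?H i (\<Phi> (j - i) i y) = 0" using i by simp
    qed
   qed (use j in auto)
   finally show ?thesis using True by (simp add: compose_eq)
  qed (simp add: cv_def compose_def)
 qed
 have w: "pb (C (n + k)) (\<lambda>x. x) (?K (n + k)) \<in> top_components I (n + k)"
 proof (rule top_componentsI[OF K(2) _ _ refl])
  have "rp ?H \<in> carrier E" using H by (simp add: E_carrier)
  from i(5)[OF this F(2)] show "rp ?K \<in> I" unfolding K(1) .
  fix j assume j: "j > n + k"
  then have "F (j - k) \<in> B (j - k)" using F(3) by simp
  from lift_coboundary[OF \<Phi> this \<eta>] show "?K j \<in> B j" using j by (simp add: Kc)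
 qed
 let ?a = "pb (C 0) (\<lambda>x. x) (aug P)"
 have "?a \<in> L S 0" "D 0 ?a = 0" using cohL[OF aug_hom] aug_bd bd(1)[of _ 0] by (auto simp: pb_def fun_eq_iff)
 moreover have "chain_map n (\<Phi> n)" using liftsD(1,3)[OF \<Phi>[of n]] by (simp add: chain_map_def)
 \<comment> \<open>Centrality at the augmentation with \<open>\<Phi> n\<close> as the other chain
   map: one order gives \<open>op k \<phi> n x\<close>, the other the leading component of the
   product.\<close>
 ultimately have "op k \<phi> (0 + n) (op n (\<Phi> n) 0 ?a) - op n (\<Phi> n) (0 + k) (op k \<phi> 0 ?a) \<in> bnd D (L S) (0 + k + n)"
  using \<phi>(2) S(1) unfolding central_def by blast
 moreover have "op n (\<Phi> n) 0 ?a = x"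
  using liftsD(2)[OF \<Phi>[of n]] mod_homD(1)[OF liftsD(1)[OF \<Phi>[of n], of 0]] by (auto simp: op_def pb_def F(4) fun_eq_iff)
 moreover have "op n (\<Phi> n) (0 + k) (op k \<phi> 0 ?a) = pb (C (n + k)) (\<lambda>x. x) (?K (n + k))"
  using mod_homD(1)[OF liftsD(1)[OF \<Phi>[of n], of k]] mod_homD(1)[OF ph(1)[of 0]]
  by (auto simp: op_def pb_def Kc fun_eq_iff compose_eq add.commute)
 ultimately have b: "op k \<phi> n x - pb (C (n + k)) (\<lambda>x. x) (?K (n + k)) \<in> bnd D (L S) (n + k)" by (simp add: add.commute)
 \<comment> \<open>Only closure under differences is available, so a sum is formed by subtracting a
   negative.\<close>
 have "0 - pb (C (n + k)) (\<lambda>x. x) (?K (n + k)) \<in> top_components I (n + k)" using diff[OF diff[OF w w] w] by simp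
 from diff[OF bnd[OF b] this] show "\<omega> n x \<in> top_components I (n + k)" by (simp add: \<phi>(1))
qed

theorem noeth_final:
 assumes N: "noeth S" and S: "\<And>s. s \<in> S ==> \<epsilon> s = 0" "\<And>h. h \<in> carrier R ==> h \<ominus>\<^sub>R sca (\<epsilon> h) \<in> rid R S"
 shows "left_noetherian_ring E"
proof (rule left_noetherian_if_acc[OF ring_E])
 obtain \<Omega> where SR: "S \<subseteq> carrier R" and \<Omega>: "\<And>k \<phi>. (k, \<phi>) \<in> \<Omega> ==> central k \<phi>" and acc: "acc (fam D (L S) (ops \<Omega>))"
  using N unfolding noeth_def by blast
 show "acc {I. left_ideal I E}"
  unfolding acc_def
 proof (intro allI impI, elim conjE)
  fix F :: "nat \<Rightarrow> (nat \<Rightarrow> ('m \<Rightarrow> 'k) set) set" assume F: "range F \<subseteq> {I. left_ideal I E}" and m: "mono F"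
  have FI: "left_ideal (F n) E" for n using F by auto
  have tm: "top_components I \<le> top_components J" if "I \<subseteq> J" for I J using that unfolding top_components_def le_fun_def by blast
  have "\<exists>N. \<forall>n\<ge>N. top_components (F n) = top_components (F N)"
   by (rule accD[OF acc]) (auto intro!: top_components_fam[OF SR S \<Omega> FI] monoI tm monoD[OF m])
  then obtain N where N: "\<forall>n\<ge>N. top_components (F n) = top_components (F N)" by (elim exE)
  have "F n = F N" if "n \<ge> N" for n
   by (rule top_components_inj[symmetric, OF FI FI monoD[OF m that] N[rule_format, OF that]])
  then show "\<exists>N. \<forall>n\<ge>N. F n = F N" by blast
 qed
qed

end

section \<open>The three deformations of the skew group algebra\<close>

context skew_setup
begin

text \<open>\<open>lam\<close> and \<open>psi\<close> are inverse isomorphisms between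
  \<open>H\<close> and the model, and the axioms are carried across.\<close>

lemma hochschild_transport:
 fixes c :: "(nat \<times> nat \<times> nat \<Rightarrow> 'k) \<Rightarrow> (nat \<times> nat \<times> nat \<Rightarrow> 'k) \<Rightarrow> nat \<times> nat \<times> nat \<Rightarrow> 'k"
 assumes c_add: "\<And>x y z. c (x + y) z = c x z + c y z" "\<And>x y z. c x (y + z) = c x y + c x z"
  and cocycle: "\<And>x y z. x \<in> V.U ==> y \<in> V.U ==> z \<in> V.U ==> c (V.Op x y) z + V.Op (c x y) z = c x (V.Op y z) + V.Op x (c y z)"
  and scalar: "\<And>l y. y \<in> V.U ==> c (sc l (V.mon 0 0 0)) y = 0" "\<And>l y. y \<in> V.U ==> c y (sc l (V.mon 0 0 0)) = 0"
 shows "hochschild H (\<lambda>x y. Hr.psi (c (lam x) (lam y)))"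
proof
 fix x y z assume x: "x \<in> carrier H" and y: "y \<in> carrier H"
 show "Hr.psi (c (lam (l \<odot>\<^sub>H \<one>\<^sub>H)) (lam x)) = \<zero>\<^sub>H" "Hr.psi (c (lam x) (lam (l \<odot>\<^sub>H \<one>\<^sub>H))) = \<zero>\<^sub>H" for l
  by (simp_all only: lam_smult[OF H.one_closed] lam_one scalar lam_U Hr.psi_zero)
 assume z: "z \<in> carrier H"
 show "Hr.psi (c (lam (x \<oplus>\<^sub>H y)) (lam z)) = Hr.psi (c (lam x) (lam z)) \<oplus>\<^sub>H Hr.psi (c (lam y) (lam z))"
  "Hr.psi (c (lam x) (lam (y \<oplus>\<^sub>H z))) = Hr.psi (c (lam x) (lam y)) \<oplus>\<^sub>H Hr.psi (c (lam x) (lam z))"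
  by (simp_all only: lam_add x y z c_add Hr.psi_add)
 have "Hr.psi (c (V.Op (lam x) (lam y)) (lam z)) \<oplus>\<^sub>H Hr.psi (c (lam x) (lam y)) \<otimes>\<^sub>H Hr.psi (lam z)
   = Hr.psi (c (lam x) (V.Op (lam y) (lam z))) \<oplus>\<^sub>H Hr.psi (lam x) \<otimes>\<^sub>H Hr.psi (c (lam y) (lam z))"
  by (simp only: Hr.psi_Op[symmetric] Hr.psi_add[symmetric] cocycle[OF lam_U lam_U lam_U])
 then show "Hr.psi (c (lam (x \<otimes>\<^sub>H y)) (lam z)) \<oplus>\<^sub>H Hr.psi (c (lam x) (lam y)) \<otimes>\<^sub>H z
   = Hr.psi (c (lam x) (lam (y \<otimes>\<^sub>H z))) \<oplus>\<^sub>H x \<otimes>\<^sub>H Hr.psi (c (lam y) (lam z))"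
  by (simp only: lam_mult x y z psi_lam)
qed simp

text \<open>\<open>H_induct\<close> builds every element from left multiplications by generators, so
  these suffice to make the right ideal of \<open>S\<close> two-sided.\<close>

lemma rid_left:
 assumes S: "S \<subseteq> carrier H" and g: "\<And>s. s \<in> S ==> aH \<otimes>\<^sub>H s \<in> rid H S" "\<And>s. s \<in> S ==> gH \<otimes>\<^sub>H s \<in> rid H S" "\<And>s. s \<in> S ==> bH \<otimes>\<^sub>H s \<in> rid H S"
  and h: "h \<in> carrier H" and x: "x \<in> rid H S"
 shows "h \<otimes>\<^sub>H x \<in> rid H S"
proof -
 note rc = H.rid_carrier[OF _ S]
 have gen: "u \<otimes>\<^sub>H x \<in> rid H S" if u: "u \<in> carrier H" "\<And>s. s \<in> S ==> u \<otimes>\<^sub>H s \<in> rid H S" and "x \<in> rid H S" for u x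
  using that(3)
 proof (induct rule: rid.induct)
  case (rid_add x y)
  then show ?case using u(1) by (simp add: rc H.r_distr rid.rid_add)
 next
  case (rid_mult x r)
  then show ?case using u(1) rid.rid_mult[OF rid_mult(2,3)] by (simp add: rc H.m_assoc)
 qed (use u in \<open>auto intro: rid_zero\<close>)
 have "\<forall>x\<in>rid H S. h \<otimes>\<^sub>H x \<in> rid H S"
  using h
 proof (induct h rule: H_induct)
  case (smult c h)
  show ?case
  proof
   fix x assume x: "x \<in> rid H S"
   have "(c \<odot>\<^sub>H h) \<otimes>\<^sub>H x = (h \<otimes>\<^sub>H x) \<otimes>\<^sub>H (c \<odot>\<^sub>H \<one>\<^sub>H)" using smult(1) rc[OF x] by (simp add: H.smult_mult_l H.smult_mult_r)
   then show "(c \<odot>\<^sub>H h) \<otimes>\<^sub>H x \<in> rid H S" using smult(2) x by (simp add: rid_mult H.smult_closed)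
  qed
 next
  case (add h h')
  then show ?case by (auto simp: H.l_distr rc intro: rid_add)
 qed (use gen g in \<open>auto simp: H.m_assoc rc\<close>)
 then show ?thesis using x by blast
qed

abbreviation tg where "tg \<equiv> gH \<ominus>\<^sub>H \<one>\<^sub>H"

text \<open>The case of \<open>b\<close> is \<open>b a = a (b + a/2)\<close>.\<close>

lemma rid_a: "aH \<in> S ==> S \<subseteq> carrier H ==> aH \<otimes>\<^sub>H aH \<in> rid H S \<and> gH \<otimes>\<^sub>H aH \<in> rid H S \<and> bH \<otimes>\<^sub>H aH \<in> rid H S"
proof -
 assume S: "aH \<in> S"
 have "bH \<otimes>\<^sub>H aH = aH \<otimes>\<^sub>H (bH \<oplus>\<^sub>H (1/2) \<odot>\<^sub>H aH)" by (simp add: Hr.ba H.r_distr H.smult_closed H.smult_mult_r)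
 then show ?thesis using S by (simp add: Hr.ga H.smult_closed rid_mult rid_gen)
qed

text \<open>Here \<open>b (g - 1) = (g - 1) b + a g\<close>, and the last term is the reason for
  having \<open>a\<close> in \<open>S\<close>.\<close>

lemma rid_g: "{tg, aH} \<subseteq> S ==> S \<subseteq> carrier H ==> aH \<otimes>\<^sub>H tg \<in> rid H S \<and> gH \<otimes>\<^sub>H tg \<in> rid H S \<and> bH \<otimes>\<^sub>H tg \<in> rid H S"
proof -
 assume S: "{tg, aH} \<subseteq> S"
 have "gH \<otimes>\<^sub>H tg = tg \<otimes>\<^sub>H gH" by (simp add: H.minus_eq H.r_distr H.l_distr H.r_minus H.l_minus)
 moreover have "bH \<otimes>\<^sub>H tg = tg \<otimes>\<^sub>H bH \<oplus>\<^sub>H aH \<otimes>\<^sub>H gH"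
  by (simp add: H.minus_eq H.r_distr H.l_distr H.r_minus H.l_minus Hr.bg H.a_ac)
 ultimately show ?thesis using S by (simp add: rid_add rid_mult rid_gen)
qed

end

context skew_hopf
begin

lemma eH_tg: "eH tg = 0"
proof -
 have tg: "tg = gH \<oplus>\<^sub>H (-1) \<odot>\<^sub>H \<one>\<^sub>H" by (simp add: H.minus_eq H.smult_minus_left H.smult_one)
 have "eH (gH \<oplus>\<^sub>H (-1) \<odot>\<^sub>H \<one>\<^sub>H) = eH gH + (-1) * eH \<one>\<^sub>H" by (simp only: eH_simps gens_H H.one_closed H.smult_closed)
 then show ?thesis unfolding tg by (simp add: eH_simps eH_gens)
qed

text \<open>The difference \<open>h - \<epsilon>(h)\<close> is followed through left
  multiplications: \<open>g x - \<epsilon>(x) = (g - 1) x + (x - \<epsilon>(x))\<close>, while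
  \<open>a x\<close> and \<open>b x\<close> have augmentation 0 and lie in the right ideal
  already.\<close>

lemma rid_augmentation:
 assumes h: "h \<in> carrier H"
 shows "h \<ominus>\<^sub>H eH h \<odot>\<^sub>H \<one>\<^sub>H \<in> rid H {bH, tg, aH}"
 using h
proof (induct h rule: H_induct)
 case one
 show ?case by (simp add: eH_simps H.smult_one H.minus_eq H.r_neg rid_zero)
next
 case (add x y)
 have "x \<oplus>\<^sub>H y \<ominus>\<^sub>H eH (x \<oplus>\<^sub>H y) \<odot>\<^sub>H \<one>\<^sub>H = (x \<ominus>\<^sub>H eH x \<odot>\<^sub>H \<one>\<^sub>H) \<oplus>\<^sub>H (y \<ominus>\<^sub>H eH y \<odot>\<^sub>H \<one>\<^sub>H)"
  using add by (simp add: eH_simps H.smult_l_distr H.minus_eq H.minus_add H.smult_closed H.a_ac)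
 then show ?case using rid_add[OF add(3,4)] by simp
next
 case (smult c x)
 have "c \<odot>\<^sub>H x \<ominus>\<^sub>H eH (c \<odot>\<^sub>H x) \<odot>\<^sub>H \<one>\<^sub>H = (x \<ominus>\<^sub>H eH x \<odot>\<^sub>H \<one>\<^sub>H) \<otimes>\<^sub>H (c \<odot>\<^sub>H \<one>\<^sub>H)"
  using smult by (simp add: eH_simps H.smult_assoc1 H.minus_eq H.smult_closed H.smult_mult_r H.smult_r_distr H.smult_minus_right)
 then show ?case using rid_mult[OF smult(2)] by (simp add: H.smult_closed)
next
 case (a x)
 have "aH \<otimes>\<^sub>H x \<ominus>\<^sub>H eH (aH \<otimes>\<^sub>H x) \<odot>\<^sub>H \<one>\<^sub>H = aH \<otimes>\<^sub>H x"
  using a(1) by (simp add: eH_simps eH_gens H.smult_zero_left H.minus_eq)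
 then show ?case using a(1) by (simp add: rid_mult rid_gen)
next
 case (g x)
 have "gH \<otimes>\<^sub>H x \<ominus>\<^sub>H eH (gH \<otimes>\<^sub>H x) \<odot>\<^sub>H \<one>\<^sub>H = tg \<otimes>\<^sub>H x \<oplus>\<^sub>H (x \<ominus>\<^sub>H eH x \<odot>\<^sub>H \<one>\<^sub>H)"
 proof -
  have "tg \<otimes>\<^sub>H x \<oplus>\<^sub>H x = gH \<otimes>\<^sub>H x" using g(1) by (simp add: H.minus_eq H.l_distr H.l_minus H.a_assoc H.l_neg)
  then show ?thesis using g(1) by (simp add: eH_simps eH_gens H.minus_eq H.a_assoc[symmetric] H.smult_closed)
 qed
 then show ?case using g(1) rid_add[OF rid_mult g(2)] by (simp add: rid_gen)
next
 case (b x)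
 have "bH \<otimes>\<^sub>H x \<ominus>\<^sub>H eH (bH \<otimes>\<^sub>H x) \<odot>\<^sub>H \<one>\<^sub>H = bH \<otimes>\<^sub>H x"
  using b(1) by (simp add: eH_simps eH_gens H.smult_zero_left H.minus_eq)
 then show ?case using b(1) by (simp add: rid_mult rid_gen)
qed

theorem left_noetherian_Ext:
 fixes P :: "('g \<Rightarrow> 'k presented, 'm, 'k) aug_complex"
 assumes P: "projective_resolution H (trivial_module eH) P"
 shows "left_noetherian_ring (Ext_ring H (trivial_module eH) P)"
proof -
 interpret TR: trivial_resolution H eH P by (intro trivial_resolution.intro trivial_resolution_axioms.intro assoc_algebra_H eH_hom P)
 interpret da: deform_a p ty by unfold_locales auto
 interpret dg: deform_g p ty by unfold_locales auto
 interpret db: deform_b p ty by unfold_locales auto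
 have ha: "hochschild H (\<lambda>x y. Hr.psi (da.c (lam x) (lam y)))" by (rule hochschild_transport[OF da.c_add da.cocycle da.c_scalar])
 have hg: "hochschild H (\<lambda>x y. Hr.psi (dg.c (lam x) (lam y)))" by (rule hochschild_transport[OF dg.c_add dg.cocycle dg.c_scalar])
 have hb: "hochschild H (\<lambda>x y. Hr.psi (db.c (lam x) (lam y)))" by (rule hochschild_transport[OF db.c_add db.cocycle db.c_scalar])
 interpret ta: twisted H eH P "\<lambda>x y. Hr.psi (da.c (lam x) (lam y))"
  by (intro twisted.intro TR.trivial_resolution_axioms ha)
 interpret tg: twisted H eH P "\<lambda>x y. Hr.psi (dg.c (lam x) (lam y))"
  by (intro twisted.intro TR.trivial_resolution_axioms hg)
 interpret tb: twisted H eH P "\<lambda>x y. Hr.psi (db.c (lam x) (lam y))"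
  by (intro twisted.intro TR.trivial_resolution_axioms hb)
 have pa: "aH [^]\<^sub>H n = Hr.psi (V.mon n 0 0)" and pb: "bH [^]\<^sub>H n = Hr.psi (V.mon 0 0 n)" for n :: nat
  unfolding Hr.psi_mon Hr.mono_def by simp_all
 have la: "lam (aH [^]\<^sub>H n) = V.mon n 0 0" and lb: "lam (bH [^]\<^sub>H n) = V.mon 0 0 n" for n :: nat
  unfolding pa pb by (rule lam_psi[OF V.mon_U])+
 have p1: "Suc (p - 1) = p" using V.p0 by simp
 have ap: "aH \<otimes>\<^sub>H aH [^]\<^sub>H (p - 1) = \<zero>\<^sub>H" "aH [^]\<^sub>H (p - 1) \<otimes>\<^sub>H aH = \<zero>\<^sub>H"
  using Hr.ap H.nat_pow_Suc2[of aH "p - 1"] H.nat_pow_Suc[of aH "p - 1"] unfolding p1 by simp_all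
 have bp: "bH \<otimes>\<^sub>H bH [^]\<^sub>H (p - 1) = \<zero>\<^sub>H" "bH [^]\<^sub>H (p - 1) \<otimes>\<^sub>H bH = \<zero>\<^sub>H"
  using Hr.bp H.nat_pow_Suc2[of bH "p - 1"] H.nat_pow_Suc[of bH "p - 1"] unfolding p1 by simp_all
 \<comment> \<open>The conditions involving \<open>S\<close> are void for the empty set; the
   cofactor of \<open>a\<close> is \<open>a^(p-1)\<close>.\<close>
 have 1: "TR.noeth {aH}"
  by (rule ta.noeth_step[OF TR.noeth_base, of aH "aH [^]\<^sub>H (p - 1)"])
   (use ap da.c_a in \<open>simp_all only: la lam_gens Hr.psi_gens gens_H H.nat_pow_closed empty_iff\<close>)
 \<comment> \<open>The cofactor of \<open>g - 1\<close>.\<close>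
 let ?N = "Hr.psi dg.N"
 have dt: "dg.t = V.mon 0 1 0 + sc (-1) (V.mon 0 0 0)" by (simp add: sc_def fun_eq_iff)
 have tU: "dg.t \<in> V.U" "dg.N \<in> V.U" unfolding dt by (intro V.U_add V.U_sc V.mon_U, intro V.U_sum V.mon_U)
 have tg: "tg = Hr.psi dg.t"
 proof -
  have "Hr.psi dg.t = gH \<oplus>\<^sub>H (-1) \<odot>\<^sub>H \<one>\<^sub>H" by (simp only: dt Hr.psi_add Hr.psi_sc Hr.psi_gens)
  then show ?thesis by (simp add: H.minus_eq H.smult_minus_left H.smult_one)
 qed
 have lt: "lam tg = dg.t" unfolding tg by (rule lam_psi[OF tU(1)])
 have lN: "lam ?N = dg.N" by (rule lam_psi[OF tU(2)])
 have tgc: "tg \<in> carrier H" by simp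
 have ridS: "h \<otimes>\<^sub>H s \<in> rid H {aH}" if "s \<in> {aH}" "h \<in> carrier H" for h s
  by (rule rid_left) (use rid_a[of "{aH}"] that in \<open>auto intro: rid_gen\<close>)
 have 2: "TR.noeth {tg, aH}"
 proof (rule tg.noeth_step[OF 1, of tg ?N])
  fix s r assume s: "s \<in> {aH}" and "r \<in> carrier H"
  then show "Hr.psi (dg.c (lam s) (lam r)) = \<zero>\<^sub>H" by (simp only: singleton_iff lam_gens dg.c_a lam_U Hr.psi_zero)
 next
  fix s assume s: "s \<in> {aH}"
  show "Hr.psi (dg.c (lam tg) (lam s)) = \<zero>\<^sub>H" "Hr.psi (dg.c (lam ?N) (lam s)) = \<zero>\<^sub>H"
   using s by (simp_all only: singleton_iff lt lN lam_gens dg.c_t_a dg.c_N_a Hr.psi_zero)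
  show "tg \<otimes>\<^sub>H s \<in> rid H {aH}" "?N \<otimes>\<^sub>H s \<in> rid H {aH}" using ridS[OF s] by simp_all
 qed (simp_all only: tgc Hr.psi_closed lt lN dg.c_t_N Hr.psi_gens, simp_all only: tg Hr.psi_Op[symmetric] dg.Op_t_N Hr.psi_zero)
 have S2: "{tg, aH} \<subseteq> carrier H" by simp
 have ridS2: "h \<otimes>\<^sub>H s \<in> rid H {tg, aH}" if s: "s \<in> {tg, aH}" and h: "h \<in> carrier H" for h s
  by (rule rid_left[OF S2 _ _ _ h rid_gen[OF s]]) (use rid_a[OF _ S2] rid_g[OF _ S2] in auto)
 have c_one: "db.c (V.mon 0 0 0) y = 0" "db.c y (V.mon 0 0 0) = 0" if "y \<in> V.U" for y
  using db.c_scalar[OF that, of 1] by simp_all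
 have c_tg: "db.c dg.t y = 0" if "y \<in> V.U" for y
  using db.c_add(1)[of dg.t "V.mon 0 0 0" y] c_one[OF that] db.c_g[OF that] by simp
 \<comment> \<open>Multiplying \<open>b^n\<close> with \<open>n < p\<close> by \<open>a\<close> or
   \<open>g\<close> keeps the exponent of \<open>b\<close> below \<open>p\<close>, so the
   deformation of \<open>b^p\<close> does not show.\<close>
 have c_box: "db.c (V.mon 0 0 n) (lam s) = 0" if n: "n < p" and s: "s \<in> {tg, aH}" for n s
 proof -
  have "db.c (V.mon 0 0 n) dg.t = 0"
   using db.c_add(2)[of "V.mon 0 0 n" dg.t "V.mon 0 0 0"] c_one[OF V.mon_U] db.c_b_box[OF n, of 0 1] db.lt by simp
  moreover have "db.c (V.mon 0 0 n) (V.mon 1 0 0) = 0" using db.c_b_box[OF n, of 1 0] db.lt by simp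
  ultimately show ?thesis using s lt lam_gens by auto
 qed
 have "TR.noeth {bH, tg, aH}"
 proof (rule tb.noeth_step[OF 2, of bH "bH [^]\<^sub>H (p - 1)"])
  fix s r assume s: "s \<in> {tg, aH}" and "r \<in> carrier H"
  have "db.c (lam s) (lam r) = 0" using s c_tg[OF lam_U] db.c_a[OF lam_U] lt lam_gens by auto
  then show "Hr.psi (db.c (lam s) (lam r)) = \<zero>\<^sub>H" by (simp only: Hr.psi_zero)
 next
  fix s assume s: "s \<in> {tg, aH}"
  show "Hr.psi (db.c (lam bH) (lam s)) = \<zero>\<^sub>H" "Hr.psi (db.c (lam (bH [^]\<^sub>H (p - 1))) (lam s)) = \<zero>\<^sub>H"
   using c_box[OF db.lt(2) s] c_box[OF db.lt(6) s] by (simp_all only: lam_gens lb Hr.psi_zero)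
  show "bH \<otimes>\<^sub>H s \<in> rid H {tg, aH}" "bH [^]\<^sub>H (p - 1) \<otimes>\<^sub>H s \<in> rid H {tg, aH}" using ridS2[OF s] by simp_all
 qed (use bp db.c_b in \<open>simp_all only: lb lam_gens Hr.psi_gens gens_H H.nat_pow_closed\<close>)
 \<comment> \<open>\<open>b\<close>, \<open>g - 1\<close> and \<open>a\<close> generate the whole
   augmentation ideal, so the functionals are now the cochains with values in
   \<open>k\<close>.\<close>
 then show ?thesis
  by (rule TR.noeth_final) (use rid_augmentation eH_tg eH_gens in auto)
qed

end

theorem mainTheorem2:
  fixes p :: nat
    and A :: "('k::field, 'k presented) module"
    and a b :: "'k presented"
    and \<epsilon> :: "'k presented \<Rightarrow> 'k"
    and G :: "'g monoid"
    and g :: 'g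
    and act :: "'k presented \<Rightarrow> 'g \<Rightarrow> 'k presented"
    and H :: "('k, 'g \<Rightarrow> 'k presented) module"
    and \<epsilon>\<^sub>H :: "('g \<Rightarrow> 'k presented) \<Rightarrow> 'k"
    and a\<^sub>H b\<^sub>H g\<^sub>H :: "'g \<Rightarrow> 'k presented"
  assumes "prime p" and "p > 2" and "CHAR('k) = p"
    and "A = alg_A p" and "a = gen_a p" and "b = gen_b p"
    and "\<epsilon> \<in> algebra_hom A ground_algebra" and "\<epsilon> a = 0" and "\<epsilon> b = 0"
    and "group G" and "order G = p" and "g \<in> carrier G" and "generate G {g} = carrier G"
    and "right_action G A act" and "act a g = a" and "act b g = a \<oplus>\<^bsub>A\<^esub> b"
    and "H = skew_group_algebra G A (left_of_right G act)"
    and "\<epsilon>\<^sub>H = skew_augmentation A \<epsilon>"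
    and "a\<^sub>H = skew_elt A a \<one>\<^bsub>G\<^esub>" and "b\<^sub>H = skew_elt A b \<one>\<^bsub>G\<^esub>" and "g\<^sub>H = skew_elt A \<one>\<^bsub>A\<^esub> g"
  shows "(\<exists>\<Delta> S. hopf_algebra H \<Delta> \<epsilon>\<^sub>H S \<and>
            \<Delta> g\<^sub>H = pure_tensor H H g\<^sub>H g\<^sub>H \<and>
            \<Delta> a\<^sub>H = pure_tensor H H a\<^sub>H \<one>\<^bsub>H\<^esub> \<oplus>\<^bsub>tensor_algebra H H\<^esub> pure_tensor H H g\<^sub>H a\<^sub>H \<and>
            \<Delta> b\<^sub>H = pure_tensor H H b\<^sub>H \<one>\<^bsub>H\<^esub> \<oplus>\<^bsub>tensor_algebra H H\<^esub> pure_tensor H H g\<^sub>H b\<^sub>H) \<and>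
         (\<forall>P :: ('g \<Rightarrow> 'k presented, 'm, 'k) aug_complex.
            projective_resolution H (trivial_module \<epsilon>\<^sub>H) P \<longrightarrow>
            left_noetherian_ring (Ext_ring H (trivial_module \<epsilon>\<^sub>H) P))"
proof -
 interpret skew_hopf p "TYPE('k)" G g act \<epsilon>
  using assms by (intro skew_hopf.intro skew_setup.intro presented.intro pbw_field.intro skew_setup_axioms.intro skew_hopf_axioms.intro) simp_all
 show ?thesis
  using hopf_structure left_noetherian_Ext unfolding assms(4-6,17-21) by blast
qed

end
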